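(* Let $X$ be a standard Borel space. Let $V= (V_x)_{x \in X}$ and $W = (W_x)_{x \in X}$ be Borel fields of separable Banach spaces. Denote by $B(V,W) = (B(V_x,W_x))_{x \in X}$ the field of spaces of bounded linear operators from $V_x$ to $W_x$. 1. There is a unique standard Borel structure on $B(V,W)$ such that the maps $\pi : B(V,W) \to X$ and $B(V,W) \times_\pi V \to W : (T,v) \mapsto T(v)$ are Borel. 2. The operator norm, addition and scalar multiplication of bounded operators all define Borel maps. If also $U = (U_x)_{x \in X}$ is a Borel field of separable Banach spaces, the composition $B(W,U) \times_\pi B(V,W) \to B(V,U) : (S,T) \mapsto S \circ T$ is a Borel map. 3. For every $\sigma$-finite Borel measure $\mu$ on $X$, $\operatorname{ball} B(V,W) = (\operatorname{ball} B(V_x,W_x))_{x\in X}$, with the strong topology on each $\operatorname{ball} B(V_x,W_x)$, is a measured field of Polish spaces over $(X,\mu)$. 4. In the following two cases, $\operatorname{ball} B(V,W)$ is a Borel field of the Polish spaces $\operatorname{ball} B(V_x,W_x)$ with the strong operator topology: (a) when $W_x$ is reflexive for every $x \in X$; (b) when for every $x \in X$, $V_x$ or $W_x$ has the metric approximation property. 5. Whenever $\varphi_n : X \to V$ is a total sequence of Borel sections, the Borel $\sigma$-algebra on $B(V,W)$ is the smallest $\sigma$-algebra that makes the maps $\pi : B(V,W) \to X$ and $B(V,W) \to W : T \mapsto T(\varphi_n(\pi(T)))$, $n\in\mathbb{N}$, measurable.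
   Context: Conventions. A standard Borel space is a measurable space isomorphic to a Borel subset of a Polish space. Product spaces carry the product $\sigma$-algebra and subsets the restricted $\sigma$-algebra. For a family of sets $V = (V_x)_{x\in X}$, the symbol $V$ also denotes the disjoint union of the $V_x$, and $\pi : V \to X$ is the map with $\pi(v) = x$ for $v \in V_x$. For two families over $X$, $V \times_\pi W = \{(v,w) \in V \times W \mid \pi(v)=\pi(w)\}$. A section is a map $\varphi : X \to V$ with $\varphi(x)\in V_x$ for all $x$. A sequence of Borel sections $\varphi_n : X \to V$ is dense if $\{\varphi_n(x) \mid n\in\mathbb{N}\}$ is dense in $V_x$ for every $x\in X$; it is total if $\{\varphi_n(x)\mid n\in\mathbb{N}\}$ has dense linear span in $V_x$ for every $x\in X$. For a Banach space $E$, $\operatorname{ball} E$ is its closed unit ball. A separable Banach space $E$ has the metric approximation property if there is a sequence of finite rank operators $T_n\in B(E)$ with $\|T_n\|\le 1$ and $T_n\to\mathrm{id}$ strongly. A Borel field of Polish spaces consists of a standard Borel space $X$, a family $V=(V_x)_{x\in X}$ of Polish spaces and a standard Borel structure on $V$ such that: (1) $\pi : V\to X$ is Borel; (2) there is a Borel map $d : V\times_\pi V\to[0,+\infty)$ whose restriction to each $V_x\times V_x$ is a separable complete metric inducing the topology of $V_x$; (3) there is a dense sequence of Borel sections $X\to V$. A measured field of Polish spaces over a standard Borel space $X$ with $\sigma$-finite measure $\mu$ is a family $V=(V_x)_{x\in X}$ of Polish spaces with a standard Borel structure on $V$ such that $\pi$ is Borel and there is a Borel set $X_0\subset X$ with $\mu(X\setminus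 X_0)=0$ and $(V_x)_{x\in X_0}$ a Borel field of Polish spaces. A Borel field of separable Banach spaces (complex scalars) consists of a standard Borel space $X$, a family $V=(V_x)_{x\in X}$ of separable Banach spaces and a standard Borel structure on $V$ such that $\pi : V\to X$, the norm $V\to[0,+\infty)$, the addition $V\times_\pi V\to V$ and the scalar multiplication $\mathbb{C}\times V\to V$ are Borel, and there is a (norm) dense sequence of Borel sections $X\to V$. *)

theory Defs
  imports
    "HOL-Algebra.Module"
    "HOL-Analysis.Analysis"
begin

section \<open>Standard Borel spaces\<close>

text \<open>
  A term of type \<open>'a measure\<close> is used as a measurable space: only its \<^const>\<open>space\<close> and
  \<^const>\<open>sets\<close> matter, except where sigma-finiteness or null sets of a measure are mentioned.
\<close>

definition polish_topology :: "'a topology \<Rightarrow> bool" where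
  "polish_topology T \<longleftrightarrow> completely_metrizable_space T \<and> separable_space T"

definition borel_of_topology :: "'a topology \<Rightarrow> 'a measure" where
  "borel_of_topology T = sigma (topspace T) {U. openin T U}"

definition isomorphic_measurable_spaces :: "'a measure \<Rightarrow> 'b measure \<Rightarrow> bool" where
  "isomorphic_measurable_spaces M N \<longleftrightarrow>
     (\<exists>f\<in>measurable M N. \<exists>g\<in>measurable N M.
        (\<forall>x\<in>space M. g (f x) = x) \<and> (\<forall>y\<in>space N. f (g y) = y))"

text \<open>
  The ambient Polish space is taken with points of type \<^typ>\<open>real\<close>, under an arbitrary Polish
  topology on an arbitrary carrier. This is no restriction, since a Polish space has at most
  continuum many points.
\<close>

definition standard_borel :: "'a measure \<Rightarrow> bool" where
  "standard_borel M \<longleftrightarrow>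
     (\<exists>(T :: real topology) B. polish_topology T \<and> B \<in> sets (borel_of_topology T) \<and>
        isomorphic_measurable_spaces M (restrict_space (borel_of_topology T) B))"


section \<open>Complex Banach spaces with explicit carrier\<close>

text \<open>
  The fibres of a field of Banach spaces are different spaces, so they are records with a carrier
  over a common type. The vector space part is a module of \<open>HOL-Algebra\<close> over the
  ring of complex numbers; the inherited multiplicative fields of the record play no role.
\<close>

definition complex_ring :: "complex ring" where
  "complex_ring =
     \<lparr>carrier = UNIV, monoid.mult = (*), one = 1, ring.zero = 0, add = (+)\<rparr>"

record 'v normed_module = "(complex, 'v) module" +
  vnorm :: "'v \<Rightarrow> real"

locale complex_normed_space = Module.module complex_ring E
  for E :: "'v normed_module" (structure) +
  assumes vnorm_nonneg: "v \<in> carrier E \<Longrightarrow> 0 \<le> vnorm E v"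
    and vnorm_eq_0_iff: "v \<in> carrier E \<Longrightarrow> vnorm E v = 0 \<longleftrightarrow> v = \<zero>\<^bsub>E\<^esub>"
    and vnorm_triangle:
      "v \<in> carrier E \<Longrightarrow> w \<in> carrier E \<Longrightarrow> vnorm E (v \<oplus>\<^bsub>E\<^esub> w) \<le> vnorm E v + vnorm E w"
    and vnorm_smult: "v \<in> carrier E \<Longrightarrow> vnorm E (c \<odot>\<^bsub>E\<^esub> v) = cmod c * vnorm E v"

text \<open>
  \<^typ>\<open>'a metric\<close> requires a distance that is nonnegative and symmetric on the whole type,
  hence the value 0 off the carrier.
\<close>

definition norm_metric :: "'v normed_module \<Rightarrow> 'v metric" where
  "norm_metric E = metric (carrier E,
     \<lambda>v w. if v \<in> carrier E \<and> w \<in> carrier E then vnorm E (v \<ominus>\<^bsub>E\<^esub> w) else 0)"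

definition norm_topology :: "'v normed_module \<Rightarrow> 'v topology" where
  "norm_topology E = mtopology_of (norm_metric E)"

definition separable_banach :: "'v normed_module \<Rightarrow> bool" where
  "separable_banach E \<longleftrightarrow>
     complex_normed_space E \<and> mcomplete_of (norm_metric E) \<and> separable_space (norm_topology E)"

definition unit_ball :: "'v normed_module \<Rightarrow> 'v set" where
  "unit_ball E = {v \<in> carrier E. vnorm E v \<le> 1}"

definition linear_span :: "'v normed_module \<Rightarrow> 'v set \<Rightarrow> 'v set" where
  "linear_span E S = \<Inter>{H. submodule H complex_ring E \<and> S \<subseteq> H}"

text \<open>
  The space \<open>B(E,F)\<close>, normed by the operator norm. Operators are extensional functions
  (\<^const>\<open>undefined\<close> off the carrier of \<open>E\<close>), so that they correspond
  one-to-one to maps on the carrier.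
\<close>

definition bounded_operators ::
  "'v normed_module \<Rightarrow> 'w normed_module \<Rightarrow> ('v \<Rightarrow> 'w) normed_module" where
  "bounded_operators E F =
     \<lparr>carrier = {T \<in> carrier E \<rightarrow>\<^sub>E carrier F.
        (\<forall>v\<in>carrier E. \<forall>w\<in>carrier E. T (v \<oplus>\<^bsub>E\<^esub> w) = T v \<oplus>\<^bsub>F\<^esub> T w) \<and>
        (\<forall>c. \<forall>v\<in>carrier E. T (c \<odot>\<^bsub>E\<^esub> v) = c \<odot>\<^bsub>F\<^esub> T v) \<and>
        (\<exists>C. \<forall>v\<in>carrier E. vnorm F (T v) \<le> C * vnorm E v)},
      monoid.mult = undefined,
      one = undefined,
      ring.zero = (\<lambda>v\<in>carrier E. \<zero>\<^bsub>F\<^esub>),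
      add = (\<lambda>S T. \<lambda>v\<in>carrier E. S v \<oplus>\<^bsub>F\<^esub> T v),
      module.smult = (\<lambda>c T. \<lambda>v\<in>carrier E. c \<odot>\<^bsub>F\<^esub> T v),
      vnorm = (\<lambda>T. SUP v\<in>unit_ball E. vnorm F (T v))\<rparr>"

text \<open>
  The product topology is the topology of pointwise convergence on the carrier of \<open>E\<close>,
  with \<open>F\<close> carrying its norm topology.
\<close>

definition strong_topology_ball ::
  "'v normed_module \<Rightarrow> 'w normed_module \<Rightarrow> ('v \<Rightarrow> 'w) topology" where
  "strong_topology_ball E F =
     subtopology (product_topology (\<lambda>_. norm_topology F) (carrier E))
       (unit_ball (bounded_operators E F))"

definition complex_line :: "complex normed_module" where
  "complex_line =
     \<lparr>carrier = UNIV, monoid.mult = (*), one = 1, ring.zero = 0, add = (+), module.smult = (*), vnorm = cmod\<rparr>"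

definition dual_space :: "'v normed_module \<Rightarrow> ('v \<Rightarrow> complex) normed_module" where
  "dual_space E = bounded_operators E complex_line"

definition reflexive_space :: "'v normed_module \<Rightarrow> bool" where
  "reflexive_space E \<longleftrightarrow>
     (\<forall>\<Phi>\<in>carrier (dual_space (dual_space E)).
        \<exists>v\<in>carrier E. \<forall>f\<in>carrier (dual_space E). \<Phi> f = f v)"

definition finite_rank :: "'v normed_module \<Rightarrow> 'w normed_module \<Rightarrow> ('v \<Rightarrow> 'w) \<Rightarrow> bool" where
  "finite_rank E F T \<longleftrightarrow>
     (\<exists>A. finite A \<and> A \<subseteq> carrier F \<and> T ` carrier E \<subseteq> linear_span F A)"

definition metric_approximation_property :: "'v normed_module \<Rightarrow> bool" where
  "metric_approximation_property E \<longleftrightarrow>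
     (\<exists>T :: nat \<Rightarrow> 'v \<Rightarrow> 'v.
        (\<forall>n. T n \<in> carrier (bounded_operators E E) \<and> finite_rank E E (T n) \<and>
             vnorm (bounded_operators E E) (T n) \<le> 1) \<and>
        (\<forall>v\<in>carrier E. limitin (norm_topology E) (\<lambda>n. T n v) v sequentially))"


section \<open>Fields over a measurable space\<close>

text \<open>
  The disjoint union of a family is a \<^const>\<open>Sigma\<close> set, with
  \<^const>\<open>fst\<close> as the projection. A Borel structure on the
  disjoint union of \<open>V\<close> is given separately as a measurable space
  \<open>MV\<close>. A section is represented by its second component.
\<close>

definition total_space :: "'x measure \<Rightarrow> ('x \<Rightarrow> 'v normed_module) \<Rightarrow> ('x \<times> 'v) set" where
  "total_space X V = (SIGMA x:space X. carrier (V x))"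

definition fibre_product ::
  "('x \<times> 'v) measure \<Rightarrow> ('x \<times> 'w) measure \<Rightarrow> (('x \<times> 'v) \<times> ('x \<times> 'w)) measure" where
  "fibre_product MV MW = restrict_space (MV \<Otimes>\<^sub>M MW) {(p, q). fst p = fst q}"

definition borel_section :: "'x measure \<Rightarrow> ('x \<times> 'v) measure \<Rightarrow> ('x \<Rightarrow> 'v) \<Rightarrow> bool" where
  "borel_section X MV s \<longleftrightarrow> (\<lambda>x. (x, s x)) \<in> measurable X MV"

definition fibre_norm :: "('x \<Rightarrow> 'v normed_module) \<Rightarrow> 'x \<times> 'v \<Rightarrow> real" where
  "fibre_norm V = (\<lambda>(x, v). vnorm (V x) v)"

definition fibre_add :: "('x \<Rightarrow> 'v normed_module) \<Rightarrow> ('x \<times> 'v) \<times> ('x \<times> 'v) \<Rightarrow> 'x \<times> 'v" where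
  "fibre_add V = (\<lambda>((x, v), (_, w)). (x, v \<oplus>\<^bsub>V x\<^esub> w))"

definition fibre_smult :: "('x \<Rightarrow> 'v normed_module) \<Rightarrow> complex \<times> ('x \<times> 'v) \<Rightarrow> 'x \<times> 'v" where
  "fibre_smult V = (\<lambda>(c, (x, v)). (x, c \<odot>\<^bsub>V x\<^esub> v))"

definition borel_field_banach ::
  "'x measure \<Rightarrow> ('x \<Rightarrow> 'v normed_module) \<Rightarrow> ('x \<times> 'v) measure \<Rightarrow> bool" where
  "borel_field_banach X V MV \<longleftrightarrow>
     standard_borel X \<and>
     (\<forall>x\<in>space X. separable_banach (V x)) \<and>
     space MV = total_space X V \<and> standard_borel MV \<and>
     fst \<in> measurable MV X \<and>
     fibre_norm V \<in> borel_measurable MV \<and>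
     fibre_add V \<in> measurable (fibre_product MV MV) MV \<and>
     fibre_smult V \<in> measurable (borel \<Otimes>\<^sub>M MV) MV \<and>
     (\<exists>\<phi> :: nat \<Rightarrow> 'x \<Rightarrow> 'v. (\<forall>n. borel_section X MV (\<phi> n)) \<and>
        (\<forall>x\<in>space X. norm_topology (V x) closure_of range (\<lambda>n. \<phi> n x) = carrier (V x)))"

definition total_sequence_of_sections ::
  "'x measure \<Rightarrow> ('x \<Rightarrow> 'v normed_module) \<Rightarrow> ('x \<times> 'v) measure \<Rightarrow> (nat \<Rightarrow> 'x \<Rightarrow> 'v) \<Rightarrow> bool" where
  "total_sequence_of_sections X V MV \<phi> \<longleftrightarrow>
     (\<forall>n. borel_section X MV (\<phi> n)) \<and>
     (\<forall>x\<in>space X.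
        norm_topology (V x) closure_of linear_span (V x) (range (\<lambda>n. \<phi> n x)) = carrier (V x))"

definition borel_field_polish ::
  "'x measure \<Rightarrow> ('x \<Rightarrow> 'v topology) \<Rightarrow> ('x \<times> 'v) measure \<Rightarrow> bool" where
  "borel_field_polish X V MV \<longleftrightarrow>
     standard_borel X \<and>
     (\<forall>x\<in>space X. polish_topology (V x)) \<and>
     space MV = (SIGMA x:space X. topspace (V x)) \<and> standard_borel MV \<and>
     fst \<in> measurable MV X \<and>
     (\<exists>d :: 'x \<Rightarrow> 'v metric.
        (\<lambda>((x, v), (_, w)). mdist (d x) v w) \<in> borel_measurable (fibre_product MV MV) \<and>
        (\<forall>x\<in>space X. mspace (d x) = topspace (V x) \<and> mcomplete_of (d x) \<and>
           mtopology_of (d x) = V x)) \<and>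
     (\<exists>\<phi> :: nat \<Rightarrow> 'x \<Rightarrow> 'v. (\<forall>n. borel_section X MV (\<phi> n)) \<and>
        (\<forall>x\<in>space X. V x closure_of range (\<lambda>n. \<phi> n x) = topspace (V x)))"

text \<open>Here \<open>\<mu>\<close> is both the base space and the measure on it.\<close>

definition measured_field_polish ::
  "'x measure \<Rightarrow> ('x \<Rightarrow> 'v topology) \<Rightarrow> ('x \<times> 'v) measure \<Rightarrow> bool" where
  "measured_field_polish \<mu> V MV \<longleftrightarrow>
     standard_borel \<mu> \<and> sigma_finite_measure \<mu> \<and>
     (\<forall>x\<in>space \<mu>. polish_topology (V x)) \<and>
     space MV = (SIGMA x:space \<mu>. topspace (V x)) \<and> standard_borel MV \<and>
     fst \<in> measurable MV \<mu> \<and>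
     (\<exists>X0\<in>sets \<mu>. emeasure \<mu> (space \<mu> - X0) = 0 \<and>
        borel_field_polish (restrict_space \<mu> X0) V (restrict_space MV {p. fst p \<in> X0}))"


section \<open>The field of bounded operators\<close>

definition operator_field ::
  "('x \<Rightarrow> 'v normed_module) \<Rightarrow> ('x \<Rightarrow> 'w normed_module) \<Rightarrow> 'x \<Rightarrow> ('v \<Rightarrow> 'w) normed_module" where
  "operator_field V W = (\<lambda>x. bounded_operators (V x) (W x))"

definition operator_borel_structure ::
  "'x measure \<Rightarrow> ('x \<Rightarrow> 'v normed_module) \<Rightarrow> ('x \<times> 'v) measure \<Rightarrow>
   ('x \<Rightarrow> 'w normed_module) \<Rightarrow> ('x \<times> 'w) measure \<Rightarrow> ('x \<times> ('v \<Rightarrow> 'w)) measure \<Rightarrow> bool" where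
  "operator_borel_structure X V MV W MW MB \<longleftrightarrow>
     space MB = total_space X (operator_field V W) \<and> standard_borel MB \<and>
     fst \<in> measurable MB X \<and>
     (\<lambda>((x, T), (_, v)). (x, T v)) \<in> measurable (fibre_product MB MV) MW"

definition operator_composition ::
  "('x \<Rightarrow> 'v normed_module) \<Rightarrow> ('x \<times> ('w \<Rightarrow> 'u)) \<times> ('x \<times> ('v \<Rightarrow> 'w)) \<Rightarrow> 'x \<times> ('v \<Rightarrow> 'u)" where
  "operator_composition V = (\<lambda>((x, S), (_, T)). (x, compose (carrier (V x)) S T))"

definition operator_ball_structure ::
  "('x \<Rightarrow> 'v normed_module) \<Rightarrow> ('x \<Rightarrow> 'w normed_module) \<Rightarrow> ('x \<times> ('v \<Rightarrow> 'w)) measure \<Rightarrow>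
   ('x \<times> ('v \<Rightarrow> 'w)) measure" where
  "operator_ball_structure V W MB =
     restrict_space MB {(x, T). T \<in> unit_ball (bounded_operators (V x) (W x))}"

end

(*
  An operator is determined by its values on a dense sequence of sections phi_n of V, and a
  sequence of vectors w_n extends to an operator of norm at most C iff the countably many
  inequalities |p w_n + q w_m - w_k| <= C |p phi_n + q phi_m - phi_k| hold, p and q running over
  the Gaussian rationals. So T |-> (T phi_n)_n embeds B(V,W) as a measurable subset of X times a
  countable power of W. Uniqueness and part 5 then follow from Lusin separation: countably
  many measurable sets separating the points of a standard Borel space generate its structure.

  The strong topology on the unit ball is given by a complete metric built from the numbers
  |S phi_n - T phi_n|, and what remains is a dense sequence of measurable sections. It suffices to
  find, for each prescribed approximation of finitely many values S phi_n, a measurable section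
  realising it wherever it can be realised.
  In part 4 the competitors are contractions with values in a subspace whose bounded sequences
  have weak cluster points: W_x itself if W_x is reflexive, a finite-dimensional subspace if one
  of the fibres has the metric approximation property. Since norms are weakly lower
  semicontinuous, solvability of closed norm constraints reduces to countably many finite
  approximate ones, hence is measurable in x, and the values |S phi_n - psi_k| of the
  lexicographically least solution depend measurably on x.
  In part 3 there is no such compactness. The solvability set is a Suslin set and, by
  Choquet's capacity argument, measurable branches exist off a null set.
*)
theory Submission
  imports Defs
begin

section \<open>Standard Borel spaces\<close>

text \<open>Every standard Borel space is coded in the single space \<open>nat => nat\<close>, where
  countably many points, indices or witnesses fit into one sequence; products, projections and
  Suslin sets then become bookkeeping on indices. The separation theorem turns measurability of
  operator-valued maps into measurability of numbers: a family \<open>T x\<close> is measurable as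
  soon as all \<open>|T x (\<phi> n x) - \<psi> k x|\<close> are. This is the origin of the
  lexicographic order. Each single pair \<open>(n, k)\<close> is a constraint with a radius of its
  own, so every solution of the full minimisation realises each radius exactly. The numbers are
  determined although the operator is picked by an arbitrary choice, and no selection theorem
  enters. The obstacle is attainment of the minima: bounded sequences of operators need not have
  strong limits, and weak cluster points must be taken for all \<open>n\<close> and all functionals
  at once. One ultrafilter, fixed once, does this without separability of the dual. When weak
  compactness fails, only sequences of indices of approximating vectors are left to choose from, and
  choosing one measurably costs a null set.\<close>

definition borel_embedding ::
  "'a measure \<Rightarrow> 'b measure \<Rightarrow> ('a \<Rightarrow> 'b) \<Rightarrow> ('b \<Rightarrow> 'a) \<Rightarrow> 'b set \<Rightarrow> bool" where
  "borel_embedding M N c d B \<longleftrightarrow>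
     B \<in> sets N \<and> c \<in> measurable M N \<and> c \<in> space M \<rightarrow> B \<and>
     d \<in> measurable (restrict_space N B) M \<and>
     (\<forall>x\<in>space M. d (c x) = x) \<and> (\<forall>y\<in>B. c (d y) = y)"

text \<open>The image of the composite is a preimage under the given inverse \<open>d'\<close>.
  Because the inverses are part of the data, measurability of images never has to be derived from
  injectivity.\<close>

lemma borel_embedding_trans:
  assumes "borel_embedding M N c d B" and "borel_embedding N P c' d' B'"
  shows "borel_embedding M P (c' \<circ> c) (d \<circ> d') {y \<in> B'. d' y \<in> B}"
proof -
  note 1 = assms(1)[unfolded borel_embedding_def] and 2 = assms(2)[unfolded borel_embedding_def]
  have BP: "{y \<in> B'. d' y \<in> B} \<in> sets P"
  proof -
    have "d' -` B \<inter> space (restrict_space P B') \<in> sets (restrict_space P B')"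
      using 1 2 by (intro measurable_sets) auto
    moreover have "space (restrict_space P B') = B'"
      using 2 sets.sets_into_space by (auto simp: space_restrict_space)
    ultimately have "d' -` B \<inter> B' \<in> sets (restrict_space P B')" by simp
    then have "d' -` B \<inter> B' \<in> sets P" using 2 by (simp add: sets_restrict_space_iff)
    moreover have "{y \<in> B'. d' y \<in> B} = d' -` B \<inter> B'" by auto
    ultimately show ?thesis by simp
  qed
  have s: "space (restrict_space P {y \<in> B'. d' y \<in> B}) = {y \<in> B'. d' y \<in> B}"
    using sets.sets_into_space[OF BP] by (auto simp: space_restrict_space)
  have "d' \<in> measurable (restrict_space (restrict_space P B') {y \<in> B'. d' y \<in> B}) N"
    using 2 by (auto intro: measurable_restrict_space1)
  also have "restrict_space (restrict_space P B') {y \<in> B'. d' y \<in> B} = restrict_space P {y \<in> B'. d' y \<in> B}"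
    using 2 BP by (subst restrict_restrict_space) (auto intro!: arg_cong[where f="restrict_space P"])
  finally have "d' \<in> measurable (restrict_space P {y \<in> B'. d' y \<in> B}) (restrict_space N B)"
    using s by (intro measurable_restrict_space2) auto
  then have "d \<circ> d' \<in> measurable (restrict_space P {y \<in> B'. d' y \<in> B}) M"
    using 1 by (intro measurable_comp) auto
  moreover have "c' \<circ> c \<in> measurable M P" using 1 2 by (auto intro: measurable_comp)
  moreover have "c x \<in> space N" if "x \<in> space M" for x using 1 that by (auto dest: measurable_space)
  ultimately show ?thesis using 1 2 BP unfolding borel_embedding_def
    by (auto simp: Pi_iff)
qed

lemma borel_embedding_restrict_space:
  assumes "B \<in> sets N"
  shows "borel_embedding (restrict_space N B) N id id B"
  using assms sets.sets_into_space[OF assms] unfolding borel_embedding_def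
  by (auto simp: space_restrict_space intro!: measurable_restrict_space1)

lemma borel_embedding_isomorphism:
  assumes "f \<in> measurable M N" "g \<in> measurable N M"
    "\<And>x. x \<in> space M \<Longrightarrow> g (f x) = x" "\<And>y. y \<in> space N \<Longrightarrow> f (g y) = y"
  shows "borel_embedding M N f g (space N)"
  using assms unfolding borel_embedding_def
  by (auto dest: measurable_space intro: measurable_restrict_space1)

lemma borel_embedding_imp_isomorphic:
  assumes "borel_embedding M N c d B"
  shows "isomorphic_measurable_spaces M (restrict_space N B)"
  unfolding isomorphic_measurable_spaces_def
proof (intro bexI conjI ballI)
  note 1 = assms[unfolded borel_embedding_def]
  show "c \<in> measurable M (restrict_space N B)" using 1 by (intro measurable_restrict_space2) auto
  show "d \<in> measurable (restrict_space N B) M" using 1 by auto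
  show "d (c x) = x" if "x \<in> space M" for x using 1 that by auto
  show "c (d y) = y" if "y \<in> space (restrict_space N B)" for y using 1 that by (auto simp: space_restrict_space)
qed

section \<open>Coding real sequences by sequences of naturals\<close>

lemma measurable_component_borel:
  "(\<lambda>y::'i::countable \<Rightarrow> 'b::second_countable_topology. y i) \<in> measurable borel borel"
  by (rule measurable_product_coordinates)

lemma measurable_count_space_nat_iff:
  "f \<in> measurable M (count_space UNIV) \<longleftrightarrow> f \<in> measurable M (borel :: nat measure)"
  using measurable_cong_sets[OF refl sets_borel_eq_count_space[where 'a=nat], of M] by blast

lemma measurable_component_nat:
  "(\<lambda>y::'i::countable \<Rightarrow> nat. y i) \<in> measurable borel (count_space UNIV)"
  unfolding measurable_count_space_nat_iff by (rule measurable_component_borel)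

text \<open>Entry \<open>(i, n)\<close> keeps the \<open>i\<close>-th term to dyadic precision
  \<open>2^-n\<close>. Floors are discontinuous but Borel, which is enough for a Borel
  embedding.\<close>

definition real_seq_code :: "(nat \<Rightarrow> real) \<Rightarrow> nat \<Rightarrow> nat" where
  "real_seq_code r m = (case prod_decode m of (i, n) \<Rightarrow> int_encode \<lfloor>r i * 2 ^ n\<rfloor>)"

text \<open>\<open>lim\<close> is total and Borel even where the quotients diverge. Decoding is thus
  measurable everywhere, and the genuine codes are cut out afterwards as the fixed points of coding
  after decoding.\<close>

definition real_seq_decode :: "(nat \<Rightarrow> nat) \<Rightarrow> nat \<Rightarrow> real" where
  "real_seq_decode y i = lim (\<lambda>n. real_of_int (int_decode (y (prod_encode (i, n)))) / 2 ^ n)"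

lemma euclidean_nat_discrete: "(euclidean :: nat topology) = discrete_topology UNIV"
  by (simp add: topology_eq open_discrete)

lemma real_seq_code_measurable: "real_seq_code \<in> measurable borel borel"
proof (rule measurable_coordinatewise_then_product)
  fix m
  obtain i n where m: "prod_decode m = (i, n)" by fastforce
  have [measurable]: "(\<lambda>r::nat \<Rightarrow> real. r i) \<in> borel_measurable borel" by (rule measurable_component_borel)
  have "(\<lambda>r::nat \<Rightarrow> real. int_encode \<lfloor>r i * 2 ^ n\<rfloor>) \<in> measurable borel (count_space UNIV)"
    by measurable
  then show "(\<lambda>x. real_seq_code x m) \<in> borel_measurable borel"
    unfolding real_seq_code_def m by (simp add: measurable_count_space_nat_iff)
qed

lemma real_seq_decode_measurable: "real_seq_decode \<in> measurable borel borel"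
proof (rule measurable_coordinatewise_then_product)
  fix i
  have [measurable]: "(\<lambda>y. real_of_int (int_decode (y (prod_encode (i, n)))) / 2 ^ n) \<in> borel_measurable (borel :: (nat \<Rightarrow> nat) measure)" for n
    by (rule measurable_compose[OF measurable_component_nat]) simp
  show "(\<lambda>y. real_seq_decode y i) \<in> borel_measurable borel"
    unfolding real_seq_decode_def by measurable
qed

lemma real_seq_decode_code: "real_seq_decode (real_seq_code r) = r"
proof
  fix i
  have "(\<lambda>n. real_of_int \<lfloor>r i * 2 ^ n\<rfloor> / 2 ^ n) \<longlonglongrightarrow> r i"
  proof (rule tendsto_sandwich)
    show "\<forall>\<^sub>F n in sequentially. r i - (1/2)^n \<le> real_of_int \<lfloor>r i * 2 ^ n\<rfloor> / 2 ^ n"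
    proof (intro always_eventually allI)
      fix n
      have "r i * 2 ^ n - 1 \<le> real_of_int \<lfloor>r i * 2 ^ n\<rfloor>" by linarith
      then have "(r i * 2 ^ n - 1) / 2^n \<le> real_of_int \<lfloor>r i * 2 ^ n\<rfloor> / 2 ^ n" by (intro divide_right_mono) auto
      then show "r i - (1/2)^n \<le> real_of_int \<lfloor>r i * 2 ^ n\<rfloor> / 2 ^ n" by (simp add: diff_divide_distrib power_one_over)
    qed
    show "\<forall>\<^sub>F n in sequentially. real_of_int \<lfloor>r i * 2 ^ n\<rfloor> / 2 ^ n \<le> r i"
      by (intro always_eventually allI) (simp add: divide_le_eq)
    have "(\<lambda>n. r i - (1/2)^n) \<longlonglongrightarrow> r i - 0" by (intro tendsto_diff tendsto_const LIMSEQ_realpow_zero) auto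
    then show "(\<lambda>n. r i - (1/2)^n) \<longlonglongrightarrow> r i" by simp
  qed simp
  then show "real_seq_decode (real_seq_code r) i = r i"
    unfolding real_seq_decode_def real_seq_code_def by (simp add: limI)
qed

lemma borel_embedding_real_seq:
  "borel_embedding borel borel real_seq_code real_seq_decode {y. real_seq_code (real_seq_decode y) = y}"
  unfolding borel_embedding_def
proof (intro conjI)
  note [measurable] = real_seq_code_measurable real_seq_decode_measurable
  have "(\<lambda>y. real_seq_code (real_seq_decode y)) \<in> measurable borel borel" by measurable
  then have [measurable]: "(\<lambda>y. real_seq_code (real_seq_decode y) n) \<in> measurable borel (count_space UNIV)" for n
    by (rule measurable_compose) (rule measurable_component_nat)
  note [measurable] = measurable_component_nat
  have "{y. real_seq_code (real_seq_decode y) = y} =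
      {y \<in> space borel. \<forall>n. real_seq_code (real_seq_decode y) n = y n}" by auto
  also have "\<dots> \<in> sets borel" by measurable
  finally show "{y. real_seq_code (real_seq_decode y) = y} \<in> sets borel" .
  show "real_seq_decode \<in> restrict_space borel {y. real_seq_code (real_seq_decode y) = y} \<rightarrow>\<^sub>M borel"
    by (intro measurable_restrict_space1) measurable
qed (auto simp: real_seq_decode_code real_seq_code_measurable)

text \<open>This describes the image of the Kuratowski embedding by countably many inequalities. By
  the second one, centres with small \<open>r\<close> form a Cauchy sequence; completeness gives the
  limit \<open>x\<close>, and the two inequalities together force the distances of \<open>x\<close>
  to be \<open>r\<close>.\<close>

lemma (in Metric_space) dist_seq_image:
  assumes comp: "mcomplete" and c: "range c \<subseteq> M" "mtopology closure_of range c = M"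
    and r: "\<And>n k. \<bar>r n - r k\<bar> \<le> d (c n) (c k)" "\<And>n k. d (c n) (c k) \<le> r n + r k"
      "\<And>j::nat. \<exists>n. r n < 1 / Suc j"
  shows "\<exists>x\<in>M. \<forall>n. r n = d x (c n)"
proof -
  obtain n where n: "\<And>j::nat. r (n j) < 1 / Suc j" using r(3) by metis
  have r0: "r n \<ge> 0" for n using r(2)[of n n] c by (auto simp: image_subset_iff)
  have lim0: "(\<lambda>j. r (n j)) \<longlonglongrightarrow> 0"
    by (rule tendsto_sandwich[OF _ _ tendsto_const lim_inverse_n'[THEN LIMSEQ_Suc]])
      (use n r0 in \<open>auto intro!: always_eventually simp: less_imp_le\<close>)
  have "MCauchy (\<lambda>j. c (n j))"
    unfolding MCauchy_def
  proof (intro conjI allI impI)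
    show "range (\<lambda>j. c (n j)) \<subseteq> M" using c by auto
    fix e :: real assume "e > 0"
    then have "\<forall>\<^sub>F j in sequentially. r (n j) < e/2" using lim0 order_tendstoD(2) half_gt_zero by blast
    then obtain N where "\<And>j. j \<ge> N \<Longrightarrow> r (n j) < e/2" by (auto simp: eventually_sequentially)
    then show "\<exists>N. \<forall>j j'. N \<le> j \<longrightarrow> N \<le> j' \<longrightarrow> d (c (n j)) (c (n j')) < e"
      using r(2) by (smt (verit) field_sum_of_halves)
  qed
  then obtain x where x: "limitin mtopology (\<lambda>j. c (n j)) x sequentially"
    using comp unfolding mcomplete_def by blast
  then have xM: "x \<in> M" by (simp add: limitin_mspace)
  have dx: "(\<lambda>j. d (c (n j)) x) \<longlonglongrightarrow> 0" using x by (simp add: limitin_metric_dist_null)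
  have "r k = d x (c k)" for k
  proof -
    have cM: "c i \<in> M" for i using c by auto
    have "(\<lambda>j. d (c (n j)) (c k)) \<longlonglongrightarrow> d x (c k)"
    proof (rule Lim_transform_bound[where g="\<lambda>j. d (c (n j)) x" and f="\<lambda>j. d (c (n j)) (c k) - d x (c k)", THEN LIM_zero_cancel])
      show "\<forall>\<^sub>F j in sequentially. norm (d (c (n j)) (c k) - d x (c k)) \<le> norm (d (c (n j)) x)"
      proof (intro always_eventually allI)
        fix j
        have "d (c (n j)) (c k) \<le> d (c (n j)) x + d x (c k)" "d x (c k) \<le> d x (c (n j)) + d (c (n j)) (c k)"
          using triangle cM xM by auto
        then show "norm (d (c (n j)) (c k) - d x (c k)) \<le> norm (d (c (n j)) x)"
          using commute[of x "c (n j)"] by auto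
      qed
    qed (rule dx)
    moreover have "(\<lambda>j. d (c (n j)) (c k)) \<longlonglongrightarrow> r k"
    proof (rule Lim_transform_bound[where g="\<lambda>j. r (n j)" and f="\<lambda>j. d (c (n j)) (c k) - r k", THEN LIM_zero_cancel])
      show "\<forall>\<^sub>F j in sequentially. norm (d (c (n j)) (c k) - r k) \<le> norm (r (n j))"
      proof (intro always_eventually allI)
        fix j
        show "norm (d (c (n j)) (c k) - r k) \<le> norm (r (n j))"
          using r(1)[of k "n j"] r(2)[of "n j" k] r0 commute[of "c k" "c (n j)"] by auto
      qed
    qed (rule lim0)
    ultimately show ?thesis using LIMSEQ_unique by blast
  qed
  then show ?thesis using xM by blast
qed

lemma borel_embedding_polish:
  assumes "polish_topology T"
  shows "\<exists>e d G. borel_embedding (borel_of_topology T) (borel :: (nat \<Rightarrow> real) measure) e d G"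
proof (cases "topspace T = {}")
  case True
  then have "space (borel_of_topology T) = {}" by (simp add: borel_of_topology_def space_measure_of_conv)
  then have "borel_embedding (borel_of_topology T) (borel :: (nat \<Rightarrow> real) measure) (\<lambda>x. undefined) (\<lambda>x. undefined) {}"
    unfolding borel_embedding_def by (auto simp: measurable_def)
  then show ?thesis by blast
next
  case False
  obtain M d where M: "Metric_space M d" "Metric_space.mcomplete M d" "T = Metric_space.mtopology M d"
    using assms unfolding polish_topology_def completely_metrizable_space_def by blast
  interpret Metric_space M d by fact
  obtain C where C: "countable C" "C \<subseteq> M" "mtopology closure_of C = M"
    using assms M unfolding polish_topology_def separable_space_def by auto
  have "C \<noteq> {}" using C False M by auto
  define c where "c = from_nat_into C"
  have rc: "range c = C" unfolding c_def using \<open>C \<noteq> {}\<close> \<open>countable C\<close> by (rule range_from_nat_into)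
  have cM: "c n \<in> M" for n using rc C by auto
  have dense: "\<exists>n. d x (c n) < e" if "x \<in> M" "e > 0" for x e
  proof -
    have "x \<in> mtopology closure_of range c" using C rc that by simp
    then show ?thesis using that unfolding metric_closure_of by (fastforce simp: in_mball)
  qed
  define e where "e = (\<lambda>x n. d x (c n))"
  define G where "G = {r :: nat \<Rightarrow> real. (\<forall>n k. \<bar>r n - r k\<bar> \<le> d (c n) (c k)) \<and> (\<forall>n k. d (c n) (c k) \<le> r n + r k) \<and>
      (\<forall>j::nat. \<exists>n. r n < 1 / Suc j)}"
  have sp: "space (borel_of_topology T) = M" unfolding borel_of_topology_def by (simp add: space_measure_of_conv M)
  have op: "U \<in> sets (borel_of_topology T)" if "openin mtopology U" for U
  proof -
    have "{U. openin T U} \<subseteq> Pow (topspace T)" using openin_subset by auto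
    then show ?thesis using that M unfolding borel_of_topology_def by (auto simp: sets_measure_of)
  qed
  have GB: "G \<in> sets borel"
  proof -
    note [measurable] = measurable_component_borel
    have "G = {r \<in> space borel. (\<forall>n k. \<bar>r n - r k\<bar> \<le> d (c n) (c k)) \<and> (\<forall>n k. d (c n) (c k) \<le> r n + r k) \<and>
      (\<forall>j::nat. \<exists>n. r n < 1 / Suc j)}" by (auto simp: G_def)
    also have "\<dots> \<in> sets borel" by measurable
    finally show ?thesis .
  qed
  have eG: "e x \<in> G" if "x \<in> M" for x
  proof -
    have "\<bar>d x (c n) - d x (c k)\<bar> \<le> d (c n) (c k)" for n k
      using mdist_reverse_triangle[OF cM that cM, of n k] commute by metis
    moreover have "d (c n) (c k) \<le> d x (c n) + d x (c k)" for n k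
      using triangle''[OF cM that cM, of n k] by (simp add: commute)
    ultimately show ?thesis using that dense[OF that] unfolding G_def e_def by auto
  qed
  define g where "g = (\<lambda>r. SOME x. x \<in> M \<and> e x = r)"
  have g: "g r \<in> M \<and> e (g r) = r" if "r \<in> G" for r
  proof -
    have "\<exists>x\<in>M. \<forall>n. r n = d x (c n)"
      using that C rc by (intro dist_seq_image[OF M(2)]) (auto simp: G_def)
    then have "\<exists>x. x \<in> M \<and> e x = r" unfolding e_def by fastforce
    then show ?thesis unfolding g_def by (rule someI_ex)
  qed
  have inj: "x = y" if xy: "x \<in> M" "y \<in> M" "e x = e y" for x y
  proof (rule ccontr)
    assume "x \<noteq> y"
    then have "d x y / 2 > 0" using xy by auto
    from dense[OF xy(1) this] obtain n where "d x (c n) < d x y / 2" by blast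
    moreover have "d y (c n) = d x (c n)" using xy(3) unfolding e_def by metis
    ultimately show False using triangle[OF xy(1) cM xy(2), of n] commute[of y "c n"] by simp
  qed
  have em: "e \<in> measurable (borel_of_topology T) borel"
  proof (rule measurable_coordinatewise_then_product)
    fix n
    show "(\<lambda>x. e x n) \<in> borel_measurable (borel_of_topology T)"
    proof (rule borel_measurableI_less)
      fix y
      have "{x \<in> space (borel_of_topology T). e x n < y} = mball (c n) y"
        using cM by (auto simp: sp e_def in_mball commute)
      then show "{x \<in> space (borel_of_topology T). e x n < y} \<in> sets (borel_of_topology T)"
        using op openin_mball by simp
    qed
  qed
  have gm: "g \<in> measurable (restrict_space borel G) (borel_of_topology T)"
    unfolding borel_of_topology_def
  proof (rule measurable_measure_of)
    show "{U. openin T U} \<subseteq> Pow (topspace T)" using openin_subset by auto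
    show "g \<in> space (restrict_space borel G) \<rightarrow> topspace T"
      using g M by (auto simp: space_restrict_space)
    fix U assume "U \<in> {U. openin T U}"
    then have U: "openin mtopology U" using M by simp
    \<comment> \<open>The rational balls inside \<open>U\<close> cover it, and membership of the
      decoded point in such a ball reads \<open>r n < q\<close>. So the preimage of \<open>U\<close>
      is a countable union of coordinate conditions.\<close>
    define I where "I = {(n, q). q \<in> \<rat> \<and> q > 0 \<and> mball (c n) q \<subseteq> U}"
    have "countable (UNIV \<times> \<rat> :: (nat \<times> real) set)" by (simp add: countable_rat)
    then have cI: "countable I" by (rule countable_subset[rotated]) (auto simp: I_def)
    have "g -` U \<inter> space (restrict_space borel G) = G \<inter> (\<Union>(n,q)\<in>I. {r. r n < q})"
    proof (intro Set.set_eqI iffI)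
      fix r assume "r \<in> g -` U \<inter> space (restrict_space borel G)"
      then have r: "r \<in> G" "g r \<in> U" by (auto simp: space_restrict_space)
      then obtain eps where eps: "eps > 0" "mball (g r) eps \<subseteq> U" using U unfolding openin_mtopology by blast
      obtain q where q: "q \<in> \<rat>" "0 < q" "q < eps/2" using Rats_dense_in_real[of 0 "eps/2"] eps by auto
      obtain n where n: "d (g r) (c n) < q" using dense g r(1) q by blast
      have "mball (c n) q \<subseteq> mball (g r) eps"
      proof
        fix z assume "z \<in> mball (c n) q"
        then have z: "z \<in> M" "d (c n) z < q" by (auto simp: in_mball)
        have "d (g r) z \<le> d (g r) (c n) + d (c n) z" using triangle g[OF r(1)] cM z by blast
        then show "z \<in> mball (g r) eps" using z n q g[OF r(1)] by (auto simp: in_mball)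
      qed
      then have "(n, q) \<in> I" using eps q by (auto simp: I_def)
      moreover have "r n < q" using n g[OF r(1)] unfolding e_def by metis
      ultimately show "r \<in> G \<inter> (\<Union>(n,q)\<in>I. {r. r n < q})" using r by auto
    next
      fix r assume "r \<in> G \<inter> (\<Union>(n,q)\<in>I. {r. r n < q})"
      then obtain n q where r: "r \<in> G" "r n < q" "mball (c n) q \<subseteq> U" by (auto simp: I_def)
      have "d (g r) (c n) < q" using g[OF r(1)] r(2) unfolding e_def by metis
      then have "g r \<in> mball (c n) q" using g[OF r(1)] cM by (auto simp: in_mball commute)
      then show "r \<in> g -` U \<inter> space (restrict_space borel G)" using r by (auto simp: space_restrict_space)
    qed
    also have "\<dots> \<in> sets (restrict_space borel G)"
    proof -
      have "(\<Union>(n,q)\<in>I. {r::nat\<Rightarrow>real. r n < q}) \<in> sets borel"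
        using cI measurable_component_borel
        by (intro sets.countable_UN') (auto split: prod.splits intro!: measurable_sets[of _ borel borel "{..<_}", unfolded vimage_def, simplified])
      then show ?thesis using GB by (auto simp: sets_restrict_space_iff)
    qed
    finally show "g -` U \<inter> space (restrict_space borel G) \<in> sets (restrict_space borel G)" .
  qed
  have "borel_embedding (borel_of_topology T) borel e g G"
    unfolding borel_embedding_def using GB em gm eG g inj sp by (auto simp: Pi_iff)
  then show ?thesis by blast
qed

lemma standard_borel_imp_embedding:
  assumes "standard_borel M"
  shows "\<exists>c d B. borel_embedding M (borel :: (nat \<Rightarrow> nat) measure) c d B"
proof -
  obtain T :: "real topology" and B where T: "polish_topology T" "B \<in> sets (borel_of_topology T)"
    "isomorphic_measurable_spaces M (restrict_space (borel_of_topology T) B)"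
    using assms unfolding standard_borel_def by blast
  obtain f g where fg: "f \<in> measurable M (restrict_space (borel_of_topology T) B)"
    "g \<in> measurable (restrict_space (borel_of_topology T) B) M"
    "\<And>x. x \<in> space M \<Longrightarrow> g (f x) = x" "\<And>y. y \<in> space (restrict_space (borel_of_topology T) B) \<Longrightarrow> f (g y) = y"
    using T(3) unfolding isomorphic_measurable_spaces_def by blast
  obtain e d G where "borel_embedding (borel_of_topology T) (borel :: (nat \<Rightarrow> real) measure) e d G"
    using borel_embedding_polish[OF T(1)] by blast
  from borel_embedding_trans[OF borel_embedding_trans[OF borel_embedding_trans[OF
        borel_embedding_isomorphism[OF fg] borel_embedding_restrict_space[OF T(2)]] this] borel_embedding_real_seq]
  show ?thesis by blast
qed

text \<open>The definition asks for a Polish topology on a set of reals. The Baire topology is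
  transported along an injection \<open>j\<close>: a sequence is sent to its graph, a set of
  naturals, and sets of naturals inject into the reals. Continuity of \<open>j\<close> for the usual
  topology of the line plays no part in the transport.\<close>

lemma embedding_imp_standard_borel:
  assumes "borel_embedding M (borel :: (nat \<Rightarrow> nat) measure) c d B"
  shows "standard_borel M"
proof -
  obtain i :: "nat set \<Rightarrow> real" where i: "inj i"
    using eqpoll_imp_lepoll[OF nat_sets_eqpoll_reals] by (auto simp: lepoll_def)
  define j where "j = (\<lambda>y::nat\<Rightarrow>nat. i {prod_encode (n, y n) |n. True})"
  have "inj j"
  proof (rule injI)
    fix y z assume "j y = j z"
    then have eq: "{prod_encode (n, y n) |n. True} = {prod_encode (n, z n) |n. True}"
      using i by (auto simp: j_def inj_eq)
    show "y = z"
    proof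
      fix n
      have "prod_encode (n, y n) \<in> {prod_encode (n, z n) |n. True}" using eq by blast
      then show "y n = z n" by (auto simp: prod_encode_eq)
    qed
  qed
  define T where "T = topology (\<lambda>U. U \<subseteq> range j \<and> open (j -` U))"
  have op: "openin T U \<longleftrightarrow> U \<subseteq> range j \<and> open (j -` U)" for U
  proof -
    have "istopology (\<lambda>U. U \<subseteq> range j \<and> open (j -` U))"
      unfolding istopology_def by (auto simp: vimage_Union)
    then show ?thesis unfolding T_def by (simp add: topology_inverse')
  qed
  have ts: "topspace T = range j"
  proof
    show "topspace T \<subseteq> range j" using op openin_topspace by blast
    have "openin T (range j)" by (simp add: op vimage_def)
    then show "range j \<subseteq> topspace T" by (rule openin_subset)
  qed
  have "homeomorphic_map euclidean T j"
  proof (rule bijective_open_imp_homeomorphic_map)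
    show "continuous_map euclidean T j"
      unfolding continuous_map_def by (auto simp: ts op vimage_def)
    show "open_map euclidean T j"
      unfolding open_map_def using \<open>inj j\<close> by (auto simp: op inj_vimage_image_eq)
  qed (auto simp: ts \<open>inj j\<close>)
  then have hs: "(euclidean :: (nat \<Rightarrow> nat) topology) homeomorphic_space T"
    by (rule homeomorphic_map_imp_homeomorphic_space)
  have eu: "(euclidean :: (nat \<Rightarrow> nat) topology) = product_topology (\<lambda>_. discrete_topology UNIV) UNIV"
    by (simp add: euclidean_product_topology[symmetric] euclidean_nat_discrete)
  obtain D :: "(nat \<Rightarrow> nat) set" where D: "countable D" "\<And>X. open X \<Longrightarrow> X \<noteq> {} \<Longrightarrow> \<exists>d\<in>D. d \<in> X"
    using countable_dense_exists[where 'a="nat \<Rightarrow> nat"] by blast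
  have "euclidean closure_of D = UNIV"
    using D(2) by (auto simp: closure_of_def)
  then have sep: "separable_space (euclidean :: (nat \<Rightarrow> nat) topology)"
    using D(1) unfolding separable_space_def by auto
  have "completely_metrizable_space (euclidean :: (nat \<Rightarrow> nat) topology)"
    unfolding eu completely_metrizable_space_product_topology
    by (simp add: completely_metrizable_space_discrete_topology)
  then have pT: "polish_topology T"
    unfolding polish_topology_def
    using homeomorphic_completely_metrizable_space[OF hs] homeomorphic_separable_space[OF hs] sep by blast
  have sp: "space (borel_of_topology T) = range j" unfolding borel_of_topology_def by (simp add: space_measure_of_conv ts)
  have "borel_embedding (borel :: (nat \<Rightarrow> nat) measure) (borel_of_topology T) j (inv_into UNIV j) (space (borel_of_topology T))"
  proof (rule borel_embedding_isomorphism)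
    show "j \<in> borel \<rightarrow>\<^sub>M borel_of_topology T"
      unfolding borel_of_topology_def
      by (rule measurable_measure_of) (auto simp: ts op)
    show "inv_into UNIV j \<in> borel_of_topology T \<rightarrow>\<^sub>M borel"
    proof (rule borel_measurableI)
      fix S :: "(nat \<Rightarrow> nat) set" assume "open S"
      have "inv_into UNIV j -` S \<inter> space (borel_of_topology T) = j ` S"
        using \<open>inj j\<close> by (auto simp: sp)
      moreover have "openin T (j ` S)" using \<open>open S\<close> \<open>inj j\<close> by (auto simp: op inj_vimage_image_eq)
      ultimately show "inv_into UNIV j -` S \<inter> space (borel_of_topology T) \<in> sets (borel_of_topology T)"
        using openin_subset unfolding borel_of_topology_def by (auto simp: sets_measure_of_conv)
    qed
  qed (use \<open>inj j\<close> in \<open>auto simp: sp\<close>)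
  from borel_embedding_trans[OF assms this]
  obtain c' d' B' where "borel_embedding M (borel_of_topology T) c' d' B'" by blast
  then have "isomorphic_measurable_spaces M (restrict_space (borel_of_topology T) B')"
    and "B' \<in> sets (borel_of_topology T)"
    by (auto intro: borel_embedding_imp_isomorphic simp: borel_embedding_def)
  then show ?thesis using pT unfolding standard_borel_def by (intro exI[of _ T] exI[of _ B'] conjI)
qed

section \<open>Closure properties of standard Borel spaces\<close>

lemma standard_borel_embedding:
  assumes "borel_embedding M N c d B" "standard_borel N"
  shows "standard_borel M"
  using assms standard_borel_imp_embedding borel_embedding_trans embedding_imp_standard_borel by meson

lemma standard_borel_restrict_space:
  "standard_borel N \<Longrightarrow> B \<in> sets N \<Longrightarrow> standard_borel (restrict_space N B)"
  using borel_embedding_restrict_space standard_borel_embedding by blast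

lemma standard_borel_cong_sets:
  assumes "sets M = sets N" "standard_borel N" shows "standard_borel M"
proof -
  have "borel_embedding M N id id (space N)"
    using assms(1) sets_eq_imp_space_eq[OF assms(1)]
    by (intro borel_embedding_isomorphism) (auto simp: measurable_cong_sets[OF assms(1) refl] intro: measurable_id
        simp: measurable_ident_sets)
  then show ?thesis using assms standard_borel_embedding by blast
qed

text \<open>The codes of all factors are the rows of one double array, flattened by
  \<open>prod_encode\<close>; \<open>s y i\<close> reads row \<open>i\<close> back.\<close>

lemma standard_borel_PiM:
  fixes M :: "nat \<Rightarrow> 'a measure"
  assumes "\<And>i. standard_borel (M i)"
  shows "standard_borel (PiM UNIV M)"
proof -
  have "\<forall>i. \<exists>c d B. borel_embedding (M i) (borel :: (nat \<Rightarrow> nat) measure) c d B"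
    using assms standard_borel_imp_embedding by blast
  then obtain c d B where cdB: "\<And>i. borel_embedding (M i) (borel :: (nat \<Rightarrow> nat) measure) (c i) (d i) (B i)" by metis
  note 1 = cdB[unfolded borel_embedding_def]
  define c' where "c' = (\<lambda>x m. case prod_decode m of (i, j) \<Rightarrow> c i (x i) j)"
  define s where "s = (\<lambda>(y::nat \<Rightarrow> nat) (i::nat) (j::nat). y (prod_encode (i, j)))"
  define B' where "B' = {y. \<forall>i. s y i \<in> B i}"
  have sm[measurable]: "(\<lambda>y. s y i) \<in> borel_measurable borel" for i
    unfolding s_def by (rule measurable_coordinatewise_then_product) (rule measurable_component_borel)
  have "borel_embedding (PiM UNIV M) borel c' (\<lambda>y i. d i (s y i)) B'"
    unfolding borel_embedding_def
  proof (intro conjI ballI)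
    have [measurable]: "B i \<in> sets borel" for i using 1 by blast
    have "B' = {y \<in> space borel. \<forall>i. s y i \<in> B i}" by (auto simp: B'_def)
    also have "\<dots> \<in> sets borel" by measurable
    finally show B': "B' \<in> sets borel" .
    show "c' \<in> borel_measurable (PiM UNIV M)"
    proof (rule measurable_coordinatewise_then_product)
      fix m obtain i j where m: "prod_decode m = (i, j)" by fastforce
      have "c i \<in> borel_measurable (M i)" using 1 by blast
      then have [measurable]: "(\<lambda>z. c i z j) \<in> borel_measurable (M i)"
        by (rule measurable_compose) (rule measurable_component_borel)
      have "(\<lambda>x. c i (x i) j) \<in> borel_measurable (PiM UNIV M)" by measurable
      then show "(\<lambda>x. c' x m) \<in> borel_measurable (PiM UNIV M)" by (simp add: c'_def m)
    qed
    have sc: "s (c' x) i = c i (x i)" for x i by (simp add: s_def c'_def fun_eq_iff)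
    show "c' \<in> space (PiM UNIV M) \<rightarrow> B'"
    proof
      fix x assume "x \<in> space (PiM UNIV M)"
      then have "x i \<in> space (M i)" for i by (auto simp: space_PiM)
      then show "c' x \<in> B'" using 1 by (auto simp: B'_def sc Pi_iff)
    qed
    show "(\<lambda>y i. d i (s y i)) \<in> measurable (restrict_space borel B') (PiM UNIV M)"
    proof (rule measurable_PiM_single')
      show "(\<lambda>\<omega>. d i (s \<omega> i)) \<in> restrict_space borel B' \<rightarrow>\<^sub>M M i" for i
      proof -
        have "(\<lambda>y. s y i) \<in> measurable (restrict_space borel B') (restrict_space borel (B i))"
          by (intro measurable_restrict_space2 measurable_restrict_space1 sm) (auto simp: space_restrict_space B'_def)
        moreover have "d i \<in> measurable (restrict_space borel (B i)) (M i)" using 1 by blast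
        ultimately show ?thesis by (rule measurable_compose)
      qed
      then show "(\<lambda>\<omega> i. d i (s \<omega> i)) \<in> space (restrict_space borel B') \<rightarrow> (\<Pi>\<^sub>E i\<in>UNIV. space (M i))"
        by (auto dest: measurable_space)
    qed
    show "(\<lambda>i. d i (s (c' x) i)) = x" if "x \<in> space (PiM UNIV M)" for x
      using that 1 by (auto simp: sc fun_eq_iff space_PiM PiE_iff)
    show "c' (\<lambda>i. d i (s y i)) = y" if "y \<in> B'" for y
    proof
      fix m obtain i j where m: "prod_decode m = (i, j)" by fastforce
      have "c i (d i (s y i)) = s y i" using 1 that by (auto simp: B'_def)
      then show "c' (\<lambda>i. d i (s y i)) m = y m" using m by (simp add: c'_def s_def) (metis prod_decode_inverse)
    qed
  qed
  then show ?thesis by (rule embedding_imp_standard_borel)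
qed

text \<open>Even positions carry the code of the first factor, odd positions that of the
  second.\<close>

lemma standard_borel_pair:
  assumes "standard_borel M" "standard_borel N"
  shows "standard_borel (M \<Otimes>\<^sub>M N)"
proof -
  obtain c d B where "borel_embedding M (borel :: (nat \<Rightarrow> nat) measure) c d B"
    using assms standard_borel_imp_embedding by blast
  note 1 = this[unfolded borel_embedding_def]
  obtain c' d' B' where "borel_embedding N (borel :: (nat \<Rightarrow> nat) measure) c' d' B'"
    using assms standard_borel_imp_embedding by blast
  note 2 = this[unfolded borel_embedding_def]
  have [measurable]: "c \<in> borel_measurable M" "c' \<in> borel_measurable N" "B \<in> sets borel" "B' \<in> sets borel" using 1 2 by auto
  define C where "C = (\<lambda>(x, x') m. if even m then c x (m div 2) else c' x' (m div 2))"
  define s where "s = (\<lambda>(y::nat\<Rightarrow>nat) n. y (2*n))"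
  define s' where "s' = (\<lambda>(y::nat\<Rightarrow>nat) n. y (2*n+1))"
  have sm[measurable]: "s \<in> borel_measurable borel" "s' \<in> borel_measurable borel"
    unfolding s_def s'_def
    by (rule measurable_coordinatewise_then_product; rule measurable_component_borel)+
  have sC: "s (C p) = c (fst p)" "s' (C p) = c' (snd p)" for p
    by (auto simp: s_def s'_def C_def fun_eq_iff split: prod.splits)
  have Cs: "C (a, b) = y" if "c a = s y" "c' b = s' y" for a b y
    using that by (auto simp: s_def s'_def C_def fun_eq_iff)
  define D where "D = {y. s y \<in> B \<and> s' y \<in> B'}"
  have "borel_embedding (M \<Otimes>\<^sub>M N) borel C (\<lambda>y. (d (s y), d' (s' y))) D"
    unfolding borel_embedding_def
  proof (intro conjI ballI)
    have "D = {y \<in> space borel. s y \<in> B \<and> s' y \<in> B'}" by (auto simp: D_def)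
    also have "\<dots> \<in> sets borel" by measurable
    finally show "D \<in> sets borel" .
    show "C \<in> borel_measurable (M \<Otimes>\<^sub>M N)"
    proof (rule measurable_coordinatewise_then_product)
      fix m
      have [measurable]: "(\<lambda>z. c z j) \<in> borel_measurable M" "(\<lambda>z. c' z j) \<in> borel_measurable N" for j
        using \<open>c \<in> borel_measurable M\<close> \<open>c' \<in> borel_measurable N\<close>
        by (auto intro: measurable_compose[OF _ measurable_component_borel])
      have "(\<lambda>p. if even m then c (fst p) (m div 2) else c' (snd p) (m div 2)) \<in> borel_measurable (M \<Otimes>\<^sub>M N)" by measurable
      then show "(\<lambda>p. C p m) \<in> borel_measurable (M \<Otimes>\<^sub>M N)" by (simp add: C_def case_prod_beta)
    qed
    show "C \<in> space (M \<Otimes>\<^sub>M N) \<rightarrow> D"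
      using 1 2 by (auto simp: D_def sC space_pair_measure)
    have "(\<lambda>y. d (s y)) \<in> measurable (restrict_space borel D) M"
    proof (rule measurable_compose[of s _ "restrict_space borel B"])
      show "s \<in> restrict_space borel D \<rightarrow>\<^sub>M restrict_space borel B"
        by (intro measurable_restrict_space2 measurable_restrict_space1 sm) (auto simp: space_restrict_space D_def)
    qed (use 1 in blast)
    moreover have "(\<lambda>y. d' (s' y)) \<in> measurable (restrict_space borel D) N"
    proof (rule measurable_compose[of s' _ "restrict_space borel B'"])
      show "s' \<in> restrict_space borel D \<rightarrow>\<^sub>M restrict_space borel B'"
        by (intro measurable_restrict_space2 measurable_restrict_space1 sm) (auto simp: space_restrict_space D_def)
    qed (use 2 in blast)
    ultimately show "(\<lambda>y. (d (s y), d' (s' y))) \<in> restrict_space borel D \<rightarrow>\<^sub>M M \<Otimes>\<^sub>M N" by (rule measurable_Pair)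
    show "(d (s (C x)), d' (s' (C x))) = x" if "x \<in> space (M \<Otimes>\<^sub>M N)" for x
      using that 1 2 by (auto simp: sC space_pair_measure)
    show "C (d (s y), d' (s' y)) = y" if "y \<in> D" for y
      using that 1 2 by (intro Cs) (auto simp: D_def)
  qed
  then show ?thesis by (rule embedding_imp_standard_borel)
qed

text \<open>This is how the operator field gets its structure: pull it back along an injective code
  and check that the image is measurable.\<close>

lemma standard_borel_vimage_algebra:
  assumes "standard_borel N" "inj_on e S" "e \<in> S \<rightarrow> space N" "e ` S \<in> sets N"
  shows "standard_borel (vimage_algebra S e N)"
proof -
  have "borel_embedding (vimage_algebra S e N) N e (the_inv_into S e) (e ` S)"
    unfolding borel_embedding_def
  proof (intro conjI)
    show "e \<in> vimage_algebra S e N \<rightarrow>\<^sub>M N" using assms by (intro measurable_vimage_algebra1) auto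
    show "the_inv_into S e \<in> restrict_space N (e ` S) \<rightarrow>\<^sub>M vimage_algebra S e N"
    proof (rule measurable_vimage_algebra2)
      show "the_inv_into S e \<in> space (restrict_space N (e ` S)) \<rightarrow> S"
        using assms by (auto simp: space_restrict_space intro: the_inv_into_into[OF assms(2)])
      have "(\<lambda>x. x) \<in> restrict_space N (e ` S) \<rightarrow>\<^sub>M N" by (rule measurable_restrict_space1) simp
      moreover have "x = e (the_inv_into S e x)" if "x \<in> space (restrict_space N (e ` S))" for x
        using that assms by (simp add: space_restrict_space f_the_inv_into_f)
      ultimately show "(\<lambda>x. e (the_inv_into S e x)) \<in> restrict_space N (e ` S) \<rightarrow>\<^sub>M N"
        by (simp add: measurable_cong[of "restrict_space N (e ` S)" "\<lambda>x. x" "\<lambda>x. e (the_inv_into S e x)"])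
    qed
    show "e ` S \<in> sets N" by fact
    show "e \<in> space (vimage_algebra S e N) \<rightarrow> e ` S" by simp
    show "\<forall>x\<in>space (vimage_algebra S e N). the_inv_into S e (e x) = x"
      using the_inv_into_f_f[OF assms(2)] by simp
    show "\<forall>y\<in>e ` S. e (the_inv_into S e y) = y" using f_the_inv_into_f[OF assms(2)] by blast
  qed
  then show ?thesis using assms(1) by (rule standard_borel_embedding)
qed

section \<open>Analytic sets and generators of standard Borel structures\<close>

text \<open>The witness space is always \<open>nat => nat\<close>, so that countably many witnesses
  can be merged into one of the same kind.\<close>

definition analytic :: "'a::topological_space set \<Rightarrow> bool" where
  "analytic A \<longleftrightarrow> (\<exists>F :: ('a \<times> (nat \<Rightarrow> nat)) set. closed F \<and> A = fst ` F)"

lemma continuous_on_snd_component: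
  "continuous_on UNIV (\<lambda>p :: 'a::topological_space \<times> (nat \<Rightarrow> nat). snd p i)"
  by (rule continuous_on_compose2[OF continuous_on_product_coordinates continuous_on_snd[OF continuous_on_id]]) auto

lemma continuous_on_subsequence_pair:
  "continuous_on UNIV (\<lambda>p :: 'a::topological_space \<times> (nat \<Rightarrow> nat). (fst p, \<lambda>i. snd p (h i)))"
  by (intro continuous_on_Pair continuous_on_coordinatewise_then_product continuous_on_snd_component
      continuous_on_fst continuous_on_id)

lemma closed_subsequence_vimage:
  fixes F :: "('a::topological_space \<times> (nat \<Rightarrow> nat)) set" and h :: "nat \<Rightarrow> nat"
  assumes "closed F"
  shows "closed {(x, y). (x, \<lambda>i. y (h i)) \<in> F}"
proof -
  have "{(x, y). (x, \<lambda>i. y (h i)) \<in> F} = (\<lambda>p. (fst p, \<lambda>i. snd p (h i))) -` F" by auto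
  then show ?thesis using closed_vimage[OF assms continuous_on_subsequence_pair[of h]] by simp
qed

text \<open>Entry 0 of the merged witness names a set of the family and the tail is a witness for
  it. The merged set is an intersection over \<open>n\<close> of the clauses "entry 0 is not
  \<open>n\<close>, or the tail works for \<open>F n\<close>"; each is closed because singletons of
  naturals are open.\<close>

lemma analytic_UN:
  fixes A :: "nat \<Rightarrow> 'a::topological_space set"
  assumes "\<And>n. analytic (A n)" shows "analytic (\<Union>n. A n)"
proof -
  obtain F :: "nat \<Rightarrow> ('a \<times> (nat \<Rightarrow> nat)) set" where F: "\<And>n. closed (F n)" "\<And>n. A n = fst ` F n"
    using assms unfolding analytic_def by metis
  have "closed {(x::'a, y::nat \<Rightarrow> nat). y 0 \<noteq> n}" for n
  proof -
    have "closed ((\<lambda>p::'a \<times> (nat \<Rightarrow> nat). snd p 0) -` (- {n}))"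
      by (rule closed_vimage[OF _ continuous_on_snd_component]) (simp add: closed_def open_discrete)
    also have "(\<lambda>p::'a \<times> (nat \<Rightarrow> nat). snd p 0) -` (- {n}) = {(x, y). y 0 \<noteq> n}" by auto
    finally show ?thesis .
  qed
  then have "closed (\<Inter>n. {(x, y). y 0 \<noteq> n} \<union> {(x, y). (x, \<lambda>i. y (Suc i)) \<in> F n})"
    by (intro closed_INT ballI closed_Un closed_subsequence_vimage F(1)) simp_all
  moreover have "(\<Union>n. A n) = fst ` (\<Inter>n. {(x, y). y 0 \<noteq> n} \<union> {(x, y). (x, \<lambda>i. y (Suc i)) \<in> F n})"
  proof (intro equalityI subsetI)
    fix x assume "x \<in> (\<Union>n. A n)"
    then obtain n y where "(x, y) \<in> F n" using F by fastforce
    then have "(x, case_nat n y) \<in> (\<Inter>n. {(x, y). y 0 \<noteq> n} \<union> {(x, y). (x, \<lambda>i. y (Suc i)) \<in> F n})" by auto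
    from imageI[OF this, of fst] show "x \<in> fst ` (\<Inter>n. {(x, y). y 0 \<noteq> n} \<union> {(x, y). (x, \<lambda>i. y (Suc i)) \<in> F n})" by simp
  next
    fix x assume "x \<in> fst ` (\<Inter>n. {(x, y). y 0 \<noteq> n} \<union> {(x, y). (x, \<lambda>i. y (Suc i)) \<in> F n})"
    then obtain y where "\<forall>n. y 0 \<noteq> n \<or> (x, \<lambda>i. y (Suc i)) \<in> F n" by auto
    then have "(x, \<lambda>i. y (Suc i)) \<in> F (y 0)" by blast
    then show "x \<in> (\<Union>n. A n)" unfolding F(2) by force
  qed
  ultimately show ?thesis unfolding analytic_def by blast
qed

text \<open>One sequence holds a witness for every \<open>n\<close>, as the rows of a double array;
  each row imposes a closed condition.\<close>

lemma analytic_INT: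
  fixes A :: "nat \<Rightarrow> 'a::topological_space set"
  assumes "\<And>n. analytic (A n)" shows "analytic (\<Inter>n. A n)"
proof -
  obtain F :: "nat \<Rightarrow> ('a \<times> (nat \<Rightarrow> nat)) set" where F: "\<And>n. closed (F n)" "\<And>n. A n = fst ` F n"
    using assms unfolding analytic_def by metis
  define G where "G = (\<Inter>n. {(x, y). (x, \<lambda>i. y (prod_encode (n, i))) \<in> F n})"
  have "closed G" unfolding G_def by (intro closed_INT ballI closed_subsequence_vimage F(1))
  moreover have "(\<Inter>n. A n) = fst ` G"
  proof (intro equalityI subsetI)
    fix x assume "x \<in> (\<Inter>n. A n)"
    then have "\<forall>n. \<exists>y. (x, y) \<in> F n" using F by fastforce
    then obtain y where y: "\<And>n. (x, y n) \<in> F n" by metis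
    have "(x, \<lambda>m. case prod_decode m of (n, i) \<Rightarrow> y n i) \<in> G" by (auto simp: G_def y)
    then show "x \<in> fst ` G" by force
  next
    fix x assume "x \<in> fst ` G"
    then obtain y where "\<forall>n. (x, \<lambda>i. y (prod_encode (n, i))) \<in> F n" by (auto simp: G_def)
    then show "x \<in> (\<Inter>n. A n)" unfolding F(2) by force
  qed
  ultimately show ?thesis unfolding analytic_def by blast
qed

lemma analytic_closed: "closed C \<Longrightarrow> analytic C"
  unfolding analytic_def by (rule exI[of _ "C \<times> UNIV"]) (auto intro: closed_Times)

lemma open_contains_cylinder:
  fixes U :: "(nat \<Rightarrow> nat) set"
  assumes "open U" "x \<in> U"
  shows "\<exists>n. {y. \<forall>i<n. y i = x i} \<subseteq> U"
proof -
  have "openin (product_topology (\<lambda>i::nat. euclidean) UNIV) U" using assms by (simp add: open_fun_def)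
  from product_topology_open_contains_basis[OF this assms(2)]
  obtain X where X: "x \<in> Pi\<^sub>E UNIV X" "finite {i. X i \<noteq> UNIV}" "Pi\<^sub>E UNIV X \<subseteq> U" by auto
  obtain n where n: "\<forall>i\<in>{i. X i \<noteq> UNIV}. i < n" using X(2) finite_nat_set_iff_bounded by auto
  have "{y. \<forall>i<n. y i = x i} \<subseteq> Pi\<^sub>E UNIV X"
  proof
    fix y assume y: "y \<in> {y. \<forall>i<n. y i = x i}"
    have "y i \<in> X i" for i
    proof (cases "X i = UNIV")
      case False
      then have "y i = x i" using n y by auto
      then show ?thesis using PiE_mem[OF X(1), of i] by simp
    qed auto
    then show "y \<in> Pi\<^sub>E UNIV X" by (simp add: PiE_iff)
  qed
  then have "{y. \<forall>i<n. y i = x i} \<subseteq> U" using X(3) by (rule subset_trans)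
  then show ?thesis by (rule exI)
qed

lemma closed_component_eq: "closed {x :: nat \<Rightarrow> nat. x i = a}"
proof -
  have "closed ((\<lambda>x :: nat \<Rightarrow> nat. x i) -` {a})"
    by (rule closed_vimage[OF _ continuous_on_product_coordinates]) simp
  then show ?thesis by (simp add: vimage_def)
qed

text \<open>Products of cylinders are closed and form a countable base, so an open set is a
  countable union of closed ones.\<close>

lemma analytic_open:
  fixes U :: "((nat \<Rightarrow> nat) \<times> (nat \<Rightarrow> nat)) set"
  assumes "open U" shows "analytic U"
proof -
  define Z where "Z = (\<lambda>s :: nat list. {x :: nat \<Rightarrow> nat. \<forall>i<length s. x i = s ! i})"
  have cZ: "closed (Z s)" for s
  proof -
    have "Z s = (\<Inter>i\<in>{..<length s}. {x. x i = s ! i})" by (auto simp: Z_def)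
    then show ?thesis by (auto intro!: closed_component_eq)
  qed
  define A where "A = (\<lambda>k. case from_nat k of (s, t) \<Rightarrow> if Z s \<times> Z t \<subseteq> U then Z s \<times> Z t else {})"
  have "U = (\<Union>k. A k)"
  proof (intro equalityI subsetI)
    fix p assume "p \<in> U"
    then obtain x y where p: "p = (x, y)" "(x, y) \<in> U" by (cases p) auto
    obtain P Q where PQ': "open P" "open Q" "(x, y) \<in> P \<times> Q" "P \<times> Q \<subseteq> U"
      using open_prod_elim[OF assms p(2)] .
    then have PQ: "open P" "open Q" "x \<in> P" "y \<in> Q" "P \<times> Q \<subseteq> U" by auto
    obtain n m where "{z. \<forall>i<n. z i = x i} \<subseteq> P" "{z. \<forall>i<m. z i = y i} \<subseteq> Q"
      using open_contains_cylinder[OF PQ(1,3)] open_contains_cylinder[OF PQ(2,4)] by (elim exE)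
    then have "Z (map x [0..<n]) \<times> Z (map y [0..<m]) \<subseteq> U" using PQ(5) by (auto simp: Z_def)
    moreover have "p \<in> Z (map x [0..<n]) \<times> Z (map y [0..<m])" by (auto simp: Z_def p)
    ultimately have "p \<in> A (to_nat (map x [0..<n], map y [0..<m]))" by (simp add: A_def)
    then show "p \<in> (\<Union>k. A k)" by blast
  next
    fix p assume "p \<in> (\<Union>k. A k)"
    then obtain k s t where "from_nat k = (s, t)" "p \<in> A k" by (metis UN_E surj_pair)
    then show "p \<in> U" by (auto simp: A_def split: if_splits)
  qed
  moreover have "analytic (A k)" for k
    using cZ by (auto simp: A_def intro!: analytic_closed closed_Times split: prod.splits)
  ultimately show ?thesis using analytic_UN by metis
qed

text \<open>Complements of analytic sets need not be analytic, so the induction over the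
  sigma-algebra carries a set and its complement together.\<close>

lemma analytic_borel:
  fixes A :: "((nat \<Rightarrow> nat) \<times> (nat \<Rightarrow> nat)) set"
  assumes "A \<in> sets borel" shows "analytic A"
proof -
  have "A \<in> sigma_sets UNIV {S. open S}" using assms by (simp add: borel_def)
  then have "analytic A \<and> analytic (- A)"
  proof induction
    case (Basic a) then show ?case using analytic_open analytic_closed[of "- a"] by auto
  next
    case Empty then show ?case using analytic_closed by auto
  next
    case (Compl a) then show ?case by (simp add: Compl_eq_Diff_UNIV[symmetric])
  next
    case (Union a)
    then show ?case using analytic_UN[of a] analytic_INT[of "\<lambda>n. - a n"] by simp
  qed
  then show ?thesis ..
qed

definition interleave :: "(nat \<Rightarrow> nat) \<Rightarrow> (nat \<Rightarrow> nat) \<Rightarrow> nat \<Rightarrow> nat" where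
  "interleave y z n = (if even n then y (n div 2) else z (n div 2))"

text \<open>The projected coordinate becomes part of the witness: even entries hold it and odd
  entries hold the old witness.\<close>

lemma analytic_projection:
  fixes H :: "('a::topological_space \<times> (nat \<Rightarrow> nat)) set"
  assumes "analytic H" shows "analytic (fst ` H)"
proof -
  obtain F :: "(('a \<times> (nat \<Rightarrow> nat)) \<times> (nat \<Rightarrow> nat)) set" where F: "closed F" "H = fst ` F" using assms unfolding analytic_def by blast
  define G where "G = {(x, w). ((x, \<lambda>i. w (2 * i)), \<lambda>i. w (Suc (2 * i))) \<in> F}"
  have "continuous_on UNIV (\<lambda>p :: 'a \<times> (nat \<Rightarrow> nat). ((fst p, \<lambda>i. snd p (2 * i)), \<lambda>i. snd p (Suc (2 * i))))"
    by (intro continuous_on_Pair continuous_on_subsequence_pair continuous_on_coordinatewise_then_product continuous_on_snd_component)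
  then have "closed ((\<lambda>p. ((fst p, \<lambda>i. snd p (2 * i)), \<lambda>i. snd p (Suc (2 * i)))) -` F)"
    by (rule closed_vimage[OF F(1)])
  moreover have "(\<lambda>p. ((fst p, \<lambda>i. snd p (2 * i)), \<lambda>i. snd p (Suc (2 * i)))) -` F = G" by (auto simp: G_def)
  ultimately have "closed G" by simp
  moreover have "fst ` H = fst ` G"
  proof (intro equalityI subsetI)
    fix x assume "x \<in> fst ` H"
    then obtain y z where "((x, y), z) \<in> F" using F by force
    then have "(x, interleave y z) \<in> G" by (simp add: G_def interleave_def)
    then show "x \<in> fst ` G" by force
  next
    fix x assume "x \<in> fst ` G"
    then obtain w where "((x, \<lambda>i. w (2 * i)), \<lambda>i. w (Suc (2 * i))) \<in> F" by (auto simp: G_def)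
    then have "(x, \<lambda>i. w (2 * i)) \<in> H" unfolding F(2) by force
    then show "x \<in> fst ` H" by force
  qed
  ultimately show ?thesis unfolding analytic_def by blast
qed

section \<open>Lusin separation\<close>

definition borel_separated :: "'a::topological_space set \<Rightarrow> 'a set \<Rightarrow> bool" where
  "borel_separated A B \<longleftrightarrow> (\<exists>D\<in>sets borel. A \<subseteq> D \<and> D \<inter> B = {})"

lemma borel_separated_UN:
  fixes A B :: "nat \<Rightarrow> 'a::topological_space set"
  assumes "\<And>i j. borel_separated (A i) (B j)"
  shows "borel_separated (\<Union>i. A i) (\<Union>j. B j)"
proof -
  obtain D where D: "\<And>i j. D i j \<in> sets borel" "\<And>i j. A i \<subseteq> D i j" "\<And>i j. D i j \<inter> B j = {}"
    using assms unfolding borel_separated_def by metis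
  have "(\<Union>i. \<Inter>j. D i j) \<in> sets borel" using D(1) by auto
  moreover have "(\<Union>i. A i) \<subseteq> (\<Union>i. \<Inter>j. D i j)" using D(2) by blast
  moreover have "(\<Union>i. \<Inter>j. D i j) \<inter> (\<Union>j. B j) = {}" using D(3) by blast
  ultimately show ?thesis unfolding borel_separated_def by blast
qed

text \<open>Both analytic sets are cut into pieces by cylinders of the
  ambient space and of the witness space at the same time, so that a pair of pieces that cannot
  be separated shrinks to a common point.\<close>

definition cyl_piece :: "((nat \<Rightarrow> nat) \<times> (nat \<Rightarrow> nat)) set \<Rightarrow> nat \<Rightarrow> (nat \<Rightarrow> nat) \<Rightarrow> (nat \<Rightarrow> nat) \<Rightarrow> (nat \<Rightarrow> nat) set" where
  "cyl_piece F n x y = fst ` (F \<inter> {(x', y'). \<forall>i<n. x' i = x i \<and> y' i = y i})"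

lemma cyl_piece_cong:
  "(\<And>i. i < n \<Longrightarrow> x i = x' i \<and> y i = y' i) \<Longrightarrow> cyl_piece F n x y = cyl_piece F n x' y'"
  unfolding cyl_piece_def by (intro arg_cong[where f="image fst"]) auto

lemma cyl_piece_iff:
  "x' \<in> cyl_piece F n x y \<longleftrightarrow> (\<exists>y'. (x', y') \<in> F \<and> (\<forall>i<n. x' i = x i \<and> y' i = y i))"
  unfolding cyl_piece_def by force

text \<open>A single natural number \<open>k\<close> codes the next ambient digit and the next
  witness digit, so the pieces form a sequence and \<open>borel_separated_UN\<close>
  applies.\<close>

lemma cyl_piece_split:
  "cyl_piece F n x y = (\<Union>k. cyl_piece F (Suc n) (x(n := fst (prod_decode k))) (y(n := snd (prod_decode k))))"
proof (intro equalityI subsetI)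
  fix x' assume "x' \<in> cyl_piece F n x y"
  then obtain y' where y': "(x', y') \<in> F" "\<forall>i<n. x' i = x i \<and> y' i = y i" unfolding cyl_piece_iff by auto
  then have "x' \<in> cyl_piece F (Suc n) (x(n := x' n)) (y(n := y' n))" unfolding cyl_piece_iff
    by (intro exI[of _ y']) (auto simp: less_Suc_eq)
  then show "x' \<in> (\<Union>k. cyl_piece F (Suc n) (x(n := fst (prod_decode k))) (y(n := snd (prod_decode k))))"
    by (intro UN_I[of "prod_encode (x' n, y' n)"]) simp_all
next
  fix x' assume "x' \<in> (\<Union>k. cyl_piece F (Suc n) (x(n := fst (prod_decode k))) (y(n := snd (prod_decode k))))"
  then obtain k where "x' \<in> cyl_piece F (Suc n) (x(n := fst (prod_decode k))) (y(n := snd (prod_decode k)))" by (elim UN_E)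
  then obtain y' where y': "(x', y') \<in> F"
    "\<forall>i<Suc n. x' i = (x(n := fst (prod_decode k))) i \<and> y' i = (y(n := snd (prod_decode k))) i"
    unfolding cyl_piece_iff by auto
  then have "\<forall>i<n. x' i = x i \<and> y' i = y i" by (metis fun_upd_other less_SucI less_irrefl_nat)
  then show "x' \<in> cyl_piece F n x y" using y'(1) unfolding cyl_piece_iff by blast
qed

text \<open>Pieces whose new ambient digits differ are separated by a cylinder. If all pairs with a
  common ambient digit were separated too, the unions would be; hence some bad pair shares the digit
  \<open>a\<close>, while the witness digits \<open>b\<close> and \<open>c\<close> are
  independent.\<close>

lemma not_borel_separated_step:
  assumes "\<not> borel_separated (cyl_piece F n x y) (cyl_piece G n x z)"
  shows "\<exists>a b c. \<not> borel_separated (cyl_piece F (Suc n) (x(n := a)) (y(n := b))) (cyl_piece G (Suc n) (x(n := a)) (z(n := c)))"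
proof (rule ccontr)
  assume "\<not> ?thesis"
  then have same: "borel_separated (cyl_piece F (Suc n) (x(n := a)) (y(n := b))) (cyl_piece G (Suc n) (x(n := a)) (z(n := c)))" for a b c
    by blast
  have "borel_separated (cyl_piece F (Suc n) (x(n := a)) (y(n := b))) (cyl_piece G (Suc n) (x(n := a')) (z(n := c)))" for a a' b c
  proof (cases "a = a'")
    case True then show ?thesis using same by simp
  next
    case False
    note [measurable] = measurable_component_nat
    have "{x' \<in> space borel. x' n = a} \<in> sets (borel :: (nat \<Rightarrow> nat) measure)" by measurable
    then have "{x'. x' n = a} \<in> sets (borel :: (nat \<Rightarrow> nat) measure)" by simp
    then show ?thesis unfolding borel_separated_def
      by (rule bexI[rotated]) (use False in \<open>auto simp: cyl_piece_def\<close>)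
  qed
  then have "borel_separated (cyl_piece F n x y) (cyl_piece G n x z)"
    unfolding cyl_piece_split[of F n] cyl_piece_split[of G n]
    by (intro borel_separated_UN)
  then show False using assms by contradiction
qed

theorem lusin_separation:
  fixes A B :: "(nat \<Rightarrow> nat) set"
  assumes "analytic A" "analytic B" "A \<inter> B = {}"
  shows "borel_separated A B"
proof (rule ccontr)
  assume neg: "\<not> borel_separated A B"
  obtain F G :: "((nat \<Rightarrow> nat) \<times> (nat \<Rightarrow> nat)) set" where FG: "closed F" "A = fst ` F" "closed G" "B = fst ` G"
    using assms unfolding analytic_def by blast
  define P where "P = (\<lambda>n (x, y, z). \<not> borel_separated (cyl_piece F n x y) (cyl_piece G n x z))"
  \<comment> \<open>Stage \<open>n\<close> changes coordinate \<open>n\<close> only, so the stages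
    stabilise coordinatewise and have a diagonal limit.\<close>
  define Q where "Q = (\<lambda>(n::nat) (x, y, z) (x', y', z'). \<exists>a b c. x' = x(n := a :: nat) \<and> y' = y(n := b :: nat) \<and> z' = z(n := c :: nat))"
  have "\<exists>s. \<forall>n. P n (s n) \<and> Q n (s n) (s (Suc n))"
  proof (rule dependent_nat_choice)
    have "P 0 (\<lambda>_. 0, \<lambda>_. 0, \<lambda>_. 0)" using neg FG by (simp add: P_def cyl_piece_def)
    then show "\<exists>s. P 0 s" by blast
    fix s n assume "P n s"
    obtain x y z where s: "s = (x, y, z)" by (cases s)
    then obtain a b c where "P (Suc n) (x(n := a), y(n := b), z(n := c))"
      using not_borel_separated_step[of F n x y G z] \<open>P n s\<close> unfolding P_def by auto
    then show "\<exists>t. P (Suc n) t \<and> Q n s t" unfolding s Q_def by (intro exI[of _ "(x(n := a), y(n := b), z(n := c))"]) auto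
  qed
  then obtain s where s: "\<And>n. P n (s n)" "\<And>n. Q n (s n) (s (Suc n))" by blast
  define x y z where "x = (\<lambda>i. fst (s (Suc i)) i)" and "y = (\<lambda>i. fst (snd (s (Suc i))) i)" and "z = (\<lambda>i. snd (snd (s (Suc i))) i)"
  have agree: "i < n \<Longrightarrow> fst (s n) i = x i \<and> fst (snd (s n)) i = y i \<and> snd (snd (s n)) i = z i" for i n
  proof (induction n)
    case (Suc n)
    show ?case
    proof (cases "i = n")
      case True then show ?thesis by (simp add: x_def y_def z_def)
    next
      case False
      then have "i < n" using Suc by simp
      then show ?thesis using Suc.IH s(2)[of n] False unfolding Q_def by (auto split: prod.splits)
    qed
  qed simp
  have sep: "\<not> borel_separated (cyl_piece F n x y) (cyl_piece G n x z)" for n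
  proof -
    have "cyl_piece F n x y = cyl_piece F n (fst (s n)) (fst (snd (s n)))"
      "cyl_piece G n x z = cyl_piece G n (fst (s n)) (snd (snd (s n)))"
      using agree by (auto intro!: cyl_piece_cong)
    then show ?thesis using s(1)[of n] unfolding P_def by (auto split: prod.splits)
  qed
  \<comment> \<open>Cylinders around \<open>(x, y)\<close> form a neighbourhood base; if each of
    them meets \<open>F\<close>, closedness puts the point itself into \<open>F\<close>.\<close>
  have mem: "(x, y) \<in> F" if "closed F" "\<And>n. cyl_piece F n x y \<noteq> {}" for F and y :: "nat \<Rightarrow> nat"
  proof (rule ccontr)
    assume "(x, y) \<notin> F"
    then have F': "open (- F)" "(x, y) \<in> - F" using that(1) by (auto simp: closed_def)
    obtain U V where UV': "open U" "open V" "(x, y) \<in> U \<times> V" "U \<times> V \<subseteq> - F"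
      using open_prod_elim[OF F'] .
    then have UV: "open U" "open V" "x \<in> U" "y \<in> V" "U \<times> V \<subseteq> - F" by auto
    obtain n where n: "{x'. \<forall>i<n. x' i = x i} \<subseteq> U"
      using open_contains_cylinder[OF UV(1,3)] by (elim exE)
    obtain m where m: "{y'. \<forall>i<m. y' i = y i} \<subseteq> V"
      using open_contains_cylinder[OF UV(2,4)] by (elim exE)
    have "(x', y') \<in> - F" if "\<forall>i<max n m. x' i = x i \<and> y' i = y i" for x' y'
    proof -
      have "x' \<in> U" "y' \<in> V" using n m that by auto
      then show ?thesis using UV(5) by blast
    qed
    then have "F \<inter> {(x', y'). \<forall>i<max n m. x' i = x i \<and> y' i = y i} = {}" by auto
    then show False using that(2)[of "max n m"] unfolding cyl_piece_def by simp
  qed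
  have "(x, y) \<in> F"
  proof (rule mem[OF FG(1)])
    \<comment> \<open>An empty piece is separated from everything: by the empty set here, by the
      whole space when the piece belongs to \<open>G\<close>.\<close>
    fix n show "cyl_piece F n x y \<noteq> {}" using sep[of n] unfolding borel_separated_def by auto
  qed
  moreover have "(x, z) \<in> G"
  proof (rule mem[OF FG(3)])
    fix n show "cyl_piece G n x z \<noteq> {}" using sep[of n] unfolding borel_separated_def by (auto intro!: bexI[of _ UNIV])
  qed
  ultimately show False using assms(3) FG by force
qed

text \<open>The graph of a Borel map is a Borel set, since equality is tested digit by digit; the
  image is its projection. Off \<open>A\<close> the map is completed by a constant, and the graph is
  taken over \<open>A\<close> only.\<close>

lemma analytic_borel_image:
  fixes f :: "(nat \<Rightarrow> nat) \<Rightarrow> (nat \<Rightarrow> nat)"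
  assumes "A \<in> sets borel" "f \<in> measurable (restrict_space borel A) borel"
  shows "analytic (f ` A)"
proof -
  define g where "g = (\<lambda>x. if x \<in> A then f x else (\<lambda>_. 0))"
  have g: "g \<in> borel_measurable borel"
    unfolding g_def using assms by (intro measurable_If_restrict_space_iff[THEN iffD2]) auto
  then have [measurable]: "(\<lambda>x. g x n) \<in> measurable borel (count_space UNIV)" for n
    by (rule measurable_compose) (rule measurable_component_nat)
  note [measurable] = assms(1)
  have [measurable]: "(\<lambda>p :: (nat \<Rightarrow> nat) \<times> (nat \<Rightarrow> nat). fst p n) \<in> measurable (borel \<Otimes>\<^sub>M borel) (count_space UNIV)" for n
    by (rule measurable_compose[OF measurable_fst measurable_component_nat])
  define H where "H = {p \<in> space (borel \<Otimes>\<^sub>M borel). snd p \<in> A \<and> (\<forall>n. fst p n = g (snd p) n)}"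
  have [measurable]: "(\<lambda>p :: (nat \<Rightarrow> nat) \<times> (nat \<Rightarrow> nat). g (snd p) n) \<in> measurable (borel \<Otimes>\<^sub>M borel) (count_space UNIV)" for n
    by (rule measurable_compose[OF measurable_snd]) measurable
  have "{p \<in> space (borel \<Otimes>\<^sub>M borel). fst p n = g (snd p) n} \<in> sets (borel \<Otimes>\<^sub>M borel)" for n
    by (rule measurable_equality_set) (simp_all flip: measurable_count_space_nat_iff)
  moreover have "snd -` A \<inter> space (borel \<Otimes>\<^sub>M borel) \<in> sets (borel \<Otimes>\<^sub>M (borel :: (nat \<Rightarrow> nat) measure))"
    using assms(1) by (rule measurable_sets[OF measurable_snd])
  moreover have "H = (snd -` A \<inter> space (borel \<Otimes>\<^sub>M borel)) \<inter> (\<Inter>n. {p \<in> space (borel \<Otimes>\<^sub>M borel). fst p n = g (snd p) n})"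
    by (auto simp: H_def)
  ultimately have "H \<in> sets (borel \<Otimes>\<^sub>M borel)" by auto
  then have "H \<in> sets borel" unfolding borel_prod .
  then have "analytic H" by (rule analytic_borel)
  then have "analytic (fst ` H)" by (rule analytic_projection)
  moreover have "fst ` H = f ` A"
    by (force simp: H_def g_def space_pair_measure image_iff fun_eq_iff)
  ultimately show ?thesis by simp
qed

text \<open>A form of Blackwell's theorem. The map \<open>b\<close> of characteristic sequences is
  measurable for the sigma-algebra generated by the \<open>C n\<close> and injective because they
  separate points. The images of \<open>A\<close> and of its complement are disjoint analytic sets,
  and pulling back a Borel set that separates them recovers \<open>A\<close>.\<close>

theorem standard_borel_sets_eq_sigma_sets:
  fixes C :: "nat \<Rightarrow> 'a set"
  assumes M: "standard_borel M" and C: "\<And>n. C n \<in> sets M"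
    and sep: "\<And>x y. x \<in> space M \<Longrightarrow> y \<in> space M \<Longrightarrow> (\<And>n. x \<in> C n \<longleftrightarrow> y \<in> C n) \<Longrightarrow> x = y"
  shows "sets M = sigma_sets (space M) (range C)"
proof
  show "sigma_sets (space M) (range C) \<subseteq> sets M" using C by (intro sets.sigma_sets_subset) auto
  show "sets M \<subseteq> sigma_sets (space M) (range C)"
  proof
    fix A assume A: "A \<in> sets M"
    obtain c d B where "borel_embedding M (borel :: (nat \<Rightarrow> nat) measure) c d B"
      using M standard_borel_imp_embedding by blast
    note 1 = this[unfolded borel_embedding_def]
    have d: "d \<in> restrict_space borel B \<rightarrow>\<^sub>M M" and B: "B \<in> sets borel" using 1 by blast+
    have spB: "space (restrict_space borel B) = B" by (simp add: space_restrict_space)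
    define b where "b = (\<lambda>x n. if x \<in> C n then 1 else 0 :: nat)"
    have bC: "b x n = 1 \<longleftrightarrow> x \<in> C n" for x n by (simp add: b_def)
    have bm: "b \<in> borel_measurable M"
    proof (rule measurable_coordinatewise_then_product)
      fix n
      have [measurable]: "C n \<in> sets M" by (rule C)
      show "(\<lambda>x. b x n) \<in> borel_measurable M" unfolding b_def by measurable
    qed
    have bd: "(\<lambda>y. b (d y)) \<in> measurable (restrict_space borel B) borel"
      using d bm by (rule measurable_compose)
    have an: "analytic (b ` S)" if S: "S \<in> sets M" for S
    proof -
      have "d -` S \<inter> B \<in> sets (restrict_space borel B)" using measurable_sets[OF d S] by (simp add: spB)
      then have S': "d -` S \<inter> B \<in> sets borel" using B by (simp add: sets_restrict_space_iff)
      have "(\<lambda>y. b (d y)) \<in> measurable (restrict_space (restrict_space borel B) (d -` S \<inter> B)) borel"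
        using bd by (rule measurable_restrict_space1)
      also have "restrict_space (restrict_space borel B) (d -` S \<inter> B) = restrict_space borel (d -` S \<inter> B)"
        using B S' by (subst restrict_restrict_space) (auto intro!: arg_cong[where f="restrict_space borel"])
      finally have "analytic ((\<lambda>y. b (d y)) ` (d -` S \<inter> B))" by (rule analytic_borel_image[OF S'])
      moreover have "(\<lambda>y. b (d y)) ` (d -` S \<inter> B) = b ` S"
      proof (intro equalityI subsetI)
        fix z assume "z \<in> b ` S"
        then obtain x where x: "x \<in> S" "z = b x" by blast
        then have xs: "x \<in> space M" using S sets.sets_into_space by blast
        have "c x \<in> B" "d (c x) = x" using 1 xs by blast+
        then show "z \<in> (\<lambda>y. b (d y)) ` (d -` S \<inter> B)" using x by force
      qed auto
      ultimately show ?thesis by simp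
    qed
    have "b ` A \<inter> b ` (space M - A) = {}"
    proof (rule ccontr)
      assume "b ` A \<inter> b ` (space M - A) \<noteq> {}"
      then obtain x y where xy: "x \<in> A" "y \<in> space M - A" "b x = b y" by auto
      then have "x = y" using sets.sets_into_space[OF A] bC by (intro sep) (auto, metis+)
      then show False using xy by auto
    qed
    then have "borel_separated (b ` A) (b ` (space M - A))"
      using A by (intro lusin_separation an) auto
    then obtain D where D: "D \<in> sets borel" "b ` A \<subseteq> D" "D \<inter> b ` (space M - A) = {}"
      unfolding borel_separated_def by blast
    let ?S = "sigma (space M) (range C)"
    have CP: "range C \<subseteq> Pow (space M)" using C sets.sets_into_space by blast
    have "b \<in> borel_measurable ?S"
    proof (rule measurable_coordinatewise_then_product)
      fix n
      have [measurable]: "C n \<in> sets ?S" using CP by (auto simp: sets_measure_of)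
      show "(\<lambda>x. b x n) \<in> borel_measurable ?S" unfolding b_def by measurable
    qed
    then have "b -` D \<inter> space ?S \<in> sets ?S" using D(1) by (rule measurable_sets)
    moreover have "b -` D \<inter> space ?S = A" using D sets.sets_into_space[OF A] by (auto simp: space_measure_of_conv)
    ultimately show "A \<in> sigma_sets (space M) (range C)" using CP by (simp add: sets_measure_of)
  qed
qed

section \<open>Measurable selection for Suslin schemes\<close>

definition suslin_set :: "(nat list \<Rightarrow> 'x set) \<Rightarrow> 'x set" where
  "suslin_set A = {x. \<exists>y. \<forall>n. x \<in> A (map y [0..<n])}"

definition bounded_lists :: "(nat \<Rightarrow> nat) \<Rightarrow> nat \<Rightarrow> nat list set" where
  "bounded_lists k n = {s. length s = n \<and> (\<forall>i<n. s ! i \<le> k i)}"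

definition tree_level :: "(nat list \<Rightarrow> 'x set) \<Rightarrow> (nat \<Rightarrow> nat) \<Rightarrow> nat list \<Rightarrow> nat \<Rightarrow> 'x set" where
  "tree_level A k s m = (\<Union>t\<in>{t \<in> bounded_lists k m. take (length s) t = s}. A t)"

text \<open>Points for which the tree of indices above \<open>s\<close>, pruned by the bound
  \<open>k\<close>, reaches every level. Only finite unions and countable intersections occur, so
  these sets stay measurable where \<open>suslin_set\<close> may fail to be.\<close>

definition tree_body :: "(nat list \<Rightarrow> 'x set) \<Rightarrow> (nat \<Rightarrow> nat) \<Rightarrow> nat list \<Rightarrow> 'x set" where
  "tree_body A k s = (\<Inter>m\<in>{length s..}. tree_level A k s m)"

lemma finite_bounded_lists: "finite (bounded_lists k n)"
proof (rule finite_subset)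
  show "bounded_lists k n \<subseteq> {s. set s \<subseteq> {..Max (k ` {..<n})} \<and> length s = n}"
    by (auto simp: bounded_lists_def in_set_conv_nth) (meson Max_ge finite_imageI finite_lessThan imageI lessThan_iff order_trans)
qed (rule finite_lists_length_eq, simp)

section \<open>Finitely branching subtrees and their leftmost branches\<close>

locale suslin_scheme =
  fixes A :: "nat list \<Rightarrow> 'x set"
  assumes decreasing: "A (s @ [a]) \<subseteq> A s"
begin

lemma decreasing_append: "A (s @ t) \<subseteq> A s"
proof (induction t rule: rev_induct)
  case (snoc a t) then show ?case using decreasing[of "s @ t" a] by auto
qed simp

lemma decreasing_take: "A t \<subseteq> A (take n t)"
  using decreasing_append[of "take n t" "drop n t"] by simp

lemma tree_level_antimono:
  assumes "length s \<le> m" "m \<le> m'" shows "tree_level A k s m' \<subseteq> tree_level A k s m"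
proof
  fix x assume "x \<in> tree_level A k s m'"
  then obtain t where t: "length t = m'" "\<forall>i<m'. t ! i \<le> k i" "take (length s) t = s" "x \<in> A t"
    by (auto simp: tree_level_def bounded_lists_def)
  have "x \<in> A (take m t)" using t decreasing_take by blast
  moreover have "take m t \<in> bounded_lists k m" using t assms by (auto simp: bounded_lists_def)
  moreover have "take (length s) (take m t) = s" using t assms by (simp add: min_absorb1)
  ultimately show "x \<in> tree_level A k s m" by (auto simp: tree_level_def)
qed

text \<open>Koenig's lemma: if every child died out at some level, a level beyond all these would be
  empty, there being only finitely many admissible children.\<close>

lemma tree_body_step:
  assumes "x \<in> tree_body A k s" shows "\<exists>a. x \<in> tree_body A k (s @ [a])"
proof (rule ccontr)
  assume "\<not> ?thesis"
  then have "\<forall>a. \<exists>m\<ge>Suc (length s). x \<notin> tree_level A k (s @ [a]) m" by (auto simp: tree_body_def)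
  then obtain m where m: "\<And>a. m a \<ge> Suc (length s)" "\<And>a. x \<notin> tree_level A k (s @ [a]) (m a)" by metis
  \<comment> \<open>\<open>Suc (length s)\<close> is included explicitly so that a list of length
    \<open>M\<close> is seen at once to have an entry at position \<open>length s\<close>, the child
    that gives the contradiction.\<close>
  define M where "M = Max (insert (Suc (length s)) (m ` {..k (length s)}))"
  have M: "m a \<le> M" if "a \<le> k (length s)" for a unfolding M_def using that by (intro Max_ge) auto
  have M': "Suc (length s) \<le> M" unfolding M_def by (intro Max_ge) auto
  have "x \<in> tree_level A k s M" using assms M' by (auto simp: tree_body_def)
  then obtain t where t: "length t = M" "\<forall>i<M. t ! i \<le> k i" "take (length s) t = s" "x \<in> A t"
    by (auto simp: tree_level_def bounded_lists_def)
  have "take (Suc (length s)) t = s @ [t ! length s]" using t M' by (simp add: take_Suc_conv_app_nth)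
  then have "x \<in> tree_level A k (s @ [t ! length s]) M" using t by (auto simp: tree_level_def bounded_lists_def)
  moreover have "t ! length s \<le> k (length s)" using t M' by auto
  ultimately show False using m M tree_level_antimono[of "s @ [t ! length s]" "m (t ! length s)" M k] by auto
qed

text \<open>Taking the least child makes the choice canonical, hence measurable in \<open>x\<close>.
  It is defined for all \<open>x\<close> but is a branch only for \<open>x\<close> in the body at
  the root.\<close>

primrec least_branch :: "(nat \<Rightarrow> nat) \<Rightarrow> 'x \<Rightarrow> nat \<Rightarrow> nat list" where
  "least_branch k x 0 = []"
| "least_branch k x (Suc n) = least_branch k x n @ [LEAST a. x \<in> tree_body A k (least_branch k x n @ [a])]"

lemma least_branch_body: "x \<in> tree_body A k [] \<Longrightarrow> x \<in> tree_body A k (least_branch k x n)"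
proof (induction n)
  case (Suc n)
  then have "\<exists>a. x \<in> tree_body A k (least_branch k x n @ [a])" by (intro tree_body_step)
  then show ?case by (auto intro: LeastI_ex)
qed simp

lemma length_least_branch: "length (least_branch k x n) = n"
  by (induction n) auto

lemma least_branch_eq_map: "least_branch k x n = map (\<lambda>i. least_branch k x (Suc i) ! i) [0..<n]"
  by (induction n) (auto simp: nth_append length_least_branch)

lemma tree_body_subset: "tree_body A k s \<subseteq> A s"
  by (auto simp: tree_body_def tree_level_def bounded_lists_def Ball_def)

lemma least_branch_in: 
  assumes "x \<in> tree_body A k []" 
  shows "x \<in> A (map (\<lambda>i. least_branch k x (Suc i) ! i) [0..<n])"
  unfolding least_branch_eq_map[symmetric] using tree_body_subset least_branch_body[OF assms, of n] by blast

text \<open>Only the first \<open>n\<close> indices are bounded while the branch has to be infinite.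
  Stage 0 is the full Suslin set, and each stage constrains one more index.\<close>

definition bounded_suslin_set :: "(nat \<Rightarrow> nat) \<Rightarrow> nat \<Rightarrow> 'x set" where
  "bounded_suslin_set k n = {x. \<exists>y. (\<forall>i<n. y i \<le> k i) \<and> (\<forall>m. x \<in> A (map y [0..<m]))}"

lemma bounded_suslin_set_subset: "bounded_suslin_set k n \<subseteq> tree_level A k [] n"
proof
  fix x assume "x \<in> bounded_suslin_set k n"
  then obtain y where "\<forall>i<n. y i \<le> k i" "\<forall>m. x \<in> A (map y [0..<m])" by (auto simp: bounded_suslin_set_def)
  then have "map y [0..<n] \<in> bounded_lists k n" "x \<in> A (map y [0..<n])" by (auto simp: bounded_lists_def)
  then show "x \<in> tree_level A k [] n" by (force simp: tree_level_def)
qed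

text \<open>The union is increasing in \<open>j\<close>, the form in which continuity of the outer
  measure can be used on sets that need not be measurable.\<close>

lemma bounded_suslin_set_Suc: "bounded_suslin_set k n = (\<Union>j. bounded_suslin_set (k(n := j)) (Suc n))"
proof (intro equalityI subsetI)
  fix x assume "x \<in> bounded_suslin_set k n"
  then obtain y where "\<forall>i<n. y i \<le> k i" "\<forall>m. x \<in> A (map y [0..<m])" by (auto simp: bounded_suslin_set_def)
  then have "x \<in> bounded_suslin_set (k(n := y n)) (Suc n)" 
    by (auto simp: bounded_suslin_set_def less_Suc_eq intro!: exI[of _ y])
  then show "x \<in> (\<Union>j. bounded_suslin_set (k(n := j)) (Suc n))" by blast
next
  fix x assume "x \<in> (\<Union>j. bounded_suslin_set (k(n := j)) (Suc n))"
  then obtain j y where "\<forall>i<Suc n. y i \<le> (k(n := j)) i" "\<forall>m. x \<in> A (map y [0..<m])"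
    by (auto simp: bounded_suslin_set_def)
  moreover have "y i \<le> k i" if "i < n" for i using calculation(1)[rule_format, of i] that by simp
  ultimately show "x \<in> bounded_suslin_set k n" by (auto simp: bounded_suslin_set_def)
qed

lemma bounded_suslin_set_cong:
  assumes "\<And>i. i < n \<Longrightarrow> k i = k' i"
  shows "bounded_suslin_set k n = bounded_suslin_set k' n"
  using assms unfolding bounded_suslin_set_def by simp

end

section \<open>Capacity approximation and measurable branches\<close>

locale measurable_suslin_scheme = suslin_scheme A for A :: "nat list \<Rightarrow> 'x set" and M :: "'x measure" +
  assumes sets_A: "A s \<in> sets M"
begin

lemma tree_level_sets: "tree_level A k s m \<in> sets M"
  unfolding tree_level_def using finite_bounded_lists sets_A by (intro sets.finite_UN) auto

lemma tree_body_sets: "tree_body A k s \<in> sets M"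
  unfolding tree_body_def using tree_level_sets by (intro sets.countable_INT') auto

lemma least_branch_measurable: "(\<lambda>x. least_branch k x n) \<in> measurable M (count_space UNIV)"
proof (induction n)
  case (Suc n)
  have "(\<lambda>x. s @ [LEAST a. x \<in> tree_body A k (s @ [a])]) \<in> measurable M (count_space UNIV)" for s
  proof -
    have [measurable]: "(\<lambda>x. LEAST a. x \<in> tree_body A k (s @ [a])) \<in> measurable M (count_space UNIV)"
      by (rule measurable_Least) (use tree_body_sets in simp)
    show ?thesis by measurable
  qed
  from measurable_compose_countable[OF this Suc] show ?case by simp
qed simp

text \<open>Choquet's capacity argument: the outer measure is continuous along increasing unions, so
  the branching can be bounded one level at a time with a loss of measure below any margin; for
  bounded branching the set is measurable by Koenig's lemma.\<close>

lemma bounded_branching_approx: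
  assumes "emeasure M (space M) \<noteq> \<infinity>" and c: "c < outer_measure_of M (suslin_set A)"
  shows "\<exists>k. c \<le> emeasure M (tree_body A k [])"
proof -
  have "\<exists>k. \<forall>n. c < outer_measure_of M (bounded_suslin_set (k n) n) \<and> (\<exists>j. k (Suc n) = (k n)(n := j))"
  proof (rule dependent_nat_choice)
    have "bounded_suslin_set (\<lambda>_. 0) 0 = suslin_set A" by (auto simp: bounded_suslin_set_def suslin_set_def)
    then show "\<exists>k. c < outer_measure_of M (bounded_suslin_set k 0)" using c by metis
    fix k n assume "c < outer_measure_of M (bounded_suslin_set k n)"
    also have "bounded_suslin_set k n = (\<Union>j. bounded_suslin_set (k(n := j)) (Suc n))" by (rule bounded_suslin_set_Suc)
    also have "outer_measure_of M \<dots> = (SUP j. outer_measure_of M (bounded_suslin_set (k(n := j)) (Suc n)))"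
    proof (rule SUP_outer_measure_of_incseq[symmetric])
      show "incseq (\<lambda>j. bounded_suslin_set (k(n := j)) (Suc n))"
      proof (rule incseq_SucI, rule subsetI)
        fix j x assume "x \<in> bounded_suslin_set (k(n := j)) (Suc n)"
        then obtain y where y: "\<forall>i<Suc n. y i \<le> (k(n := j)) i" "\<forall>m. x \<in> A (map y [0..<m])"
          by (auto simp: bounded_suslin_set_def)
        have "\<forall>i<Suc n. y i \<le> (k(n := Suc j)) i" using y(1) by (auto simp: less_Suc_eq)
        then show "x \<in> bounded_suslin_set (k(n := Suc j)) (Suc n)" using y(2) unfolding bounded_suslin_set_def by blast
      qed
      show "bounded_suslin_set (k(n := j)) (Suc n) \<subseteq> space M" for j
        using bounded_suslin_set_subset sets.sets_into_space[OF tree_level_sets] by blast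
    qed
    finally obtain j where "c < outer_measure_of M (bounded_suslin_set (k(n := j)) (Suc n))"
      by (auto simp: less_SUP_iff)
    then show "\<exists>k'. c < outer_measure_of M (bounded_suslin_set k' (Suc n)) \<and> (\<exists>j. k' = k(n := j))" by blast
  qed
  then obtain K where K: "\<And>n. c < outer_measure_of M (bounded_suslin_set (K n) n)" "\<And>n. \<exists>j. K (Suc n) = (K n)(n := j)"
    by blast
  \<comment> \<open>Entry \<open>i\<close> is fixed at stage \<open>i + 1\<close> and kept
    afterwards, so the diagonal agrees with \<open>K n\<close> below \<open>n\<close>.\<close>
  define k where "k = (\<lambda>i. K (Suc i) i)"
  have agree: "i < n \<Longrightarrow> K n i = k i" for i n
  proof (induction n)
    case (Suc n)
    obtain j where j: "K (Suc n) = (K n)(n := j)" using K(2) by blast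
    show ?case
    proof (cases "i = n")
      case False then show ?thesis using Suc j by simp
    qed (simp add: k_def)
  qed simp
  have le: "c \<le> emeasure M (tree_level A k [] n)" for n
  proof -
    have "c \<le> outer_measure_of M (bounded_suslin_set k n)"
      using K(1)[of n] bounded_suslin_set_cong[of n "K n" k] agree by simp
    also have "\<dots> \<le> outer_measure_of M (tree_level A k [] n)" by (intro outer_measure_of_mono bounded_suslin_set_subset)
    finally show ?thesis using tree_level_sets by simp
  qed
  have "(\<lambda>n. emeasure M (tree_level A k [] n)) \<longlonglongrightarrow> emeasure M (\<Inter>n. tree_level A k [] n)"
  proof (rule Lim_emeasure_decseq)
    show "decseq (\<lambda>n. tree_level A k [] n)" 
      by (intro antimonoI tree_level_antimono) simp_all
    show "emeasure M (tree_level A k [] i) \<noteq> \<infinity>" for i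
      using assms(1) emeasure_space[of M "tree_level A k [] i"] by (auto simp: top_unique)
  qed (use tree_level_sets in auto)
  then have "c \<le> emeasure M (\<Inter>n. tree_level A k [] n)" by (rule Lim_bounded2) (use le in auto)
  also have "(\<Inter>n. tree_level A k [] n) = tree_body A k []" by (auto simp: tree_body_def)
  finally show ?thesis by blast
qed

text \<open>Let \<open>E\<close> be a measurable hull of the Suslin set. Bodies of finitely
  branching subtrees lie inside the Suslin set and reach every measure below its outer measure, so
  countably many of them fill \<open>E\<close> up to a null set; on each body the leftmost branch is
  measurable.\<close>

lemma finite_selection:
  assumes fin: "emeasure M (space M) \<noteq> \<infinity>"
  shows "\<exists>Q N y. Q \<in> sets M \<and> N \<in> null_sets M \<and> suslin_set A \<subseteq> Q \<union> N \<and>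
    (\<forall>n. (\<lambda>x. y x n) \<in> measurable M (count_space UNIV)) \<and> (\<forall>x\<in>Q. \<forall>n. x \<in> A (map (y x) [0..<n]))"
proof (cases "outer_measure_of M (suslin_set A) = 0")
  \<comment> \<open>With outer measure zero the hull itself is the null set. The other case needs
    values strictly below the outer measure that converge to it.\<close>
  case True
  have "suslin_set A \<subseteq> space M" using sets.sets_into_space[OF sets_A] unfolding suslin_set_def by blast
  then obtain E where E: "E \<in> sets M" "suslin_set A \<subseteq> E" "outer_measure_of M (suslin_set A) = emeasure M E"
    using outer_measure_of_attain[of "suslin_set A" M] by blast
  then have "E \<in> null_sets M" using True by auto
  then show ?thesis using E by (intro exI[of _ "{}"] exI[of _ E] exI[of _ "\<lambda>_ _. 0"]) auto
next
  case False
  let ?L = "outer_measure_of M (suslin_set A)"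
  have "suslin_set A \<subseteq> space M" using sets.sets_into_space[OF sets_A] unfolding suslin_set_def by blast
  then obtain E where E: "E \<in> sets M" "suslin_set A \<subseteq> E" "?L = emeasure M E"
    using outer_measure_of_attain[of "suslin_set A" M] by blast
  have "0 < ?L" using False by (simp add: zero_less_iff_neq_zero)
  then obtain c :: "nat \<Rightarrow> ennreal" where c: "\<And>n. c n < ?L" "c \<longlonglongrightarrow> ?L"
    using approx_from_below_dense_linorder[of 0 ?L] by auto
  have "\<forall>n. \<exists>k. c n \<le> emeasure M (tree_body A k [])" using bounded_branching_approx[OF fin c(1)] by blast
  then obtain k where k: "\<And>n. c n \<le> emeasure M (tree_body A (k n) [])" by metis
  define Q where "Q = (\<Union>n. tree_body A (k n) [])"
  have Q: "Q \<in> sets M" unfolding Q_def using tree_body_sets by auto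
  have le: "c n \<le> emeasure M Q" for n
    by (rule order_trans[OF k emeasure_mono]) (use Q in \<open>auto simp: Q_def\<close>)
  have "?L \<le> emeasure M Q" by (rule LIMSEQ_le_const2[OF c(2)]) (use le in auto)
  have QS: "Q \<subseteq> suslin_set A"
    unfolding Q_def suslin_set_def using least_branch_in by blast
  have QE: "Q \<subseteq> E" using QS E by blast
  have "emeasure M (E - Q) = emeasure M E - emeasure M Q"
    using Q E QE fin emeasure_space[of M Q] by (intro emeasure_Diff) (auto simp: top_unique)
  also have "\<dots> = 0" 
    using \<open>?L \<le> emeasure M Q\<close> E(3) fin emeasure_space[of M E]
    by (simp add: diff_eq_0_iff_ennreal top_unique less_top)
  finally have N: "E - Q \<in> null_sets M" using E Q by auto
  \<comment> \<open>The first body containing \<open>x\<close> decides which of the countably many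
    branch functions is used; this keeps the combined choice measurable.\<close>
  define J where "J = (\<lambda>x. LEAST n. x \<in> tree_body A (k n) [])"
  define y where "y = (\<lambda>x i. least_branch (k (J x)) x (Suc i) ! i)"
  have J: "J \<in> measurable M (count_space UNIV)"
    unfolding J_def by (rule measurable_Least) (use tree_body_sets in simp)
  have "(\<lambda>x. y x n) \<in> measurable M (count_space UNIV)" for n
  proof -
    have "(\<lambda>x. least_branch (k j) x (Suc n) ! n) \<in> measurable M (count_space UNIV)" for j
      by (rule measurable_compose[OF least_branch_measurable]) simp
    from measurable_compose_countable[where f="\<lambda>j x. least_branch (k j) x (Suc n) ! n", OF this J] show ?thesis unfolding y_def .
  qed
  moreover have "x \<in> A (map (y x) [0..<n])" if "x \<in> Q" for x n
  proof -
    have "\<exists>n. x \<in> tree_body A (k n) []" using that by (auto simp: Q_def)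
    then have "x \<in> tree_body A (k (J x)) []" unfolding J_def by (rule LeastI_ex)
    from least_branch_in[OF this] show ?thesis by (simp add: y_def)
  qed
  ultimately show ?thesis using Q N E by (intro exI[of _ Q] exI[of _ "E - Q"] exI[of _ y]) auto
qed

end

text \<open>A strictly positive integrable density replaces the sigma-finite measure by a finite one
  with the same null sets.\<close>

theorem suslin_selection:
  assumes "sigma_finite_measure M" "\<And>s. A s \<in> sets M" "\<And>s a. A (s @ [a]) \<subseteq> A s"
  shows "\<exists>Q N y. Q \<in> sets M \<and> N \<in> null_sets M \<and> suslin_set A \<subseteq> Q \<union> N \<and>
    (\<forall>n. (\<lambda>x. y x n) \<in> measurable M (count_space UNIV)) \<and> (\<forall>x\<in>Q. \<forall>n. x \<in> A (map (y x) [0..<n]))"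
proof -
  interpret sigma_finite_measure M by fact
  obtain h where h: "h \<in> borel_measurable M" "integral\<^sup>N M h \<noteq> \<infinity>" "\<And>x. x \<in> space M \<Longrightarrow> 0 < h x"
    using Ex_finite_integrable_function by blast
  interpret D: measurable_suslin_scheme A "density M h"
    by unfold_locales (use assms in auto)
  have "emeasure (density M h) (space (density M h)) \<noteq> \<infinity>"
    using h by (simp add: emeasure_density cong: nn_integral_cong)
  from D.finite_selection[OF this]
  obtain Q N y where Q: "Q \<in> sets M" "N \<in> null_sets (density M h)" "suslin_set A \<subseteq> Q \<union> N"
    "\<And>n. (\<lambda>x. y x n) \<in> measurable M (count_space UNIV)" "\<And>x n. x \<in> Q \<Longrightarrow> x \<in> A (map (y x) [0..<n])"
    unfolding sets_density measurable_density_eq1 by blast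
  have "N \<in> sets M" "AE x in M. x \<in> N \<longrightarrow> h x = 0"
    using Q(2) null_sets_density_iff[OF h(1)] by auto
  moreover have "AE x in M. 0 < h x" using h(3) by auto
  ultimately have "AE x in M. x \<notin> N" by (auto elim: AE_mp)
  then have "N \<in> null_sets M" using \<open>N \<in> sets M\<close> by (simp add: AE_iff_null_sets)
  then show ?thesis using Q by blast
qed

section \<open>Normed spaces and bounded operators\<close>

lemma complex_ring_simps [simp]:
  "carrier complex_ring = UNIV" "\<one>\<^bsub>complex_ring\<^esub> = 1" "\<zero>\<^bsub>complex_ring\<^esub> = 0"
  "a \<otimes>\<^bsub>complex_ring\<^esub> b = a * b" "a \<oplus>\<^bsub>complex_ring\<^esub> b = a + b"
  by (simp_all add: complex_ring_def)

section \<open>Vector algebra and norm convergence\<close>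

context complex_normed_space
begin

lemma scale_closed [simp, intro]: "v \<in> carrier E \<Longrightarrow> c \<odot> v \<in> carrier E"
  using smult_closed[of c v] by simp

lemma scale_left_distrib: "v \<in> carrier E \<Longrightarrow> (a + b) \<odot> v = a \<odot> v \<oplus> b \<odot> v"
  using smult_l_distr[of a b v] by simp

lemma scale_right_distrib: "v \<in> carrier E \<Longrightarrow> w \<in> carrier E \<Longrightarrow> a \<odot> (v \<oplus> w) = a \<odot> v \<oplus> a \<odot> w"
  using smult_r_distr[of a v w] by simp

lemma scale_scale: "v \<in> carrier E \<Longrightarrow> a \<odot> (b \<odot> v) = (a * b) \<odot> v"
  using smult_assoc1[of a b v] by simp

lemma scale_one [simp]: "v \<in> carrier E \<Longrightarrow> 1 \<odot> v = v"
  using smult_one[of v] by simp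

lemma scale_zero_left [simp]: "v \<in> carrier E \<Longrightarrow> 0 \<odot> v = \<zero>"
  using smult_l_null[of v] by simp

lemma scale_zero_right [simp]: "a \<odot> \<zero> = \<zero>"
  using smult_r_null[of a] by simp

lemma scale_minus_one: "v \<in> carrier E \<Longrightarrow> (- 1) \<odot> v = \<ominus> v"
proof -
  assume v: "v \<in> carrier E"
  have "(- 1) \<odot> v \<oplus> 1 \<odot> v = (- 1 + 1) \<odot> v" using v by (simp only: scale_left_distrib)
  then show "(- 1) \<odot> v = \<ominus> v" using v by (intro M.minus_equality[symmetric]) simp_all
qed

lemma scale_minus_left: "v \<in> carrier E \<Longrightarrow> (- a) \<odot> v = \<ominus> (a \<odot> v)"
  using scale_scale[of v "-1" a] scale_minus_one[of "a \<odot> v"] by simp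

lemma scale_minus_right: "v \<in> carrier E \<Longrightarrow> a \<odot> (\<ominus> v) = \<ominus> (a \<odot> v)"
  using scale_scale[of v a "-1"] scale_minus_one[of v] scale_minus_left[of v a] by simp

lemma diff_closed [simp, intro]: "v \<in> carrier E \<Longrightarrow> w \<in> carrier E \<Longrightarrow> v \<ominus> w \<in> carrier E"
  by (simp add: M.minus_eq)

lemma norm_zero [simp]: "vnorm E \<zero> = 0"
  using vnorm_eq_0_iff[of \<zero>] by simp

lemma norm_minus [simp]: "v \<in> carrier E \<Longrightarrow> vnorm E (\<ominus> v) = vnorm E v"
  using vnorm_smult[of v "-1"] by (simp add: scale_minus_one)

lemma diff_self [simp]: "v \<in> carrier E \<Longrightarrow> v \<ominus> v = \<zero>"
  by (simp add: M.minus_eq M.r_neg)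

lemma diff_zero [simp]: "v \<in> carrier E \<Longrightarrow> v \<ominus> \<zero> = v"
  by (simp add: M.minus_eq)

lemma minus_diff: "v \<in> carrier E \<Longrightarrow> w \<in> carrier E \<Longrightarrow> \<ominus> (v \<ominus> w) = w \<ominus> v"
  by (simp add: M.minus_eq M.minus_add M.a_comm)

lemma diff_add_diff: 
  "u \<in> carrier E \<Longrightarrow> v \<in> carrier E \<Longrightarrow> w \<in> carrier E \<Longrightarrow> (u \<ominus> v) \<oplus> (v \<ominus> w) = u \<ominus> w"
  by (simp add: M.minus_eq M.a_assoc M.r_neg1)

lemma add_diff_add:
  "a \<in> carrier E \<Longrightarrow> b \<in> carrier E \<Longrightarrow> c \<in> carrier E \<Longrightarrow> d \<in> carrier E \<Longrightarrow>
     (a \<oplus> b) \<ominus> (c \<oplus> d) = (a \<ominus> c) \<oplus> (b \<ominus> d)"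
  by (simp add: M.minus_eq M.minus_add M.a_ac)

lemma add_diff_cancel: "a \<in> carrier E \<Longrightarrow> b \<in> carrier E \<Longrightarrow> (a \<oplus> b) \<ominus> b = a"
  by (simp add: M.minus_eq M.a_assoc M.r_neg)

lemma diff_add_cancel: "a \<in> carrier E \<Longrightarrow> b \<in> carrier E \<Longrightarrow> (a \<ominus> b) \<oplus> b = a"
  by (simp add: M.minus_eq M.a_assoc M.l_neg)

lemma diff_eq_zero_iff: "v \<in> carrier E \<Longrightarrow> w \<in> carrier E \<Longrightarrow> v \<ominus> w = \<zero> \<longleftrightarrow> v = w"
  using diff_add_cancel[of v w] by auto

lemma scale_diff_right: "v \<in> carrier E \<Longrightarrow> w \<in> carrier E \<Longrightarrow> c \<odot> (v \<ominus> w) = c \<odot> v \<ominus> c \<odot> w"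
  by (simp add: M.minus_eq scale_right_distrib scale_minus_right)

lemma scale_diff_left: "v \<in> carrier E \<Longrightarrow> (a - b) \<odot> v = a \<odot> v \<ominus> b \<odot> v"
  using scale_left_distrib[of v a "- b"] by (simp add: M.minus_eq scale_minus_left)

lemma norm_diff_commute: "v \<in> carrier E \<Longrightarrow> w \<in> carrier E \<Longrightarrow> vnorm E (v \<ominus> w) = vnorm E (w \<ominus> v)"
  using minus_diff[of v w] norm_minus[of "v \<ominus> w"] by simp

lemma norm_diff_triangle:
  "u \<in> carrier E \<Longrightarrow> v \<in> carrier E \<Longrightarrow> w \<in> carrier E \<Longrightarrow>
     vnorm E (u \<ominus> w) \<le> vnorm E (u \<ominus> v) + vnorm E (v \<ominus> w)"
  using vnorm_triangle[of "u \<ominus> v" "v \<ominus> w"] by (simp add: diff_add_diff)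

lemma norm_diff_eq_zero_iff: "v \<in> carrier E \<Longrightarrow> w \<in> carrier E \<Longrightarrow> vnorm E (v \<ominus> w) = 0 \<longleftrightarrow> v = w"
  by (simp add: vnorm_eq_0_iff diff_eq_zero_iff)

lemma norm_diff_le: "v \<in> carrier E \<Longrightarrow> w \<in> carrier E \<Longrightarrow> vnorm E (v \<ominus> w) \<le> vnorm E v + vnorm E w"
  using vnorm_triangle[of v "\<ominus> w"] by (simp add: M.minus_eq)

lemma norm_le_diff: "v \<in> carrier E \<Longrightarrow> w \<in> carrier E \<Longrightarrow> vnorm E v \<le> vnorm E (v \<ominus> w) + vnorm E w"
  using vnorm_triangle[of "v \<ominus> w" w] by (simp add: diff_add_cancel)

lemma abs_norm_diff: "v \<in> carrier E \<Longrightarrow> w \<in> carrier E \<Longrightarrow> \<bar>vnorm E v - vnorm E w\<bar> \<le> vnorm E (v \<ominus> w)"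
  using norm_le_diff[of v w] norm_le_diff[of w v] norm_diff_commute[of v w] by simp

lemma norm_add_diff_add:
  "a \<in> carrier E \<Longrightarrow> b \<in> carrier E \<Longrightarrow> c \<in> carrier E \<Longrightarrow> d \<in> carrier E \<Longrightarrow>
     vnorm E ((a \<oplus> b) \<ominus> (c \<oplus> d)) \<le> vnorm E (a \<ominus> c) + vnorm E (b \<ominus> d)"
  using vnorm_triangle[of "a \<ominus> c" "b \<ominus> d"] by (simp add: add_diff_add)

lemma norm_scale_diff_scale:
  "v \<in> carrier E \<Longrightarrow> w \<in> carrier E \<Longrightarrow>
     vnorm E (a \<odot> v \<ominus> b \<odot> w) \<le> cmod a * vnorm E (v \<ominus> w) + cmod (a - b) * vnorm E w"
  using norm_diff_triangle[of "a \<odot> v" "a \<odot> w" "b \<odot> w"] vnorm_smult[of "v \<ominus> w" a] vnorm_smult[of w "a - b"]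
  by (simp add: scale_diff_right scale_diff_left)

text \<open>An arbitrary filter is allowed so that the same rules serve sequences and ultrafilter
  limits.\<close>

definition conv :: "('n \<Rightarrow> 'v) \<Rightarrow> 'v \<Rightarrow> 'n filter \<Rightarrow> bool" where
  "conv f l F \<longleftrightarrow> ((\<lambda>n. vnorm E (f n \<ominus> l)) \<longlongrightarrow> 0) F"

lemma conv_add:
  assumes "conv f a F" "conv g b F" "\<And>n. f n \<in> carrier E" "\<And>n. g n \<in> carrier E" "a \<in> carrier E" "b \<in> carrier E"
  shows "conv (\<lambda>n. f n \<oplus> g n) (a \<oplus> b) F"
  unfolding conv_def
proof (rule Lim_null_comparison)
  show "\<forall>\<^sub>F n in F. norm (vnorm E ((f n \<oplus> g n) \<ominus> (a \<oplus> b))) \<le> vnorm E (f n \<ominus> a) + vnorm E (g n \<ominus> b)"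
    using assms by (intro always_eventually allI) (simp add: norm_add_diff_add vnorm_nonneg)
  show "((\<lambda>n. vnorm E (f n \<ominus> a) + vnorm E (g n \<ominus> b)) \<longlongrightarrow> 0) F"
    using tendsto_add[OF assms(1,2)[unfolded conv_def]] by simp
qed

lemma conv_scale:
  assumes "(c \<longlongrightarrow> z) F" "conv f a F" "\<And>n. f n \<in> carrier E" "a \<in> carrier E"
  shows "conv (\<lambda>n. c n \<odot> f n) (z \<odot> a) F"
  unfolding conv_def
proof (rule Lim_null_comparison)
  show "\<forall>\<^sub>F n in F. norm (vnorm E (c n \<odot> f n \<ominus> z \<odot> a)) \<le> cmod (c n) * vnorm E (f n \<ominus> a) + cmod (c n - z) * vnorm E a"
    using assms by (intro always_eventually allI) (simp add: norm_scale_diff_scale vnorm_nonneg)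
  have "((\<lambda>n. cmod (c n) * vnorm E (f n \<ominus> a) + cmod (c n - z) * vnorm E a) \<longlongrightarrow> cmod z * 0 + cmod (z - z) * vnorm E a) F"
    using assms(1) assms(2)[unfolded conv_def] by (intro tendsto_intros)
  then show "((\<lambda>n. cmod (c n) * vnorm E (f n \<ominus> a) + cmod (c n - z) * vnorm E a) \<longlongrightarrow> 0) F" by simp
qed

lemma conv_const: "a \<in> carrier E \<Longrightarrow> conv (\<lambda>n. a) a F"
  unfolding conv_def by simp

lemma conv_diff:
  assumes "conv f a F" "conv g b F" "\<And>n. f n \<in> carrier E" "\<And>n. g n \<in> carrier E" "a \<in> carrier E" "b \<in> carrier E"
  shows "conv (\<lambda>n. f n \<ominus> g n) (a \<ominus> b) F"
  using conv_add[OF assms(1) conv_scale[OF tendsto_const[of "- 1"] assms(2)]] assms(3-)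
  by (simp add: scale_minus_one M.minus_eq)

lemma conv_norm:
  assumes "conv f a F" "\<And>n. f n \<in> carrier E" "a \<in> carrier E"
  shows "((\<lambda>n. vnorm E (f n)) \<longlongrightarrow> vnorm E a) F"
proof (rule LIM_zero_cancel, rule Lim_null_comparison)
  show "\<forall>\<^sub>F n in F. norm (vnorm E (f n) - vnorm E a) \<le> vnorm E (f n \<ominus> a)"
    using assms by (intro always_eventually allI) (simp add: abs_norm_diff)
  show "((\<lambda>n. vnorm E (f n \<ominus> a)) \<longlongrightarrow> 0) F" using assms(1) by (simp add: conv_def)
qed

lemma conv_unique:
  assumes "conv f a F" "conv f b F" "F \<noteq> bot" "\<And>n. f n \<in> carrier E" "a \<in> carrier E" "b \<in> carrier E"
  shows "a = b"
proof -
  have "conv (\<lambda>n. f n \<ominus> f n) (a \<ominus> b) F" using assms by (intro conv_diff)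
  then have "((\<lambda>n. vnorm E (f n \<ominus> f n)) \<longlongrightarrow> vnorm E (a \<ominus> b)) F" using assms by (intro conv_norm) auto
  then have "((\<lambda>n. 0) \<longlongrightarrow> vnorm E (a \<ominus> b)) F" using assms by simp
  then have "vnorm E (a \<ominus> b) = 0" using tendsto_unique[OF assms(3) _ tendsto_const] by metis
  then show ?thesis using assms norm_diff_eq_zero_iff by blast
qed

text \<open>The defect of the relation \<open>w = p u + q v\<close>. A bound on the norm of the
  image defect by that of the original one expresses additivity, homogeneity, well-definedness and
  boundedness at once.\<close>

definition lin :: "complex \<Rightarrow> complex \<Rightarrow> 'v \<Rightarrow> 'v \<Rightarrow> 'v \<Rightarrow> 'v" where
  "lin p q u v w = (p \<odot> u \<oplus> q \<odot> v) \<ominus> w"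

lemma lin_closed [simp, intro]: "u \<in> carrier E \<Longrightarrow> v \<in> carrier E \<Longrightarrow> w \<in> carrier E \<Longrightarrow> lin p q u v w \<in> carrier E"
  by (simp add: lin_def)

lemma conv_lin:
  assumes "(p \<longlongrightarrow> p0) F" "(q \<longlongrightarrow> q0) F" "conv f a F" "conv g b F" "conv h c F"
    "\<And>n. f n \<in> carrier E" "\<And>n. g n \<in> carrier E" "\<And>n. h n \<in> carrier E" "a \<in> carrier E" "b \<in> carrier E" "c \<in> carrier E"
  shows "conv (\<lambda>n. lin (p n) (q n) (f n) (g n) (h n)) (lin p0 q0 a b c) F"
  unfolding lin_def by (intro conv_diff conv_add conv_scale assms M.a_closed scale_closed)

lemma lin_eq_zero_iff:
  "u \<in> carrier E \<Longrightarrow> v \<in> carrier E \<Longrightarrow> w \<in> carrier E \<Longrightarrow> vnorm E (lin p q u v w) = 0 \<longleftrightarrow> w = p \<odot> u \<oplus> q \<odot> v"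
  unfolding lin_def by (auto simp: norm_diff_eq_zero_iff)

abbreviation norm_dist :: "'v \<Rightarrow> 'v \<Rightarrow> real" where
  "norm_dist v w \<equiv> if v \<in> carrier E \<and> w \<in> carrier E then vnorm E (v \<ominus> w) else 0"

lemma Metric_space_norm: "Metric_space (carrier E) norm_dist"
  by unfold_locales
    (auto simp: vnorm_nonneg norm_diff_commute norm_diff_eq_zero_iff norm_diff_triangle)

lemma mspace_norm_metric [simp]: "mspace (norm_metric E) = carrier E"
  unfolding norm_metric_def using Metric_space_norm by (rule Metric_space.mspace_metric)

lemma mdist_norm_metric: "mdist (norm_metric E) = norm_dist"
  unfolding norm_metric_def using Metric_space_norm by (rule Metric_space.mdist_metric)

lemma topspace_norm_topology [simp]: "topspace (norm_topology E) = carrier E"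
  by (simp add: norm_topology_def)

lemma norm_topology_eq: "norm_topology E = Metric_space.mtopology (carrier E) norm_dist"
  by (simp add: norm_topology_def mtopology_of_def mdist_norm_metric)

lemma closure_norm_topology_iff:
  "norm_topology E closure_of S = carrier E \<longleftrightarrow>
     (\<forall>v\<in>carrier E. \<forall>e>0. \<exists>s\<in>S. s \<in> carrier E \<and> vnorm E (v \<ominus> s) < e)"
proof -
  interpret N: Metric_space "carrier E" norm_dist by (rule Metric_space_norm)
  show ?thesis unfolding norm_topology_eq N.metric_closure_of
    by (auto simp: N.in_mball set_eq_iff)
qed

lemma limitin_norm_topology_iff:
  assumes "\<And>n. f n \<in> carrier E"
  shows "limitin (norm_topology E) f l F \<longleftrightarrow> l \<in> carrier E \<and> conv f l F"
proof -
  interpret N: Metric_space "carrier E" norm_dist by (rule Metric_space_norm)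
  show ?thesis unfolding norm_topology_eq N.limitin_metric_dist_null conv_def
    using assms by (auto intro!: always_eventually)
qed

lemma mcomplete_norm_iff: "mcomplete_of (norm_metric E) \<longleftrightarrow> 
  (\<forall>f. range f \<subseteq> carrier E \<longrightarrow> (\<forall>e>0. \<exists>N. \<forall>n\<ge>N. \<forall>m\<ge>N. vnorm E (f n \<ominus> f m) < e) \<longrightarrow> (\<exists>l\<in>carrier E. conv f l sequentially))"
proof -
  interpret N: Metric_space "carrier E" norm_dist by (rule Metric_space_norm)
  have lim: "(\<exists>l. limitin N.mtopology f l sequentially) \<longleftrightarrow> (\<exists>l\<in>carrier E. conv f l sequentially)" if "range f \<subseteq> carrier E" for f
    using limitin_norm_topology_iff[of f _ sequentially] that unfolding norm_topology_eq by blast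
  have cau: "N.MCauchy f \<longleftrightarrow> range f \<subseteq> carrier E \<and> (\<forall>e>0. \<exists>N. \<forall>n\<ge>N. \<forall>m\<ge>N. vnorm E (f n \<ominus> f m) < e)" for f
  proof (cases "range f \<subseteq> carrier E")
    case True
    then have "\<And>n. f n \<in> carrier E" by auto
    then show ?thesis unfolding N.MCauchy_def using True by auto
  qed (simp add: N.MCauchy_def)
  show ?thesis
    unfolding mcomplete_of_def mspace_norm_metric mdist_norm_metric N.mcomplete_def cau
    by (simp only: imp_conjL lim cong: imp_cong) blast?
qed

end

lemma separable_banach_normed: "separable_banach E \<Longrightarrow> complex_normed_space E"
  by (simp add: separable_banach_def)

section \<open>Gaussian rationals and dense sequences\<close>

definition cq :: "nat \<Rightarrow> complex" where
  "cq n = (case from_nat n of (a, b) \<Rightarrow> Complex (of_rat a) (of_rat b))"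

lemma cq_dense:
  assumes "e > 0" shows "\<exists>n. cmod (z - cq n) < e"
proof -
  obtain a where a: "Re z - e/2 < of_rat a" "of_rat a < Re z + e/2" using of_rat_dense[of "Re z - e/2" "Re z + e/2"] assms by auto
  obtain b where b: "Im z - e/2 < of_rat b" "of_rat b < Im z + e/2" using of_rat_dense[of "Im z - e/2" "Im z + e/2"] assms by auto
  have "cmod (z - Complex (of_rat a) (of_rat b)) \<le> \<bar>Re z - of_rat a\<bar> + \<bar>Im z - of_rat b\<bar>"
    using cmod_le[of "z - Complex (of_rat a) (of_rat b)"] by simp
  also have "\<dots> < e" using a b by linarith
  finally show ?thesis by (intro exI[of _ "to_nat (a, b)"]) (simp add: cq_def)
qed

lemma cq_seq: "\<exists>s :: nat \<Rightarrow> nat. (\<lambda>j. cq (s j)) \<longlonglongrightarrow> z"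
proof -
  have "\<exists>n. cmod (z - cq n) < 1 / Suc j" for j by (intro cq_dense) simp
  then obtain s where s: "\<And>j. cmod (z - cq (s j)) < 1 / Suc j" by metis
  have "(\<lambda>j. cq (s j) - z) \<longlonglongrightarrow> 0"
  proof (rule Lim_null_comparison)
    show "\<forall>\<^sub>F j in sequentially. cmod (cq (s j) - z) \<le> inverse (real (Suc j))"
      using s by (auto intro!: always_eventually less_imp_le simp: norm_minus_commute inverse_eq_divide)
    show "(\<lambda>j. inverse (real (Suc j))) \<longlonglongrightarrow> 0" by (rule LIMSEQ_inverse_real_of_nat)
  qed
  then have "(\<lambda>j. cq (s j)) \<longlonglongrightarrow> z" by (rule LIM_zero_cancel)
  then show ?thesis by (rule exI[of _ s])
qed

context complex_normed_space
begin

definition dense_seq :: "(nat \<Rightarrow> 'v) \<Rightarrow> bool" where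
  "dense_seq \<phi> \<longleftrightarrow> (\<forall>n. \<phi> n \<in> carrier E) \<and> (\<forall>v\<in>carrier E. \<forall>e>0. \<exists>n. vnorm E (v \<ominus> \<phi> n) < e)"

lemma dense_seq_conv:
  assumes "dense_seq \<phi>" "v \<in> carrier E"
  shows "\<exists>s :: nat \<Rightarrow> nat. conv (\<lambda>j. \<phi> (s j)) v sequentially"
proof -
  have "\<forall>j. \<exists>n. vnorm E (v \<ominus> \<phi> n) < 1 / Suc j" using assms unfolding dense_seq_def by simp
  from choice[OF this] obtain s where s: "\<And>j. vnorm E (v \<ominus> \<phi> (s j)) < 1 / Suc j" by blast
  have "conv (\<lambda>j. \<phi> (s j)) v sequentially"
    unfolding conv_def
  proof (rule Lim_null_comparison)
    show "\<forall>\<^sub>F j in sequentially. norm (vnorm E (\<phi> (s j) \<ominus> v)) \<le> inverse (real (Suc j))"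
    proof (intro always_eventually allI)
      fix j
      have "\<phi> (s j) \<in> carrier E" using assms unfolding dense_seq_def by blast
      then show "norm (vnorm E (\<phi> (s j) \<ominus> v)) \<le> inverse (real (Suc j))"
        using s[of j] norm_diff_commute[of v "\<phi> (s j)"] assms(2)
        by (simp add: vnorm_nonneg inverse_eq_divide)
    qed
    show "(\<lambda>j. inverse (real (Suc j))) \<longlonglongrightarrow> 0" by (rule LIMSEQ_inverse_real_of_nat)
  qed
  then show ?thesis by blast
qed

end

section \<open>Bounded operators and their extension from a dense sequence\<close>

locale normed_pair = E: complex_normed_space E + F: complex_normed_space F
  for E :: "'v normed_module" and F :: "'w normed_module"
begin

abbreviation bops :: "('v \<Rightarrow> 'w) set" where "bops \<equiv> carrier (bounded_operators E F)"
abbreviation opnorm :: "('v \<Rightarrow> 'w) \<Rightarrow> real" where "opnorm \<equiv> vnorm (bounded_operators E F)"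

lemma bops_iff: "T \<in> bops \<longleftrightarrow> T \<in> carrier E \<rightarrow>\<^sub>E carrier F \<and>
    (\<forall>v\<in>carrier E. \<forall>w\<in>carrier E. T (v \<oplus>\<^bsub>E\<^esub> w) = T v \<oplus>\<^bsub>F\<^esub> T w) \<and>
    (\<forall>c. \<forall>v\<in>carrier E. T (c \<odot>\<^bsub>E\<^esub> v) = c \<odot>\<^bsub>F\<^esub> T v) \<and>
    (\<exists>C. \<forall>v\<in>carrier E. vnorm F (T v) \<le> C * vnorm E v)"
  by (simp add: bounded_operators_def)

lemma bops_closed [simp, intro]: "T \<in> bops \<Longrightarrow> v \<in> carrier E \<Longrightarrow> T v \<in> carrier F"
  unfolding bops_iff by auto

lemma bops_add: "T \<in> bops \<Longrightarrow> v \<in> carrier E \<Longrightarrow> w \<in> carrier E \<Longrightarrow> T (v \<oplus>\<^bsub>E\<^esub> w) = T v \<oplus>\<^bsub>F\<^esub> T w"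
  unfolding bops_iff by blast

lemma bops_scale: "T \<in> bops \<Longrightarrow> v \<in> carrier E \<Longrightarrow> T (c \<odot>\<^bsub>E\<^esub> v) = c \<odot>\<^bsub>F\<^esub> T v"
  unfolding bops_iff by blast

lemma bops_zero: "T \<in> bops \<Longrightarrow> T \<zero>\<^bsub>E\<^esub> = \<zero>\<^bsub>F\<^esub>"
  using bops_scale[of T "\<zero>\<^bsub>E\<^esub>" 0] by simp

lemma bops_diff: "T \<in> bops \<Longrightarrow> v \<in> carrier E \<Longrightarrow> w \<in> carrier E \<Longrightarrow> T (v \<ominus>\<^bsub>E\<^esub> w) = T v \<ominus>\<^bsub>F\<^esub> T w"
  using bops_add[of T v "(-1) \<odot>\<^bsub>E\<^esub> w"] bops_scale[of T w "-1"]
  by (simp add: E.scale_minus_one F.scale_minus_one E.M.minus_eq F.M.minus_eq)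

lemma bops_lin: "T \<in> bops \<Longrightarrow> u \<in> carrier E \<Longrightarrow> v \<in> carrier E \<Longrightarrow> w \<in> carrier E \<Longrightarrow>
   T (E.lin p q u v w) = F.lin p q (T u) (T v) (T w)"
  by (simp add: E.lin_def F.lin_def bops_diff bops_add bops_scale)

lemma bops_extensional: "T \<in> bops \<Longrightarrow> T \<in> extensional (carrier E)"
  unfolding bops_iff by (auto simp: PiE_iff)

lemma bopsI:
  assumes "\<And>v. v \<in> carrier E \<Longrightarrow> T v \<in> carrier F"
    "\<And>v w. v \<in> carrier E \<Longrightarrow> w \<in> carrier E \<Longrightarrow> T (v \<oplus>\<^bsub>E\<^esub> w) = T v \<oplus>\<^bsub>F\<^esub> T w"
    "\<And>c v. v \<in> carrier E \<Longrightarrow> T (c \<odot>\<^bsub>E\<^esub> v) = c \<odot>\<^bsub>F\<^esub> T v"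
    "\<And>v. v \<in> carrier E \<Longrightarrow> vnorm F (T v) \<le> C * vnorm E v"
  shows "restrict T (carrier E) \<in> bops"
proof -
  have "\<exists>C. \<forall>v\<in>carrier E. vnorm F (T v) \<le> C * vnorm E v" using assms(4) by blast
  then show ?thesis unfolding bops_iff using assms(1-3) by auto
qed

lemma zero_in_unit_ball: "\<zero>\<^bsub>E\<^esub> \<in> unit_ball E"
  by (simp add: unit_ball_def)

lemma opnorm_bdd:
  assumes "T \<in> bops" shows "bdd_above ((\<lambda>v. vnorm F (T v)) ` unit_ball E)"
proof -
  obtain C where C: "\<And>v. v \<in> carrier E \<Longrightarrow> vnorm F (T v) \<le> C * vnorm E v" using assms unfolding bops_iff by blast
  have "vnorm F (T v) \<le> \<bar>C\<bar>" if "v \<in> unit_ball E" for v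
  proof -
    have v: "v \<in> carrier E" "vnorm E v \<le> 1" "0 \<le> vnorm E v" using that E.vnorm_nonneg by (auto simp: unit_ball_def)
    have "C * vnorm E v \<le> \<bar>C\<bar> * 1" using v by (intro mult_mono) auto
    then show ?thesis using C[OF v(1)] by linarith
  qed
  then show ?thesis by (auto intro!: bdd_aboveI2)
qed

lemma opnorm_def: "opnorm T = (SUP v\<in>unit_ball E. vnorm F (T v))"
  by (simp add: bounded_operators_def)

lemma opnorm_nonneg: "T \<in> bops \<Longrightarrow> 0 \<le> opnorm T"
  unfolding opnorm_def using cSUP_upper[OF zero_in_unit_ball opnorm_bdd] by (simp add: bops_zero)

lemma opnorm_bound:
  assumes T: "T \<in> bops" and v: "v \<in> carrier E"
  shows "vnorm F (T v) \<le> opnorm T * vnorm E v"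
proof (cases "vnorm E v = 0")
  case True
  then have "v = \<zero>\<^bsub>E\<^esub>" using v E.vnorm_eq_0_iff by blast
  then show ?thesis using T by (simp add: bops_zero)
next
  case False
  then have pos: "vnorm E v > 0" using E.vnorm_nonneg[OF v] by simp
  define c where "c = complex_of_real (1 / vnorm E v)"
  have "vnorm E (c \<odot>\<^bsub>E\<^esub> v) = 1" using v pos by (simp add: E.vnorm_smult c_def norm_divide)
  then have "c \<odot>\<^bsub>E\<^esub> v \<in> unit_ball E" using v by (simp add: unit_ball_def)
  then have "vnorm F (T (c \<odot>\<^bsub>E\<^esub> v)) \<le> opnorm T" unfolding opnorm_def using opnorm_bdd[OF T] by (intro cSUP_upper)
  also have "vnorm F (T (c \<odot>\<^bsub>E\<^esub> v)) = vnorm F (T v) / vnorm E v"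
    using T v pos by (simp add: bops_scale F.vnorm_smult c_def norm_divide)
  finally show ?thesis using pos by (simp add: divide_le_eq)
qed

lemma opnorm_le_iff:
  assumes T: "T \<in> bops" and C: "0 \<le> C"
  shows "opnorm T \<le> C \<longleftrightarrow> (\<forall>v\<in>carrier E. vnorm F (T v) \<le> C * vnorm E v)"
proof
  assume "opnorm T \<le> C"
  then show "\<forall>v\<in>carrier E. vnorm F (T v) \<le> C * vnorm E v"
    using opnorm_bound[OF T] E.vnorm_nonneg by (meson mult_right_mono order_trans)
next
  assume *: "\<forall>v\<in>carrier E. vnorm F (T v) \<le> C * vnorm E v"
  show "opnorm T \<le> C" unfolding opnorm_def
  proof (rule cSUP_least)
    fix v assume "v \<in> unit_ball E"
    then have "v \<in> carrier E" "vnorm E v \<le> 1" by (auto simp: unit_ball_def)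
    then show "vnorm F (T v) \<le> C" using * C mult_left_mono[of "vnorm E v" 1 C] by fastforce
  qed (use zero_in_unit_ball in blast)
qed

abbreviation opball :: "('v \<Rightarrow> 'w) set" where "opball \<equiv> unit_ball (bounded_operators E F)"

lemma opball_iff: "T \<in> opball \<longleftrightarrow> T \<in> bops \<and> (\<forall>v\<in>carrier E. vnorm F (T v) \<le> vnorm E v)"
  using opnorm_le_iff[of T 1] by (auto simp: unit_ball_def)

lemma opball_bops: "T \<in> opball \<Longrightarrow> T \<in> bops"
  by (simp add: unit_ball_def)

lemma conv_bops:
  assumes "T \<in> bops" "E.conv f a G" "\<And>n. f n \<in> carrier E" "a \<in> carrier E"
  shows "F.conv (\<lambda>n. T (f n)) (T a) G"
  unfolding F.conv_def
proof (rule Lim_null_comparison)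
  show "\<forall>\<^sub>F n in G. norm (vnorm F (T (f n) \<ominus>\<^bsub>F\<^esub> T a)) \<le> opnorm T * vnorm E (f n \<ominus>\<^bsub>E\<^esub> a)"
    using assms opnorm_bound[OF assms(1), of "f _ \<ominus>\<^bsub>E\<^esub> a"]
    by (intro always_eventually allI) (simp add: bops_diff F.vnorm_nonneg)
  show "((\<lambda>n. opnorm T * vnorm E (f n \<ominus>\<^bsub>E\<^esub> a)) \<longlongrightarrow> 0) G"
    using tendsto_mult_left[OF assms(2)[unfolded E.conv_def], of "opnorm T"] by simp
qed

lemma bops_eq_dense:
  assumes "S \<in> bops" "T \<in> bops" "E.dense_seq \<phi>" "\<And>n. S (\<phi> n) = T (\<phi> n)"
  shows "S = T"
proof (rule extensionalityI[of _ "carrier E"])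
  fix v assume v: "v \<in> carrier E"
  have \<phi>: "\<phi> n \<in> carrier E" for n using assms(3) by (simp add: E.dense_seq_def)
  obtain s where s: "E.conv (\<lambda>j. \<phi> (s j)) v sequentially" using E.dense_seq_conv[OF assms(3) v] by blast
  have "F.conv (\<lambda>j. S (\<phi> (s j))) (S v) sequentially" "F.conv (\<lambda>j. S (\<phi> (s j))) (T v) sequentially"
    using conv_bops[OF assms(1) s] conv_bops[OF assms(2) s] v \<phi> assms(4) by simp_all
  then show "S v = T v" using F.conv_unique assms v \<phi> by (metis bops_closed sequentially_bot)
qed (use assms bops_extensional in auto)

text \<open>Both sides of the inequality are continuous in the vector, so an uncountable supremum
  becomes countably many conditions; the measurability of the operator norm rests on this.\<close>

lemma opnorm_le_dense_iff:
  assumes T: "T \<in> bops" and C: "0 \<le> C" and d: "E.dense_seq \<phi>"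
  shows "opnorm T \<le> C \<longleftrightarrow> (\<forall>n. vnorm F (T (\<phi> n)) \<le> C * vnorm E (\<phi> n))"
proof
  have \<phi>: "\<phi> n \<in> carrier E" for n using d by (simp add: E.dense_seq_def)
  show "opnorm T \<le> C \<Longrightarrow> \<forall>n. vnorm F (T (\<phi> n)) \<le> C * vnorm E (\<phi> n)" using opnorm_le_iff[OF T C] \<phi> by blast
  assume *: "\<forall>n. vnorm F (T (\<phi> n)) \<le> C * vnorm E (\<phi> n)"
  have "vnorm F (T v) \<le> C * vnorm E v" if v: "v \<in> carrier E" for v
  proof -
    obtain s where s: "E.conv (\<lambda>j. \<phi> (s j)) v sequentially" using E.dense_seq_conv[OF d v] by blast
    have 1: "(\<lambda>j. vnorm F (T (\<phi> (s j)))) \<longlonglongrightarrow> vnorm F (T v)"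
      using T v \<phi> by (intro F.conv_norm conv_bops s) auto
    have 2: "(\<lambda>j. C * vnorm E (\<phi> (s j))) \<longlonglongrightarrow> C * vnorm E v"
      using v \<phi> by (intro tendsto_mult_left E.conv_norm s) auto
    show ?thesis by (rule LIMSEQ_le[OF 1 2]) (use * in auto)
  qed
  then show "opnorm T \<le> C" using opnorm_le_iff[OF T C] by blast
qed

text \<open>The condition below encodes linearity, well-definedness and boundedness on a dense sequence
  by countably many inequalities.\<close>

definition bounded_on_seq :: "(nat \<Rightarrow> 'v) \<Rightarrow> real \<Rightarrow> (nat \<Rightarrow> 'w) \<Rightarrow> bool" where
  "bounded_on_seq \<phi> C w \<longleftrightarrow> (\<forall>i j n m k. vnorm F (F.lin (cq i) (cq j) (w n) (w m) (w k)) \<le>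
      C * vnorm E (E.lin (cq i) (cq j) (\<phi> n) (\<phi> m) (\<phi> k)))"

lemma bops_bounded_on_seq:
  assumes "T \<in> bops" "opnorm T \<le> C" "\<And>n. \<phi> n \<in> carrier E"
  shows "bounded_on_seq \<phi> C (\<lambda>n. T (\<phi> n))"
  unfolding bounded_on_seq_def
proof (intro allI)
  fix i j n m k
  have "0 \<le> C" using opnorm_nonneg[OF assms(1)] assms(2) by simp
  then have "vnorm F (T (E.lin (cq i) (cq j) (\<phi> n) (\<phi> m) (\<phi> k))) \<le> C * vnorm E (E.lin (cq i) (cq j) (\<phi> n) (\<phi> m) (\<phi> k))"
    using assms opnorm_le_iff[OF assms(1)] by blast
  then show "vnorm F (F.lin (cq i) (cq j) (T (\<phi> n)) (T (\<phi> m)) (T (\<phi> k))) \<le> C * vnorm E (E.lin (cq i) (cq j) (\<phi> n) (\<phi> m) (\<phi> k))"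
    using assms by (simp add: bops_lin)
qed

text \<open>The extension sends \<open>v\<close> to the limit of \<open>w\<close> along any
  subfamily of \<open>\<phi>\<close> that converges to \<open>v\<close>; the Lipschitz estimate
  makes this independent of the subfamily. The inequality passes to the limit, and linearity is its
  special case with vanishing defect.\<close>

theorem extend_bounded_on_seq:
  assumes comp: "mcomplete_of (norm_metric F)" and d: "E.dense_seq \<phi>" and w: "\<And>n. w n \<in> carrier F"
    and C: "0 \<le> C" and bd: "bounded_on_seq \<phi> C w"
  shows "\<exists>T\<in>bops. (\<forall>n. T (\<phi> n) = w n) \<and> opnorm T \<le> C"
proof -
  have \<phi>: "\<phi> n \<in> carrier E" for n using d by (simp add: E.dense_seq_def)
  \<comment> \<open>Both sides are continuous in the coefficients, which carries the bound from
    Gaussian rationals to all scalars.\<close>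
  have bd': "vnorm F (F.lin p q (w n) (w m) (w k)) \<le> C * vnorm E (E.lin p q (\<phi> n) (\<phi> m) (\<phi> k))" for p q n m k
  proof -
    obtain s t where st: "(\<lambda>j. cq (s j)) \<longlonglongrightarrow> p" "(\<lambda>j. cq (t j)) \<longlonglongrightarrow> q" using cq_seq by meson
    have 1: "(\<lambda>j. vnorm F (F.lin (cq (s j)) (cq (t j)) (w n) (w m) (w k))) \<longlonglongrightarrow> vnorm F (F.lin p q (w n) (w m) (w k))"
      by (intro F.conv_norm F.conv_lin st F.conv_const w F.lin_closed)
    have 2: "(\<lambda>j. C * vnorm E (E.lin (cq (s j)) (cq (t j)) (\<phi> n) (\<phi> m) (\<phi> k))) \<longlonglongrightarrow> C * vnorm E (E.lin p q (\<phi> n) (\<phi> m) (\<phi> k))"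
      by (intro tendsto_mult_left E.conv_norm E.conv_lin st E.conv_const \<phi> E.lin_closed)
    show ?thesis by (rule LIMSEQ_le[OF 1 2]) (use bd in \<open>auto simp: bounded_on_seq_def\<close>)
  qed
  \<comment> \<open>Coefficients 1 and 0 give a Lipschitz estimate; in particular a vector that
    occurs twice in \<open>\<phi>\<close> is given one value.\<close>
  have dif: "vnorm F (w n \<ominus>\<^bsub>F\<^esub> w m) \<le> C * vnorm E (\<phi> n \<ominus>\<^bsub>E\<^esub> \<phi> m)" for n m
    using bd'[of 1 0 n n m] w \<phi> by (simp add: E.lin_def F.lin_def)
  have "\<exists>u. u \<in> carrier F \<and> (\<forall>s. E.conv (\<lambda>j. \<phi> (s j)) v sequentially \<longrightarrow> F.conv (\<lambda>j. w (s j)) u sequentially)"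
    if v: "v \<in> carrier E" for v
  proof -
    obtain s where s: "E.conv (\<lambda>j. \<phi> (s j)) v sequentially" using E.dense_seq_conv[OF d v] by blast
    have "\<exists>N. \<forall>n\<ge>N. \<forall>m\<ge>N. vnorm F (w (s n) \<ominus>\<^bsub>F\<^esub> w (s m)) < e" if e: "e > 0" for e
    proof -
      \<comment> \<open>\<open>C + 1\<close> instead of \<open>C\<close> also covers
        \<open>C = 0\<close>.\<close>
      define e' where "e' = e / (2 * (C + 1))"
      have "e' > 0" using e C by (simp add: e'_def)
      then have "\<forall>\<^sub>F j in sequentially. vnorm E (\<phi> (s j) \<ominus>\<^bsub>E\<^esub> v) < e'" using s unfolding E.conv_def
        by (rule order_tendstoD(2)[rotated])
      then obtain N where N: "\<And>j. j \<ge> N \<Longrightarrow> vnorm E (\<phi> (s j) \<ominus>\<^bsub>E\<^esub> v) < e'" by (auto simp: eventually_sequentially)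
      have "vnorm F (w (s n) \<ominus>\<^bsub>F\<^esub> w (s m)) < e" if "n \<ge> N" "m \<ge> N" for n m
      proof -
        have "vnorm E (\<phi> (s n) \<ominus>\<^bsub>E\<^esub> \<phi> (s m)) \<le> vnorm E (\<phi> (s n) \<ominus>\<^bsub>E\<^esub> v) + vnorm E (v \<ominus>\<^bsub>E\<^esub> \<phi> (s m))"
          using \<phi> v by (intro E.norm_diff_triangle)
        also have "\<dots> \<le> 2 * e'" using N[OF that(1)] N[OF that(2)] \<phi> v by (simp add: E.norm_diff_commute[of v])
        finally have "vnorm F (w (s n) \<ominus>\<^bsub>F\<^esub> w (s m)) \<le> C * (2 * e')"
          using dif[of "s n" "s m"] C by (meson mult_left_mono order_trans)
        also have "\<dots> < (C + 1) * (2 * e')" using \<open>e' > 0\<close> by (intro mult_strict_right_mono) auto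
        also have "\<dots> = e" using C by (simp add: e'_def field_simps)
        finally show ?thesis .
      qed
      then show ?thesis by blast
    qed
    then obtain u where u: "u \<in> carrier F" "F.conv (\<lambda>j. w (s j)) u sequentially"
      using comp w unfolding F.mcomplete_norm_iff by (metis (no_types, lifting) image_subset_iff)
    have "F.conv (\<lambda>j. w (t j)) u sequentially" if t: "E.conv (\<lambda>j. \<phi> (t j)) v sequentially" for t
      unfolding F.conv_def
    proof (rule Lim_null_comparison)
      show "\<forall>\<^sub>F j in sequentially. norm (vnorm F (w (t j) \<ominus>\<^bsub>F\<^esub> u)) \<le>
         C * (vnorm E (\<phi> (t j) \<ominus>\<^bsub>E\<^esub> v) + vnorm E (\<phi> (s j) \<ominus>\<^bsub>E\<^esub> v)) + vnorm F (w (s j) \<ominus>\<^bsub>F\<^esub> u)"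
      proof (intro always_eventually allI)
        fix j
        have "vnorm E (\<phi> (t j) \<ominus>\<^bsub>E\<^esub> \<phi> (s j)) \<le> vnorm E (\<phi> (t j) \<ominus>\<^bsub>E\<^esub> v) + vnorm E (\<phi> (s j) \<ominus>\<^bsub>E\<^esub> v)"
          using E.norm_diff_triangle[OF \<phi> v \<phi>, of "t j" "s j"] E.norm_diff_commute[OF v \<phi>, of "s j"] by simp
        then have "C * vnorm E (\<phi> (t j) \<ominus>\<^bsub>E\<^esub> \<phi> (s j)) \<le> C * (vnorm E (\<phi> (t j) \<ominus>\<^bsub>E\<^esub> v) + vnorm E (\<phi> (s j) \<ominus>\<^bsub>E\<^esub> v))"
          using C by (rule mult_left_mono)
        then show "norm (vnorm F (w (t j) \<ominus>\<^bsub>F\<^esub> u)) \<le>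
         C * (vnorm E (\<phi> (t j) \<ominus>\<^bsub>E\<^esub> v) + vnorm E (\<phi> (s j) \<ominus>\<^bsub>E\<^esub> v)) + vnorm F (w (s j) \<ominus>\<^bsub>F\<^esub> u)"
          using dif[of "t j" "s j"] F.norm_diff_triangle[OF w w u(1), of "t j" "s j"] w u(1) by (simp add: F.vnorm_nonneg)
      qed
      have "(\<lambda>j. C * (vnorm E (\<phi> (t j) \<ominus>\<^bsub>E\<^esub> v) + vnorm E (\<phi> (s j) \<ominus>\<^bsub>E\<^esub> v)) + vnorm F (w (s j) \<ominus>\<^bsub>F\<^esub> u)) \<longlonglongrightarrow> C * (0 + 0) + 0"
        using s t u(2) unfolding E.conv_def F.conv_def by (intro tendsto_intros)
      then show "(\<lambda>j. C * (vnorm E (\<phi> (t j) \<ominus>\<^bsub>E\<^esub> v) + vnorm E (\<phi> (s j) \<ominus>\<^bsub>E\<^esub> v)) + vnorm F (w (s j) \<ominus>\<^bsub>F\<^esub> u)) \<longlonglongrightarrow> 0" by simp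
    qed
    then show ?thesis using u by blast
  qed
  then obtain T where T: "\<And>v. v \<in> carrier E \<Longrightarrow> T v \<in> carrier F"
    "\<And>v s. v \<in> carrier E \<Longrightarrow> E.conv (\<lambda>j. \<phi> (s j)) v sequentially \<Longrightarrow> F.conv (\<lambda>j. w (s j)) (T v) sequentially"
    by metis
  have T\<phi>: "T (\<phi> n) = w n" for n
    using F.conv_unique[OF T(2)[OF \<phi> E.conv_const[OF \<phi>]] F.conv_const[OF w] sequentially_bot] T(1) w \<phi> by blast
  have TC: "vnorm F (F.lin p q (T u) (T v) (T z)) \<le> C * vnorm E (E.lin p q u v z)"
    if uvz: "u \<in> carrier E" "v \<in> carrier E" "z \<in> carrier E" for p q u v z
  proof -
    obtain r where r: "E.conv (\<lambda>j. \<phi> (r j)) u sequentially" using E.dense_seq_conv[OF d uvz(1)] by blast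
    obtain s where s: "E.conv (\<lambda>j. \<phi> (s j)) v sequentially" using E.dense_seq_conv[OF d uvz(2)] by blast
    obtain t where t: "E.conv (\<lambda>j. \<phi> (t j)) z sequentially" using E.dense_seq_conv[OF d uvz(3)] by blast
    note st = r s t
    have 1: "(\<lambda>j. vnorm F (F.lin p q (w (r j)) (w (s j)) (w (t j)))) \<longlonglongrightarrow> vnorm F (F.lin p q (T u) (T v) (T z))"
      by (intro F.conv_norm F.conv_lin tendsto_const T st uvz w F.lin_closed)
    have 2: "(\<lambda>j. C * vnorm E (E.lin p q (\<phi> (r j)) (\<phi> (s j)) (\<phi> (t j)))) \<longlonglongrightarrow> C * vnorm E (E.lin p q u v z)"
      by (intro tendsto_mult_left E.conv_norm E.conv_lin tendsto_const st uvz \<phi> E.lin_closed)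
    show ?thesis by (rule LIMSEQ_le[OF 1 2]) (use bd' in auto)
  qed
  have Tlin: "T (p \<odot>\<^bsub>E\<^esub> u \<oplus>\<^bsub>E\<^esub> q \<odot>\<^bsub>E\<^esub> v) = p \<odot>\<^bsub>F\<^esub> T u \<oplus>\<^bsub>F\<^esub> q \<odot>\<^bsub>F\<^esub> T v" if "u \<in> carrier E" "v \<in> carrier E" for p q u v
  proof -
    \<comment> \<open>For this third vector the defect in \<open>E\<close> is zero, so the bound
      forces the defect of the images to vanish.\<close>
    let ?z = "p \<odot>\<^bsub>E\<^esub> u \<oplus>\<^bsub>E\<^esub> q \<odot>\<^bsub>E\<^esub> v"
    have z: "?z \<in> carrier E" using that by simp
    have "vnorm E (E.lin p q u v ?z) = 0" using E.lin_eq_zero_iff[OF that z] by blast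
    then have "vnorm F (F.lin p q (T u) (T v) (T ?z)) \<le> 0" using TC[OF that z, of p q] by simp
    then have "vnorm F (F.lin p q (T u) (T v) (T ?z)) = 0"
      using F.vnorm_nonneg[OF F.lin_closed[OF T(1)[OF that(1)] T(1)[OF that(2)] T(1)[OF z]], of p q] by linarith
    then show ?thesis using F.lin_eq_zero_iff T(1) that z by blast
  qed
  have Tb: "vnorm F (T v) \<le> C * vnorm E v" if v: "v \<in> carrier E" for v
  proof -
    have z: "T \<zero>\<^bsub>E\<^esub> = \<zero>\<^bsub>F\<^esub>" using Tlin[of "\<zero>\<^bsub>E\<^esub>" "\<zero>\<^bsub>E\<^esub>" 0 0] T(1)[of "\<zero>\<^bsub>E\<^esub>"] by simp
    then show ?thesis using TC[OF v v E.M.zero_closed, of 1 0] v T(1)[OF v] by (simp add: E.lin_def F.lin_def)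
  qed
  have "restrict T (carrier E) \<in> bops"
  proof (rule bopsI)
    show "T (v \<oplus>\<^bsub>E\<^esub> z) = T v \<oplus>\<^bsub>F\<^esub> T z" if "v \<in> carrier E" "z \<in> carrier E" for v z
      using Tlin[OF that, of 1 1] that T(1) by simp
    show "T (c \<odot>\<^bsub>E\<^esub> v) = c \<odot>\<^bsub>F\<^esub> T v" if "v \<in> carrier E" for c v
      using Tlin[OF that that, of c 0] that T(1) by simp
  qed (use T Tb in auto)
  moreover have "opnorm (restrict T (carrier E)) \<le> C"
    using opnorm_le_iff[OF calculation C] Tb by simp
  ultimately show ?thesis using T\<phi> \<phi> by (intro bexI[of _ "restrict T (carrier E)"]) auto
qed

end

section \<open>Weak compactness in reflexive spaces\<close>

text \<open>Zorn's lemma on proper filters finer than \<open>sequentially\<close>. The infimum of a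
  chain is proper because whatever holds eventually in it already does so in a member. A minimal
  filter decides each \<open>P\<close>: either it refutes \<open>P\<close>, or adjoining
  \<open>P\<close> leaves a proper finer filter, which must be the same one.\<close>

lemma ultrafilter_exists:
  "\<exists>U :: nat filter. U \<noteq> bot \<and> U \<le> sequentially \<and> (\<forall>P. eventually P U \<or> eventually (\<lambda>n. \<not> P n) U)"
proof -
  define A where "A = {F :: nat filter. F \<noteq> bot \<and> F \<le> sequentially}"
  have "\<exists>U\<in>A. \<forall>F\<in>A. F \<le> U \<longrightarrow> F = U"
  proof (rule predicate_Zorn[of A "\<lambda>F G. G \<le> F"])
    show "partial_order_on A (relation_of (\<lambda>F G. G \<le> F) A)"
      by (intro partial_order_on_relation_ofI) auto
    fix C assume C: "C \<in> Chains (relation_of (\<lambda>F G. G \<le> F) A)"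
    have CA: "C \<subseteq> A" using C by (auto simp: Chains_def relation_of_def)
    have ch: "F \<le> G \<or> G \<le> F" if "F \<in> C" "G \<in> C" for F G
      using C that by (auto simp: Chains_def relation_of_def)
    show "\<exists>u\<in>A. \<forall>a\<in>C. u \<le> a"
    proof (cases "C = {}")
      case True then show ?thesis by (intro bexI[of _ sequentially]) (auto simp: A_def)
    next
      case False
      have ev: "eventually P (Inf C) \<longleftrightarrow> (\<exists>b\<in>C. eventually P b)" for P
      proof (rule eventually_Inf_base[OF False])
        fix F G assume "F \<in> C" "G \<in> C"
        then show "\<exists>x\<in>C. x \<le> inf F G" using ch[of F G] by auto
      qed
      have "Inf C \<noteq> bot"
      proof
        assume "Inf C = bot"
        then obtain b where "b \<in> C" "eventually (\<lambda>_. False) b" using ev[of "\<lambda>_. False"] by auto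
        then show False using CA by (auto simp: A_def trivial_limit_def)
      qed
      moreover obtain b where "b \<in> C" using False by blast
      then have "Inf C \<le> sequentially" using CA Inf_lower[of b C] by (auto simp: A_def intro: order_trans)
      ultimately show ?thesis by (intro bexI[of _ "Inf C"]) (auto simp: A_def intro: Inf_lower)
    qed
  qed
  then obtain U where U: "U \<noteq> bot" "U \<le> sequentially" "\<And>F. F \<noteq> bot \<Longrightarrow> F \<le> sequentially \<Longrightarrow> F \<le> U \<Longrightarrow> F = U"
    by (auto simp: A_def)
  have "eventually P U \<or> eventually (\<lambda>n. \<not> P n) U" for P
  proof (cases "inf U (principal {n. P n}) = bot")
    case True
    then have "eventually (\<lambda>_. False) (inf U (principal {n. P n}))" by simp
    then show ?thesis by (simp add: eventually_inf_principal)
  next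
    case False
    have "inf U (principal {n. P n}) = U" using U(2) False by (intro U(3)) (auto intro: le_infI1)
    moreover have "eventually P (inf U (principal {n. P n}))" by (simp add: eventually_inf_principal)
    ultimately show ?thesis by simp
  qed
  then show ?thesis using U(1,2) by blast
qed

text \<open>A single ultrafilter for all arguments: every bounded scalar sequence converges along
  it, so limits for uncountably many functionals are available at once and no subsequences are
  extracted.\<close>

definition ultra :: "nat filter" where
  "ultra = (SOME U. U \<noteq> bot \<and> U \<le> sequentially \<and> (\<forall>P. eventually P U \<or> eventually (\<lambda>n. \<not> P n) U))"

lemma ultra: "ultra \<noteq> bot" "ultra \<le> sequentially" "eventually P ultra \<or> eventually (\<lambda>n. \<not> P n) ultra"
  unfolding ultra_def using someI_ex[OF ultrafilter_exists] by blast+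

text \<open>Compactness of a disc gives a cluster point, and an ultrafilter converges to each of its
  cluster points: values not eventually in a neighbourhood are eventually outside it.\<close>

lemma ultra_convergent:
  fixes f :: "nat \<Rightarrow> complex"
  assumes "\<And>n. cmod (f n) \<le> C"
  shows "\<exists>l. (f \<longlongrightarrow> l) ultra"
proof -
  have "filtermap f ultra \<noteq> bot" using ultra(1) by (simp add: filtermap_bot_iff)
  moreover have "eventually (\<lambda>z. z \<in> cball 0 C) (filtermap f ultra)"
    using assms by (simp add: eventually_filtermap)
  ultimately obtain l where l: "inf (nhds l) (filtermap f ultra) \<noteq> bot"
    using compact_cball[of "0 :: complex" C] unfolding compact_filter by blast
  have "(f \<longlongrightarrow> l) ultra"
  proof (rule topological_tendstoI)
    fix S assume S: "open S" "l \<in> S"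
    show "eventually (\<lambda>n. f n \<in> S) ultra"
    proof (rule ccontr)
      assume "\<not> ?thesis"
      then have 1: "eventually (\<lambda>z. z \<notin> S) (filtermap f ultra)"
        using ultra(3)[of "\<lambda>n. f n \<in> S"] by (simp add: eventually_filtermap)
      have 2: "eventually (\<lambda>z. z \<in> S) (nhds l)" using S by (auto simp: eventually_nhds)
      have "eventually (\<lambda>_. False) (inf (nhds l) (filtermap f ultra))"
        unfolding eventually_inf using 1 2 by blast
      then show False using l by (simp add: trivial_limit_def)
    qed
  qed
  then show ?thesis by blast
qed

section \<open>Norming functionals from minimal sublinear ones\<close>

context complex_normed_space
begin

text \<open>The value 0 off the carrier lets the pointwise order on total functions serve as the
  order for Zorn's lemma, with minimality giving equality of functions. Homogeneity is stated as an
  inequality; its converse follows by scaling back with \<open>1/r\<close>.\<close>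

definition sublinear :: "('v \<Rightarrow> real) \<Rightarrow> bool" where
  "sublinear q \<longleftrightarrow> (\<forall>v\<in>carrier E. \<forall>w\<in>carrier E. q (v \<oplus> w) \<le> q v + q w) \<and>
     (\<forall>v\<in>carrier E. \<forall>r\<ge>0. q (complex_of_real r \<odot> v) \<le> r * q v) \<and>
     (\<forall>v\<in>carrier E. q v \<le> vnorm E v) \<and> (\<forall>v. v \<notin> carrier E \<longrightarrow> q v = 0)"

lemma sublinearD:
  assumes "sublinear q"
  shows "\<And>v w. v \<in> carrier E \<Longrightarrow> w \<in> carrier E \<Longrightarrow> q (v \<oplus> w) \<le> q v + q w"
    "\<And>v r. v \<in> carrier E \<Longrightarrow> r \<ge> 0 \<Longrightarrow> q (complex_of_real r \<odot> v) \<le> r * q v"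
    "\<And>v. v \<in> carrier E \<Longrightarrow> q v \<le> vnorm E v" "\<And>v. v \<notin> carrier E \<Longrightarrow> q v = 0"
  using assms unfolding sublinear_def by blast+

lemma sublinear_zero: "sublinear q \<Longrightarrow> q \<zero> = 0"
  using sublinearD(1)[of q \<zero> \<zero>] sublinearD(2)[of q \<zero> 0] by simp

lemma sublinear_minus: "sublinear q \<Longrightarrow> v \<in> carrier E \<Longrightarrow> 0 \<le> q v + q (\<ominus> v)"
  using sublinearD(1)[of q v "\<ominus> v"] by (simp add: M.r_neg sublinear_zero)

lemma sublinear_lower: "sublinear q \<Longrightarrow> v \<in> carrier E \<Longrightarrow> - vnorm E v \<le> q v"
  using sublinear_minus[of q v] sublinearD(3)[of q "\<ominus> v"] by simp

lemma sublinear_scale: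
  assumes q: "sublinear q" and v: "v \<in> carrier E" and r: "r \<ge> 0"
  shows "q (complex_of_real r \<odot> v) = r * q v"
proof (cases "r = 0")
  case True then show ?thesis using sublinear_zero[OF q] v by simp
next
  case False
  have "q v = q (complex_of_real (1/r) \<odot> (complex_of_real r \<odot> v))" using False v by (simp add: scale_scale flip: of_real_mult)
  also have "\<dots> \<le> (1/r) * q (complex_of_real r \<odot> v)" using r v by (intro sublinearD(2)[OF q]) auto
  finally have "r * q v \<le> q (complex_of_real r \<odot> v)" using False r by (simp add: field_simps)
  then show ?thesis using sublinearD(2)[OF q v r] by simp
qed

text \<open>Lowers \<open>q\<close> just enough to be odd in the direction \<open>y\<close>: the
  parameter \<open>t = 0\<close> shows that the result is below \<open>q\<close>, and
  \<open>t = 1\<close> bounds its value at minus \<open>y\<close> by \<open>- q y\<close>.\<close>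

definition sublinear_shift :: "'v \<Rightarrow> ('v \<Rightarrow> real) \<Rightarrow> 'v \<Rightarrow> real" where
  "sublinear_shift y q v = (if v \<in> carrier E then INF t\<in>{0..}. q (v \<oplus> complex_of_real t \<odot> y) - t * q y else 0)"

lemma sublinear_shift_le:
  assumes q: "sublinear q" and y: "y \<in> carrier E" and v: "v \<in> carrier E" and t: "t \<ge> 0"
  shows "sublinear_shift y q v \<le> q (v \<oplus> complex_of_real t \<odot> y) - t * q y"
proof -
  \<comment> \<open>A lower bound independent of \<open>s\<close>, so that the infimum is a genuine
    one.\<close>
  have lower: "- q (\<ominus> v) \<le> q (v \<oplus> complex_of_real s \<odot> y) - s * q y" if "s \<ge> 0" for s
  proof -
    have "s * q y = q (complex_of_real s \<odot> y)" using sublinear_scale[OF q y that] by simp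
    also have "complex_of_real s \<odot> y = (v \<oplus> complex_of_real s \<odot> y) \<oplus> \<ominus> v"
      using v y add_diff_cancel[of "complex_of_real s \<odot> y" v] M.a_comm[of v "complex_of_real s \<odot> y"] by (simp add: M.minus_eq)
    also have "q \<dots> \<le> q (v \<oplus> complex_of_real s \<odot> y) + q (\<ominus> v)" using v y by (intro sublinearD(1)[OF q]) auto
    finally show ?thesis by simp
  qed
  have "bdd_below ((\<lambda>t. q (v \<oplus> complex_of_real t \<odot> y) - t * q y) ` {0..})"
    by (rule bdd_belowI2[where m="- q (\<ominus> v)"]) (use lower in auto)
  then show ?thesis unfolding sublinear_shift_def using v t by (auto intro: cINF_lower)
qed

lemma sublinear_shift_greatest:
  assumes "v \<in> carrier E" "\<And>t. t \<ge> 0 \<Longrightarrow> m \<le> q (v \<oplus> complex_of_real t \<odot> y) - t * q y"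
  shows "m \<le> sublinear_shift y q v"
  unfolding sublinear_shift_def using assms by (auto intro!: cINF_greatest)

lemma sublinear_shift_base: "sublinear q \<Longrightarrow> y \<in> carrier E \<Longrightarrow> sublinear_shift y q v \<le> q v"
  using sublinear_shift_le[of q y v 0] sublinearD(4)[of q v] by (cases "v \<in> carrier E") (auto simp: sublinear_shift_def)

lemma sublinear_shift_neg: "sublinear q \<Longrightarrow> y \<in> carrier E \<Longrightarrow> sublinear_shift y q (\<ominus> y) \<le> - q y"
  using sublinear_shift_le[of q y "\<ominus> y" 1] by (simp add: M.l_neg sublinear_zero)

lemma sublinear_shift:
  assumes q: "sublinear q" and y: "y \<in> carrier E"
  shows "sublinear (sublinear_shift y q)"
  unfolding sublinear_def
proof (intro conjI ballI allI impI)
  let ?q = "sublinear_shift y q"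
  fix v assume v: "v \<in> carrier E"
  show "?q v \<le> vnorm E v" using sublinear_shift_base[OF q y, of v] sublinearD(3)[OF q v] by simp
  show "?q (v \<oplus> w) \<le> ?q v + ?q w" if w: "w \<in> carrier E" for w
  proof -
    have "?q (v \<oplus> w) \<le> (q (v \<oplus> complex_of_real t \<odot> y) - t * q y) + (q (w \<oplus> complex_of_real s \<odot> y) - s * q y)" if "t \<ge> 0" "s \<ge> 0" for s t
    proof -
      have eq: "(v \<oplus> w) \<oplus> complex_of_real (t + s) \<odot> y = (v \<oplus> complex_of_real t \<odot> y) \<oplus> (w \<oplus> complex_of_real s \<odot> y)"
        using v w y by (simp add: scale_left_distrib M.a_ac)
      have "?q (v \<oplus> w) \<le> q ((v \<oplus> w) \<oplus> complex_of_real (t + s) \<odot> y) - (t + s) * q y"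
        using that v w by (intro sublinear_shift_le[OF q y]) auto
      also have "q ((v \<oplus> w) \<oplus> complex_of_real (t + s) \<odot> y) \<le> q (v \<oplus> complex_of_real t \<odot> y) + q (w \<oplus> complex_of_real s \<odot> y)"
        unfolding eq using v w y by (intro sublinearD(1)[OF q]) auto
      finally show ?thesis by (simp add: algebra_simps)
    qed
    then have "?q (v \<oplus> w) - (q (w \<oplus> complex_of_real s \<odot> y) - s * q y) \<le> ?q v" if "s \<ge> 0" for s
      using that v by (intro sublinear_shift_greatest) (auto simp: algebra_simps)
    then have "?q (v \<oplus> w) - ?q v \<le> q (w \<oplus> complex_of_real s \<odot> y) - s * q y" if "s \<ge> 0" for s
      using that by fastforce
    then have "?q (v \<oplus> w) - ?q v \<le> ?q w" using w by (intro sublinear_shift_greatest)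
    then show ?thesis by simp
  qed
  show "?q (complex_of_real r \<odot> v) \<le> r * ?q v" if r: "r \<ge> 0" for r
  proof (cases "r = 0")
    case True
    then show ?thesis using v sublinear_shift_base[OF q y, of \<zero>] sublinear_zero[OF q] by simp
  next
    case False
    have "?q (complex_of_real r \<odot> v) / r \<le> q (v \<oplus> complex_of_real t \<odot> y) - t * q y" if t: "t \<ge> 0" for t
    proof -
      have eq: "complex_of_real r \<odot> v \<oplus> complex_of_real (r * t) \<odot> y = complex_of_real r \<odot> (v \<oplus> complex_of_real t \<odot> y)"
        using v y by (simp add: scale_right_distrib scale_scale)
      have "?q (complex_of_real r \<odot> v) \<le> q (complex_of_real r \<odot> v \<oplus> complex_of_real (r * t) \<odot> y) - (r * t) * q y"
        using r t v by (intro sublinear_shift_le[OF q y]) auto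
      also have "q (complex_of_real r \<odot> v \<oplus> complex_of_real (r * t) \<odot> y) \<le> r * q (v \<oplus> complex_of_real t \<odot> y)"
        unfolding eq using v y r by (intro sublinearD(2)[OF q]) auto
      finally show ?thesis using False r by (simp add: field_simps)
    qed
    then have "?q (complex_of_real r \<odot> v) / r \<le> ?q v" using v by (intro sublinear_shift_greatest)
    then show ?thesis using False r by (simp add: field_simps)
  qed
qed (simp add: sublinear_shift_def)

text \<open>Lower bounds of chains for Zorn's lemma. The norm bounds all members from below, and
  subadditivity survives because two members can be replaced by the smaller of the two before
  splitting a sum.\<close>

lemma sublinear_INF:
  assumes ne: "C \<noteq> {}" and C: "\<And>q. q \<in> C \<Longrightarrow> sublinear q" and chain: "\<And>q q'. q \<in> C \<Longrightarrow> q' \<in> C \<Longrightarrow> q \<le> q' \<or> q' \<le> q"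
  shows "sublinear (\<lambda>v. INF q\<in>C. q v)" "\<And>q. q \<in> C \<Longrightarrow> (\<lambda>v. INF q\<in>C. q v) \<le> q"
proof -
  let ?u = "\<lambda>v. INF q\<in>C. q v"
  have le: "?u v \<le> q v" if "q \<in> C" for q v
  proof (cases "v \<in> carrier E")
    case True
    have "bdd_below ((\<lambda>q. q v) ` C)" by (rule bdd_belowI2[where m="- vnorm E v"]) (use C True sublinear_lower in blast)
    then show ?thesis using that by (rule cINF_lower)
  next
    case False
    then have "(\<lambda>q. q v) ` C = {0}" using C ne sublinearD(4) by fastforce
    then show ?thesis using sublinearD(4)[OF C[OF that] False] by simp
  qed
  then show "?u \<le> q" if "q \<in> C" for q using that by (simp add: le_fun_def)
  have gr: "m \<le> ?u v" if "\<And>q. q \<in> C \<Longrightarrow> m \<le> q v" for m v using ne that by (rule cINF_greatest)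
  show "sublinear ?u"
    unfolding sublinear_def
  proof (intro conjI ballI allI impI)
    fix v assume v: "v \<in> carrier E"
    obtain q0 where "q0 \<in> C" using ne by blast
    then show "?u v \<le> vnorm E v" using le[of q0 v] sublinearD(3)[OF C v, of q0] by simp
    show "?u (v \<oplus> w) \<le> ?u v + ?u w" if w: "w \<in> carrier E" for w
    proof -
      have "?u (v \<oplus> w) \<le> q v + q' w" if qq: "q \<in> C" "q' \<in> C" for q q'
      proof -
        obtain p where p: "p \<in> C" "p \<le> q" "p \<le> q'" using chain[OF qq] qq by auto
        have "?u (v \<oplus> w) \<le> p (v \<oplus> w)" using p by (intro le)
        also have "\<dots> \<le> p v + p w" using sublinearD(1)[OF C[OF p(1)] v w] .
        also have "\<dots> \<le> q v + q' w" using p by (intro add_mono) (auto simp: le_fun_def)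
        finally show ?thesis .
      qed
      then have "?u (v \<oplus> w) - q' w \<le> ?u v" if "q' \<in> C" for q' using that by (intro gr) (fastforce simp: algebra_simps)
      then have "?u (v \<oplus> w) - ?u v \<le> ?u w" by (intro gr) (fastforce simp: algebra_simps)
      then show ?thesis by simp
    qed
    show "?u (complex_of_real r \<odot> v) \<le> r * ?u v" if r: "r \<ge> 0" for r
    proof (cases "r = 0")
      case True
      have "?u \<zero> \<le> q0 \<zero>" using \<open>q0 \<in> C\<close> by (rule le)
      then show ?thesis using True v sublinear_zero[OF C[OF \<open>q0 \<in> C\<close>]] by simp
    next
      case False
      have "?u (complex_of_real r \<odot> v) / r \<le> q v" if "q \<in> C" for q
        using le[OF that, of "complex_of_real r \<odot> v"] sublinearD(2)[OF C[OF that] v r] False r by (simp add: field_simps)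
      then have "?u (complex_of_real r \<odot> v) / r \<le> ?u v" by (rule gr)
      then show ?thesis using False r by (simp add: field_simps)
    qed
  next
    fix v assume "v \<notin> carrier E"
    then have "(\<lambda>q. q v) ` C = {0}" using C ne sublinearD(4) by fastforce
    then show "?u v = 0" by simp
  qed
qed

text \<open>A minimal sublinear functional is linear; starting below the shift of the norm in the
  direction of \<open>w\<close> makes it attain the norm at \<open>w\<close>.\<close>

lemma real_norming_functional:
  assumes w: "w \<in> carrier E"
  shows "\<exists>f. (\<forall>u\<in>carrier E. \<forall>v\<in>carrier E. f (u \<oplus> v) = f u + f v) \<and>
    (\<forall>r. \<forall>v\<in>carrier E. f (complex_of_real r \<odot> v) = r * f v) \<and> (\<forall>v\<in>carrier E. f v \<le> vnorm E v) \<and> f w = vnorm E w"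
proof -
  define n where "n = (\<lambda>v. if v \<in> carrier E then vnorm E v else 0)"
  have n: "sublinear n" unfolding sublinear_def n_def by (auto simp: vnorm_triangle vnorm_smult)
  define q0 where "q0 = sublinear_shift w n"
  have q0: "sublinear q0" unfolding q0_def by (rule sublinear_shift[OF n w])
  define A where "A = {q. sublinear q \<and> q \<le> q0}"
  have "\<exists>q\<in>A. \<forall>p\<in>A. p \<le> q \<longrightarrow> p = q"
  proof (rule predicate_Zorn[of A "\<lambda>q p. p \<le> q"])
    show "partial_order_on A (relation_of (\<lambda>q p. p \<le> q) A)"
      by (intro partial_order_on_relation_ofI) auto
    fix C assume C: "C \<in> Chains (relation_of (\<lambda>q p. p \<le> q) A)"
    have CA: "C \<subseteq> A" using C by (auto simp: Chains_def relation_of_def)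
    have ch: "p \<le> q \<or> q \<le> p" if "p \<in> C" "q \<in> C" for p q
      using C that by (auto simp: Chains_def relation_of_def)
    show "\<exists>u\<in>A. \<forall>a\<in>C. u \<le> a"
    proof (cases "C = {}")
      case True then show ?thesis using q0 by (intro bexI[of _ q0]) (auto simp: A_def)
    next
      case False
      have Cs: "\<And>q. q \<in> C \<Longrightarrow> sublinear q" using CA by (auto simp: A_def)
      have u: "sublinear (\<lambda>v. INF q\<in>C. q v)" by (rule sublinear_INF(1)[OF False]) (use Cs ch in auto)
      have u': "(\<lambda>v. INF q\<in>C. q v) \<le> p" if "p \<in> C" for p
        by (rule sublinear_INF(2)[OF False _ _ that]) (use Cs ch in auto)
      obtain p where p: "p \<in> C" using False by blast
      then have "p \<le> q0" using CA by (auto simp: A_def)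
      with u'[OF p] have "(\<lambda>v. INF q\<in>C. q v) \<le> q0" by (rule order_trans)
      then show ?thesis using u u' by (intro bexI[of _ "\<lambda>v. INF q\<in>C. q v"]) (auto simp: A_def)
    qed
  qed
  then obtain q where q: "sublinear q" "q \<le> q0" "\<And>p. sublinear p \<Longrightarrow> p \<le> q0 \<Longrightarrow> p \<le> q \<Longrightarrow> p = q"
    by (auto simp: A_def)
  \<comment> \<open>Minimality makes \<open>q\<close> equal to its own shift in every direction,
    hence odd; an odd subadditive function is additive.\<close>
  have neg: "q (\<ominus> y) = - q y" if y: "y \<in> carrier E" for y
  proof -
    have le: "sublinear_shift y q \<le> q" using sublinear_shift_base[OF q(1) y] by (simp add: le_fun_def)
    have "sublinear_shift y q = q"
      by (rule q(3)[OF sublinear_shift[OF q(1) y] order_trans[OF le q(2)] le])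
    then have "q (\<ominus> y) \<le> - q y" using sublinear_shift_neg[OF q(1) y] by simp
    then show ?thesis using sublinear_minus[OF q(1) y] by simp
  qed
  have add: "q (u \<oplus> v) = q u + q v" if "u \<in> carrier E" "v \<in> carrier E" for u v
  proof -
    have "q u = q ((u \<oplus> v) \<oplus> \<ominus> v)" using that add_diff_cancel[of u v] by (simp add: M.minus_eq)
    also have "\<dots> \<le> q (u \<oplus> v) + q (\<ominus> v)" using that by (intro sublinearD(1)[OF q(1)]) auto
    finally show ?thesis using neg[OF that(2)] sublinearD(1)[OF q(1) that] by simp
  qed
  have sc: "q (complex_of_real r \<odot> v) = r * q v" if v: "v \<in> carrier E" for r v
  proof (cases "r \<ge> 0")
    case True then show ?thesis using sublinear_scale[OF q(1) v] by simp
  next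
    case False
    have "complex_of_real r \<odot> v = \<ominus> (complex_of_real (- r) \<odot> v)" using v scale_minus_left[of v "complex_of_real (- r)"] by simp
    then show ?thesis using neg[of "complex_of_real (- r) \<odot> v"] sublinear_scale[OF q(1) v, of "- r"] False v by simp
  qed
  have "q (\<ominus> w) \<le> q0 (\<ominus> w)" using q(2) by (simp add: le_fun_def)
  also have "\<dots> \<le> - vnorm E w" using sublinear_shift_neg[OF n w] w by (simp add: q0_def n_def)
  finally have "q w = vnorm E w" using neg[OF w] sublinearD(3)[OF q(1) w] by simp
  then show ?thesis using add sc sublinearD(3)[OF q(1)] by blast
qed

end

section \<open>Functionals as operators into the scalar line\<close>

lemma complex_line_simps [simp]:
  "carrier complex_line = UNIV" "\<zero>\<^bsub>complex_line\<^esub> = 0" "z \<oplus>\<^bsub>complex_line\<^esub> w = z + w"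
  "z \<odot>\<^bsub>complex_line\<^esub> w = z * w" "vnorm complex_line z = cmod z"
  by (simp_all add: complex_line_def)

lemma complex_ring_cring: "cring complex_ring"
proof (intro cringI abelian_groupI comm_monoidI)
  fix x assume "x \<in> carrier complex_ring"
  show "\<exists>y\<in>carrier complex_ring. y \<oplus>\<^bsub>complex_ring\<^esub> x = \<zero>\<^bsub>complex_ring\<^esub>" by (intro bexI[of _ "- x"]) auto
qed (auto simp: algebra_simps)

lemma complex_line_normed: "complex_normed_space complex_line"
proof (intro complex_normed_space.intro complex_normed_space_axioms.intro moduleI complex_ring_cring abelian_groupI)
  fix x assume "x \<in> carrier complex_line"
  show "\<exists>y\<in>carrier complex_line. y \<oplus>\<^bsub>complex_line\<^esub> x = \<zero>\<^bsub>complex_line\<^esub>" by (intro bexI[of _ "- x"]) auto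
qed (auto simp: algebra_simps norm_triangle_ineq norm_mult)

context normed_pair
begin

lemma bops_add_closed:
  assumes "S \<in> bops" "T \<in> bops" shows "S \<oplus>\<^bsub>bounded_operators E F\<^esub> T \<in> bops"
proof -
  have "S \<oplus>\<^bsub>bounded_operators E F\<^esub> T = restrict (\<lambda>v. S v \<oplus>\<^bsub>F\<^esub> T v) (carrier E)" by (simp add: bounded_operators_def)
  also have "\<dots> \<in> bops"
  proof (rule bopsI)
    fix v w assume v: "v \<in> carrier E" and w: "w \<in> carrier E"
    show "S (v \<oplus>\<^bsub>E\<^esub> w) \<oplus>\<^bsub>F\<^esub> T (v \<oplus>\<^bsub>E\<^esub> w) = S v \<oplus>\<^bsub>F\<^esub> T v \<oplus>\<^bsub>F\<^esub> (S w \<oplus>\<^bsub>F\<^esub> T w)"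
      using assms v w by (simp add: bops_add F.M.a_ac)
  next
    fix c v assume v: "v \<in> carrier E"
    show "S (c \<odot>\<^bsub>E\<^esub> v) \<oplus>\<^bsub>F\<^esub> T (c \<odot>\<^bsub>E\<^esub> v) = c \<odot>\<^bsub>F\<^esub> (S v \<oplus>\<^bsub>F\<^esub> T v)"
      using assms v by (simp add: bops_scale F.scale_right_distrib)
  next
    fix v assume v: "v \<in> carrier E"
    show "vnorm F (S v \<oplus>\<^bsub>F\<^esub> T v) \<le> (opnorm S + opnorm T) * vnorm E v"
      using F.vnorm_triangle[of "S v" "T v"] opnorm_bound[OF assms(1) v] opnorm_bound[OF assms(2) v] assms v
      by (simp add: algebra_simps)
  qed (use assms in auto)
  finally show ?thesis .
qed

lemma bops_scale_closed:
  assumes "T \<in> bops" shows "a \<odot>\<^bsub>bounded_operators E F\<^esub> T \<in> bops"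
proof -
  have "a \<odot>\<^bsub>bounded_operators E F\<^esub> T = restrict (\<lambda>v. a \<odot>\<^bsub>F\<^esub> T v) (carrier E)" by (simp add: bounded_operators_def)
  also have "\<dots> \<in> bops"
  proof (rule bopsI)
    fix v w assume v: "v \<in> carrier E" and w: "w \<in> carrier E"
    show "a \<odot>\<^bsub>F\<^esub> T (v \<oplus>\<^bsub>E\<^esub> w) = a \<odot>\<^bsub>F\<^esub> T v \<oplus>\<^bsub>F\<^esub> a \<odot>\<^bsub>F\<^esub> T w"
      using assms v w by (simp add: bops_add F.scale_right_distrib)
  next
    fix c v assume v: "v \<in> carrier E"
    show "a \<odot>\<^bsub>F\<^esub> T (c \<odot>\<^bsub>E\<^esub> v) = c \<odot>\<^bsub>F\<^esub> (a \<odot>\<^bsub>F\<^esub> T v)"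
      using assms v by (simp add: bops_scale F.scale_scale mult.commute)
  next
    fix v assume v: "v \<in> carrier E"
    show "vnorm F (a \<odot>\<^bsub>F\<^esub> T v) \<le> (cmod a * opnorm T) * vnorm E v"
      using mult_left_mono[OF opnorm_bound[OF assms(1) v], of "cmod a"] assms v by (simp add: F.vnorm_smult algebra_simps)
  qed (use assms in auto)
  finally show ?thesis .
qed

lemma bops_add_apply: "v \<in> carrier E \<Longrightarrow> (S \<oplus>\<^bsub>bounded_operators E F\<^esub> T) v = S v \<oplus>\<^bsub>F\<^esub> T v"
  by (simp add: bounded_operators_def)

lemma bops_scale_apply: "v \<in> carrier E \<Longrightarrow> (a \<odot>\<^bsub>bounded_operators E F\<^esub> T) v = a \<odot>\<^bsub>F\<^esub> T v"
  by (simp add: bounded_operators_def)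

end

lemma (in complex_normed_space) dual_pair: "normed_pair E complex_line"
  using complex_normed_space_axioms complex_line_normed by (rule normed_pair.intro)

context complex_normed_space
begin

sublocale D: normed_pair E complex_line by (rule dual_pair)

abbreviation dual :: "('v \<Rightarrow> complex) set" where "dual \<equiv> carrier (dual_space E)"

lemma dual_iff: "f \<in> dual \<longleftrightarrow> f \<in> D.bops"
  by (simp add: dual_space_def)

text \<open>The usual complexification: a real functional \<open>f\<close> is the real part of the
  complex functional with imaginary part \<open>- f (\<i> v)\<close>.\<close>

lemma norming_functional:
  assumes w: "w \<in> carrier E"
  shows "\<exists>g\<in>dual. (\<forall>v\<in>carrier E. cmod (g v) \<le> vnorm E v) \<and> Re (g w) = vnorm E w"
proof -
  obtain f where f: "\<And>u v. u \<in> carrier E \<Longrightarrow> v \<in> carrier E \<Longrightarrow> f (u \<oplus> v) = f u + f v"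
    "\<And>r v. v \<in> carrier E \<Longrightarrow> f (complex_of_real r \<odot> v) = r * f v" "\<And>v. v \<in> carrier E \<Longrightarrow> f v \<le> vnorm E v" "f w = vnorm E w"
    using real_norming_functional[OF w] by blast
  define g where "g = (\<lambda>v. Complex (f v) (- f (\<i> \<odot> v)))"
  have g_add: "g (u \<oplus> v) = g u + g v" if "u \<in> carrier E" "v \<in> carrier E" for u v
    using that by (simp add: g_def complex_eq_iff f(1) scale_right_distrib)
  have g_scale: "g (c \<odot> v) = c * g v" if v: "v \<in> carrier E" for c v
  proof -
    have "c = complex_of_real (Re c) + complex_of_real (Im c) * \<i>" by (simp add: complex_eq_iff)
    then have "c \<odot> v = complex_of_real (Re c) \<odot> v \<oplus> complex_of_real (Im c) \<odot> (\<i> \<odot> v)"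
      using v scale_left_distrib[OF v] scale_scale[OF v] by metis
    then have 1: "f (c \<odot> v) = Re c * f v + Im c * f (\<i> \<odot> v)" using v by (simp add: f)
    have "\<i> * c = complex_of_real (Re c) * \<i> + complex_of_real (- Im c)" by (simp add: complex_eq_iff)
    then have "\<i> \<odot> (c \<odot> v) = complex_of_real (Re c) \<odot> (\<i> \<odot> v) \<oplus> complex_of_real (- Im c) \<odot> v"
      using v scale_left_distrib[OF v] scale_scale[OF v] by metis
    then have 2: "f (\<i> \<odot> (c \<odot> v)) = Re c * f (\<i> \<odot> v) - Im c * f v" using v f(2)[OF v, of "- Im c"] by (simp add: f)
    show ?thesis using 1 2 by (simp add: g_def complex_eq_iff)
  qed
  have g_le: "cmod (g v) \<le> vnorm E v" if v: "v \<in> carrier E" for v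
  proof (cases "g v = 0")
    case True then show ?thesis using vnorm_nonneg[OF v] by simp
  next
    case False
    \<comment> \<open>A rotation that makes the value of \<open>g\<close> real and nonnegative,
      where it coincides with \<open>f\<close> and inherits the bound by the norm.\<close>
    define c where "c = cnj (g v) / cmod (g v)"
    have "cmod c = 1" using False by (simp add: c_def norm_divide)
    have "c * g v = complex_of_real ((cmod (g v))\<^sup>2) / cmod (g v)"
      unfolding c_def complex_norm_square by (simp add: mult.commute)
    also have "\<dots> = cmod (g v)" using False by (simp add: power2_eq_square)
    finally have "g (c \<odot> v) = cmod (g v)" using g_scale[OF v] by simp
    then have "cmod (g v) = f (c \<odot> v)" by (metis complex.sel(1) g_def Re_complex_of_real)
    also have "\<dots> \<le> vnorm E (c \<odot> v)" using v by (intro f) auto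
    also have "\<dots> = vnorm E v" using v \<open>cmod c = 1\<close> by (simp add: vnorm_smult)
    finally show ?thesis .
  qed
  have "restrict g (carrier E) \<in> D.bops"
    by (rule D.bopsI[where C=1]) (use g_add g_scale g_le in auto)
  then show ?thesis using g_le f(4) w by (intro bexI[of _ "restrict g (carrier E)"]) (auto simp: dual_iff g_def)
qed

section \<open>Weak limits along the fixed ultrafilter\<close>

definition weak_conv :: "(nat \<Rightarrow> 'v) \<Rightarrow> 'v \<Rightarrow> bool" where
  "weak_conv u w \<longleftrightarrow> (\<forall>f\<in>dual. ((\<lambda>m. f (u m)) \<longlongrightarrow> f w) ultra)"

text \<open>Weak lower semicontinuity of the norm, tested on a functional that norms the limit. The
  bounds \<open>s m\<close> may vary with \<open>m\<close>, which absorbs the errors of approximate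
  solutions.\<close>

lemma weak_conv_norm_le:
  assumes "weak_conv u w" "w \<in> carrier E" "\<And>m. u m \<in> carrier E" "eventually (\<lambda>m. vnorm E (u m) \<le> s m) ultra" "(s \<longlongrightarrow> s0) ultra"
  shows "vnorm E w \<le> s0"
proof -
  obtain g where g: "g \<in> dual" "\<And>v. v \<in> carrier E \<Longrightarrow> cmod (g v) \<le> vnorm E v" "Re (g w) = vnorm E w"
    using norming_functional[OF assms(2)] by blast
  have "((\<lambda>m. Re (g (u m))) \<longlongrightarrow> Re (g w)) ultra"
    using assms(1) g(1) unfolding weak_conv_def by (intro tendsto_Re) blast
  moreover have "eventually (\<lambda>m. Re (g (u m)) \<le> s m) ultra"
    using assms(4)
  proof eventually_elim
    case (elim m)
    then show ?case using g(2)[OF assms(3)[of m]] complex_Re_le_cmod[of "g (u m)"] by linarith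
  qed
  ultimately have "Re (g w) \<le> s0" using ultra(1) assms(5) by (intro tendsto_le)
  then show ?thesis using g(3) by simp
qed

lemma weak_conv_lin:
  assumes "weak_conv a a0" "weak_conv b b0" "weak_conv c c0"
    "\<And>m. a m \<in> carrier E" "\<And>m. b m \<in> carrier E" "\<And>m. c m \<in> carrier E" "a0 \<in> carrier E" "b0 \<in> carrier E" "c0 \<in> carrier E"
  shows "weak_conv (\<lambda>m. lin p q (a m) (b m) (c m)) (lin p q a0 b0 c0)"
  unfolding weak_conv_def
proof
  fix f assume f: "f \<in> dual"
  have eq: "f (lin p q x y z) = p * f x + q * f y - f z" if "x \<in> carrier E" "y \<in> carrier E" "z \<in> carrier E" for x y z
    using that f D.bops_add[of f] D.bops_scale[of f] D.bops_scale[of f z "-1"]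
    by (simp add: lin_def dual_iff M.minus_eq flip: scale_minus_one)
  show "((\<lambda>m. f (lin p q (a m) (b m) (c m))) \<longlongrightarrow> f (lin p q a0 b0 c0)) ultra"
    using assms f unfolding weak_conv_def by (simp add: eq) (intro tendsto_intros; blast)
qed

lemma conv_imp_weak_conv:
  assumes "conv u w ultra" "\<And>m. u m \<in> carrier E" "w \<in> carrier E" shows "weak_conv u w"
  unfolding weak_conv_def
proof
  fix f assume "f \<in> dual"
  then have f: "f \<in> D.bops" by (simp add: dual_iff)
  have "D.F.conv (\<lambda>m. f (u m)) (f w) ultra" using f assms by (intro D.conv_bops)
  moreover have "x \<ominus>\<^bsub>complex_line\<^esub> y = x - y" for x y
    using D.F.scale_minus_one[of y] by (simp add: D.F.M.minus_eq)
  ultimately show "((\<lambda>m. f (u m)) \<longlongrightarrow> f w) ultra"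
    unfolding D.F.conv_def by (simp add: tendsto_norm_zero_iff LIM_zero_iff)
qed

text \<open>Precisely the compactness used in the minimisation: the ultrafilter limit of a bounded
  sequence exists weakly and stays in \<open>S\<close>. The two instances are a reflexive space and
  a finite-dimensional span.\<close>

definition weakly_compact_subspace :: "'v set \<Rightarrow> bool" where
  "weakly_compact_subspace S \<longleftrightarrow> S \<subseteq> carrier E \<and>
     (\<forall>u C. (\<forall>m. u m \<in> S \<and> vnorm E (u m) \<le> C) \<longrightarrow> (\<exists>w\<in>S. weak_conv u w))"

text \<open>Pointwise limits of the evaluations along \<open>ultra\<close> define a bounded
  functional \<open>L\<close> on the dual; reflexivity represents it by a vector, which is then the
  weak limit.\<close>

theorem reflexive_weakly_compact:
  assumes "reflexive_space E"
  shows "weakly_compact_subspace (carrier E)"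
  unfolding weakly_compact_subspace_def
proof (intro conjI allI impI)
  fix u :: "nat \<Rightarrow> 'v" and C assume uC: "\<forall>m. u m \<in> carrier E \<and> vnorm E (u m) \<le> C"
  have u: "u m \<in> carrier E" for m using uC by blast
  have bd: "cmod (f (u m)) \<le> C * vnorm (dual_space E) f" if "f \<in> dual" for f m
  proof -
    have f: "f \<in> D.bops" using that by (simp add: dual_iff)
    have "cmod (f (u m)) \<le> D.opnorm f * vnorm E (u m)" using D.opnorm_bound[OF f u] by simp
    also have "\<dots> \<le> D.opnorm f * C" using uC D.opnorm_nonneg[OF f] by (intro mult_left_mono) auto
    finally show ?thesis by (simp add: dual_space_def mult.commute)
  qed
  have "\<forall>f\<in>dual. \<exists>l. ((\<lambda>m. f (u m)) \<longlongrightarrow> l) ultra" by (intro ballI ultra_convergent[OF bd])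
  then obtain L where L: "\<And>f. f \<in> dual \<Longrightarrow> ((\<lambda>m. f (u m)) \<longlongrightarrow> L f) ultra" by metis
  have add_closed: "f \<oplus>\<^bsub>dual_space E\<^esub> g \<in> dual" if "f \<in> dual" "g \<in> dual" for f g
    using D.bops_add_closed[of f g] that by (simp add: dual_space_def)
  have scale_closed': "c \<odot>\<^bsub>dual_space E\<^esub> f \<in> dual" if "f \<in> dual" for f c
    using D.bops_scale_closed[of f c] that by (simp add: dual_space_def)
  have L_add: "L (f \<oplus>\<^bsub>dual_space E\<^esub> g) = L f + L g" if "f \<in> dual" "g \<in> dual" for f g
  proof (rule tendsto_unique[OF ultra(1) L[OF add_closed[OF that]]])
    have "(f \<oplus>\<^bsub>dual_space E\<^esub> g) (u m) = f (u m) + g (u m)" for m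
      using D.bops_add_apply[OF u] by (simp add: dual_space_def)
    then show "((\<lambda>m. (f \<oplus>\<^bsub>dual_space E\<^esub> g) (u m)) \<longlongrightarrow> L f + L g) ultra"
      using tendsto_add[OF L[OF that(1)] L[OF that(2)]] by simp
  qed
  have L_scale: "L (c \<odot>\<^bsub>dual_space E\<^esub> f) = c * L f" if "f \<in> dual" for f c
  proof (rule tendsto_unique[OF ultra(1) L[OF scale_closed'[OF that]]])
    have "(c \<odot>\<^bsub>dual_space E\<^esub> f) (u m) = c * f (u m)" for m
      using D.bops_scale_apply[OF u] by (simp add: dual_space_def)
    then show "((\<lambda>m. (c \<odot>\<^bsub>dual_space E\<^esub> f) (u m)) \<longlongrightarrow> c * L f) ultra"
      using tendsto_mult_left[OF L[OF that], of c] by simp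
  qed
  have L_bd: "cmod (L f) \<le> C * vnorm (dual_space E) f" if "f \<in> dual" for f
    by (rule tendsto_upperbound[OF tendsto_norm[OF L[OF that]] _ ultra(1)]) (use bd[OF that] in auto)
  have ex_bd: "\<exists>C. \<forall>f\<in>dual. cmod (L f) \<le> C * vnorm (dual_space E) f" using L_bd by blast
  have "restrict L dual \<in> carrier (dual_space (dual_space E))"
    unfolding dual_space_def[of "dual_space E"] bounded_operators_def[of "dual_space E"]
    using L_add L_scale ex_bd add_closed scale_closed' by auto
  then obtain w where w: "w \<in> carrier E" "\<And>f. f \<in> dual \<Longrightarrow> L f = f w"
    using assms unfolding reflexive_space_def by fastforce
  then have "weak_conv u w" unfolding weak_conv_def using L by metis
  then show "\<exists>w\<in>carrier E. weak_conv u w" using w(1) by blast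
qed simp

end

section \<open>Finite rank operators and metric approximation\<close>

context complex_normed_space
begin

primrec lc :: "(nat \<Rightarrow> complex) \<Rightarrow> (nat \<Rightarrow> 'v) \<Rightarrow> nat \<Rightarrow> 'v" where
  "lc c a 0 = \<zero>"
| "lc c a (Suc n) = lc c a n \<oplus> c n \<odot> a n"

definition lspan :: "(nat \<Rightarrow> 'v) \<Rightarrow> nat \<Rightarrow> 'v set" where
  "lspan a n = range (\<lambda>c. lc c a n)"

lemma lc_closed [simp]: "(\<And>i. a i \<in> carrier E) \<Longrightarrow> lc c a n \<in> carrier E"
  by (induction n) auto

lemma lc_cong: "(\<And>i. i < n \<Longrightarrow> c i = d i \<and> a i = b i) \<Longrightarrow> lc c a n = lc d b n"
  by (induction n) auto

lemma lc_add: "(\<And>i. a i \<in> carrier E) \<Longrightarrow> lc (\<lambda>i. c i + d i) a n = lc c a n \<oplus> lc d a n"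
  by (induction n) (auto simp: scale_left_distrib M.a_ac)

lemma lc_scale: "(\<And>i. a i \<in> carrier E) \<Longrightarrow> lc (\<lambda>i. z * c i) a n = z \<odot> lc c a n"
  by (induction n) (auto simp: scale_right_distrib scale_scale)

lemma lc_diff: "(\<And>i. a i \<in> carrier E) \<Longrightarrow> lc (\<lambda>i. c i - d i) a n = lc c a n \<ominus> lc d a n"
  using lc_add[of a c "\<lambda>i. -1 * d i" n] lc_scale[of a "-1" d n] by (simp add: scale_minus_one M.minus_eq)

lemma lc_zero: "(\<And>i. a i \<in> carrier E) \<Longrightarrow> lc (\<lambda>_. 0) a n = \<zero>"
  by (induction n) auto

lemma lc_unit: "(\<And>i. a i \<in> carrier E) \<Longrightarrow> lc (\<lambda>j. if j = i then 1 else 0) a n = (if i < n then a i else \<zero>)"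
proof (induction n)
  case (Suc n)
  then show ?case by (cases "i = n") auto
qed simp

lemma conv_lc:
  assumes "\<And>i. a i \<in> carrier E" "\<And>i. i < n \<Longrightarrow> ((\<lambda>m. c m i) \<longlongrightarrow> d i) F"
  shows "conv (\<lambda>m. lc (c m) a n) (lc d a n) F"
  using assms(2)
proof (induction n)
  case 0 then show ?case by (simp add: conv_const)
next
  case (Suc n)
  have "conv (\<lambda>m. lc (c m) a n \<oplus> c m n \<odot> a n) (lc d a n \<oplus> d n \<odot> a n) F"
    using Suc assms(1) by (intro conv_add conv_scale conv_const Suc.IH) auto
  then show ?case by simp
qed

lemma norm_lc_diff:
  assumes "\<And>i. a i \<in> carrier E" "\<And>i. b i \<in> carrier E"
  shows "vnorm E (lc c a n \<ominus> lc c b n) \<le> (\<Sum>i<n. cmod (c i) * vnorm E (a i \<ominus> b i))"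
proof (induction n)
  case (Suc n)
  have "vnorm E (lc c a (Suc n) \<ominus> lc c b (Suc n)) \<le> vnorm E (lc c a n \<ominus> lc c b n) + vnorm E (c n \<odot> a n \<ominus> c n \<odot> b n)"
    using assms by (simp add: norm_add_diff_add)
  also have "c n \<odot> a n \<ominus> c n \<odot> b n = c n \<odot> (a n \<ominus> b n)" using assms by (simp add: scale_diff_right)
  finally show ?case using Suc assms by (simp add: vnorm_smult)
qed simp

lemma lspan_add: "(\<And>i. a i \<in> carrier E) \<Longrightarrow> u \<in> lspan a n \<Longrightarrow> v \<in> lspan a n \<Longrightarrow> u \<oplus> v \<in> lspan a n"
  unfolding lspan_def by (auto simp flip: lc_add)

lemma lspan_scale: "(\<And>i. a i \<in> carrier E) \<Longrightarrow> u \<in> lspan a n \<Longrightarrow> z \<odot> u \<in> lspan a n"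
  unfolding lspan_def by (auto simp flip: lc_scale)

lemma lspan_carrier: "(\<And>i. a i \<in> carrier E) \<Longrightarrow> u \<in> lspan a n \<Longrightarrow> u \<in> carrier E"
  unfolding lspan_def by auto

lemma lspan_zero: "(\<And>i. a i \<in> carrier E) \<Longrightarrow> \<zero> \<in> lspan a n"
  unfolding lspan_def using lc_zero[of a n] by (metis rangeI)

lemma lspan_base: "(\<And>i. a i \<in> carrier E) \<Longrightarrow> i < n \<Longrightarrow> a i \<in> lspan a n"
  unfolding lspan_def using lc_unit[of a i n] by (metis rangeI)

lemma lc_in_lspan:
  assumes "\<And>i. a i \<in> carrier E" "\<And>i. i < k \<Longrightarrow> b i \<in> lspan a n"
  shows "lc c b k \<in> lspan a n"
  using assms(2) by (induction k) (auto intro!: lspan_add lspan_scale lspan_zero assms(1))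

text \<open>The number \<open>\<delta>\<close> is a lower bound for the distance of
  \<open>a n\<close> from the span of its predecessors. Were that distance zero, bounded
  approximants would by \<open>cpt\<close> converge inside the span, placing \<open>a n\<close> in
  it. \<open>cpt\<close> is the induction hypothesis of \<open>lc_compact\<close>.\<close>

lemma lc_coefficient_bound:
  assumes a: "\<And>i. a i \<in> carrier E"
    and cpt: "\<And>c C. \<forall>m. vnorm E (lc (c m) a n) \<le> C \<Longrightarrow> \<exists>d. conv (\<lambda>m. lc (c m) a n) (lc d a n) ultra"
    and notin: "a n \<notin> lspan a n"
  shows "\<exists>\<delta>>0. \<forall>c. cmod (c n) * \<delta> \<le> vnorm E (lc c a (Suc n))"
proof -
  have "\<exists>\<delta>>0. \<forall>c. \<delta> \<le> vnorm E (a n \<ominus> lc c a n)"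
  proof (rule ccontr)
    assume "\<not> ?thesis"
    then have "\<forall>j. \<exists>c. vnorm E (a n \<ominus> lc c a n) < 1 / Suc j" by (metis linorder_not_le zero_less_divide_1_iff of_nat_0_less_iff zero_less_Suc)
    then obtain c where c: "\<And>j. vnorm E (a n \<ominus> lc (c j) a n) < 1 / Suc j" by metis
    have "vnorm E (lc (c j) a n) \<le> vnorm E (a n) + 1" for j
    proof -
      have "vnorm E (lc (c j) a n) \<le> vnorm E (lc (c j) a n \<ominus> a n) + vnorm E (a n)" using a by (intro norm_le_diff) auto
      moreover have "vnorm E (lc (c j) a n \<ominus> a n) < 1 / Suc j" using c[of j] a by (simp add: norm_diff_commute)
      moreover have "1 / real (Suc j) \<le> 1" by simp
      ultimately show ?thesis by linarith
    qed
    then obtain d where d: "conv (\<lambda>m. lc (c m) a n) (lc d a n) ultra" using cpt by blast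
    have "conv (\<lambda>m. lc (c m) a n) (a n) sequentially"
      unfolding conv_def
    proof (rule Lim_null_comparison)
      show "\<forall>\<^sub>F j in sequentially. norm (vnorm E (lc (c j) a n \<ominus> a n)) \<le> inverse (real (Suc j))"
      proof (intro always_eventually allI)
        fix j show "norm (vnorm E (lc (c j) a n \<ominus> a n)) \<le> inverse (real (Suc j))"
          using c[of j] a norm_diff_commute[of "a n" "lc (c j) a n"] by (simp add: vnorm_nonneg inverse_eq_divide)
      qed
      show "(\<lambda>j. inverse (real (Suc j))) \<longlonglongrightarrow> 0" by (rule LIMSEQ_inverse_real_of_nat)
    qed
    then have "conv (\<lambda>m. lc (c m) a n) (a n) ultra" unfolding conv_def using ultra(2) tendsto_mono by blast
    then have "a n = lc d a n" using d ultra(1) a by (intro conv_unique[of "\<lambda>m. lc (c m) a n"]) auto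
    then show False using notin unfolding lspan_def by blast
  qed
  then obtain \<delta> where \<delta>: "\<delta> > 0" "\<And>c. \<delta> \<le> vnorm E (a n \<ominus> lc c a n)" by blast
  have "cmod (c n) * \<delta> \<le> vnorm E (lc c a (Suc n))" for c
  proof (cases "c n = 0")
    case True then show ?thesis using a vnorm_nonneg[of "lc c a (Suc n)"] by simp
  next
    case False
    define u where "u = lc (\<lambda>i. (- 1 / c n) * c i) a n"
    have u: "u \<in> carrier E" unfolding u_def by (rule lc_closed[OF a])
    have "u = (- 1 / c n) \<odot> lc c a n" unfolding u_def by (rule lc_scale[OF a])
    then have "c n \<odot> u = (- 1) \<odot> lc c a n" using a False by (simp add: scale_scale)
    then have "c n \<odot> (a n \<ominus> u) = lc c a (Suc n)"
      using a u by (simp add: scale_diff_right) (simp add: scale_minus_one M.minus_eq M.a_comm)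
    then have "vnorm E (lc c a (Suc n)) = cmod (c n) * vnorm E (a n \<ominus> u)"
      using a u vnorm_smult[of "a n \<ominus> u" "c n"] by (metis diff_closed)
    then show ?thesis using \<delta>(2)[of "\<lambda>i. (- 1 / c n) * c i"] unfolding u_def by (simp only: mult_left_mono norm_ge_zero)
  qed
  then show ?thesis using \<delta>(1) by blast
qed

text \<open>Induction on the number of vectors. A dependent last vector is absorbed into the others;
  an independent one has bounded coefficients, which converge along \<open>ultra\<close>, and
  subtracting its term leaves a bounded sequence in the smaller span.\<close>

lemma lc_compact:
  assumes a: "\<And>i. a i \<in> carrier E" and bd: "\<forall>m. vnorm E (lc (c m) a n) \<le> C"
  shows "\<exists>d. conv (\<lambda>m. lc (c m) a n) (lc d a n) ultra"
  using bd
proof (induction n arbitrary: c C)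
  case 0 then show ?case by (simp add: conv_const)
next
  case (Suc n)
  show ?case
  proof (cases "a n \<in> lspan a n")
    case True
    then obtain e where e: "a n = lc e a n" by (auto simp: lspan_def)
    have eq: "lc c a (Suc n) = lc (\<lambda>i. c i + c n * e i) a n" for c
      using a by (subst lc_add) (auto simp: lc_scale e[symmetric])
    have "\<exists>d. conv (\<lambda>m. lc (\<lambda>i. c m i + c m n * e i) a n) (lc d a n) ultra"
      using Suc.prems unfolding eq by (rule Suc.IH)
    then obtain d where d: "conv (\<lambda>m. lc (c m) a (Suc n)) (lc d a n) ultra" unfolding eq by blast
    have "lc d a n = lc (\<lambda>i. if i < n then d i else 0) a (Suc n)"
      using a lc_cong[of n d "\<lambda>i. if i < n then d i else 0" a a] by simp
    then show ?thesis using d by metis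
  next
    case False
    obtain \<delta> where \<delta>: "\<delta> > 0" "\<And>c. cmod (c n) * \<delta> \<le> vnorm E (lc c a (Suc n))"
      using lc_coefficient_bound[where a=a and n=n, OF a _ False] Suc.IH by blast
    have cn: "cmod (c m n) \<le> C / \<delta>" for m
      using order_trans[OF \<delta>(2)[of "c m"] Suc.prems[rule_format, of m]] \<delta>(1) by (simp add: pos_le_divide_eq)
    then obtain z where z: "((\<lambda>m. c m n) \<longlongrightarrow> z) ultra" using ultra_convergent[of "\<lambda>m. c m n", OF cn] by blast
    have "vnorm E (lc (c m) a n) \<le> C + C / \<delta> * vnorm E (a n)" for m
    proof -
      have "lc (c m) a n = lc (c m) a (Suc n) \<ominus> c m n \<odot> a n" using a by (simp add: add_diff_cancel)
      then have "vnorm E (lc (c m) a n) \<le> vnorm E (lc (c m) a (Suc n)) + vnorm E (c m n \<odot> a n)"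
        using a norm_diff_le[of "lc (c m) a (Suc n)" "c m n \<odot> a n"] by (metis lc_closed scale_closed)
      moreover have "vnorm E (c m n \<odot> a n) \<le> C / \<delta> * vnorm E (a n)"
        using mult_right_mono[OF cn[of m] vnorm_nonneg[OF a]] by (simp only: vnorm_smult[OF a])
      ultimately show ?thesis using Suc.prems[rule_format, of m] by linarith
    qed
    then have "\<forall>m. vnorm E (lc (c m) a n) \<le> C + C / \<delta> * vnorm E (a n)" by blast
    then obtain d where d: "conv (\<lambda>m. lc (c m) a n) (lc d a n) ultra" using Suc.IH by blast
    have "conv (\<lambda>m. lc (c m) a n \<oplus> c m n \<odot> a n) (lc d a n \<oplus> z \<odot> a n) ultra"
      using a d z by (intro conv_add conv_scale conv_const) auto
    moreover have "lc d a n = lc (d(n := z)) a n" by (rule lc_cong) auto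
    ultimately have "conv (\<lambda>m. lc (c m) a (Suc n)) (lc (d(n := z)) a (Suc n)) ultra" by simp
    then show ?thesis by blast
  qed
qed

lemma lspan_weakly_compact:
  assumes a: "\<And>i. a i \<in> carrier E"
  shows "weakly_compact_subspace (lspan a n)"
  unfolding weakly_compact_subspace_def
proof (intro conjI allI impI)
  show "lspan a n \<subseteq> carrier E" using lspan_carrier[of a, OF a] by blast
  fix u :: "nat \<Rightarrow> 'v" and C assume u: "\<forall>m. u m \<in> lspan a n \<and> vnorm E (u m) \<le> C"
  then have "\<forall>m. \<exists>c. u m = lc c a n" by (auto simp: lspan_def)
  then obtain c where c: "\<And>m. u m = lc (c m) a n" by metis
  then obtain d where d: "conv (\<lambda>m. lc (c m) a n) (lc d a n) ultra"
    using lc_compact[where a=a and c=c and n=n and C=C, OF a] u by auto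
  moreover have "(\<lambda>m. lc (c m) a n) = u" using c by (intro ext) simp
  ultimately have "conv u (lc d a n) ultra" by simp
  then have "weak_conv u (lc d a n)" using a c by (intro conv_imp_weak_conv) auto
  then show "\<exists>w\<in>lspan a n. weak_conv u w" unfolding lspan_def by blast
qed

lemma bounded_coordinates:
  assumes a: "\<And>i. a i \<in> carrier E"
  shows "\<exists>b k K. (\<forall>i. b i \<in> carrier E) \<and> 0 \<le> K \<and> lspan a n \<subseteq> lspan b k \<and>
     (\<forall>c. \<forall>i<k. cmod (c i) \<le> K * vnorm E (lc c b k))"
proof (induction n)
  case 0
  have "lspan a 0 \<subseteq> lspan a 0" by simp
  then show ?case using a by (intro exI[of _ a] exI[of _ 0] exI[of _ 0]) auto
next
  case (Suc n)
  then obtain b k K where b: "\<And>i. b i \<in> carrier E" and K: "0 \<le> K" "lspan a n \<subseteq> lspan b k"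
    "\<And>c i. i < k \<Longrightarrow> cmod (c i) \<le> K * vnorm E (lc c b k)" by blast
  have step: "lspan a (Suc n) \<subseteq> lspan b' k'"
    if "\<And>i. b' i \<in> carrier E" "lspan b k \<subseteq> lspan b' k'" "a n \<in> lspan b' k'" for b' k'
  proof
    fix u assume "u \<in> lspan a (Suc n)"
    then obtain c where "u = lc c a n \<oplus> c n \<odot> a n" by (auto simp: lspan_def)
    moreover have "lc c a n \<in> lspan b' k'" using K(2) that(2) by (auto simp: lspan_def)
    ultimately show "u \<in> lspan b' k'" using that by (auto intro!: lspan_add lspan_scale)
  qed
  show ?case
  proof (cases "a n \<in> lspan b k")
    case True
    have "lspan a (Suc n) \<subseteq> lspan b k" by (rule step[OF b subset_refl True])
    then show ?thesis using b K(1,3) by (intro exI[of _ b] exI[of _ k] exI[of _ K]) auto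
  next
    case False
    define b' where "b' = b(k := a n)"
    have b': "b' i \<in> carrier E" for i using a b by (simp add: b'_def)
    have lcb: "lc c b' k = lc c b k" for c by (rule lc_cong) (simp add: b'_def)
    have "b' k \<notin> lspan b' k" using False by (simp add: lspan_def lcb) (simp add: b'_def)
    then have "\<exists>\<delta>>0. \<forall>c. cmod (c k) * \<delta> \<le> vnorm E (lc c b' (Suc k))"
      by (intro lc_coefficient_bound[where a=b' and n=k] lc_compact[where a=b' and n=k] b')
    then obtain \<delta> where \<delta>: "\<delta> > 0" "\<And>c. cmod (c k) * \<delta> \<le> vnorm E (lc c b' (Suc k))" by blast
    \<comment> \<open>The new coefficient costs \<open>1 / \<delta>\<close>; removing its term
      enlarges the norm by at most the factor \<open>1 + |a n| / \<delta>\<close>, to which the old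
      constant applies.\<close>
    define K' where "K' = max (1 / \<delta>) (K * (1 + vnorm E (a n) / \<delta>))"
    have ck: "cmod (c k) \<le> 1 / \<delta> * vnorm E (lc c b' (Suc k))" for c
      using \<delta>(2)[of c] \<delta>(1) by (simp add: field_simps)
    have bound: "cmod (c i) \<le> K' * vnorm E (lc c b' (Suc k))" if "i < Suc k" for c i
    proof (cases "i = k")
      case True
      have "1 / \<delta> * vnorm E (lc c b' (Suc k)) \<le> K' * vnorm E (lc c b' (Suc k))"
        using vnorm_nonneg[of "lc c b' (Suc k)"] b' by (intro mult_right_mono) (auto simp: K'_def)
      then show ?thesis using ck[of c] True by simp
    next
      case False
      then have "cmod (c i) \<le> K * vnorm E (lc c b k)" using K(3) that by simp
      also have "vnorm E (lc c b k) \<le> (1 + vnorm E (a n) / \<delta>) * vnorm E (lc c b' (Suc k))"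
      proof -
        have "b' k = a n" by (simp add: b'_def)
        then have "lc c b' (Suc k) = lc c b k \<oplus> c k \<odot> a n" by (simp only: lc.simps lcb)
        then have "lc c b k = lc c b' (Suc k) \<ominus> c k \<odot> a n" using b a by (simp only: add_diff_cancel lc_closed scale_closed)
        then have "vnorm E (lc c b k) \<le> vnorm E (lc c b' (Suc k)) + vnorm E (c k \<odot> a n)"
          using norm_diff_le[of "lc c b' (Suc k)" "c k \<odot> a n"] a b' by (metis lc_closed scale_closed)
        also have "vnorm E (c k \<odot> a n) \<le> (1 / \<delta> * vnorm E (lc c b' (Suc k))) * vnorm E (a n)"
          using a ck[of c] vnorm_nonneg[OF a] by (simp only: vnorm_smult) (intro mult_right_mono)
        finally show ?thesis by (simp add: algebra_simps)
      qed
      then have "K * vnorm E (lc c b k) \<le> K * ((1 + vnorm E (a n) / \<delta>) * vnorm E (lc c b' (Suc k)))"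
        using K(1) by (intro mult_left_mono)
      also have "\<dots> = (K * (1 + vnorm E (a n) / \<delta>)) * vnorm E (lc c b' (Suc k))" by simp
      also have "\<dots> \<le> K' * vnorm E (lc c b' (Suc k))"
        using vnorm_nonneg[of "lc c b' (Suc k)"] b' by (intro mult_right_mono) (auto simp: K'_def)
      finally show ?thesis .
    qed
    have "lspan b k \<subseteq> lspan b' (Suc k)"
    proof
      fix u assume "u \<in> lspan b k"
      then obtain c where "u = lc c b' k" by (auto simp: lspan_def lcb)
      then show "u \<in> lspan b' (Suc k)" using b' by (auto intro!: lc_in_lspan lspan_base)
    qed
    moreover have "a n \<in> lspan b' (Suc k)" using lspan_base[of b' k "Suc k", OF b'] by (simp add: b'_def)
    ultimately have "lspan a (Suc n) \<subseteq> lspan b' (Suc k)" by (rule step[OF b'])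
    moreover have "0 \<le> K'" using \<delta>(1) by (auto simp: K'_def le_max_iff_disj)
    ultimately show ?thesis using b' bound by blast
  qed
qed

lemma linear_span_least:
  assumes "S \<subseteq> H" "H \<subseteq> carrier E" "\<zero> \<in> H" "\<And>u v. u \<in> H \<Longrightarrow> v \<in> H \<Longrightarrow> u \<oplus> v \<in> H"
    "\<And>c u. u \<in> H \<Longrightarrow> c \<odot> u \<in> H"
  shows "linear_span E S \<subseteq> H"
proof -
  have "submodule H complex_ring E"
  proof (rule submoduleI)
    fix u assume "u \<in> H"
    then show "\<ominus> u \<in> H" using assms(2) assms(5)[of u "-1"] by (auto simp: scale_minus_one)
  qed (use assms in auto)
  then show ?thesis using assms(1) by (auto simp: linear_span_def)
qed

lemma linear_span_finite:
  assumes "finite A" "A \<subseteq> carrier E"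
  shows "\<exists>a k. (\<forall>i. a i \<in> carrier E) \<and> linear_span E A \<subseteq> lspan a k"
proof -
  obtain l where l: "set l = A" using finite_list[OF assms(1)] by blast
  define a where "a = (\<lambda>i. if i < length l then l ! i else \<zero>)"
  have a: "a i \<in> carrier E" for i using l assms(2) nth_mem by (fastforce simp: a_def)
  have "A \<subseteq> lspan a (length l)"
  proof
    fix v assume "v \<in> A"
    then obtain i where "i < length l" "v = a i" using l by (auto simp: in_set_conv_nth a_def)
    then show "v \<in> lspan a (length l)" using lspan_base[where a=a, OF a] by simp
  qed
  then have "linear_span E A \<subseteq> lspan a (length l)"
    using lspan_carrier[OF a] lspan_zero[OF a] lspan_add[OF a] lspan_scale[OF a]
    by (intro linear_span_least) auto
  then show ?thesis using a by blast
qed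

end

section \<open>Finite rank contractions\<close>

context normed_pair
begin

lemma bops_lc:
  assumes "T \<in> bops" "\<And>i. a i \<in> carrier E"
  shows "T (E.lc c a n) = F.lc c (\<lambda>i. T (a i)) n"
  using assms by (induction n) (auto simp: bops_zero bops_add bops_scale)

text \<open>A finite rank contraction is perturbed so that its range is spanned by members of a given
  dense sequence: replace the basis of the range and rescale.\<close>

lemma finite_rank_perturbation:
  assumes R: "R \<in> opball" and a: "\<And>i. a i \<in> carrier F" and rng: "\<And>v. v \<in> carrier E \<Longrightarrow> R v \<in> F.lspan a k0"
    and \<psi>: "F.dense_seq \<psi>" and e: "e > 0"
  shows "\<exists>N. \<exists>Q\<in>opball. (\<forall>v\<in>carrier E. Q v \<in> F.lspan \<psi> N) \<and> (\<forall>v\<in>carrier E. vnorm F (Q v \<ominus>\<^bsub>F\<^esub> R v) \<le> e * vnorm E v)"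
proof -
  have Rb: "R \<in> bops" and Rc: "\<And>v. v \<in> carrier E \<Longrightarrow> vnorm F (R v) \<le> vnorm E v" using R opball_iff by blast+
  have \<psi>c: "\<psi> i \<in> carrier F" for i using \<psi> by (simp add: F.dense_seq_def)
  obtain b k K where b: "\<And>i. b i \<in> carrier F" and K: "0 \<le> K" "F.lspan a k0 \<subseteq> F.lspan b k"
    "\<And>c i. i < k \<Longrightarrow> cmod (c i) \<le> K * vnorm F (F.lc c b k)" using F.bounded_coordinates[of a k0, OF a] by blast
  have "\<forall>v\<in>carrier E. \<exists>d. R v = F.lc d b k" using rng K(2) by (fastforce simp: F.lspan_def)
  then obtain d where d: "\<And>v. v \<in> carrier E \<Longrightarrow> R v = F.lc (d v) b k" by metis
  \<comment> \<open>Uniqueness of coordinates makes the arbitrarily chosen coefficients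
    \<open>d v\<close> linear in \<open>v\<close>, so replacing the basis gives a linear
    map.\<close>
  have uniq: "c i = c' i" if "F.lc c b k = F.lc c' b k" "i < k" for c c' i
  proof -
    have "F.lc (\<lambda>i. c i - c' i) b k = \<zero>\<^bsub>F\<^esub>" using F.lc_diff[of b c c' k] b that(1) by simp
    then show ?thesis using K(3)[OF that(2), of "\<lambda>i. c i - c' i"] by simp
  qed
  define e' where "e' = e / 2"
  have e': "e' > 0" using e by (simp add: e'_def)
  \<comment> \<open>Each of the \<open>k\<close> coefficients is at most \<open>K |v|\<close>, so
    moving the basis vectors by \<open>\<eta>\<close> costs at most \<open>k K \<eta> |v|\<close>.
    The added 1 keeps the denominator positive.\<close>
  define \<eta> where "\<eta> = e' / (real k * K + 1)"
  have kK: "real k * K \<ge> 0" using K(1) by simp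
  have \<eta>: "\<eta> > 0" using e' kK by (simp add: \<eta>_def add_nonneg_pos)
  have "\<forall>i. \<exists>n. vnorm F (b i \<ominus>\<^bsub>F\<^esub> \<psi> n) < \<eta>" using \<psi> b \<eta> by (simp add: F.dense_seq_def)
  then obtain n where n: "\<And>i. vnorm F (b i \<ominus>\<^bsub>F\<^esub> \<psi> (n i)) < \<eta>" by metis
  define b' where "b' = (\<lambda>i. \<psi> (n i))"
  have b': "b' i \<in> carrier F" for i using \<psi>c by (simp add: b'_def)
  define R1 where "R1 = (\<lambda>v. F.lc (d v) b' k)"
  have R1c: "R1 v \<in> carrier F" for v using b' by (simp add: R1_def)
  have R1_add: "R1 (v \<oplus>\<^bsub>E\<^esub> w) = R1 v \<oplus>\<^bsub>F\<^esub> R1 w" if vw: "v \<in> carrier E" "w \<in> carrier E" for v w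
  proof -
    have "F.lc (d (v \<oplus>\<^bsub>E\<^esub> w)) b k = F.lc (\<lambda>i. d v i + d w i) b k"
      using vw b Rb d[of v] d[of w] d[of "v \<oplus>\<^bsub>E\<^esub> w"] bops_add[of R v w] F.lc_add[of b "d v" "d w" k] by simp
    then have "F.lc (d (v \<oplus>\<^bsub>E\<^esub> w)) b' k = F.lc (\<lambda>i. d v i + d w i) b' k" using uniq by (intro F.lc_cong) auto
    then show ?thesis using b' by (simp add: R1_def F.lc_add)
  qed
  have R1_scale: "R1 (c \<odot>\<^bsub>E\<^esub> v) = c \<odot>\<^bsub>F\<^esub> R1 v" if v: "v \<in> carrier E" for c v
  proof -
    have "F.lc (d (c \<odot>\<^bsub>E\<^esub> v)) b k = F.lc (\<lambda>i. c * d v i) b k"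
      using v b Rb d[of v] d[of "c \<odot>\<^bsub>E\<^esub> v"] bops_scale[of R v c] F.lc_scale[of b c "d v" k] by simp
    then have "F.lc (d (c \<odot>\<^bsub>E\<^esub> v)) b' k = F.lc (\<lambda>i. c * d v i) b' k" using uniq by (intro F.lc_cong) auto
    then show ?thesis using b' by (simp add: R1_def F.lc_scale)
  qed
  have R1_near: "vnorm F (R1 v \<ominus>\<^bsub>F\<^esub> R v) \<le> e' * vnorm E v" if v: "v \<in> carrier E" for v
  proof -
    have "vnorm F (R1 v \<ominus>\<^bsub>F\<^esub> R v) \<le> (\<Sum>i<k. cmod (d v i) * vnorm F (b' i \<ominus>\<^bsub>F\<^esub> b i))"
      unfolding R1_def d[OF v] by (rule F.norm_lc_diff[OF b' b])
    also have "\<dots> \<le> (\<Sum>i<k. (K * vnorm E v) * \<eta>)"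
    proof (intro sum_mono mult_mono)
      fix i assume "i \<in> {..<k}"
      then have "cmod (d v i) \<le> K * vnorm F (R v)" using K(3)[of i "d v"] d[OF v] by simp
      also have "\<dots> \<le> K * vnorm E v" using Rc[OF v] K(1) by (intro mult_left_mono)
      finally show "cmod (d v i) \<le> K * vnorm E v" .
      show "vnorm F (b' i \<ominus>\<^bsub>F\<^esub> b i) \<le> \<eta>" using n[of i] b b' F.norm_diff_commute[of "b i" "b' i"] by (simp add: b'_def)
      show "0 \<le> K * vnorm E v" using K(1) E.vnorm_nonneg[OF v] by simp
    qed (use F.vnorm_nonneg b b' in auto)
    also have "\<dots> = (real k * K * \<eta>) * vnorm E v" by simp
    also have "\<dots> \<le> e' * vnorm E v"
    proof (rule mult_right_mono)
      have "real k * K * \<eta> \<le> (real k * K + 1) * \<eta>" using \<eta> by (intro mult_right_mono) auto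
      also have "\<dots> = e'" using kK by (simp add: \<eta>_def)
      finally show "real k * K * \<eta> \<le> e'" .
    qed (use E.vnorm_nonneg[OF v] in simp)
    finally show ?thesis .
  qed
  have R1_norm: "vnorm F (R1 v) \<le> (1 + e') * vnorm E v" if v: "v \<in> carrier E" for v
    using R1_near[OF v] Rc[OF v] F.norm_le_diff[OF R1c[of v] bops_closed[OF Rb v]] by (simp add: algebra_simps)
  \<comment> \<open>The perturbed map has norm at most \<open>1 + e'\<close>; scaling back to a
    contraction costs another \<open>e'\<close>, which is why \<open>e'\<close> is half of
    \<open>e\<close>.\<close>
  define t where "t = 1 / (1 + e')"
  have t: "0 < t" "t \<le> 1" "t * (1 + e') = 1" using e' by (auto simp: t_def)
  define Q where "Q = restrict (\<lambda>v. complex_of_real t \<odot>\<^bsub>F\<^esub> R1 v) (carrier E)"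
  have Qn: "vnorm F (Q v) \<le> 1 * vnorm E v" if v: "v \<in> carrier E" for v
  proof -
    have "vnorm F (Q v) = t * vnorm F (R1 v)" using v t R1c by (simp add: Q_def F.vnorm_smult)
    also have "\<dots> \<le> t * ((1 + e') * vnorm E v)" using R1_norm[OF v] t by (intro mult_left_mono) auto
    also have "\<dots> = 1 * vnorm E v" using t(3) by (simp flip: mult.assoc)
    finally show ?thesis .
  qed
  have "Q \<in> bops" unfolding Q_def
  proof (rule bopsI[where C=1])
    show "complex_of_real t \<odot>\<^bsub>F\<^esub> R1 (v \<oplus>\<^bsub>E\<^esub> w) = complex_of_real t \<odot>\<^bsub>F\<^esub> R1 v \<oplus>\<^bsub>F\<^esub> complex_of_real t \<odot>\<^bsub>F\<^esub> R1 w"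
      if "v \<in> carrier E" "w \<in> carrier E" for v w using R1_add[OF that] R1c by (simp add: F.scale_right_distrib)
    show "complex_of_real t \<odot>\<^bsub>F\<^esub> R1 (c \<odot>\<^bsub>E\<^esub> v) = c \<odot>\<^bsub>F\<^esub> (complex_of_real t \<odot>\<^bsub>F\<^esub> R1 v)" if "v \<in> carrier E" for c v
      using R1_scale[OF that] R1c by (simp add: F.scale_scale mult.commute)
    show "vnorm F (complex_of_real t \<odot>\<^bsub>F\<^esub> R1 v) \<le> 1 * vnorm E v" if "v \<in> carrier E" for v
      using Qn[OF that] that by (simp add: Q_def)
  qed (use R1c in auto)
  then have "Q \<in> opball" using Qn opball_iff by simp
  moreover have "vnorm F (Q v \<ominus>\<^bsub>F\<^esub> R v) \<le> e * vnorm E v" if v: "v \<in> carrier E" for v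
  proof -
    have "Q v \<ominus>\<^bsub>F\<^esub> R1 v = complex_of_real (t - 1) \<odot>\<^bsub>F\<^esub> R1 v"
      using v R1c F.scale_diff_left[of "R1 v" "complex_of_real t" 1] by (simp add: Q_def)
    then have "vnorm F (Q v \<ominus>\<^bsub>F\<^esub> R1 v) = cmod (complex_of_real (t - 1)) * vnorm F (R1 v)"
      using R1c F.vnorm_smult by simp
    also have "cmod (complex_of_real (t - 1)) = 1 - t" using t by (simp only: norm_of_real)
    also have "(1 - t) * vnorm F (R1 v) \<le> (1 - t) * ((1 + e') * vnorm E v)" using R1_norm[OF v] t by (intro mult_left_mono) auto
    also have "\<dots> = ((1 + e') - t * (1 + e')) * vnorm E v" by (simp add: algebra_simps)
    also have "\<dots> = e' * vnorm E v" using t(3) by simp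
    finally have "vnorm F (Q v \<ominus>\<^bsub>F\<^esub> R1 v) \<le> e' * vnorm E v" .
    moreover have "Q v \<in> carrier F" using v R1c by (simp add: Q_def)
    ultimately show ?thesis using R1_near[OF v] F.norm_diff_triangle[OF _ R1c bops_closed[OF Rb v], of "Q v" v]
      by (simp add: e'_def)
  qed
  moreover have "\<exists>N. \<forall>v\<in>carrier E. Q v \<in> F.lspan \<psi> N"
  proof -
    define N where "N = Suc (Max (insert 0 (n ` {..<k})))"
    have "b' i \<in> F.lspan \<psi> N" if "i < k" for i
    proof -
      have "n i \<le> Max (insert 0 (n ` {..<k}))" using that by (intro Max_ge) auto
      then show ?thesis unfolding b'_def using \<psi>c by (intro F.lspan_base) (auto simp: N_def)
    qed
    then have "R1 v \<in> F.lspan \<psi> N" for v unfolding R1_def using \<psi>c by (intro F.lc_in_lspan)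
    then show ?thesis using \<psi>c F.lspan_scale by (intro exI[of _ N]) (auto simp: Q_def)
  qed
  ultimately show ?thesis by blast
qed

end

lemma compose_bops:
  assumes "complex_normed_space E" "complex_normed_space F" "complex_normed_space G"
    "S \<in> carrier (bounded_operators F G)" "T \<in> carrier (bounded_operators E F)"
  shows "compose (carrier E) S T \<in> carrier (bounded_operators E G)"
    "vnorm (bounded_operators E G) (compose (carrier E) S T) \<le> vnorm (bounded_operators F G) S * vnorm (bounded_operators E F) T"
proof -
  interpret EF: normed_pair E F using assms by (intro normed_pair.intro)
  interpret FG: normed_pair F G using assms by (intro normed_pair.intro)
  interpret EG: normed_pair E G using assms by (intro normed_pair.intro)
  have bd: "vnorm G (S (T v)) \<le> FG.opnorm S * EF.opnorm T * vnorm E v" if v: "v \<in> carrier E" for v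
  proof -
    have "vnorm G (S (T v)) \<le> FG.opnorm S * vnorm F (T v)" using assms v by (intro FG.opnorm_bound) auto
    also have "\<dots> \<le> FG.opnorm S * (EF.opnorm T * vnorm E v)"
      using EF.opnorm_bound[OF assms(5) v] FG.opnorm_nonneg[OF assms(4)] by (intro mult_left_mono)
    finally show ?thesis by simp
  qed
  have "restrict (\<lambda>v. S (T v)) (carrier E) \<in> EG.bops"
  proof (rule EG.bopsI)
    fix v w assume "v \<in> carrier E" "w \<in> carrier E"
    then show "S (T (v \<oplus>\<^bsub>E\<^esub> w)) = S (T v) \<oplus>\<^bsub>G\<^esub> S (T w)"
      using assms EF.bops_add[OF assms(5)] FG.bops_add[OF assms(4)] EF.bops_closed[OF assms(5)] by simp
  next
    fix c v assume "v \<in> carrier E"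
    then show "S (T (c \<odot>\<^bsub>E\<^esub> v)) = c \<odot>\<^bsub>G\<^esub> S (T v)"
      using assms EF.bops_scale[OF assms(5)] FG.bops_scale[OF assms(4)] EF.bops_closed[OF assms(5)] by simp
  qed (use bd assms in auto)
  then show in_bops: "compose (carrier E) S T \<in> EG.bops" by (simp add: compose_def)
  show "EG.opnorm (compose (carrier E) S T) \<le> FG.opnorm S * EF.opnorm T"
    using EG.opnorm_le_iff[OF in_bops] bd FG.opnorm_nonneg[OF assms(4)] EF.opnorm_nonneg[OF assms(5)]
    by (simp add: compose_def)
qed

lemma compose_unit_ball:
  assumes "complex_normed_space E" "complex_normed_space F" "complex_normed_space G"
    "S \<in> unit_ball (bounded_operators F G)" "T \<in> unit_ball (bounded_operators E F)"
  shows "compose (carrier E) S T \<in> unit_ball (bounded_operators E G)"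
proof -
  interpret EF: normed_pair E F using assms by (intro normed_pair.intro)
  interpret FG: normed_pair F G using assms by (intro normed_pair.intro)
  have ST: "S \<in> FG.bops" "T \<in> EF.bops" "FG.opnorm S \<le> 1" "EF.opnorm T \<le> 1" using assms by (auto simp: unit_ball_def)
  have "FG.opnorm S * EF.opnorm T \<le> 1 * 1"
    using ST FG.opnorm_nonneg[OF ST(1)] EF.opnorm_nonneg[OF ST(2)] by (intro mult_mono) auto
  then show ?thesis using compose_bops[OF assms(1-3) ST(1,2)] by (auto simp: unit_ball_def)
qed

text \<open>Approximants of the identity are composed with \<open>T\<close> on the right or on the
  left, according to which space has the property. Both composites are finite rank contractions near
  \<open>T\<close> on the finite set; moving the range into the span of \<open>\<psi>\<close> uses
  the other half of \<open>e\<close>.\<close>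

lemma (in normed_pair) metric_approximation:
  assumes map: "metric_approximation_property E \<or> metric_approximation_property F"
    and T: "T \<in> opball" and \<psi>: "F.dense_seq \<psi>" and e: "e > 0" and vs: "finite vs" "vs \<subseteq> carrier E"
  shows "\<exists>N. \<exists>Q\<in>opball. (\<forall>v\<in>carrier E. Q v \<in> F.lspan \<psi> N) \<and> (\<forall>v\<in>vs. vnorm F (Q v \<ominus>\<^bsub>F\<^esub> T v) < e)"
proof -
  have Tb: "T \<in> bops" using T by (rule opball_bops)
  note En = E.complex_normed_space_axioms and Fn = F.complex_normed_space_axioms
  have "\<exists>R\<in>opball. (\<exists>a k. (\<forall>i. a i \<in> carrier F) \<and> (\<forall>v\<in>carrier E. R v \<in> F.lspan a k)) \<and>
     (\<forall>v\<in>vs. vnorm F (R v \<ominus>\<^bsub>F\<^esub> T v) < e / 2)"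
    using map
  proof
    assume "metric_approximation_property E"
    then obtain P where P: "\<And>n. P n \<in> carrier (bounded_operators E E)" "\<And>n. finite_rank E E (P n)"
      "\<And>n. vnorm (bounded_operators E E) (P n) \<le> 1" "\<And>v. v \<in> carrier E \<Longrightarrow> limitin (norm_topology E) (\<lambda>n. P n v) v sequentially"
      unfolding metric_approximation_property_def by blast
    interpret EE: normed_pair E E using En by (intro normed_pair.intro)
    have Pc: "P n v \<in> carrier E" if "v \<in> carrier E" for n v using P(1) that by blast
    have cv: "F.conv (\<lambda>n. T (P n v)) (T v) sequentially" if v: "v \<in> carrier E" for v
      using P(4)[OF v] E.limitin_norm_topology_iff[of "\<lambda>n. P n v" v sequentially] Pc[OF v] v by (intro conv_bops Tb) auto
    have "\<forall>\<^sub>F n in sequentially. \<forall>v\<in>vs. vnorm F (T (P n v) \<ominus>\<^bsub>F\<^esub> T v) < e / 2"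
      using cv vs e unfolding F.conv_def by (intro eventually_ball_finite ballI order_tendstoD(2)) auto
    then obtain n where n: "\<forall>v\<in>vs. vnorm F (T (P n v) \<ominus>\<^bsub>F\<^esub> T v) < e / 2"
      by (auto simp: eventually_sequentially)
    define R where "R = compose (carrier E) T (P n)"
    have "R \<in> opball" unfolding R_def using P(1,3) T En Fn by (intro compose_unit_ball) (auto simp: unit_ball_def)
    moreover obtain a k where a: "\<And>i. a i \<in> carrier E" "\<And>v. v \<in> carrier E \<Longrightarrow> P n v \<in> E.lspan a k"
      using P(2)[of n] E.linear_span_finite unfolding finite_rank_def by (metis image_subset_iff subset_iff)
    have "R v \<in> F.lspan (\<lambda>i. T (a i)) k" if v: "v \<in> carrier E" for v
    proof -
      obtain c where "P n v = E.lc c a k" using a(2)[OF v] by (auto simp: E.lspan_def)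
      then have "R v = F.lc c (\<lambda>i. T (a i)) k" using v bops_lc[OF Tb a(1)] by (simp add: R_def compose_def)
      then show ?thesis by (simp add: F.lspan_def)
    qed
    moreover have "T (a i) \<in> carrier F" for i using Tb a(1) by blast
    moreover have "\<forall>v\<in>vs. vnorm F (R v \<ominus>\<^bsub>F\<^esub> T v) < e / 2" using n vs by (auto simp: R_def compose_def)
    ultimately show ?thesis by (intro bexI[of _ R] conjI exI[of _ "\<lambda>i. T (a i)"] exI[of _ k]) auto
  next
    assume "metric_approximation_property F"
    then obtain P where P: "\<And>n. P n \<in> carrier (bounded_operators F F)" "\<And>n. finite_rank F F (P n)"
      "\<And>n. vnorm (bounded_operators F F) (P n) \<le> 1" "\<And>v. v \<in> carrier F \<Longrightarrow> limitin (norm_topology F) (\<lambda>n. P n v) v sequentially"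
      unfolding metric_approximation_property_def by blast
    interpret FF: normed_pair F F using Fn by (intro normed_pair.intro)
    have Pc: "P n v \<in> carrier F" if "v \<in> carrier F" for n v using P(1) that by blast
    have cv: "F.conv (\<lambda>n. P n (T v)) (T v) sequentially" if v: "v \<in> carrier E" for v
    proof -
      have Tv: "T v \<in> carrier F" using Tb v by blast
      show ?thesis using P(4)[OF Tv] F.limitin_norm_topology_iff[of "\<lambda>n. P n (T v)" "T v" sequentially] Pc[OF Tv] by auto
    qed
    have "\<forall>\<^sub>F n in sequentially. \<forall>v\<in>vs. vnorm F (P n (T v) \<ominus>\<^bsub>F\<^esub> T v) < e / 2"
      using cv vs e unfolding F.conv_def by (intro eventually_ball_finite ballI order_tendstoD(2)) auto
    then obtain n where n: "\<forall>v\<in>vs. vnorm F (P n (T v) \<ominus>\<^bsub>F\<^esub> T v) < e / 2"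
      by (auto simp: eventually_sequentially)
    define R where "R = compose (carrier E) (P n) T"
    have "R \<in> opball" unfolding R_def using P(1,3) T En Fn by (intro compose_unit_ball) (auto simp: unit_ball_def)
    moreover obtain a k where a: "\<And>i. a i \<in> carrier F" "\<And>v. v \<in> carrier F \<Longrightarrow> P n v \<in> F.lspan a k"
      using P(2)[of n] F.linear_span_finite unfolding finite_rank_def by (metis image_subset_iff subset_iff)
    have "R v \<in> F.lspan a k" if v: "v \<in> carrier E" for v using a(2) Tb v by (auto simp: R_def compose_def)
    moreover have "\<forall>v\<in>vs. vnorm F (R v \<ominus>\<^bsub>F\<^esub> T v) < e / 2" using n vs by (auto simp: R_def compose_def)
    ultimately show ?thesis using a(1) by blast
  qed
  then obtain R a k where R: "R \<in> opball" "\<And>i. a i \<in> carrier F" "\<And>v. v \<in> carrier E \<Longrightarrow> R v \<in> F.lspan a k"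
    "\<And>v. v \<in> vs \<Longrightarrow> vnorm F (R v \<ominus>\<^bsub>F\<^esub> T v) < e / 2" by blast
  \<comment> \<open>A positive bound for the test vectors: the perturbation lemma gives an error
    relative to the norm, and an absolute one is wanted.\<close>
  define M where "M = Max (insert 0 (vnorm E ` vs)) + 1"
  have M0: "0 \<le> Max (insert 0 (vnorm E ` vs))" using vs by (intro Max_ge) auto
  have M: "M > 0" "\<And>v. v \<in> vs \<Longrightarrow> vnorm E v \<le> M"
  proof -
    show "M > 0" using M0 by (simp add: M_def)
    show "vnorm E v \<le> M" if "v \<in> vs" for v
      
    proof -
      have "vnorm E v \<le> Max (insert 0 (vnorm E ` vs))" using that vs by (intro Max_ge) auto
      then show ?thesis by (simp add: M_def)
    qed
  qed
  obtain N Q where Q: "Q \<in> opball" "\<forall>v\<in>carrier E. Q v \<in> F.lspan \<psi> N"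
    "\<forall>v\<in>carrier E. vnorm F (Q v \<ominus>\<^bsub>F\<^esub> R v) \<le> e / (2 * M) * vnorm E v"
    using finite_rank_perturbation[OF R(1,2,3) \<psi>, of "e / (2 * M)"] e M(1) by auto
  have "vnorm F (Q v \<ominus>\<^bsub>F\<^esub> T v) < e" if v: "v \<in> vs" for v
  proof -
    have vE: "v \<in> carrier E" using v vs by blast
    have "e / (2 * M) * vnorm E v \<le> e / (2 * M) * M" using M(2)[OF v] e M(1) by (intro mult_left_mono) auto
    also have "\<dots> = e / 2" using M(1) by simp
    finally have "e / (2 * M) * vnorm E v \<le> e / 2" .
    with bspec[OF Q(3) vE] have "vnorm F (Q v \<ominus>\<^bsub>F\<^esub> R v) \<le> e / 2" by (rule order_trans)
    moreover have "vnorm F (Q v \<ominus>\<^bsub>F\<^esub> T v) \<le> vnorm F (Q v \<ominus>\<^bsub>F\<^esub> R v) + vnorm F (R v \<ominus>\<^bsub>F\<^esub> T v)"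
      using Q(1) R(1) Tb vE opball_bops by (intro F.norm_diff_triangle) auto
    ultimately show ?thesis using R(4)[OF v] by simp
  qed
  then show ?thesis using Q by blast
qed

section \<open>The strong topology on the unit ball\<close>

lemma topology_eq_of_continuous_id:
  assumes "continuous_map X Y (\<lambda>x. x)" "continuous_map Y X (\<lambda>x. x)" "topspace X = topspace Y"
  shows "X = Y"
proof -
  have "openin X U" if "openin Y U" for U
  proof -
    have "openin X {x \<in> topspace X. x \<in> U}" using assms(1) that by (auto simp: continuous_map_def)
    moreover have "{x \<in> topspace X. x \<in> U} = U" using openin_subset[OF that] assms(3) by auto
    ultimately show ?thesis by simp
  qed
  moreover have "openin Y U" if "openin X U" for U
  proof -
    have "openin Y {x \<in> topspace Y. x \<in> U}" using assms(2) that by (auto simp: continuous_map_def)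
    moreover have "{x \<in> topspace Y. x \<in> U} = U" using openin_subset[OF that] assms(3) by auto
    ultimately show ?thesis by simp
  qed
  ultimately show ?thesis by (auto simp: topology_eq)
qed

section \<open>A complete metric for the strong topology\<close>

context normed_pair
begin

text \<open>The cap \<open>1 / Suc n\<close> leaves only finitely many coordinates relevant at each
  scale. The metric is the supremum of the gaps rather than a weighted sum, so that a bound on it is
  a countable conjunction, convenient for completeness and for measurability.\<close>

definition gap :: "(nat \<Rightarrow> 'v) \<Rightarrow> ('v \<Rightarrow> 'w) \<Rightarrow> ('v \<Rightarrow> 'w) \<Rightarrow> nat \<Rightarrow> real" where
  "gap \<phi> S T n = min (1 / Suc n) (vnorm F (S (\<phi> n) \<ominus>\<^bsub>F\<^esub> T (\<phi> n)))"

definition strong_dist :: "(nat \<Rightarrow> 'v) \<Rightarrow> ('v \<Rightarrow> 'w) \<Rightarrow> ('v \<Rightarrow> 'w) \<Rightarrow> real" where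
  "strong_dist \<phi> S T = (if S \<in> opball \<and> T \<in> opball then SUP n. gap \<phi> S T n else 0)"

lemma gap_le_1: "gap \<phi> S T n \<le> 1"
  unfolding gap_def by (rule min.coboundedI1) simp

lemma gap_bdd: "bdd_above (range (gap \<phi> S T))"
  using gap_le_1 by (intro bdd_aboveI2) blast

lemma strong_dist_le_iff:
  assumes "S \<in> opball" "T \<in> opball"
  shows "strong_dist \<phi> S T \<le> r \<longleftrightarrow> (\<forall>n. gap \<phi> S T n \<le> r)"
  using assms cSUP_le_iff[OF _ gap_bdd, of \<phi> S T r] by (simp add: strong_dist_def)

lemma gap_le_strong_dist: "S \<in> opball \<Longrightarrow> T \<in> opball \<Longrightarrow> gap \<phi> S T n \<le> strong_dist \<phi> S T"
  using strong_dist_le_iff[of S T \<phi> "strong_dist \<phi> S T"] by blast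

lemma gap_nonneg:
  assumes "S \<in> opball" "T \<in> opball" "\<phi> n \<in> carrier E" shows "0 \<le> gap \<phi> S T n"
  using assms F.vnorm_nonneg[of "S (\<phi> n) \<ominus>\<^bsub>F\<^esub> T (\<phi> n)"] opball_bops by (simp add: gap_def)

lemma gap_commute:
  assumes "S \<in> opball" "T \<in> opball" "\<phi> n \<in> carrier E" shows "gap \<phi> S T n = gap \<phi> T S n"
  using assms opball_bops F.norm_diff_commute[of "S (\<phi> n)" "T (\<phi> n)"] by (simp add: gap_def)

lemma gap_triangle:
  assumes "R \<in> opball" "S \<in> opball" "T \<in> opball" "\<phi> n \<in> carrier E"
  shows "gap \<phi> R T n \<le> gap \<phi> R S n + gap \<phi> S T n"
proof -
  have c: "R (\<phi> n) \<in> carrier F" "S (\<phi> n) \<in> carrier F" "T (\<phi> n) \<in> carrier F" using assms opball_bops by blast+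
  have "vnorm F (R (\<phi> n) \<ominus>\<^bsub>F\<^esub> T (\<phi> n)) \<le> vnorm F (R (\<phi> n) \<ominus>\<^bsub>F\<^esub> S (\<phi> n)) + vnorm F (S (\<phi> n) \<ominus>\<^bsub>F\<^esub> T (\<phi> n))"
    using c by (intro F.norm_diff_triangle)
  moreover have "0 \<le> vnorm F (R (\<phi> n) \<ominus>\<^bsub>F\<^esub> S (\<phi> n))" "0 \<le> vnorm F (S (\<phi> n) \<ominus>\<^bsub>F\<^esub> T (\<phi> n))"
    using c F.vnorm_nonneg by auto
  moreover have "0 \<le> 1 / real (Suc n)" by simp
  ultimately show ?thesis unfolding gap_def min_def by (smt (verit))
qed

end

locale dense_normed_pair = normed_pair +
  fixes \<phi> :: "nat \<Rightarrow> 'a" and \<psi> :: "nat \<Rightarrow> 'b"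
  assumes \<phi>: "E.dense_seq \<phi>" and \<psi>: "F.dense_seq \<psi>" and complete: "mcomplete_of (norm_metric F)"
begin

lemma \<phi>_closed [simp]: "\<phi> n \<in> carrier E" using \<phi> by (simp add: E.dense_seq_def)
lemma \<psi>_closed [simp]: "\<psi> n \<in> carrier F" using \<psi> by (simp add: F.dense_seq_def)

sublocale B: Metric_space opball "strong_dist \<phi>"
proof
  fix R S T
  show "0 \<le> strong_dist \<phi> S T"
    using gap_le_strong_dist[of S T \<phi> 0] gap_nonneg[of S T \<phi> 0] by (fastforce simp: strong_dist_def)
  show "strong_dist \<phi> S T = strong_dist \<phi> T S"
    using gap_commute[of S T \<phi>] by (simp add: strong_dist_def)
  show "strong_dist \<phi> S T = 0 \<longleftrightarrow> S = T" if ST: "S \<in> opball" "T \<in> opball"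
  proof
    assume 0: "strong_dist \<phi> S T = 0"
    have "S (\<phi> n) = T (\<phi> n)" for n
    proof -
      have "gap \<phi> S T n \<le> 0" using gap_le_strong_dist[OF ST, of \<phi> n] 0 by simp
      then have "vnorm F (S (\<phi> n) \<ominus>\<^bsub>F\<^esub> T (\<phi> n)) \<le> 0" by (simp add: gap_def min_le_iff_disj)
      moreover have c: "S (\<phi> n) \<in> carrier F" "T (\<phi> n) \<in> carrier F" using ST opball_bops by auto
      ultimately have "vnorm F (S (\<phi> n) \<ominus>\<^bsub>F\<^esub> T (\<phi> n)) = 0"
        using F.vnorm_nonneg[of "S (\<phi> n) \<ominus>\<^bsub>F\<^esub> T (\<phi> n)"] by simp
      then show ?thesis using c F.norm_diff_eq_zero_iff by blast
    qed
    then show "S = T" using ST opball_bops \<phi> by (intro bops_eq_dense[of S T \<phi>]) auto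
  next
    assume "S = T"
    then have "gap \<phi> S T n = 0" for n using ST opball_bops by (simp add: gap_def)
    then show "strong_dist \<phi> S T = 0" using ST by (simp add: strong_dist_def)
  qed
  show "strong_dist \<phi> R T \<le> strong_dist \<phi> R S + strong_dist \<phi> S T" if "R \<in> opball" "S \<in> opball" "T \<in> opball"
    unfolding strong_dist_le_iff[OF that(1,3)]
  proof
    fix n
    show "gap \<phi> R T n \<le> strong_dist \<phi> R S + strong_dist \<phi> S T"
      using gap_triangle[OF that, of \<phi> n] gap_le_strong_dist[OF that(1,2), of \<phi> n] gap_le_strong_dist[OF that(2,3), of \<phi> n] by simp
  qed
qed

text \<open>Values on the dense sequence converge, their limits inherit the inequalities of
  \<open>bounded_on_seq\<close> with constant 1, and the extension theorem returns a
  contraction.\<close>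

lemma strong_dist_complete: "B.mcomplete"
  unfolding B.mcomplete_def
proof (intro allI impI)
  fix T assume C: "B.MCauchy T"
  then have T: "T j \<in> opball" for j by (auto simp: B.MCauchy_def)
  have Tb: "T j \<in> bops" for j using T opball_bops by blast
  have Tc: "T j (\<phi> n) \<in> carrier F" for j n by (rule bops_closed[OF Tb]) simp
  have cau: "\<exists>N. \<forall>i\<ge>N. \<forall>j\<ge>N. strong_dist \<phi> (T i) (T j) < e" if "e > 0" for e
    using C that unfolding B.MCauchy_def by meson
  have "\<exists>w\<in>carrier F. F.conv (\<lambda>j. T j (\<phi> n)) w sequentially" for n
  proof -
    have "\<exists>N. \<forall>i\<ge>N. \<forall>j\<ge>N. vnorm F (T i (\<phi> n) \<ominus>\<^bsub>F\<^esub> T j (\<phi> n)) < e" if e: "e > 0" for e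
    proof -
      \<comment> \<open>Below the cap \<open>1 / Suc n\<close> the gap at \<open>n\<close> is the
        norm itself.\<close>
      obtain N where N: "\<And>i j. i \<ge> N \<Longrightarrow> j \<ge> N \<Longrightarrow> strong_dist \<phi> (T i) (T j) < min e (1 / Suc n)"
        using cau[of "min e (1 / Suc n)"] e by auto
      have "vnorm F (T i (\<phi> n) \<ominus>\<^bsub>F\<^esub> T j (\<phi> n)) < e" if "i \<ge> N" "j \<ge> N" for i j
        using N[OF that] gap_le_strong_dist[OF T T, of \<phi> i j n] by (auto simp: gap_def min_def split: if_splits)
      then show ?thesis by blast
    qed
    moreover have "range (\<lambda>j. T j (\<phi> n)) \<subseteq> carrier F" using Tc by auto
    ultimately show ?thesis using complete[unfolded F.mcomplete_norm_iff, THEN spec, of "\<lambda>j. T j (\<phi> n)"] by simp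
  qed
  then obtain w where w: "\<And>n. w n \<in> carrier F" "\<And>n. F.conv (\<lambda>j. T j (\<phi> n)) (w n) sequentially" by metis
  have "bounded_on_seq \<phi> 1 w"
    unfolding bounded_on_seq_def
  proof (intro allI)
    fix i j n m k
    have lim: "(\<lambda>l. vnorm F (F.lin (cq i) (cq j) (T l (\<phi> n)) (T l (\<phi> m)) (T l (\<phi> k)))) \<longlonglongrightarrow> vnorm F (F.lin (cq i) (cq j) (w n) (w m) (w k))"
      by (intro F.conv_norm F.conv_lin tendsto_const w Tc F.lin_closed)
    have "vnorm F (F.lin (cq i) (cq j) (T l (\<phi> n)) (T l (\<phi> m)) (T l (\<phi> k))) \<le> 1 * vnorm E (E.lin (cq i) (cq j) (\<phi> n) (\<phi> m) (\<phi> k))" for l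
      using bops_bounded_on_seq[of "T l" 1 \<phi>] T[of l] Tb unfolding bounded_on_seq_def by (auto simp: unit_ball_def)
    then show "vnorm F (F.lin (cq i) (cq j) (w n) (w m) (w k)) \<le> 1 * vnorm E (E.lin (cq i) (cq j) (\<phi> n) (\<phi> m) (\<phi> k))"
      by (intro LIMSEQ_le_const2[OF lim]) auto
  qed
  from extend_bounded_on_seq[OF complete \<phi> w(1) _ this]
  obtain S where S: "S \<in> bops" "\<And>n. S (\<phi> n) = w n" "opnorm S \<le> 1" by auto
  then have SB: "S \<in> opball" by (simp add: unit_ball_def)
  have "limitin B.mtopology T S sequentially"
    unfolding B.limit_metric_sequentially
  proof (intro conjI allI impI)
    fix e :: real assume e: "e > 0"
    obtain N where N: "\<And>i j. i \<ge> N \<Longrightarrow> j \<ge> N \<Longrightarrow> strong_dist \<phi> (T i) (T j) < e / 2" using cau[of "e / 2"] e by auto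
    have "strong_dist \<phi> (T i) S \<le> e / 2" if i: "i \<ge> N" for i
      unfolding strong_dist_le_iff[OF T SB]
    proof
      fix n
      have "(\<lambda>j. vnorm F (T i (\<phi> n) \<ominus>\<^bsub>F\<^esub> T j (\<phi> n))) \<longlonglongrightarrow> vnorm F (T i (\<phi> n) \<ominus>\<^bsub>F\<^esub> w n)"
        by (intro F.conv_norm F.conv_diff F.conv_const w Tc F.diff_closed)
      then have lim: "(\<lambda>j. gap \<phi> (T i) (T j) n) \<longlonglongrightarrow> gap \<phi> (T i) S n"
        unfolding gap_def S(2) by (intro tendsto_min tendsto_const)
      have "gap \<phi> (T i) (T j) n \<le> e / 2" if "j \<ge> N" for j
        using N[OF i that] gap_le_strong_dist[OF T T, of \<phi> i j n] by simp
      then show "gap \<phi> (T i) S n \<le> e / 2" by (intro LIMSEQ_le_const2[OF lim]) auto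
    qed
    then show "\<exists>N. \<forall>n\<ge>N. T n \<in> opball \<and> strong_dist \<phi> (T n) S < e" using e T by (intro exI[of _ N]) fastforce
  qed (rule SB)
  then show "\<exists>x. limitin B.mtopology T x sequentially" by blast
qed

text \<open>All coordinates from \<open>N\<close> on are capped by \<open>1 / Suc N\<close>, so only
  the first \<open>N\<close> have to be controlled.\<close>

lemma strong_dist_lessI:
  assumes S: "S \<in> opball" and T: "T \<in> opball" and e: "e > 0" and N: "1 / Suc N < e"
    and near: "\<And>n. n < N \<Longrightarrow> vnorm F (S (\<phi> n) \<ominus>\<^bsub>F\<^esub> T (\<phi> n)) \<le> r" and r: "r < e"
  shows "strong_dist \<phi> S T < e"
proof -
  have "strong_dist \<phi> S T \<le> max r (1 / Suc N)"
    unfolding strong_dist_le_iff[OF S T]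
  proof
    fix n
    show "gap \<phi> S T n \<le> max r (1 / Suc N)"
    proof (cases "n < N")
      case True
      then show ?thesis unfolding gap_def using near by (intro min.coboundedI2 max.coboundedI1)
    next
      case False
      then have "1 / real (Suc n) \<le> 1 / Suc N" by (intro divide_left_mono) auto
      then show ?thesis unfolding gap_def by (intro min.coboundedI1 max.coboundedI2)
    qed
  qed
  also have "\<dots> < e" using N r by simp
  finally show ?thesis .
qed

text \<open>Contractions are equicontinuous, so closeness at one nearby member of the dense sequence
  gives closeness at \<open>v\<close>.\<close>

lemma strong_dist_controls:
  assumes T: "T \<in> opball" and v: "v \<in> carrier E" and e: "e > 0"
  shows "\<exists>\<delta>>0. \<forall>S\<in>opball. strong_dist \<phi> T S < \<delta> \<longrightarrow> vnorm F (T v \<ominus>\<^bsub>F\<^esub> S v) < e"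
proof -
  obtain n where n: "vnorm E (v \<ominus>\<^bsub>E\<^esub> \<phi> n) < e / 4" using \<phi> v e unfolding E.dense_seq_def by (meson divide_pos_pos zero_less_numeral)
  \<comment> \<open>Replacing \<open>v\<close> by \<open>\<phi> n\<close> costs less than
    \<open>e / 4\<close> for each of the two operators, leaving \<open>e / 2\<close> for the middle
    term; the bound \<open>1 / Suc n\<close> keeps the gap at \<open>n\<close> below its
    cap.\<close>
  show ?thesis
  proof (intro exI[of _ "min (1 / Suc n) (e / 2)"] conjI ballI impI)
    show "0 < min (1 / real (Suc n)) (e / 2)" using e by simp
    fix S assume S: "S \<in> opball" and d: "strong_dist \<phi> T S < min (1 / Suc n) (e / 2)"
    have c: "R u \<in> carrier F" if "R \<in> opball" "u \<in> carrier E" for R u using that opball_bops by blast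
    have a: "vnorm F (T (\<phi> n) \<ominus>\<^bsub>F\<^esub> S (\<phi> n)) < e / 2"
      using gap_le_strong_dist[OF T S, of \<phi> n] d by (auto simp: gap_def min_def split: if_splits)
    have near: "vnorm F (R v \<ominus>\<^bsub>F\<^esub> R (\<phi> n)) < e / 4" if R: "R \<in> opball" for R
    proof -
      have "R v \<ominus>\<^bsub>F\<^esub> R (\<phi> n) = R (v \<ominus>\<^bsub>E\<^esub> \<phi> n)" using bops_diff[OF opball_bops[OF R] v, of "\<phi> n"] by simp
      moreover have "vnorm F (R (v \<ominus>\<^bsub>E\<^esub> \<phi> n)) \<le> vnorm E (v \<ominus>\<^bsub>E\<^esub> \<phi> n)" using R v unfolding opball_iff by simp
      ultimately show ?thesis using n by simp
    qed
    have "vnorm F (T v \<ominus>\<^bsub>F\<^esub> S v) \<le> vnorm F (T v \<ominus>\<^bsub>F\<^esub> T (\<phi> n)) + vnorm F (T (\<phi> n) \<ominus>\<^bsub>F\<^esub> S v)"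
      using c T S v by (intro F.norm_diff_triangle) auto
    also have "vnorm F (T (\<phi> n) \<ominus>\<^bsub>F\<^esub> S v) \<le> vnorm F (T (\<phi> n) \<ominus>\<^bsub>F\<^esub> S (\<phi> n)) + vnorm F (S (\<phi> n) \<ominus>\<^bsub>F\<^esub> S v)"
      using c T S v by (intro F.norm_diff_triangle) auto
    also have "vnorm F (S (\<phi> n) \<ominus>\<^bsub>F\<^esub> S v) = vnorm F (S v \<ominus>\<^bsub>F\<^esub> S (\<phi> n))"
      using c S v by (intro F.norm_diff_commute) auto
    finally show "vnorm F (T v \<ominus>\<^bsub>F\<^esub> S v) < e" using near[OF T] near[OF S] a by linarith
  qed
qed

lemma topspace_strong [simp]: "topspace (strong_topology_ball E F) = opball"
proof -
  have "opball \<subseteq> (\<Pi>\<^sub>E v\<in>carrier E. carrier F)"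
  proof
    fix T assume "T \<in> opball"
    then have "T \<in> bops" by (rule opball_bops)
    then show "T \<in> (\<Pi>\<^sub>E v\<in>carrier E. carrier F)" unfolding bops_iff by (rule conjunct1)
  qed
  then show ?thesis unfolding strong_topology_ball_def by (simp add: Int_absorb1)
qed

lemma mtopology_strong_dist: "B.mtopology = strong_topology_ball E F"
proof (rule topology_eq_of_continuous_id)
  interpret N: Metric_space "carrier F" F.norm_dist by (rule F.Metric_space_norm)
  show "topspace B.mtopology = topspace (strong_topology_ball E F)" by simp
  show "continuous_map B.mtopology (strong_topology_ball E F) (\<lambda>x. x)"
    unfolding strong_topology_ball_def continuous_map_in_subtopology continuous_map_componentwise
  proof (intro conjI ballI)
    show "(\<lambda>x. x) ` topspace B.mtopology \<subseteq> extensional (carrier E)"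
      using opball_bops bops_extensional by auto
    fix v assume v: "v \<in> carrier E"
    show "continuous_map B.mtopology (norm_topology F) (\<lambda>S. S v)"
      unfolding F.norm_topology_eq N.continuous_map_to_metric
    proof (intro ballI allI impI)
      fix T and e :: real assume T: "T \<in> topspace B.mtopology" and e: "e > 0"
      then have TB: "T \<in> opball" by simp
      obtain \<delta> where \<delta>: "\<delta> > 0" "\<And>S. S \<in> opball \<Longrightarrow> strong_dist \<phi> T S < \<delta> \<Longrightarrow> vnorm F (T v \<ominus>\<^bsub>F\<^esub> S v) < e"
        using strong_dist_controls[OF TB v e] by blast
      show "\<exists>U. openin B.mtopology U \<and> T \<in> U \<and> (\<forall>S\<in>U. S v \<in> N.mball (T v) e)"
      proof (intro exI[of _ "B.mball T \<delta>"] conjI ballI)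
        fix S assume "S \<in> B.mball T \<delta>"
        then have S: "S \<in> opball" "strong_dist \<phi> T S < \<delta>" by auto
        then show "S v \<in> N.mball (T v) e" using \<delta>(2)[OF S] TB v opball_bops by (auto simp: N.in_mball)
      qed (use TB \<delta> in auto)
    qed
  next
    show "(\<lambda>x. x) \<in> topspace B.mtopology \<rightarrow> opball" by simp
  qed
  show "continuous_map (strong_topology_ball E F) B.mtopology (\<lambda>x. x)"
    unfolding B.continuous_map_to_metric
  proof (intro ballI allI impI)
    fix T and e :: real assume "T \<in> topspace (strong_topology_ball E F)" and e: "e > 0"
    then have T: "T \<in> opball" by simp
    obtain N where N: "1 / real (Suc N) < e" using nat_approx_posE[OF e] by auto
    define U where "U = (\<Inter>n\<in>{..<N}. {S \<in> topspace (strong_topology_ball E F). S (\<phi> n) \<in> N.mball (T (\<phi> n)) (e / 2)}) \<inter> topspace (strong_topology_ball E F)"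
    have op: "openin (strong_topology_ball E F) {S \<in> topspace (strong_topology_ball E F). S (\<phi> n) \<in> N.mball (T (\<phi> n)) (e / 2)}" for n
    proof -
      have "continuous_map (strong_topology_ball E F) (norm_topology F) (\<lambda>S. S (\<phi> n))"
        unfolding strong_topology_ball_def by (intro continuous_map_from_subtopology continuous_map_product_projection) simp
      then show ?thesis by (rule openin_continuous_map_preimage) (simp add: F.norm_topology_eq N.openin_mball)
    qed
    have "openin (strong_topology_ball E F) U"
      unfolding U_def by (rule openin_INT[OF _ op]) simp
    moreover have "T \<in> U" using T e opball_bops by (auto simp: U_def N.in_mball)
    moreover have "S \<in> B.mball T e" if "S \<in> U" for S
    proof -
      have S: "S \<in> opball" using that by (simp add: U_def)
      have "vnorm F (T (\<phi> n) \<ominus>\<^bsub>F\<^esub> S (\<phi> n)) \<le> e / 2" if "n < N" for n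
      proof -
        have "S (\<phi> n) \<in> N.mball (T (\<phi> n)) (e / 2)" using \<open>S \<in> U\<close> that unfolding U_def by blast
        moreover have "S (\<phi> n) \<in> carrier F" "T (\<phi> n) \<in> carrier F" using S T opball_bops by auto
        ultimately show ?thesis by (simp add: N.in_mball)
      qed
      then have "strong_dist \<phi> T S < e" using e N by (intro strong_dist_lessI[OF T S, where r="e/2" and N=N]) auto
      then show ?thesis using S T by simp
    qed
    ultimately show "\<exists>U. openin (strong_topology_ball E F) U \<and> T \<in> U \<and> (\<forall>S\<in>U. S \<in> B.mball T e)" by blast
  qed
qed

definition near_set :: "nat list \<Rightarrow> nat \<Rightarrow> ('a \<Rightarrow> 'b) set" where
  "near_set l m = {S \<in> opball. \<forall>n<length l. vnorm F (S (\<phi> n) \<ominus>\<^bsub>F\<^esub> \<psi> (l ! n)) < 1 / Suc m}"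

text \<open>For an operator \<open>T\<close>, indices of vectors near \<open>T (\<phi> n)\<close>
  give a list \<open>l\<close> for which \<open>T\<close> itself lies in
  \<open>near_set l m\<close>; any \<open>S\<close> satisfying the conclusion is within
  \<open>2 / Suc m\<close> of \<open>T\<close> there. The inequality is strict in the premise and
  weak in the conclusion because the solutions will come from closed constraints or from
  limits.\<close>

lemma strong_dense_criterion:
  assumes D: "D \<subseteq> opball" and meets: "\<And>l m. near_set l m \<noteq> {} \<Longrightarrow>
      \<exists>S\<in>D. \<forall>n<length l. vnorm F (S (\<phi> n) \<ominus>\<^bsub>F\<^esub> \<psi> (l ! n)) \<le> 1 / Suc m"
  shows "strong_topology_ball E F closure_of D = opball"
proof -
  have "T \<in> B.mtopology closure_of D" if T: "T \<in> opball" for T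
    unfolding B.metric_closure_of
  proof (simp add: T, intro allI impI)
    fix e :: real assume e: "e > 0"
    obtain N where N: "1 / real (Suc N) < e" using nat_approx_posE[OF e] by auto
    obtain m where m: "1 / real (Suc m) < e / 3" using nat_approx_posE[of "e / 3"] e by auto
    have Tc: "T (\<phi> n) \<in> carrier F" for n using T opball_bops by auto
    have "\<forall>n. \<exists>k. vnorm F (T (\<phi> n) \<ominus>\<^bsub>F\<^esub> \<psi> k) < 1 / Suc m" using \<psi> Tc unfolding F.dense_seq_def by simp
    then obtain k where k: "\<And>n. vnorm F (T (\<phi> n) \<ominus>\<^bsub>F\<^esub> \<psi> (k n)) < 1 / Suc m" by metis
    define l where "l = map k [0..<N]"
    have "T \<in> near_set l m" using T k by (simp add: near_set_def l_def)
    then obtain S where S: "S \<in> D" "\<And>n. n < length l \<Longrightarrow> vnorm F (S (\<phi> n) \<ominus>\<^bsub>F\<^esub> \<psi> (l ! n)) \<le> 1 / Suc m" using meets by blast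
    have SB: "S \<in> opball" using S D by blast
    have Sc: "S (\<phi> n) \<in> carrier F" for n using SB opball_bops by auto
    have "vnorm F (T (\<phi> n) \<ominus>\<^bsub>F\<^esub> S (\<phi> n)) \<le> 2 * (1 / Suc m)" if "n < N" for n
    proof -
      have "vnorm F (T (\<phi> n) \<ominus>\<^bsub>F\<^esub> S (\<phi> n)) \<le> vnorm F (T (\<phi> n) \<ominus>\<^bsub>F\<^esub> \<psi> (k n)) + vnorm F (\<psi> (k n) \<ominus>\<^bsub>F\<^esub> S (\<phi> n))"
        using Tc Sc by (intro F.norm_diff_triangle) auto
      moreover have "vnorm F (\<psi> (k n) \<ominus>\<^bsub>F\<^esub> S (\<phi> n)) \<le> 1 / Suc m"
        using S(2)[of n] that Sc F.norm_diff_commute[of "S (\<phi> n)" "\<psi> (k n)"] by (simp add: l_def)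
      ultimately show ?thesis using k[of n] by simp
    qed
    then have "strong_dist \<phi> T S < e" using e N m
      by (intro strong_dist_lessI[OF T SB e N, where r="2 * (1 / Suc m)"]) auto
    then show "\<exists>S\<in>D. S \<in> opball \<and> strong_dist \<phi> T S < e" using S SB by blast
  qed
  moreover have "B.mtopology closure_of D \<subseteq> opball" using closure_of_subset_topspace[of B.mtopology D] by simp
  ultimately show ?thesis unfolding mtopology_strong_dist by blast
qed

lemma polish_strong_topology_ball: "polish_topology (strong_topology_ball E F)"
  unfolding polish_topology_def
proof
  show "completely_metrizable_space (strong_topology_ball E F)"
    unfolding mtopology_strong_dist[symmetric] using strong_dist_complete by (rule B.completely_metrizable_space_mtopology)
  define s where "s = (\<lambda>(l, m). SOME S. S \<in> near_set l m)"
  define D where "D = s ` {p. near_set (fst p) (snd p) \<noteq> {}}"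
  have s: "s (l, m) \<in> near_set l m" if "near_set l m \<noteq> {}" for l m
    unfolding s_def using that by (simp add: some_in_eq)
  have "countable D" unfolding D_def by simp
  moreover have DB: "D \<subseteq> opball"
  proof
    fix S assume "S \<in> D"
    then obtain p where "near_set (fst p) (snd p) \<noteq> {}" "S = s p" unfolding D_def by blast
    then obtain l m where "near_set l m \<noteq> {}" "S = s (l, m)" by (cases p) simp
    then show "S \<in> opball" using s[of l m] by (simp add: near_set_def)
  qed
  moreover have "strong_topology_ball E F closure_of D = opball"
  proof (rule strong_dense_criterion[OF DB])
    fix l m assume ne: "near_set l m \<noteq> {}"
    then have "s (l, m) \<in> D" by (auto simp: D_def)
    then show "\<exists>S\<in>D. \<forall>n<length l. vnorm F (S (\<phi> n) \<ominus>\<^bsub>F\<^esub> \<psi> (l ! n)) \<le> 1 / Suc m"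
      using s[OF ne] by (intro bexI[of _ "s (l, m)"]) (auto simp: near_set_def less_imp_le)
  qed
  ultimately show "separable_space (strong_topology_ball E F)" unfolding separable_space_def by auto
qed

end

section \<open>Borel structure on the operator field\<close>

text \<open>A countable separating family generates the target, so preimages of its members are all
  that is tested.\<close>

lemma measurable_into_standard_borel:
  fixes C :: "'i::countable \<Rightarrow> 'a set"
  assumes M: "standard_borel M" and C: "\<And>i. C i \<in> sets M"
    and sep: "\<And>x y. x \<in> space M \<Longrightarrow> y \<in> space M \<Longrightarrow> (\<And>i. x \<in> C i \<longleftrightarrow> y \<in> C i) \<Longrightarrow> x = y"
    and f: "f \<in> space N \<rightarrow> space M" "\<And>i. f -` C i \<inter> space N \<in> sets N"
  shows "f \<in> measurable N M"
proof (rule measurable_sigma_sets)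
  show "sets M = sigma_sets (space M) (range (\<lambda>n. C (from_nat n)))"
  proof (rule standard_borel_sets_eq_sigma_sets[OF M C])
    fix x y assume "x \<in> space M" "y \<in> space M" "\<And>n. x \<in> C (from_nat n) \<longleftrightarrow> y \<in> C (from_nat n)"
    then show "x = y" using sep[of x y] from_nat_to_nat by metis
  qed
  show "range (\<lambda>n. C (from_nat n)) \<subseteq> Pow (space M)" using C sets.sets_into_space by blast
qed (use f in auto)

lemma standard_borel_separating:
  assumes "standard_borel M"
  shows "\<exists>C :: nat \<times> nat \<Rightarrow> 'a set. (\<forall>i. C i \<in> sets M) \<and>
    (\<forall>x\<in>space M. \<forall>y\<in>space M. (\<forall>i. x \<in> C i \<longleftrightarrow> y \<in> C i) \<longrightarrow> x = y)"
proof -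
  obtain c d B where "borel_embedding M (borel :: (nat \<Rightarrow> nat) measure) c d B"
    using standard_borel_imp_embedding[OF assms] by blast
  then have c: "c \<in> borel_measurable M" "\<And>x. x \<in> space M \<Longrightarrow> d (c x) = x" unfolding borel_embedding_def by blast+
  define C where "C = (\<lambda>(n, k). {x \<in> space M. c x n = k})"
  have [measurable]: "(\<lambda>x. c x n) \<in> measurable M (count_space UNIV)" for n
    by (rule measurable_compose[OF c(1) measurable_component_nat])
  have "C i \<in> sets M" for i by (cases i) (simp add: C_def)
  moreover have "x = y" if "x \<in> space M" "y \<in> space M" "\<forall>i. x \<in> C i \<longleftrightarrow> y \<in> C i" for x y
  proof -
    have "c x n = c y n" for n using that(3)[rule_format, of "(n, c x n)"] that by (simp add: C_def)
    then have "c x = c y" by (rule ext)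
    then show ?thesis using c(2) that by metis
  qed
  ultimately show ?thesis by blast
qed

lemma complex_normed_space_minus_add:
  assumes "complex_normed_space E" "u \<in> carrier E" "v \<in> carrier E"
  shows "u \<ominus>\<^bsub>E\<^esub> v = u \<oplus>\<^bsub>E\<^esub> (- 1) \<odot>\<^bsub>E\<^esub> v"
proof -
  interpret complex_normed_space E by fact
  show ?thesis using assms by (simp add: scale_minus_one M.minus_eq)
qed

section \<open>Measurable vectors in a Borel field of Banach spaces\<close>

locale banach_field =
  fixes X :: "'x measure" and V :: "'x \<Rightarrow> 'v normed_module" and MV :: "('x \<times> 'v) measure"
    and \<phi> :: "nat \<Rightarrow> 'x \<Rightarrow> 'v"
  assumes field: "borel_field_banach X V MV"
    and sections: "\<And>n. borel_section X MV (\<phi> n)"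
    and dense: "\<And>x. x \<in> space X \<Longrightarrow> norm_topology (V x) closure_of range (\<lambda>n. \<phi> n x) = carrier (V x)"

lemma borel_field_banach_imp_sections: "borel_field_banach X V MV \<Longrightarrow> \<exists>\<phi>. banach_field X V MV \<phi>"
proof -
  assume f: "borel_field_banach X V MV"
  then obtain \<phi> :: "nat \<Rightarrow> 'a \<Rightarrow> 'b" where "\<forall>n. borel_section X MV (\<phi> n)"
    "\<forall>x\<in>space X. norm_topology (V x) closure_of range (\<lambda>n. \<phi> n x) = carrier (V x)"
    unfolding borel_field_banach_def by blast
  with f have "banach_field X V MV \<phi>" by (intro banach_field.intro) auto
  then show ?thesis by blast
qed

context banach_field
begin

lemma standard_base: "standard_borel X" and standard_total: "standard_borel MV"
  and space_MV: "space MV = total_space X V" and fst_measurable: "fst \<in> measurable MV X"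
  and norm_measurable: "fibre_norm V \<in> borel_measurable MV"
  and add_measurable: "fibre_add V \<in> measurable (fibre_product MV MV) MV"
  and smult_measurable: "fibre_smult V \<in> measurable (borel \<Otimes>\<^sub>M MV) MV"
  using field by (auto simp: borel_field_banach_def)

lemma banach: "x \<in> space X \<Longrightarrow> separable_banach (V x)"
  using field by (auto simp: borel_field_banach_def)

lemma normed: "x \<in> space X \<Longrightarrow> complex_normed_space (V x)"
  using banach separable_banach_normed by blast

lemma complete: "x \<in> space X \<Longrightarrow> mcomplete_of (norm_metric (V x))"
  using banach by (simp add: separable_banach_def)

lemma in_space: "p \<in> space MV \<longleftrightarrow> fst p \<in> space X \<and> snd p \<in> carrier (V (fst p))"
  by (cases p) (auto simp: space_MV total_space_def)

lemma section_carrier: "x \<in> space X \<Longrightarrow> \<phi> n x \<in> carrier (V x)"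
  using measurable_space[OF sections[of n, unfolded borel_section_def], of x] by (simp add: in_space)

lemma dense_seq: "x \<in> space X \<Longrightarrow> complex_normed_space.dense_seq (V x) (\<lambda>n. \<phi> n x)"
  using dense[of x] complex_normed_space.closure_norm_topology_iff[OF normed, of x] section_carrier
  by (fastforce simp: complex_normed_space.dense_seq_def[OF normed])

text \<open>Keeping the base point \<open>a y\<close> apart from the vector lets fibrewise sums be
  formed without a side condition: vectors over the same \<open>a\<close> land in the fibre product
  automatically.\<close>

definition meas :: "'n measure \<Rightarrow> ('n \<Rightarrow> 'x) \<Rightarrow> ('n \<Rightarrow> 'v) \<Rightarrow> bool" where
  "meas N a u \<longleftrightarrow> (\<lambda>y. (a y, u y)) \<in> measurable N MV"

lemma meas_carrier: "meas N a u \<Longrightarrow> y \<in> space N \<Longrightarrow> a y \<in> space X \<and> u y \<in> carrier (V (a y))"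
  using measurable_space[of "\<lambda>y. (a y, u y)" N MV y] by (simp add: meas_def in_space)

lemma meas_section: "a \<in> measurable N X \<Longrightarrow> meas N a (\<lambda>y. \<phi> n (a y))"
  unfolding meas_def using measurable_compose[OF _ sections[of n, unfolded borel_section_def]] by blast

lemma meas_norm: "meas N a u \<Longrightarrow> (\<lambda>y. vnorm (V (a y)) (u y)) \<in> borel_measurable N"
  unfolding meas_def using measurable_compose[OF _ norm_measurable, of "\<lambda>y. (a y, u y)" N] by (simp add: fibre_norm_def)

lemma meas_add:
  assumes "meas N a u" "meas N a v" shows "meas N a (\<lambda>y. u y \<oplus>\<^bsub>V (a y)\<^esub> v y)"
proof -
  have "(\<lambda>y. ((a y, u y), (a y, v y))) \<in> measurable N (fibre_product MV MV)"
    unfolding fibre_product_def using assms unfolding meas_def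
    by (intro measurable_restrict_space2 measurable_Pair) auto
  from measurable_compose[OF this add_measurable] show ?thesis by (simp add: meas_def fibre_add_def)
qed

lemma meas_scale:
  assumes "c \<in> borel_measurable N" "meas N a u" shows "meas N a (\<lambda>y. c y \<odot>\<^bsub>V (a y)\<^esub> u y)"
proof -
  have "(\<lambda>y. (c y, (a y, u y))) \<in> measurable N (borel \<Otimes>\<^sub>M MV)"
    using assms unfolding meas_def by (intro measurable_Pair)
  from measurable_compose[OF this smult_measurable] show ?thesis by (simp add: meas_def fibre_smult_def)
qed

lemma meas_cong: "(\<And>y. y \<in> space N \<Longrightarrow> u y = v y) \<Longrightarrow> meas N a u \<longleftrightarrow> meas N a v"
  unfolding meas_def by (intro measurable_cong) simp

lemma meas_diff:
  assumes "meas N a u" "meas N a v" shows "meas N a (\<lambda>y. u y \<ominus>\<^bsub>V (a y)\<^esub> v y)"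
proof -
  have "meas N a (\<lambda>y. u y \<oplus>\<^bsub>V (a y)\<^esub> (- 1) \<odot>\<^bsub>V (a y)\<^esub> v y)"
    by (intro meas_add meas_scale assms) simp
  moreover have "u y \<ominus>\<^bsub>V (a y)\<^esub> v y = u y \<oplus>\<^bsub>V (a y)\<^esub> (- 1) \<odot>\<^bsub>V (a y)\<^esub> v y" if "y \<in> space N" for y
    using meas_carrier[OF assms(1) that] meas_carrier[OF assms(2) that] by (intro complex_normed_space_minus_add normed) auto
  ultimately show ?thesis
    using meas_cong[of N "\<lambda>y. u y \<ominus>\<^bsub>V (a y)\<^esub> v y" "\<lambda>y. u y \<oplus>\<^bsub>V (a y)\<^esub> (- 1) \<odot>\<^bsub>V (a y)\<^esub> v y" a]
    by blast
qed

lemma meas_lin: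
  assumes "meas N a u" "meas N a v" "meas N a w"
  shows "meas N a (\<lambda>y. complex_normed_space.lin (V (a y)) p q (u y) (v y) (w y))"
proof -
  have "meas N a (\<lambda>y. (p \<odot>\<^bsub>V (a y)\<^esub> u y \<oplus>\<^bsub>V (a y)\<^esub> q \<odot>\<^bsub>V (a y)\<^esub> v y) \<ominus>\<^bsub>V (a y)\<^esub> w y)"
    by (intro meas_diff meas_add meas_scale assms) simp_all
  moreover have "complex_normed_space.lin (V (a y)) p q (u y) (v y) (w y) =
      (p \<odot>\<^bsub>V (a y)\<^esub> u y \<oplus>\<^bsub>V (a y)\<^esub> q \<odot>\<^bsub>V (a y)\<^esub> v y) \<ominus>\<^bsub>V (a y)\<^esub> w y" if "y \<in> space N" for y
    using meas_carrier[OF assms(1) that] normed by (intro complex_normed_space.lin_def) auto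
  ultimately show ?thesis
    using meas_cong[of N "\<lambda>y. complex_normed_space.lin (V (a y)) p q (u y) (v y) (w y)"
        "\<lambda>y. (p \<odot>\<^bsub>V (a y)\<^esub> u y \<oplus>\<^bsub>V (a y)\<^esub> q \<odot>\<^bsub>V (a y)\<^esub> v y) \<ominus>\<^bsub>V (a y)\<^esub> w y" a]
    by blast
qed

text \<open>Only countably many functions have to be checked, because a countable separating family of
  Borel sets generates a standard Borel structure.\<close>

theorem measI:
  assumes car: "\<And>y. y \<in> space N \<Longrightarrow> u y \<in> carrier (V (a y))" and a: "a \<in> measurable N X"
    and d: "\<And>n. (\<lambda>y. vnorm (V (a y)) (u y \<ominus>\<^bsub>V (a y)\<^esub> \<phi> n (a y))) \<in> borel_measurable N"
  shows "meas N a u"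
proof -
  obtain B :: "nat \<times> nat \<Rightarrow> 'x set" where B: "\<And>i. B i \<in> sets X"
    "\<And>x y. x \<in> space X \<Longrightarrow> y \<in> space X \<Longrightarrow> (\<And>i. x \<in> B i \<longleftrightarrow> y \<in> B i) \<Longrightarrow> x = y"
    using standard_borel_separating[OF standard_base] by blast
  have id: "meas MV fst snd" unfolding meas_def by simp
  define C :: "(nat \<times> nat) + (nat \<times> nat) \<Rightarrow> ('x \<times> 'v) set" where
    "C = (\<lambda>i. case i of Inl j \<Rightarrow> fst -` B j \<inter> space MV
      | Inr (n, m) \<Rightarrow> {p \<in> space MV. vnorm (V (fst p)) (snd p \<ominus>\<^bsub>V (fst p)\<^esub> \<phi> n (fst p)) < 1 / Suc m})"
  have nm: "(\<lambda>p. vnorm (V (fst p)) (snd p \<ominus>\<^bsub>V (fst p)\<^esub> \<phi> n (fst p))) \<in> borel_measurable MV" for n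
    by (intro meas_norm meas_diff id meas_section fst_measurable)
  have "(\<lambda>y. (a y, u y)) \<in> measurable N MV"
  proof (rule measurable_into_standard_borel[OF standard_total, of C])
    show "C i \<in> sets MV" for i
    proof (cases i)
      case (Inl j) then show ?thesis using measurable_sets[OF fst_measurable B(1)] by (simp add: C_def)
    next
      case (Inr q)
      obtain n m where q: "q = (n, m)" by fastforce
      have [measurable]: "(\<lambda>p. vnorm (V (fst p)) (snd p \<ominus>\<^bsub>V (fst p)\<^esub> \<phi> n (fst p))) \<in> borel_measurable MV" by (rule nm)
      show ?thesis unfolding C_def Inr q by simp
    qed
    show "(\<lambda>y. (a y, u y)) -` C i \<inter> space N \<in> sets N" for i
    proof (cases i)
      case (Inl j)
      have "(\<lambda>y. (a y, u y)) -` C i \<inter> space N = a -` B j \<inter> space N"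
        using car measurable_space[OF a] by (auto simp: C_def Inl in_space)
      then show ?thesis using measurable_sets[OF a B(1)] by simp
    next
      case (Inr q)
      obtain n m where q: "q = (n, m)" by fastforce
      have [measurable]: "(\<lambda>y. vnorm (V (a y)) (u y \<ominus>\<^bsub>V (a y)\<^esub> \<phi> n (a y))) \<in> borel_measurable N" by (rule d)
      have "(\<lambda>y. (a y, u y)) -` C i \<inter> space N = {y \<in> space N. vnorm (V (a y)) (u y \<ominus>\<^bsub>V (a y)\<^esub> \<phi> n (a y)) < 1 / Suc m}"
        using car measurable_space[OF a] by (auto simp: C_def Inr q in_space)
      then show ?thesis by simp
    qed
    show "(\<lambda>y. (a y, u y)) \<in> space N \<rightarrow> space MV" using car measurable_space[OF a] by (auto simp: in_space)
    fix p q assume pq: "p \<in> space MV" "q \<in> space MV" and eq: "\<And>i. p \<in> C i \<longleftrightarrow> q \<in> C i"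
    have "fst p = fst q"
    proof (rule B(2))
      show "fst p \<in> B j \<longleftrightarrow> fst q \<in> B j" for j using eq[of "Inl j"] pq by (simp add: C_def)
    qed (use pq in \<open>auto simp: in_space\<close>)
    moreover define x where "x = fst p"
    ultimately have x: "fst p = x" "fst q = x" "x \<in> space X" "snd p \<in> carrier (V x)" "snd q \<in> carrier (V x)"
      using pq by (auto simp: in_space)
    interpret E: complex_normed_space "V x" using x by (intro normed)
    \<comment> \<open>Distinct vectors are told apart by a ball around some
      \<open>\<phi> n x\<close> of radius below half their distance.\<close>
    have "vnorm (V x) (snd p \<ominus>\<^bsub>V x\<^esub> snd q) = 0"
    proof (rule ccontr)
      assume "\<not> ?thesis"
      then have "0 < vnorm (V x) (snd p \<ominus>\<^bsub>V x\<^esub> snd q) / 2" using E.vnorm_nonneg[of "snd p \<ominus>\<^bsub>V x\<^esub> snd q"] x by simp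
      then obtain m where m: "1 / real (Suc m) < vnorm (V x) (snd p \<ominus>\<^bsub>V x\<^esub> snd q) / 2" by (metis nat_approx_posE)
      have "1 / real (Suc m) > 0" by simp
      then obtain n where n: "vnorm (V x) (snd p \<ominus>\<^bsub>V x\<^esub> \<phi> n x) < 1 / Suc m"
        using dense_seq[OF x(3)] x(4) unfolding E.dense_seq_def by blast
      then have "p \<in> C (Inr (n, m))" using pq x by (simp add: C_def)
      then have "q \<in> C (Inr (n, m))" using eq by blast
      then have "vnorm (V x) (snd q \<ominus>\<^bsub>V x\<^esub> \<phi> n x) < 1 / Suc m" using x by (simp add: C_def)
      then show False using n m E.norm_diff_triangle[of "snd p" "\<phi> n x" "snd q"] E.norm_diff_commute[of "\<phi> n x" "snd q"]
          section_carrier[OF x(3), of n] x by simp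
    qed
    then have "snd p = snd q" using E.norm_diff_eq_zero_iff x by blast
    then show "p = q" using x by (simp add: prod_eq_iff)
  qed
  then show ?thesis by (simp add: meas_def)
qed

end

text \<open>The vectors on which two operators agree form a subspace, which contains the linear span
  of the sequence; continuity extends the agreement to its closure.\<close>

lemma (in normed_pair) bops_eq_total:
  assumes S: "S \<in> bops" and T: "T \<in> bops" and \<phi>: "\<And>n. \<phi> n \<in> carrier E"
    and total: "norm_topology E closure_of linear_span E (range \<phi>) = carrier E" and eq: "\<And>n::nat. S (\<phi> n) = T (\<phi> n)"
  shows "S = T"
proof (rule extensionalityI[of _ "carrier E"])
  have H: "linear_span E (range \<phi>) \<subseteq> {v \<in> carrier E. S v = T v}"
    using S T \<phi> eq by (intro E.linear_span_least) (auto simp: bops_zero bops_add bops_scale)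
  fix v assume v: "v \<in> carrier E"
  have "\<exists>s. s \<in> carrier E \<and> S s = T s \<and> vnorm E (v \<ominus>\<^bsub>E\<^esub> s) < 1 / Suc j" for j
    using total[unfolded E.closure_norm_topology_iff, rule_format, OF v, of "1 / Suc j"] H by auto
  then obtain s where s: "\<And>j. s j \<in> carrier E" "\<And>j. S (s j) = T (s j)" "\<And>j. vnorm E (v \<ominus>\<^bsub>E\<^esub> s j) < 1 / Suc j" by metis
  have "E.conv s v sequentially"
    unfolding E.conv_def
  proof (rule Lim_null_comparison)
    show "\<forall>\<^sub>F j in sequentially. norm (vnorm E (s j \<ominus>\<^bsub>E\<^esub> v)) \<le> inverse (real (Suc j))"
    proof (intro always_eventually allI)
      fix j
      show "norm (vnorm E (s j \<ominus>\<^bsub>E\<^esub> v)) \<le> inverse (real (Suc j))"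
        using s(3)[of j] s(1)[of j] v E.norm_diff_commute[OF v s(1), of j] by (simp add: E.vnorm_nonneg inverse_eq_divide)
    qed
    show "(\<lambda>j. inverse (real (Suc j))) \<longlonglongrightarrow> 0" by (rule LIMSEQ_inverse_real_of_nat)
  qed
  then have "F.conv (\<lambda>j. S (s j)) (S v) sequentially" "F.conv (\<lambda>j. S (s j)) (T v) sequentially"
    using conv_bops[OF S _ s(1) v] conv_bops[OF T _ s(1) v] s(2) by simp_all
  then show "S v = T v" using F.conv_unique S T v s(1) by (metis bops_closed sequentially_bot)
qed (use S T bops_extensional in auto)

section \<open>Existence of the operator structure\<close>

locale field_pair = V: banach_field X V MV \<phi> + W: banach_field X W MW \<psi>
  for X :: "'x measure" and V :: "'x \<Rightarrow> 'v normed_module" and MV \<phi>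
    and W :: "'x \<Rightarrow> 'w normed_module" and MW \<psi>
begin

lemma pair: "x \<in> space X \<Longrightarrow> normed_pair (V x) (W x)"
  using V.normed W.normed by (intro normed_pair.intro)

lemma dense_pair: "x \<in> space X \<Longrightarrow> dense_normed_pair (V x) (W x) (\<lambda>n. \<phi> n x) (\<lambda>n. \<psi> n x)"
  using pair V.dense_seq W.dense_seq W.complete by (intro dense_normed_pair.intro dense_normed_pair_axioms.intro)

abbreviation ops where "ops x \<equiv> carrier (bounded_operators (V x) (W x))"

lemma in_total_operators: "p \<in> total_space X (operator_field V W) \<longleftrightarrow> fst p \<in> space X \<and> snd p \<in> ops (fst p)"
  by (cases p) (auto simp: total_space_def operator_field_def)

lemma ops_carrier: "x \<in> space X \<Longrightarrow> T \<in> ops x \<Longrightarrow> v \<in> carrier (V x) \<Longrightarrow> T v \<in> carrier (W x)"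
  using normed_pair.bops_closed[OF pair] by blast

definition bounded_at :: "'x \<Rightarrow> real \<Rightarrow> (nat \<Rightarrow> 'w) \<Rightarrow> bool" where
  "bounded_at x C w \<longleftrightarrow> normed_pair.bounded_on_seq (V x) (W x) (\<lambda>n. \<phi> n x) C w"

text \<open>The base point is repeated in every entry, since the values are recorded as points of
  the total space of \<open>W\<close>. This makes the target an ordinary product, in which the codes
  form a measurable subset.\<close>

definition operator_code :: "'x \<times> ('v \<Rightarrow> 'w) \<Rightarrow> 'x \<times> (nat \<Rightarrow> 'x \<times> 'w)" where
  "operator_code = (\<lambda>(x, T). (x, \<lambda>n. (x, T (\<phi> n x))))"

abbreviation code_space where "code_space \<equiv> X \<Otimes>\<^sub>M PiM UNIV (\<lambda>_::nat. MW)"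

text \<open>By the extension theorem an element of the product is a code exactly when all base
  points agree and the countable system of inequalities holds with some constant; natural constants
  suffice, so the union over them is countable.\<close>

lemma code_image_sets: "operator_code ` total_space X (operator_field V W) \<in> sets code_space"
proof -
  obtain B :: "nat \<times> nat \<Rightarrow> 'x set" where B: "\<And>i. B i \<in> sets X"
    "\<And>x y. x \<in> space X \<Longrightarrow> y \<in> space X \<Longrightarrow> (\<And>i. x \<in> B i \<longleftrightarrow> y \<in> B i) \<Longrightarrow> x = y"
    using standard_borel_separating[OF V.standard_base] by blast
  have sn: "(\<lambda>y. snd y n) \<in> measurable code_space MW" for n by measurable
  have a: "fst \<in> measurable code_space X" by measurable
  \<comment> \<open>Equality of base points is measurable because it is tested on a countable
    separating family.\<close>
  define A where "A = {y \<in> space code_space. \<forall>n i. fst y \<in> B i \<longleftrightarrow> fst (snd y n) \<in> B i}"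
  have A: "A \<in> sets code_space"
  proof -
    have [measurable]: "(\<lambda>y. fst (snd y n)) \<in> measurable code_space X" for n
      by (rule measurable_compose[OF sn W.fst_measurable])
    have [measurable]: "B i \<in> sets X" for i by (rule B)
    show ?thesis unfolding A_def by measurable
  qed
  have spc: "fst (snd y n) \<in> space X" "snd (snd y n) \<in> carrier (W (fst (snd y n)))" "fst y \<in> space X" if "y \<in> space code_space" for y n
    using measurable_space[OF sn that] measurable_space[OF a that] by (auto simp: W.in_space)
  have A_eq: "A = {y \<in> space code_space. \<forall>n. fst (snd y n) = fst y}"
  proof (intro Set.set_eqI iffI)
    fix y assume "y \<in> A"
    then have y: "y \<in> space code_space" "\<And>n i. fst y \<in> B i \<longleftrightarrow> fst (snd y n) \<in> B i" by (auto simp: A_def)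
    have "fst (snd y n) = fst y" for n using y(2)[of _ n] spc(1)[OF y(1), of n] spc(3)[OF y(1)] by (intro B(2)) auto
    then show "y \<in> {y \<in> space code_space. \<forall>n. fst (snd y n) = fst y}" using y by simp
  qed (auto simp: A_def)
  let ?N = "restrict_space code_space A"
  have spN: "space ?N = A" using sets.sets_into_space[OF A] by (auto simp: space_restrict_space)
  have aN: "fst \<in> measurable ?N X" using a by (rule measurable_restrict_space1)
  have mw: "W.meas ?N fst (\<lambda>y. snd (snd y n))" for n
  proof -
    have "(\<lambda>y. snd y n) \<in> measurable ?N MW" using sn by (rule measurable_restrict_space1)
    moreover have "snd y n = (fst y, snd (snd y n))" if "y \<in> space ?N" for y
      using that spN A_eq by (auto simp: prod_eq_iff)
    ultimately show ?thesis unfolding W.meas_def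
      using measurable_cong[of ?N "\<lambda>y. snd y n" "\<lambda>y. (fst y, snd (snd y n))"] by blast
  qed
  define G where "G = {y \<in> space ?N. \<exists>C::nat. \<forall>i j n m k.
      vnorm (W (fst y)) (complex_normed_space.lin (W (fst y)) (cq i) (cq j) (snd (snd y n)) (snd (snd y m)) (snd (snd y k))) \<le>
      real C * vnorm (V (fst y)) (complex_normed_space.lin (V (fst y)) (cq i) (cq j) (\<phi> n (fst y)) (\<phi> m (fst y)) (\<phi> k (fst y)))}"
  have "G \<in> sets ?N"
  proof -
    have [measurable]: "(\<lambda>y. vnorm (W (fst y)) (complex_normed_space.lin (W (fst y)) (cq i) (cq j) (snd (snd y n)) (snd (snd y m)) (snd (snd y k)))) \<in> borel_measurable ?N" for i j n m k
      by (intro W.meas_norm W.meas_lin mw)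
    have [measurable]: "(\<lambda>y. vnorm (V (fst y)) (complex_normed_space.lin (V (fst y)) (cq i) (cq j) (\<phi> n (fst y)) (\<phi> m (fst y)) (\<phi> k (fst y)))) \<in> borel_measurable ?N" for i j n m k
      by (intro V.meas_norm V.meas_lin V.meas_section aN)
    show ?thesis unfolding G_def by measurable
  qed
  then have "G \<in> sets code_space" using A by (simp add: sets_restrict_space_iff)
  moreover have "operator_code ` total_space X (operator_field V W) = G"
  proof (intro equalityI subsetI)
    fix y assume "y \<in> operator_code ` total_space X (operator_field V W)"
    then obtain x T where x: "x \<in> space X" and T: "T \<in> ops x" and y: "y = (x, \<lambda>n. (x, T (\<phi> n x)))"
      by (auto simp: total_space_def operator_field_def operator_code_def)
    interpret P: dense_normed_pair "V x" "W x" "\<lambda>n. \<phi> n x" "\<lambda>n. \<psi> n x" using dense_pair[OF x] .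
    have "y \<in> A" unfolding A_eq using x T by (auto simp: y space_pair_measure space_PiM W.in_space)
    moreover obtain C :: nat where "P.opnorm T \<le> C" using real_arch_simple by blast
    then have "P.bounded_on_seq (\<lambda>n. \<phi> n x) C (\<lambda>n. T (\<phi> n x))" using T by (intro P.bops_bounded_on_seq) auto
    ultimately show "y \<in> G" unfolding G_def P.bounded_on_seq_def by (auto simp: spN y)
  next
    fix y assume "y \<in> G"
    then obtain C :: nat where yA: "y \<in> A" and C: "\<forall>i j n m k.
      vnorm (W (fst y)) (complex_normed_space.lin (W (fst y)) (cq i) (cq j) (snd (snd y n)) (snd (snd y m)) (snd (snd y k))) \<le>
      real C * vnorm (V (fst y)) (complex_normed_space.lin (V (fst y)) (cq i) (cq j) (\<phi> n (fst y)) (\<phi> m (fst y)) (\<phi> k (fst y)))"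
      unfolding G_def spN by blast
    define x where "x = fst y"
    have y: "y \<in> space code_space" "\<And>n. fst (snd y n) = x" using yA by (auto simp: A_eq x_def)
    have x: "x \<in> space X" using spc(3)[OF y(1)] by (simp add: x_def)
    interpret P: dense_normed_pair "V x" "W x" "\<lambda>n. \<phi> n x" "\<lambda>n. \<psi> n x" using dense_pair[OF x] .
    have w: "snd (snd y n) \<in> carrier (W x)" for n using spc(2)[OF y(1), of n] y(2)[of n] by simp
    have "P.bounded_on_seq (\<lambda>n. \<phi> n x) C (\<lambda>n. snd (snd y n))" using C unfolding x_def[symmetric] P.bounded_on_seq_def by blast
    then obtain T where T: "T \<in> ops x" "\<And>n. T (\<phi> n x) = snd (snd y n)"
      using P.extend_bounded_on_seq[OF P.complete P.\<phi>, of "\<lambda>n. snd (snd y n)" "real C"] w by auto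
    have "y = operator_code (x, T)"
      using T(2) y(2) by (auto simp: operator_code_def prod_eq_iff x_def fun_eq_iff)
    moreover have "(x, T) \<in> total_space X (operator_field V W)" using x T by (simp add: in_total_operators)
    ultimately show "y \<in> operator_code ` total_space X (operator_field V W)" by blast
  qed
  ultimately show ?thesis by simp
qed

lemma operator_code_inj: "inj_on operator_code (total_space X (operator_field V W))"
proof (rule inj_onI)
  fix p q assume pq: "p \<in> total_space X (operator_field V W)" "q \<in> total_space X (operator_field V W)" "operator_code p = operator_code q"
  obtain x S where p: "p = (x, S)" by (cases p)
  obtain x' T where q: "q = (x', T)" by (cases q)
  have x': "x' = x" and eq: "S (\<phi> n x) = T (\<phi> n x)" for n
    using pq(3) by (auto simp: p q operator_code_def fun_eq_iff)
  have x: "x \<in> space X" "S \<in> ops x" "T \<in> ops x" using pq(1,2) by (auto simp: p q x' in_total_operators)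
  have "S = T" using normed_pair.bops_eq_dense[OF pair[OF x(1)] x(2,3) V.dense_seq[OF x(1)]] eq by blast
  then show "p = q" by (simp add: p q x')
qed

lemma operator_code_space: "operator_code \<in> total_space X (operator_field V W) \<rightarrow> space code_space"
  using ops_carrier V.section_carrier
  by (auto simp: operator_code_def total_space_def operator_field_def space_pair_measure space_PiM W.in_space)

text \<open>The code only records values on the dense sections. Evaluation at a variable vector is
  recovered as a limit of evaluations at sections whose index is chosen measurably.\<close>

lemma operator_borel_structure_exists:
  "operator_borel_structure X V MV W MW (vimage_algebra (total_space X (operator_field V W)) operator_code code_space)"
  (is "operator_borel_structure X V MV W MW ?MB")
  unfolding operator_borel_structure_def
proof (intro conjI)
  let ?N = "fibre_product ?MB MV"
  show sp: "space ?MB = total_space X (operator_field V W)" by simp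
  show "standard_borel ?MB"
    by (intro standard_borel_vimage_algebra standard_borel_pair standard_borel_PiM V.standard_base W.standard_total
        operator_code_inj operator_code_space code_image_sets)
  have code: "operator_code \<in> measurable ?MB code_space" by (rule measurable_vimage_algebra1[OF operator_code_space])
  have "(\<lambda>p. fst (operator_code p)) \<in> measurable ?MB X" using code by measurable
  then show fst_B: "fst \<in> measurable ?MB X" by (simp add: operator_code_def case_prod_beta case_prod_beta')
  have ev: "(\<lambda>p. (fst p, snd p (\<phi> n (fst p)))) \<in> measurable ?MB MW" for n
  proof -
    have "(\<lambda>p. snd (operator_code p) n) \<in> measurable ?MB MW" using code by measurable
    then show ?thesis by (simp add: operator_code_def case_prod_beta case_prod_beta')
  qed
  have fsts: "(\<lambda>y. fst y) \<in> measurable ?N ?MB" and snds: "(\<lambda>y. snd y) \<in> measurable ?N MV"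
    unfolding fibre_product_def by (auto intro!: measurable_restrict_space1)
  have spN: "y \<in> space ?N \<Longrightarrow> fst (fst y) \<in> space X \<and> snd (fst y) \<in> ops (fst (fst y)) \<and> snd (snd y) \<in> carrier (V (fst (fst y))) \<and> fst (snd y) = fst (fst y)" for y
    by (auto simp: fibre_product_def space_restrict_space space_pair_measure in_total_operators V.in_space)
  let ?a = "\<lambda>y. fst (fst y)"
  have a: "?a \<in> measurable ?N X" using measurable_compose[OF fsts fst_B] .
  have mv: "V.meas ?N ?a (\<lambda>y. snd (snd y))"
  proof -
    have "(\<lambda>y. (?a y, snd (snd y))) \<in> measurable ?N MV \<longleftrightarrow> (\<lambda>y. snd y) \<in> measurable ?N MV"
      by (rule measurable_cong) (use spN in \<open>auto simp: prod_eq_iff\<close>)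
    then show ?thesis using snds by (simp add: V.meas_def)
  qed
  \<comment> \<open>The first section within \<open>1 / Suc m\<close> of the given vector; a least
    index is a measurable function with countably many values.\<close>
  define nr :: "nat \<Rightarrow> ('x \<times> ('v \<Rightarrow> 'w)) \<times> ('x \<times> 'v) \<Rightarrow> nat" where "nr = (\<lambda>m y. LEAST n. vnorm (V (?a y)) (snd (snd y) \<ominus>\<^bsub>V (?a y)\<^esub> \<phi> n (?a y)) < 1 / Suc m)"
  have nr: "nr m \<in> measurable ?N (count_space UNIV)" for m
  proof -
    have [measurable]: "(\<lambda>y. vnorm (V (?a y)) (snd (snd y) \<ominus>\<^bsub>V (?a y)\<^esub> \<phi> n (?a y))) \<in> borel_measurable ?N" for n
      by (intro V.meas_norm V.meas_diff mv V.meas_section a)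
    show ?thesis unfolding nr_def by measurable
  qed
  have ev': "W.meas ?N ?a (\<lambda>y. snd (fst y) (\<phi> n (?a y)))" for n
    unfolding W.meas_def using measurable_compose[OF fsts ev] .
  have "W.meas ?N ?a (\<lambda>y. snd (fst y) (snd (snd y)))"
  proof (rule W.measI)
    show "snd (fst y) (snd (snd y)) \<in> carrier (W (?a y))" if "y \<in> space ?N" for y using spN[OF that] ops_carrier by blast
    show "?a \<in> measurable ?N X" by (rule a)
    fix k
    let ?f = "\<lambda>m y. vnorm (W (?a y)) (snd (fst y) (\<phi> (nr m y) (?a y)) \<ominus>\<^bsub>W (?a y)\<^esub> \<psi> k (?a y))"
    show "(\<lambda>y. vnorm (W (?a y)) (snd (fst y) (snd (snd y)) \<ominus>\<^bsub>W (?a y)\<^esub> \<psi> k (?a y))) \<in> borel_measurable ?N"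
    proof (rule borel_measurable_LIMSEQ_real)
      show "?f m \<in> borel_measurable ?N" for m
      proof -
        have "(\<lambda>y. vnorm (W (?a y)) (snd (fst y) (\<phi> n (?a y)) \<ominus>\<^bsub>W (?a y)\<^esub> \<psi> k (?a y))) \<in> borel_measurable ?N" for n
          by (intro W.meas_norm W.meas_diff ev' W.meas_section a)
        from measurable_compose_countable[where f="\<lambda>n y. vnorm (W (?a y)) (snd (fst y) (\<phi> n (?a y)) \<ominus>\<^bsub>W (?a y)\<^esub> \<psi> k (?a y))", OF this nr]
        show ?thesis .
      qed
      fix y assume y: "y \<in> space ?N"
      define x where "x = ?a y"
      define T where "T = snd (fst y)"
      define v where "v = snd (snd y)"
      have x: "x \<in> space X" and T: "T \<in> ops x" and v: "v \<in> carrier (V x)" using spN[OF y] by (auto simp: x_def T_def v_def)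
      interpret P: dense_normed_pair "V x" "W x" "\<lambda>n. \<phi> n x" "\<lambda>n. \<psi> n x" using dense_pair[OF x] .
      have near: "vnorm (V x) (v \<ominus>\<^bsub>V x\<^esub> \<phi> (nr m y) x) < 1 / Suc m" for m
      proof -
        have "1 / real (Suc m) > 0" by simp
        then have "\<exists>n. vnorm (V x) (v \<ominus>\<^bsub>V x\<^esub> \<phi> n x) < 1 / Suc m" using P.\<phi> v unfolding P.E.dense_seq_def by blast
        then show ?thesis unfolding nr_def x_def[symmetric] v_def[symmetric] by (rule LeastI_ex)
      qed
      have "P.E.conv (\<lambda>m. \<phi> (nr m y) x) v sequentially"
        unfolding P.E.conv_def
      proof (rule Lim_null_comparison)
        show "\<forall>\<^sub>F m in sequentially. norm (vnorm (V x) (\<phi> (nr m y) x \<ominus>\<^bsub>V x\<^esub> v)) \<le> inverse (real (Suc m))"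
        proof (intro always_eventually allI)
          fix m show "norm (vnorm (V x) (\<phi> (nr m y) x \<ominus>\<^bsub>V x\<^esub> v)) \<le> inverse (real (Suc m))"
            using near[of m] v P.E.norm_diff_commute[of v "\<phi> (nr m y) x"] by (simp add: P.E.vnorm_nonneg inverse_eq_divide)
        qed
        show "(\<lambda>j. inverse (real (Suc j))) \<longlonglongrightarrow> 0" by (rule LIMSEQ_inverse_real_of_nat)
      qed
      then have "P.F.conv (\<lambda>m. T (\<phi> (nr m y) x)) (T v) sequentially" using T v by (intro P.conv_bops) auto
      then have "(\<lambda>m. vnorm (W x) (T (\<phi> (nr m y) x) \<ominus>\<^bsub>W x\<^esub> \<psi> k x)) \<longlonglongrightarrow> vnorm (W x) (T v \<ominus>\<^bsub>W x\<^esub> \<psi> k x)"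
        using T v by (intro P.F.conv_norm P.F.conv_diff P.F.conv_const) auto
      then show "(\<lambda>m. ?f m y) \<longlonglongrightarrow> vnorm (W (?a y)) (snd (fst y) (snd (snd y)) \<ominus>\<^bsub>W (?a y)\<^esub> \<psi> k (?a y))"
        by (simp add: x_def T_def v_def)
    qed
  qed
  then show "(\<lambda>((x, T), (_, v)). (x, T v)) \<in> measurable ?N MW"
    unfolding W.meas_def by (simp add: case_prod_beta case_prod_beta')
qed

lemma dense_imp_total: "total_sequence_of_sections X V MV \<phi>"
  unfolding total_sequence_of_sections_def
proof (intro conjI allI ballI V.sections)
  fix x assume x: "x \<in> space X"
  interpret E: complex_normed_space "V x" using V.normed[OF x] .
  have "range (\<lambda>n. \<phi> n x) \<subseteq> linear_span (V x) (range (\<lambda>n. \<phi> n x))" by (auto simp: linear_span_def)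
  then show "norm_topology (V x) closure_of linear_span (V x) (range (\<lambda>n. \<phi> n x)) = carrier (V x)"
    using V.dense_seq[OF x] unfolding E.closure_norm_topology_iff E.dense_seq_def by blast
qed

end

section \<open>Measurable maps into and on the operator field\<close>

locale operator_field_structure = field_pair +
  fixes MB
  assumes is_structure: "operator_borel_structure X V MV W MW MB"
begin

lemma standard_B: "standard_borel MB" and space_B: "space MB = total_space X (operator_field V W)"
  and fst_B: "fst \<in> measurable MB X" and eval_B: "(\<lambda>((x, T), (_, v)). (x, T v)) \<in> measurable (fibre_product MB MV) MW"
  using is_structure by (auto simp: operator_borel_structure_def)

lemma in_B: "p \<in> space MB \<longleftrightarrow> fst p \<in> space X \<and> snd p \<in> ops (fst p)"
  unfolding space_B by (rule in_total_operators)

lemma meas_eval: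
  assumes T: "(\<lambda>y. (a y, T y)) \<in> measurable N MB" and v: "V.meas N a v"
  shows "W.meas N a (\<lambda>y. T y (v y))"
proof -
  have "(\<lambda>y. ((a y, T y), (a y, v y))) \<in> measurable N (fibre_product MB MV)"
    unfolding fibre_product_def using assms unfolding V.meas_def
    by (intro measurable_restrict_space2 measurable_Pair) auto
  from measurable_compose[OF this eval_B] show ?thesis by (simp add: W.meas_def)
qed

lemma eval_section: 
  assumes "borel_section X MV s"
  shows "(\<lambda>p. (fst p, snd p (s (fst p)))) \<in> measurable MB MW"
proof -
  have "V.meas MB fst (\<lambda>p. s (fst p))"
    using measurable_compose[OF fst_B assms[unfolded borel_section_def]] by (simp add: V.meas_def)
  from meas_eval[OF _ this, of snd] show ?thesis by (simp add: W.meas_def)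
qed

text \<open>The base point together with the values on a total sequence separates the points of the
  operator field. Preimages of a countable family built from these maps therefore decide
  measurability.\<close>

theorem measurable_into_operators:
  assumes total: "total_sequence_of_sections X V MV \<xi>"
    and T: "\<And>y. y \<in> space N \<Longrightarrow> T y \<in> ops (a y)" and a: "a \<in> measurable N X"
    and ev: "\<And>n. W.meas N a (\<lambda>y. T y (\<xi> n (a y)))"
  shows "(\<lambda>y. (a y, T y)) \<in> measurable N MB"
proof -
  have sec: "borel_section X MV (\<xi> n)" for n using total by (simp add: total_sequence_of_sections_def)
  have \<xi>: "\<xi> n x \<in> carrier (V x)" if "x \<in> space X" for n x
    using measurable_space[OF sec[of n, unfolded borel_section_def] that] by (simp add: V.in_space)
  obtain B :: "nat \<times> nat \<Rightarrow> 'a set" where B: "\<And>i. B i \<in> sets X"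
    "\<And>x y. x \<in> space X \<Longrightarrow> y \<in> space X \<Longrightarrow> (\<And>i. x \<in> B i \<longleftrightarrow> y \<in> B i) \<Longrightarrow> x = y"
    using standard_borel_separating[OF V.standard_base] by blast
  obtain D :: "nat \<times> nat \<Rightarrow> ('a \<times> 'c) set" where D: "\<And>i. D i \<in> sets MW"
    "\<And>x y. x \<in> space MW \<Longrightarrow> y \<in> space MW \<Longrightarrow> (\<And>i. x \<in> D i \<longleftrightarrow> y \<in> D i) \<Longrightarrow> x = y"
    using standard_borel_separating[OF W.standard_total] by blast
  define C :: "(nat \<times> nat) + (nat \<times> nat \<times> nat) \<Rightarrow> ('a \<times> ('b \<Rightarrow> 'c)) set" where
    "C = (\<lambda>i. case i of Inl j \<Rightarrow> fst -` B j \<inter> space MB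
      | Inr (n, j) \<Rightarrow> (\<lambda>p. (fst p, snd p (\<xi> n (fst p)))) -` D j \<inter> space MB)"
  show ?thesis
  proof (rule measurable_into_standard_borel[OF standard_B, of C])
    show "C i \<in> sets MB" for i
      using measurable_sets[OF fst_B B(1)] measurable_sets[OF eval_section[OF sec] D(1)]
      by (auto simp: C_def split: sum.splits)
    have sp: "(a y, T y) \<in> space MB" if "y \<in> space N" for y using T[OF that] measurable_space[OF a that] by (simp add: in_B)
    then show "(\<lambda>y. (a y, T y)) \<in> space N \<rightarrow> space MB" by auto
    show "(\<lambda>y. (a y, T y)) -` C i \<inter> space N \<in> sets N" for i
    proof (cases i)
      case (Inl j)
      have "(\<lambda>y. (a y, T y)) -` C i \<inter> space N = a -` B j \<inter> space N" using sp by (auto simp: C_def Inl)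
      then show ?thesis using measurable_sets[OF a B(1)] by simp
    next
      case (Inr q)
      obtain n j where q: "q = (n, j)" by (cases q)
      have "(\<lambda>y. (a y, T y)) -` C i \<inter> space N = (\<lambda>y. (a y, T y (\<xi> n (a y)))) -` D j \<inter> space N"
        using sp by (auto simp: C_def Inr q)
      then show ?thesis using measurable_sets[OF ev[unfolded W.meas_def] D(1)] by simp
    qed
    fix p q assume pq: "p \<in> space MB" "q \<in> space MB" and eq: "\<And>i. p \<in> C i \<longleftrightarrow> q \<in> C i"
    have "fst p = fst q"
    proof (rule B(2))
      show "fst p \<in> B j \<longleftrightarrow> fst q \<in> B j" for j using eq[of "Inl j"] pq by (simp add: C_def)
    qed (use pq in \<open>auto simp: in_B\<close>)
    moreover define x where "x = fst p"
    ultimately have x: "fst p = x" "fst q = x" "x \<in> space X" "snd p \<in> ops x" "snd q \<in> ops x"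
      using pq by (auto simp: in_B)
    interpret P: normed_pair "V x" "W x" using pair[OF x(3)] .
    have "(x, snd p (\<xi> n x)) = (x, snd q (\<xi> n x))" for n
    proof (rule D(2))
      show "(x, snd p (\<xi> n x)) \<in> D j \<longleftrightarrow> (x, snd q (\<xi> n x)) \<in> D j" for j
        using eq[of "Inr (n, j)"] pq x by (simp add: C_def)
    qed (use x \<xi> in \<open>auto simp: W.in_space\<close>)
    then have "snd p = snd q"
      using total x \<xi> by (intro P.bops_eq_total[of "snd p" "snd q" "\<lambda>n. \<xi> n x"]) (auto simp: total_sequence_of_sections_def)
    then show "p = q" using x by (simp add: prod_eq_iff)
  qed
qed

text \<open>The identity from \<open>N\<close> to \<open>MB\<close> is measurable by the previous
  criterion. With the dense sequence in place of a general total one, the same inclusion used in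
  both directions gives uniqueness.\<close>

lemma generated:
  assumes total: "total_sequence_of_sections X V MV \<xi>" and sp: "space N = total_space X (operator_field V W)"
    and f: "fst \<in> measurable N X" and ev: "\<And>n. (\<lambda>(x, T). (x, T (\<xi> n x))) \<in> measurable N MW"
  shows "sets MB \<subseteq> sets N"
proof -
  have "(\<lambda>p. (fst p, snd p)) \<in> measurable N MB"
  proof (rule measurable_into_operators[OF total])
    show "snd p \<in> ops (fst p)" if "p \<in> space N" for p using that sp in_total_operators by blast
    show "W.meas N fst (\<lambda>p. snd p (\<xi> n (fst p)))" for n using ev[of n] by (simp add: W.meas_def case_prod_beta case_prod_beta')
  qed (rule f)
  then have id: "(\<lambda>p. p) \<in> measurable N MB" by simp
  show ?thesis
  proof
    fix A assume A: "A \<in> sets MB"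
    then have "(\<lambda>p. p) -` A \<inter> space N \<in> sets N" using id by (intro measurable_sets)
    moreover have "(\<lambda>p. p) -` A \<inter> space N = A" using sets.sets_into_space[OF A] sp space_B by auto
    ultimately show "A \<in> sets N" by simp
  qed
qed

lemma opnorm_measurable: "fibre_norm (operator_field V W) \<in> borel_measurable MB"
proof (rule borel_measurableI_le)
  fix r :: real
  have p: "normed_pair (V (fst p)) (W (fst p))" if "p \<in> space MB" for p using that pair by (simp add: in_B)
  have fn: "fibre_norm (operator_field V W) p = vnorm (bounded_operators (V (fst p)) (W (fst p))) (snd p)" for p
    by (cases p) (simp add: fibre_norm_def operator_field_def)
  show "{p \<in> space MB. fibre_norm (operator_field V W) p \<le> r} \<in> sets MB"
  proof (cases "0 \<le> r")
    case False
    have "\<not> fibre_norm (operator_field V W) p \<le> r" if "p \<in> space MB" for p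
      using normed_pair.opnorm_nonneg[OF p[OF that], of "snd p"] that False unfolding fn in_B by simp
    then have "{p \<in> space MB. fibre_norm (operator_field V W) p \<le> r} = {}" by blast
    then show ?thesis by (simp only: sets.empty_sets)
  next
    case True
    have "{p \<in> space MB. fibre_norm (operator_field V W) p \<le> r} =
       {p \<in> space MB. \<forall>n. vnorm (W (fst p)) (snd p (\<phi> n (fst p))) \<le> r * vnorm (V (fst p)) (\<phi> n (fst p))}"
      using normed_pair.opnorm_le_dense_iff[OF p _ True V.dense_seq] in_B unfolding fn by blast
    moreover have [measurable]: "(\<lambda>p. vnorm (W (fst p)) (snd p (\<phi> n (fst p)))) \<in> borel_measurable MB" for n
      using eval_section[OF V.sections[of n]] by (intro W.meas_norm) (simp add: W.meas_def)
    moreover have [measurable]: "(\<lambda>p. vnorm (V (fst p)) (\<phi> n (fst p))) \<in> borel_measurable MB" for n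
      by (intro V.meas_norm V.meas_section fst_B)
    ultimately show ?thesis by simp
  qed
qed

lemma operator_add_measurable: "fibre_add (operator_field V W) \<in> measurable (fibre_product MB MB) MB"
proof -
  let ?N = "fibre_product MB MB"
  have 1: "(\<lambda>y. fst y) \<in> measurable ?N MB" and 2: "(\<lambda>y. snd y) \<in> measurable ?N MB"
    unfolding fibre_product_def by (auto intro!: measurable_restrict_space1)
  have sp: "fst (snd y) = fst (fst y) \<and> fst (fst y) \<in> space X \<and> snd (fst y) \<in> ops (fst (fst y)) \<and> snd (snd y) \<in> ops (fst (fst y))" if "y \<in> space ?N" for y
    using that by (auto simp: fibre_product_def space_restrict_space space_pair_measure in_B)
  let ?a = "\<lambda>y. fst (fst y)"
  have a: "?a \<in> measurable ?N X" using measurable_compose[OF 1 fst_B] .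
  have m2: "(\<lambda>y. (?a y, snd (snd y))) \<in> measurable ?N MB"
    using measurable_cong[of ?N "\<lambda>y. (?a y, snd (snd y))" "\<lambda>y. snd y"] 2 sp by (auto simp: prod_eq_iff)
  have m1: "(\<lambda>y. (?a y, snd (fst y))) \<in> measurable ?N MB" using 1 by simp
  have "(\<lambda>y. (?a y, snd (fst y) \<oplus>\<^bsub>operator_field V W (?a y)\<^esub> snd (snd y))) \<in> measurable ?N MB"
  proof (rule measurable_into_operators[OF dense_imp_total _ a])
    fix y assume "y \<in> space ?N"
    then show "snd (fst y) \<oplus>\<^bsub>operator_field V W (?a y)\<^esub> snd (snd y) \<in> ops (?a y)"
      using sp normed_pair.bops_add_closed[OF pair] by (simp add: operator_field_def)
  next
    fix n
    have "W.meas ?N ?a (\<lambda>y. snd (fst y) (\<phi> n (?a y)) \<oplus>\<^bsub>W (?a y)\<^esub> snd (snd y) (\<phi> n (?a y)))"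
      by (intro W.meas_add meas_eval[OF m1] meas_eval[OF m2] V.meas_section a)
    then show "W.meas ?N ?a (\<lambda>y. (snd (fst y) \<oplus>\<^bsub>operator_field V W (?a y)\<^esub> snd (snd y)) (\<phi> n (?a y)))"
      by (rule W.meas_cong[THEN iffD1, rotated])
        (use sp V.section_carrier in \<open>simp add: operator_field_def normed_pair.bops_add_apply[OF pair]\<close>)
  qed
  then show ?thesis by (simp add: fibre_add_def case_prod_beta case_prod_beta')
qed

lemma operator_smult_measurable: "fibre_smult (operator_field V W) \<in> measurable (borel \<Otimes>\<^sub>M MB) MB"
proof -
  let ?N = "borel \<Otimes>\<^sub>M MB :: (complex \<times> _) measure"
  have 2: "(\<lambda>y. snd y) \<in> measurable ?N MB" by measurable
  have sp: "fst (snd y) \<in> space X \<and> snd (snd y) \<in> ops (fst (snd y))" if "y \<in> space ?N" for y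
    using that by (auto simp: space_pair_measure in_B)
  let ?a = "\<lambda>y. fst (snd y)"
  have a: "?a \<in> measurable ?N X" using measurable_compose[OF 2 fst_B] .
  have m2: "(\<lambda>y. (?a y, snd (snd y))) \<in> measurable ?N MB" using 2 by simp
  have "(\<lambda>y. (?a y, fst y \<odot>\<^bsub>operator_field V W (?a y)\<^esub> snd (snd y))) \<in> measurable ?N MB"
  proof (rule measurable_into_operators[OF dense_imp_total _ a])
    fix y assume "y \<in> space ?N"
    then show "fst y \<odot>\<^bsub>operator_field V W (?a y)\<^esub> snd (snd y) \<in> ops (?a y)"
      using sp normed_pair.bops_scale_closed[OF pair] by (simp add: operator_field_def)
  next
    fix n
    have "W.meas ?N ?a (\<lambda>y. fst y \<odot>\<^bsub>W (?a y)\<^esub> snd (snd y) (\<phi> n (?a y)))"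
      by (intro W.meas_scale meas_eval[OF m2] V.meas_section a) simp
    then show "W.meas ?N ?a (\<lambda>y. (fst y \<odot>\<^bsub>operator_field V W (?a y)\<^esub> snd (snd y)) (\<phi> n (?a y)))"
      by (rule W.meas_cong[THEN iffD1, rotated])
        (use sp V.section_carrier in \<open>simp add: operator_field_def normed_pair.bops_scale_apply[OF pair]\<close>)
  qed
  then show ?thesis by (simp add: fibre_smult_def case_prod_beta case_prod_beta')
qed

lemma operator_composition_measurable:
  assumes U: "borel_field_banach X U MU" and WU: "operator_borel_structure X W MW U MU MWU"
    and VU: "operator_borel_structure X V MV U MU MVU"
  shows "operator_composition V \<in> measurable (fibre_product MWU MB) MVU"
proof -
  obtain \<theta> where "banach_field X U MU \<theta>" using borel_field_banach_imp_sections[OF U] by blast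
  then interpret U: banach_field X U MU \<theta> .
  interpret WU: operator_field_structure X W MW \<psi> U MU \<theta> MWU by unfold_locales (rule WU)
  interpret VU: operator_field_structure X V MV \<phi> U MU \<theta> MVU by unfold_locales (rule VU)
  let ?N = "fibre_product MWU MB"
  have 1: "(\<lambda>y. fst y) \<in> measurable ?N MWU" and 2: "(\<lambda>y. snd y) \<in> measurable ?N MB"
    unfolding fibre_product_def by (auto intro!: measurable_restrict_space1)
  have sp: "fst (snd y) = fst (fst y) \<and> fst (fst y) \<in> space X \<and> snd (fst y) \<in> WU.ops (fst (fst y)) \<and> snd (snd y) \<in> ops (fst (fst y))" if "y \<in> space ?N" for y
    using that by (auto simp: fibre_product_def space_restrict_space space_pair_measure in_B WU.in_B)
  let ?a = "\<lambda>y. fst (fst y)"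
  have a: "?a \<in> measurable ?N X" using measurable_compose[OF 1 WU.fst_B] .
  have m2: "(\<lambda>y. (?a y, snd (snd y))) \<in> measurable ?N MB"
    using measurable_cong[of ?N "\<lambda>y. (?a y, snd (snd y))" "\<lambda>y. snd y"] 2 sp by (auto simp: prod_eq_iff)
  have m1: "(\<lambda>y. (?a y, snd (fst y))) \<in> measurable ?N MWU" using 1 by simp
  have "(\<lambda>y. (?a y, compose (carrier (V (?a y))) (snd (fst y)) (snd (snd y)))) \<in> measurable ?N MVU"
  proof (rule VU.measurable_into_operators[OF VU.dense_imp_total _ a])
    fix y assume "y \<in> space ?N"
    then show "compose (carrier (V (?a y))) (snd (fst y)) (snd (snd y)) \<in> VU.ops (?a y)"
      using sp V.normed W.normed U.normed by (intro compose_bops(1)[of _ "W (?a y)"]) auto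
  next
    fix n
    have "U.meas ?N ?a (\<lambda>y. snd (fst y) (snd (snd y) (\<phi> n (?a y))))"
      by (intro WU.meas_eval[OF m1] meas_eval[OF m2] V.meas_section a)
    then show "U.meas ?N ?a (\<lambda>y. compose (carrier (V (?a y))) (snd (fst y)) (snd (snd y)) (\<phi> n (?a y)))"
      by (rule U.meas_cong[THEN iffD1, rotated]) (use sp V.section_carrier in \<open>simp add: compose_def\<close>)
  qed
  then show ?thesis by (simp add: operator_composition_def case_prod_beta case_prod_beta')
qed

end

section \<open>Lexicographically minimal operators\<close>

text \<open>Perturbing all three vectors by at most \<open>1 / Suc j\<close> costs
  \<open>(|p| + |q| + 1) / Suc j\<close>, the tolerance that reappears in the codes of
  operators.\<close>

lemma (in complex_normed_space) norm_lin_le: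
  assumes "a \<in> carrier E" "b \<in> carrier E" "c \<in> carrier E" "a' \<in> carrier E" "b' \<in> carrier E" "c' \<in> carrier E"
  shows "vnorm E (lin p q a b c) \<le> vnorm E (lin p q a' b' c') +
     (cmod p * vnorm E (a \<ominus> a') + cmod q * vnorm E (b \<ominus> b') + vnorm E (c \<ominus> c'))"
proof -
  have eq: "lin p q x y z = (p \<odot> x \<oplus> q \<odot> y) \<oplus> (- 1) \<odot> z" if "x \<in> carrier E" "y \<in> carrier E" "z \<in> carrier E" for x y z
    using that by (simp add: lin_def M.minus_eq scale_minus_one)
  have "vnorm E (lin p q a b c \<ominus> lin p q a' b' c') \<le>
      vnorm E ((p \<odot> a \<oplus> q \<odot> b) \<ominus> (p \<odot> a' \<oplus> q \<odot> b')) + vnorm E ((- 1) \<odot> c \<ominus> (- 1) \<odot> c')"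
    using assms by (simp only: eq) (intro norm_add_diff_add; simp)
  moreover have "vnorm E ((p \<odot> a \<oplus> q \<odot> b) \<ominus> (p \<odot> a' \<oplus> q \<odot> b')) \<le> vnorm E (p \<odot> a \<ominus> p \<odot> a') + vnorm E (q \<odot> b \<ominus> q \<odot> b')"
    using assms by (intro norm_add_diff_add) auto
  moreover have "vnorm E (p \<odot> a \<ominus> p \<odot> a') \<le> cmod p * vnorm E (a \<ominus> a')" "vnorm E (q \<odot> b \<ominus> q \<odot> b') \<le> cmod q * vnorm E (b \<ominus> b')"
     "vnorm E ((- 1) \<odot> c \<ominus> (- 1) \<odot> c') \<le> vnorm E (c \<ominus> c')"
    using assms norm_scale_diff_scale[of a a' p p] norm_scale_diff_scale[of b b' q q] norm_scale_diff_scale[of c c' "-1" "-1"] by simp_all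
  moreover have "vnorm E (lin p q a b c) \<le> vnorm E (lin p q a b c \<ominus> lin p q a' b' c') + vnorm E (lin p q a' b' c')"
    using assms by (intro norm_le_diff) auto
  ultimately show ?thesis by linarith
qed

lemma (in normed_pair) zero_operator: "restrict (\<lambda>_. \<zero>\<^bsub>F\<^esub>) (carrier E) \<in> opball"
proof -
  have "restrict (\<lambda>_. \<zero>\<^bsub>F\<^esub>) (carrier E) \<in> bops" by (rule bopsI[where C=0]) auto
  then show ?thesis unfolding opball_iff by (simp add: E.vnorm_nonneg)
qed

lemma cq_zero: "\<exists>i. cq i = 0"
  by (rule exI[of _ "to_nat (0 :: rat, 0 :: rat)"]) (simp add: cq_def Complex_eq_0)

text \<open>\<open>K\<close> is the range allowed for the values on \<open>\<phi>\<close>. Each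
  \<open>L i\<close> is a finite block of pairs \<open>(n, k)\<close>, bounding the distances of
  \<open>S (\<phi> n)\<close> from \<open>\<psi> k\<close> by one common radius \<open>r i\<close>;
  minimising the radii one after another is the lexicographic problem.\<close>

locale compact_range = dense_normed_pair E F \<phi> \<psi>
  for E :: "'v normed_module" and F :: "'w normed_module" and \<phi> \<psi> +
  fixes K :: "'w set" and \<xi> :: "nat \<Rightarrow> 'w" and L :: "nat \<Rightarrow> (nat \<times> nat) list"
  assumes weakly_compact: "F.weakly_compact_subspace K" and zero_in: "\<zero>\<^bsub>F\<^esub> \<in> K"
    and \<xi>_in: "\<And>j. \<xi> j \<in> K" and \<xi>_dense: "\<And>v e. v \<in> K \<Longrightarrow> e > 0 \<Longrightarrow> \<exists>j. vnorm F (v \<ominus>\<^bsub>F\<^esub> \<xi> j) < e"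
begin

lemma K_carrier: "v \<in> K \<Longrightarrow> v \<in> carrier F"
  using weakly_compact by (auto simp: F.weakly_compact_subspace_def)

lemma \<xi>_closed [simp]: "\<xi> j \<in> carrier F"
  using \<xi>_in K_carrier by blast

definition feasible :: "nat set \<Rightarrow> (nat \<Rightarrow> real) \<Rightarrow> ('v \<Rightarrow> 'w) set" where
  "feasible J r = {S \<in> opball. (\<forall>n. S (\<phi> n) \<in> K) \<and>
     (\<forall>i\<in>J. \<forall>(n, k)\<in>set (L i). vnorm F (S (\<phi> n) \<ominus>\<^bsub>F\<^esub> \<psi> k) \<le> r i)}"

text \<open>The finite shadow of feasibility at stage \<open>q\<close>: only indices below
  \<open>q\<close>, values from the countable set \<open>\<xi>\<close>, and slack
  \<open>\<delta>\<close>. The witness is a finite list, so existence is a countable union.\<close>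

definition approx :: "nat set \<Rightarrow> (nat \<Rightarrow> real) \<Rightarrow> nat \<Rightarrow> real \<Rightarrow> nat list \<Rightarrow> bool" where
  "approx J r q \<delta> u \<longleftrightarrow>
     (\<forall>i<q. \<forall>j<q. \<forall>n<q. \<forall>m<q. \<forall>k<q. vnorm F (F.lin (cq i) (cq j) (\<xi> (u ! n)) (\<xi> (u ! m)) (\<xi> (u ! k)))
        \<le> vnorm E (E.lin (cq i) (cq j) (\<phi> n) (\<phi> m) (\<phi> k)) + \<delta>) \<and>
     (\<forall>i<q. i \<in> J \<longrightarrow> (\<forall>(n, k)\<in>set (L i). n < q \<longrightarrow> vnorm F (\<xi> (u ! n) \<ominus>\<^bsub>F\<^esub> \<psi> k) \<le> r i + \<delta>))"

lemma feasibleD: "S \<in> feasible J r \<Longrightarrow> i \<in> J \<Longrightarrow> (n, k) \<in> set (L i) \<Longrightarrow> vnorm F (S (\<phi> n) \<ominus>\<^bsub>F\<^esub> \<psi> k) \<le> r i"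
  unfolding feasible_def by auto

lemma \<xi>_conv:
  assumes v: "v \<in> K" shows "\<exists>s :: nat \<Rightarrow> nat. F.conv (\<lambda>t. \<xi> (s t)) v sequentially"
proof -
  have "\<exists>j. vnorm F (v \<ominus>\<^bsub>F\<^esub> \<xi> j) < 1 / Suc t" for t using \<xi>_dense[OF v, of "1 / Suc t"] by simp
  then obtain s where s: "\<And>t. vnorm F (v \<ominus>\<^bsub>F\<^esub> \<xi> (s t)) < 1 / Suc t" by metis
  have "F.conv (\<lambda>t. \<xi> (s t)) v sequentially"
    unfolding F.conv_def
  proof (rule Lim_null_comparison)
    show "\<forall>\<^sub>F t in sequentially. norm (vnorm F (\<xi> (s t) \<ominus>\<^bsub>F\<^esub> v)) \<le> inverse (real (Suc t))"
    proof (intro always_eventually allI)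
      fix t show "norm (vnorm F (\<xi> (s t) \<ominus>\<^bsub>F\<^esub> v)) \<le> inverse (real (Suc t))"
        using s[of t] K_carrier[OF v] F.norm_diff_commute[of v "\<xi> (s t)"] by (simp add: F.vnorm_nonneg inverse_eq_divide)
    qed
    show "(\<lambda>t. inverse (real (Suc t))) \<longlonglongrightarrow> 0" by (rule LIMSEQ_inverse_real_of_nat)
  qed
  then show ?thesis by blast
qed

text \<open>Values of \<open>S\<close> are replaced by nearby members of \<open>\<xi>\<close>. The
  radii need to hold only up to the strict slack \<open>\<delta>\<close>, so nearly optimal
  operators can be used when an infimum is shown to be attained.\<close>

lemma feasible_approx:
  assumes S: "S \<in> opball" and SK: "\<And>n. S (\<phi> n) \<in> K" and \<delta>: "\<delta> > 0"
    and r: "\<And>i n k. i < q \<Longrightarrow> i \<in> J \<Longrightarrow> (n, k) \<in> set (L i) \<Longrightarrow> vnorm F (S (\<phi> n) \<ominus>\<^bsub>F\<^esub> \<psi> k) < r i + \<delta>"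
  shows "\<exists>u. length u = q \<and> approx J r q \<delta> u"
proof -
  have Sb: "S \<in> bops" using S by (rule opball_bops)
  have "\<exists>s :: nat \<Rightarrow> nat. F.conv (\<lambda>t. \<xi> (s t)) (S (\<phi> n)) sequentially" for n using \<xi>_conv[OF SK] .
  then obtain s where s: "\<And>n. F.conv (\<lambda>t. \<xi> (s n t)) (S (\<phi> n)) sequentially" by metis
  have Sc: "S (\<phi> n) \<in> carrier F" for n by (rule bops_closed[OF Sb]) simp
  have 1: "\<forall>\<^sub>F t in sequentially. vnorm F (F.lin (cq i) (cq j) (\<xi> (s n t)) (\<xi> (s m t)) (\<xi> (s k t)))
        \<le> vnorm E (E.lin (cq i) (cq j) (\<phi> n) (\<phi> m) (\<phi> k)) + \<delta>" for i j n m k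
  proof -
    have lim: "(\<lambda>t. vnorm F (F.lin (cq i) (cq j) (\<xi> (s n t)) (\<xi> (s m t)) (\<xi> (s k t)))) \<longlonglongrightarrow> vnorm F (F.lin (cq i) (cq j) (S (\<phi> n)) (S (\<phi> m)) (S (\<phi> k)))"
      by (intro F.conv_norm F.conv_lin s tendsto_const Sc \<xi>_closed F.lin_closed)
    have "vnorm F (F.lin (cq i) (cq j) (S (\<phi> n)) (S (\<phi> m)) (S (\<phi> k))) \<le> 1 * vnorm E (E.lin (cq i) (cq j) (\<phi> n) (\<phi> m) (\<phi> k))"
      using bops_bounded_on_seq[of S 1 \<phi>] S Sb unfolding bounded_on_seq_def by (auto simp: unit_ball_def)
    then have "vnorm F (F.lin (cq i) (cq j) (S (\<phi> n)) (S (\<phi> m)) (S (\<phi> k))) < vnorm E (E.lin (cq i) (cq j) (\<phi> n) (\<phi> m) (\<phi> k)) + \<delta>"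
      using \<delta> by simp
    from order_tendstoD(2)[OF lim this] show ?thesis by eventually_elim simp
  qed
  have 2: "\<forall>\<^sub>F t in sequentially. vnorm F (\<xi> (s n t) \<ominus>\<^bsub>F\<^esub> \<psi> k) \<le> r i + \<delta>" if "i < q" "i \<in> J" "(n, k) \<in> set (L i)" for i n k
  proof -
    have lim: "(\<lambda>t. vnorm F (\<xi> (s n t) \<ominus>\<^bsub>F\<^esub> \<psi> k)) \<longlonglongrightarrow> vnorm F (S (\<phi> n) \<ominus>\<^bsub>F\<^esub> \<psi> k)"
      by (intro F.conv_norm F.conv_diff F.conv_const s Sc \<xi>_closed \<psi>_closed F.diff_closed)
    from order_tendstoD(2)[OF lim r[OF that]] show ?thesis by eventually_elim simp
  qed
  have "\<forall>\<^sub>F t in sequentially. \<forall>i\<in>{..<q}. \<forall>j\<in>{..<q}. \<forall>n\<in>{..<q}. \<forall>m\<in>{..<q}. \<forall>k\<in>{..<q}.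
      vnorm F (F.lin (cq i) (cq j) (\<xi> (s n t)) (\<xi> (s m t)) (\<xi> (s k t))) \<le> vnorm E (E.lin (cq i) (cq j) (\<phi> n) (\<phi> m) (\<phi> k)) + \<delta>"
    using 1 by (intro eventually_ball_finite ballI) auto
  moreover have "\<forall>\<^sub>F t in sequentially. \<forall>i\<in>{i. i < q \<and> i \<in> J}. \<forall>p\<in>set (L i). vnorm F (\<xi> (s (fst p) t) \<ominus>\<^bsub>F\<^esub> \<psi> (snd p)) \<le> r i + \<delta>"
    using 2 by (intro eventually_ball_finite ballI) auto
  ultimately have "\<forall>\<^sub>F t in sequentially. approx J r q \<delta> (map (\<lambda>n. s n t) [0..<q])"
    by eventually_elim (auto simp: approx_def case_prod_beta)
  then obtain t where "approx J r q \<delta> (map (\<lambda>n. s n t) [0..<q])" using eventually_happens'[OF sequentially_bot] by blast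
  then show ?thesis by (intro exI[of _ "map (\<lambda>n. s n t) [0..<q]"]) simp
qed

text \<open>Finite approximate solutions have a weak cluster point, and norms are weakly lower
  semicontinuous, so approximate solvability is the same as solvability. It is expressed by
  countably many inequalities, hence is a Borel condition in a field.\<close>

lemma approx_feasible:
  assumes "\<And>q. \<exists>u. length u = q \<and> approx J r q (1 / Suc q) u"
  shows "feasible J r \<noteq> {}"
proof -
  obtain u where u: "\<And>q. approx J r q (1 / Suc q) (u q)" using assms by metis
  \<comment> \<open>With both coefficients zero the inequality for \<open>lin\<close> becomes a norm
    bound, available once \<open>i0\<close> is below \<open>q\<close>; this keeps the sequences
    bounded.\<close>
  obtain i0 where i0: "cq i0 = 0" using cq_zero by blast
  \<comment> \<open>The default zero lies in \<open>K\<close> and is taken for finitely many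
    \<open>q\<close> only, which \<open>ultra\<close> ignores.\<close>
  define w where "w = (\<lambda>n q. if max i0 n < q then \<xi> (u q ! n) else \<zero>\<^bsub>F\<^esub>)"
  have wK: "w n q \<in> K" for n q using \<xi>_in zero_in by (simp add: w_def)
  have wc: "w n q \<in> carrier F" for n q using wK K_carrier by blast
  have bd: "vnorm F (w n q) \<le> vnorm E (\<phi> n) + 1" for n q
  proof (cases "max i0 n < q")
    case True
    have "vnorm F (F.lin (cq i0) (cq i0) (\<xi> (u q ! n)) (\<xi> (u q ! n)) (\<xi> (u q ! n))) \<le>
       vnorm E (E.lin (cq i0) (cq i0) (\<phi> n) (\<phi> n) (\<phi> n)) + 1 / Suc q"
      using u[of q] True unfolding approx_def by auto
    then have "vnorm F (\<xi> (u q ! n)) \<le> vnorm E (\<phi> n) + 1 / Suc q"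
      by (simp add: i0 F.lin_def E.lin_def F.M.minus_eq E.M.minus_eq)
    moreover have "1 / real (Suc q) \<le> 1" by simp
    ultimately have "vnorm F (\<xi> (u q ! n)) \<le> vnorm E (\<phi> n) + 1" by linarith
    then show ?thesis unfolding w_def using True by simp
  next
    case False
    then have "w n q = \<zero>\<^bsub>F\<^esub>" unfolding w_def by (rule if_not_P)
    then show ?thesis using E.vnorm_nonneg[of "\<phi> n"] by simp
  qed
  have "\<exists>z\<in>K. F.weak_conv (w n) z" for n
    using weakly_compact wK bd unfolding F.weakly_compact_subspace_def by blast
  then obtain z where z: "\<And>n. z n \<in> K" "\<And>n. F.weak_conv (w n) (z n)" by metis
  have zc: "z n \<in> carrier F" for n using z K_carrier by blast
  have inv: "((\<lambda>q. 1 / real (Suc q)) \<longlongrightarrow> 0) ultra"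
    by (rule tendsto_mono[OF ultra(2)]) (use LIMSEQ_inverse_real_of_nat in \<open>simp add: inverse_eq_divide\<close>)
  have large: "eventually (\<lambda>q. N < q) ultra" for N
    using ultra(2) eventually_gt_at_top[of N] filter_leD by blast
  have "bounded_on_seq \<phi> 1 z"
    unfolding bounded_on_seq_def
  proof (intro allI)
    fix i j n m k
    have "vnorm F (F.lin (cq i) (cq j) (z n) (z m) (z k)) \<le> vnorm E (E.lin (cq i) (cq j) (\<phi> n) (\<phi> m) (\<phi> k)) + 0"
    proof (rule F.weak_conv_norm_le)
      show "F.weak_conv (\<lambda>q. F.lin (cq i) (cq j) (w n q) (w m q) (w k q)) (F.lin (cq i) (cq j) (z n) (z m) (z k))"
        by (intro F.weak_conv_lin z wc zc)
      show "((\<lambda>q. vnorm E (E.lin (cq i) (cq j) (\<phi> n) (\<phi> m) (\<phi> k)) + 1 / Suc q) \<longlongrightarrow> vnorm E (E.lin (cq i) (cq j) (\<phi> n) (\<phi> m) (\<phi> k)) + 0) ultra"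
        by (intro tendsto_intros inv)
      show "\<forall>\<^sub>F q in ultra. vnorm F (F.lin (cq i) (cq j) (w n q) (w m q) (w k q)) \<le> vnorm E (E.lin (cq i) (cq j) (\<phi> n) (\<phi> m) (\<phi> k)) + 1 / Suc q"
        using large[of "i0 + i + j + n + m + k"]
      proof eventually_elim
        case (elim q)
        then show ?case using u[of q] unfolding approx_def by (simp add: w_def)
      qed
    qed (use zc wc in auto)
    then show "vnorm F (F.lin (cq i) (cq j) (z n) (z m) (z k)) \<le> 1 * vnorm E (E.lin (cq i) (cq j) (\<phi> n) (\<phi> m) (\<phi> k))" by simp
  qed
  from extend_bounded_on_seq[OF complete \<phi> zc _ this]
  obtain S where S: "S \<in> bops" "\<And>n. S (\<phi> n) = z n" "opnorm S \<le> 1" by auto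
  have "vnorm F (z n \<ominus>\<^bsub>F\<^esub> \<psi> k) \<le> r i" if i: "i \<in> J" "(n, k) \<in> set (L i)" for i n k
  proof -
    \<comment> \<open>A distance is a special \<open>lin\<close> whose third argument is constant,
      so the rule for weak limits of \<open>lin\<close> covers it.\<close>
    have lin1: "F.lin 1 0 a a (\<psi> k) = a \<ominus>\<^bsub>F\<^esub> \<psi> k" if "a \<in> carrier F" for a using that by (simp add: F.lin_def)
    have "vnorm F (z n \<ominus>\<^bsub>F\<^esub> \<psi> k) \<le> r i + 0"
    proof (rule F.weak_conv_norm_le)
      have "F.weak_conv (\<lambda>q. \<psi> k) (\<psi> k)" by (simp add: F.weak_conv_def)
      then have "F.weak_conv (\<lambda>q. F.lin 1 0 (w n q) (w n q) (\<psi> k)) (F.lin 1 0 (z n) (z n) (\<psi> k))"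
        by (intro F.weak_conv_lin z wc zc \<psi>_closed)
      then show "F.weak_conv (\<lambda>q. w n q \<ominus>\<^bsub>F\<^esub> \<psi> k) (z n \<ominus>\<^bsub>F\<^esub> \<psi> k)" using lin1 wc zc by simp
      show "((\<lambda>q. r i + 1 / Suc q) \<longlongrightarrow> r i + 0) ultra" by (intro tendsto_intros inv)
      show "\<forall>\<^sub>F q in ultra. vnorm F (w n q \<ominus>\<^bsub>F\<^esub> \<psi> k) \<le> r i + 1 / Suc q"
        using large[of "i0 + i + n"]
      proof eventually_elim
        case (elim q)
        have "i < q" "n < q" "max i0 n < q" using elim by auto
        then show ?case using u[of q] i unfolding approx_def by (auto simp: w_def)
      qed
    qed (use zc wc in auto)
    then show ?thesis by simp
  qed
  then have "S \<in> feasible J r" using S z(1) by (auto simp: feasible_def unit_ball_def)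
  then show ?thesis by blast
qed

lemma feasible_iff_approx:
  "feasible J r \<noteq> {} \<longleftrightarrow> (\<forall>q. \<exists>u. length u = q \<and> approx J r q (1 / Suc q) u)"
proof
  assume "feasible J r \<noteq> {}"
  then obtain S where S: "S \<in> opball" "\<And>n. S (\<phi> n) \<in> K" "\<And>i n k. i \<in> J \<Longrightarrow> (n, k) \<in> set (L i) \<Longrightarrow> vnorm F (S (\<phi> n) \<ominus>\<^bsub>F\<^esub> \<psi> k) \<le> r i"
    by (fastforce simp: feasible_def)
  show "\<forall>q. \<exists>u. length u = q \<and> approx J r q (1 / Suc q) u"
  proof
    fix q
    show "\<exists>u. length u = q \<and> approx J r q (1 / Suc q) u"
    proof (rule feasible_approx[OF S(1,2)])
      fix i n k assume "i \<in> J" "(n, k) \<in> set (L i)"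
      then have "vnorm F (S (\<phi> n) \<ominus>\<^bsub>F\<^esub> \<psi> k) \<le> r i" by (rule S(3))
      also have "\<dots> < r i + 1 / Suc q" by simp
      finally show "vnorm F (S (\<phi> n) \<ominus>\<^bsub>F\<^esub> \<psi> k) < r i + 1 / Suc q" .
    qed simp
  qed
qed (use approx_feasible in blast)

lemma feasible_mono: "(\<And>i. i \<in> J \<Longrightarrow> r i \<le> r' i) \<Longrightarrow> feasible J r \<subseteq> feasible J r'"
  unfolding feasible_def by fastforce

lemma feasible_cong: "(\<And>i. i \<in> J \<Longrightarrow> r i = r' i) \<Longrightarrow> feasible J r = feasible J r'"
  unfolding feasible_def by auto

text \<open>At stage \<open>i\<close> the radii below \<open>i\<close> are frozen at their
  successive minima; the entries from \<open>i\<close> on are still the placeholder 0.\<close>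

primrec lexmin :: "nat \<Rightarrow> nat \<Rightarrow> real" where
  "lexmin 0 = (\<lambda>_. 0)"
| "lexmin (Suc i) = (lexmin i)(i := Inf {c. 0 \<le> c \<and> feasible {..i} ((lexmin i)(i := c)) \<noteq> {}})"

definition least_value :: "nat \<Rightarrow> real" where
  "least_value i = lexmin (Suc i) i"

lemma lexmin_eq: "i < j \<Longrightarrow> lexmin j i = least_value i"
proof (induction j)
  case (Suc j)
  then show ?case by (cases "i = j") (auto simp: least_value_def)
qed simp

text \<open>The three claims depend on each other: the infimum for block \<open>i\<close> is taken
  over a nonempty set only if the earlier minima are attained, and its own attainment lets the
  induction continue.\<close>

lemma feasible_lexmin: "feasible {..<i} (lexmin i) \<noteq> {}"
  and least_value_le_iff: "0 \<le> c \<Longrightarrow> least_value i \<le> c \<longleftrightarrow> feasible {..i} ((lexmin i)(i := c)) \<noteq> {}"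
  and least_value_nonneg: "0 \<le> least_value i"
proof -
  have step: "(\<forall>c\<ge>0. least_value i \<le> c \<longleftrightarrow> feasible {..i} ((lexmin i)(i := c)) \<noteq> {}) \<and> 0 \<le> least_value i"
    if ne: "feasible {..<i} (lexmin i) \<noteq> {}" for i
  proof -
    let ?C = "{c. 0 \<le> c \<and> feasible {..i} ((lexmin i)(i := c)) \<noteq> {}}"
    obtain S where S: "S \<in> feasible {..<i} (lexmin i)" using ne by blast
    \<comment> \<open>A solution for the earlier blocks also satisfies block \<open>i\<close> with
      this radius, as a sum of nonnegative numbers bounds each of them.\<close>
    define c0 where "c0 = (\<Sum>p\<leftarrow>L i. vnorm F (S (\<phi> (fst p)) \<ominus>\<^bsub>F\<^esub> \<psi> (snd p)))"
    have Sc: "S (\<phi> n) \<in> carrier F" for n using S opball_bops by (auto simp: feasible_def)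
    have nn: "0 \<le> vnorm F (S (\<phi> n) \<ominus>\<^bsub>F\<^esub> \<psi> k)" for n k using Sc by (intro F.vnorm_nonneg) auto
    have c0: "0 \<le> c0" unfolding c0_def using nn by (intro sum_list_nonneg) auto
    have "vnorm F (S (\<phi> n) \<ominus>\<^bsub>F\<^esub> \<psi> k) \<le> c0" if "(n, k) \<in> set (L i)" for n k
      unfolding c0_def using that nn
      by (intro member_le_sum_list) (auto simp: image_iff intro!: bexI[of _ "(n, k)"])
    then have "S \<in> feasible {..i} ((lexmin i)(i := c0))" using S by (auto simp: feasible_def)
    then have neC: "c0 \<in> ?C" using c0 by blast
    have bdd: "bdd_below ?C" by (rule bdd_belowI[of _ 0]) auto
    have lv: "least_value i = Inf ?C" by (simp add: least_value_def)
    have lv0: "0 \<le> least_value i" unfolding lv using neC by (intro cInf_greatest) auto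
    \<comment> \<open>An operator with radius within \<open>1 / Suc q\<close> of the infimum
      supplies the approximate solution of stage \<open>q\<close>; weak compactness then yields an
      exact one.\<close>
    have att: "feasible {..i} ((lexmin i)(i := least_value i)) \<noteq> {}"
    proof (rule approx_feasible)
      fix q
      have "Inf ?C < least_value i + 1 / Suc q" unfolding lv by simp
      from cInf_lessD[OF _ this] neC obtain c where c: "c \<in> ?C" "c < least_value i + 1 / Suc q" by blast
      then obtain T where T: "T \<in> feasible {..i} ((lexmin i)(i := c))" by blast
      then have TB: "T \<in> opball" and TK: "\<And>n. T (\<phi> n) \<in> K" by (auto simp: feasible_def)
      show "\<exists>u. length u = q \<and> approx {..i} ((lexmin i)(i := least_value i)) q (1 / Suc q) u"
      proof (rule feasible_approx[OF TB TK])
        fix j n k assume j: "j \<in> {..i}" "(n, k) \<in> set (L j)"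
        have "vnorm F (T (\<phi> n) \<ominus>\<^bsub>F\<^esub> \<psi> k) \<le> ((lexmin i)(i := c)) j" using T j by (rule feasibleD)
        also have "\<dots> < ((lexmin i)(i := least_value i)) j + 1 / Suc q" using c(2) by auto
        finally show "vnorm F (T (\<phi> n) \<ominus>\<^bsub>F\<^esub> \<psi> k) < ((lexmin i)(i := least_value i)) j + 1 / Suc q" .
      qed simp
    qed
    have "least_value i \<le> c \<longleftrightarrow> feasible {..i} ((lexmin i)(i := c)) \<noteq> {}" if "0 \<le> c" for c
    proof
      assume "least_value i \<le> c"
      then have "feasible {..i} ((lexmin i)(i := least_value i)) \<subseteq> feasible {..i} ((lexmin i)(i := c))"
        by (intro feasible_mono) auto
      then show "feasible {..i} ((lexmin i)(i := c)) \<noteq> {}" using att by blast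
    next
      assume "feasible {..i} ((lexmin i)(i := c)) \<noteq> {}"
      then have "c \<in> ?C" using that by blast
      then show "least_value i \<le> c" unfolding lv using bdd by (rule cInf_lower)
    qed
    then show ?thesis using lv0 by blast
  qed
  show ne: "feasible {..<i} (lexmin i) \<noteq> {}" for i
  proof (induction i)
    case 0
    have "restrict (\<lambda>_. \<zero>\<^bsub>F\<^esub>) (carrier E) \<in> feasible {..<0} (lexmin 0)"
      using zero_operator zero_in by (simp add: feasible_def)
    then show ?case by blast
  next
    case (Suc i)
    have "feasible {..i} ((lexmin i)(i := least_value i)) \<noteq> {}" using step[OF Suc] by blast
    moreover have "feasible {..<Suc i} (lexmin (Suc i)) = feasible {..i} ((lexmin i)(i := least_value i))"
      unfolding lessThan_Suc_atMost by (rule feasible_cong) (auto simp: least_value_def)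
    ultimately show ?case by metis
  qed
  show "0 \<le> c \<Longrightarrow> least_value i \<le> c \<longleftrightarrow> feasible {..i} ((lexmin i)(i := c)) \<noteq> {}" "0 \<le> least_value i"
    using step[OF ne] by blast+
qed

text \<open>Stage \<open>q\<close> of the approximation sees only the first \<open>q\<close> radii,
  which are solvable together; compactness passes to all of them.\<close>

lemma lexmin_solution: "feasible UNIV least_value \<noteq> {}"
proof (rule approx_feasible)
  fix q
  obtain u where "length u = q" "approx {..<q} (lexmin q) q (1 / Suc q) u"
    using feasible_lexmin[of q] unfolding feasible_iff_approx by blast
  then show "\<exists>u. length u = q \<and> approx UNIV least_value q (1 / Suc q) u"
    by (intro exI[of _ u]) (auto simp: approx_def lexmin_eq)
qed

text \<open>A smaller value at block \<open>i\<close> would contradict minimality given the same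
  earlier radii. With one pair in the block the distance is thus the same for all solutions, and
  independent of how a solution is chosen.\<close>

lemma lexmin_solution_value:
  assumes S: "S \<in> feasible UNIV least_value" and L: "L i = [(n, k)]"
  shows "vnorm F (S (\<phi> n) \<ominus>\<^bsub>F\<^esub> \<psi> k) = least_value i"
proof (rule antisym)
  show "vnorm F (S (\<phi> n) \<ominus>\<^bsub>F\<^esub> \<psi> k) \<le> least_value i" using S by (rule feasibleD) (simp_all add: L)
  let ?c = "vnorm F (S (\<phi> n) \<ominus>\<^bsub>F\<^esub> \<psi> k)"
  have "S \<in> opball" using S by (simp add: feasible_def)
  then have c: "0 \<le> ?c" using opball_bops by (intro F.vnorm_nonneg) auto
  have "S \<in> feasible {..i} ((lexmin i)(i := ?c))"
    unfolding feasible_def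
  proof (intro CollectI conjI ballI)
    fix j p assume j: "j \<in> {..i}" and p: "p \<in> set (L j)"
    show "case p of (n', k') \<Rightarrow> vnorm F (S (\<phi> n') \<ominus>\<^bsub>F\<^esub> \<psi> k') \<le> ((lexmin i)(i := ?c)) j"
    proof (cases "j = i")
      case True then show ?thesis using p L by simp
    next
      case False
      then have "lexmin i j = least_value j" using j by (intro lexmin_eq) simp
      then show ?thesis using S p False by (auto simp: feasible_def)
    qed
  qed (use S in \<open>auto simp: feasible_def\<close>)
  then show "least_value i \<le> ?c" using least_value_le_iff[OF c] by blast
qed

lemma least_value_0_le:
  assumes "R \<in> opball" "\<And>n. R (\<phi> n) \<in> K" "\<And>n k. (n, k) \<in> set (L 0) \<Longrightarrow> vnorm F (R (\<phi> n) \<ominus>\<^bsub>F\<^esub> \<psi> k) \<le> c" "0 \<le> c"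
  shows "least_value 0 \<le> c"
proof -
  have "R \<in> feasible {..0} ((lexmin 0)(0 := c))" using assms by (auto simp: feasible_def)
  then show ?thesis using least_value_le_iff[OF assms(4), of 0] by blast
qed

end

section \<open>Borel fields of operator balls\<close>

lemma sets_restrict_space_Int_space: "sets (restrict_space M S) = sets (restrict_space M (S \<inter> space M))"
proof -
  have "S \<inter> A = S \<inter> space M \<inter> A" if "A \<in> sets M" for A using sets.sets_into_space[OF that] by (simp add: Int_assoc Int_absorb1)
  then show ?thesis unfolding sets_restrict_space by (intro image_cong refl)
qed

lemma standard_borel_restrict_space_Int:
  assumes "standard_borel M" "S \<inter> space M \<in> sets M" shows "standard_borel (restrict_space M S)"
  using sets_restrict_space_Int_space standard_borel_restrict_space[OF assms] by (rule standard_borel_cong_sets)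

lemma (in complex_normed_space) lspan_rational_dense:
  assumes a: "\<And>i. a i \<in> carrier E" and v: "v \<in> lspan a N" and e: "e > 0"
  shows "\<exists>s. vnorm E (v \<ominus> lc (\<lambda>i. cq (s i)) a N) < e"
proof -
  obtain c where c: "v = lc c a N" using v by (auto simp: lspan_def)
  have "\<forall>i. \<exists>s :: nat \<Rightarrow> nat. (\<lambda>t. cq (s t)) \<longlonglongrightarrow> c i" using cq_seq by blast
  then obtain s where s: "\<And>i. (\<lambda>t. cq (s i t)) \<longlonglongrightarrow> c i" by metis
  have "conv (\<lambda>t. lc (\<lambda>i. cq (s i t)) a N) v sequentially" unfolding c by (intro conv_lc a s)
  then have "\<forall>\<^sub>F t in sequentially. vnorm E (lc (\<lambda>i. cq (s i t)) a N \<ominus> v) < e"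
    unfolding conv_def using e by (intro order_tendstoD(2))
  then obtain t where "vnorm E (lc (\<lambda>i. cq (s i t)) a N \<ominus> v) < e" using eventually_happens'[OF sequentially_bot] by blast
  then have "vnorm E (v \<ominus> lc (\<lambda>i. cq (s i t)) a N) < e"
    using norm_diff_commute[of v "lc (\<lambda>i. cq (s i t)) a N"] lspan_carrier[where a=a, OF a v] a by simp
  then show ?thesis by (rule exI[of _ "\<lambda>i. s i t"])
qed

section \<open>Sections of the field of operator balls\<close>

context operator_field_structure
begin

abbreviation ball where "ball x \<equiv> unit_ball (bounded_operators (V x) (W x))"
abbreviation near where "near x \<equiv> dense_normed_pair.near_set (V x) (W x) (\<lambda>n. \<phi> n x) (\<lambda>n. \<psi> n x)"

lemma ball_ops: "T \<in> ball x \<Longrightarrow> T \<in> ops x"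
  by (simp add: unit_ball_def)

lemma ball_sets: "{p. snd p \<in> ball (fst p)} \<inter> space MB \<in> sets MB"
proof -
  have [measurable]: "fibre_norm (operator_field V W) \<in> borel_measurable MB" by (rule opnorm_measurable)
  have "{p. snd p \<in> ball (fst p)} \<inter> space MB = {p \<in> space MB. fibre_norm (operator_field V W) p \<le> 1}"
    by (auto simp: in_B unit_ball_def fibre_norm_def operator_field_def)
  then show ?thesis by simp
qed

lemma ball_structure: "operator_ball_structure V W MB = restrict_space MB {p. snd p \<in> ball (fst p)}"
  unfolding operator_ball_structure_def by (rule arg_cong[where f="restrict_space MB"]) auto

lemma space_ball: "space (operator_ball_structure V W MB) = (SIGMA x:space X. ball x)"
  by (auto simp: ball_structure space_restrict_space in_B ball_ops)

lemma standard_ball: "standard_borel (operator_ball_structure V W MB)"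
  unfolding ball_structure by (rule standard_borel_restrict_space_Int[OF standard_B ball_sets])

lemma ball_to_B: "(\<lambda>p. p) \<in> measurable (operator_ball_structure V W MB) MB"
  unfolding ball_structure by (intro measurable_restrict_space1) simp

lemma measurable_into_ball:
  assumes "(\<lambda>y. (a y, T y)) \<in> measurable N MB" "\<And>y. y \<in> space N \<Longrightarrow> T y \<in> ball (a y)"
  shows "(\<lambda>y. (a y, T y)) \<in> measurable N (operator_ball_structure V W MB)"
  unfolding ball_structure using assms by (intro measurable_restrict_space2) auto

lemma topspace_ball: "x \<in> space X \<Longrightarrow> topspace (strong_topology_ball (V x) (W x)) = ball x"
  using dense_normed_pair.topspace_strong[OF dense_pair] .

text \<open>The base \<open>Y\<close> is only mapped into \<open>X\<close> by the identity, so that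
  the result serves both the full base and a conull part of it. What remains to be supplied is a
  sequence of sections meeting the density criterion.\<close>

theorem ball_field_polish:
  fixes S :: "nat \<Rightarrow> 'a \<Rightarrow> 'b \<Rightarrow> 'c"
  assumes Y: "standard_borel Y" and idY: "(\<lambda>x. x) \<in> measurable Y X" and MY: "standard_borel MY"
    and spMY: "space MY = (SIGMA x:space Y. ball x)" and fst_MY: "fst \<in> measurable MY Y"
    and idM: "(\<lambda>p. p) \<in> measurable MY MB" and sec: "\<And>j. borel_section Y MY (S j)"
    and dense: "\<And>x l m. x \<in> space Y \<Longrightarrow> near x l m \<noteq> {} \<Longrightarrow>
       \<exists>j. \<forall>n<length l. vnorm (W x) (S j x (\<phi> n x) \<ominus>\<^bsub>W x\<^esub> \<psi> (l ! n) x) \<le> 1 / Suc m"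
  shows "borel_field_polish Y (\<lambda>x. strong_topology_ball (V x) (W x)) MY"
proof -
  have YX: "x \<in> space X" if "x \<in> space Y" for x using measurable_space[OF idY that] .
  define sd where "sd = (\<lambda>x. normed_pair.strong_dist (V x) (W x) (\<lambda>n. \<phi> n x))"
  define d where "d = (\<lambda>x. metric (ball x, sd x))"
  have MS: "Metric_space (ball x) (sd x)" if "x \<in> space Y" for x
  proof -
    interpret P: dense_normed_pair "V x" "W x" "\<lambda>n. \<phi> n x" "\<lambda>n. \<psi> n x" using dense_pair[OF YX[OF that]] .
    show ?thesis unfolding sd_def by (rule P.B.Metric_space_axioms)
  qed
  have mdist: "mdist (d x) = sd x" and mspace: "mspace (d x) = ball x" if "x \<in> space Y" for x
    using MS[OF that] unfolding d_def by (simp_all add: Metric_space.mdist_metric Metric_space.mspace_metric)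
  have SB: "S j x \<in> ball x" if "x \<in> space Y" for j x
    using measurable_space[OF sec[of j, unfolded borel_section_def] that] spMY by auto
  have "(\<lambda>((x, v), (_, w)). mdist (d x) v w) \<in> borel_measurable (fibre_product MY MY)"
  proof (rule borel_measurableI_le)
    fix r :: real
    let ?N = "fibre_product MY MY"
    have f: "(\<lambda>y. fst y) \<in> measurable ?N MY" and s: "(\<lambda>y. snd y) \<in> measurable ?N MY"
      unfolding fibre_product_def by (auto intro!: measurable_restrict_space1)
    have m1: "(\<lambda>y. fst y) \<in> measurable ?N MB" using measurable_compose[OF f idM] .
    have m2: "(\<lambda>y. snd y) \<in> measurable ?N MB" using measurable_compose[OF s idM] .
    let ?a = "\<lambda>y. fst (fst y)"
    have sp: "fst (snd y) = ?a y \<and> ?a y \<in> space Y \<and> snd (fst y) \<in> ball (?a y) \<and> snd (snd y) \<in> ball (?a y)" if "y \<in> space ?N" for y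
      using that spMY by (auto simp: fibre_product_def space_restrict_space space_pair_measure)
    have a: "?a \<in> measurable ?N X" using measurable_compose[OF m1 fst_B] .
    have m2': "(\<lambda>y. (?a y, snd (snd y))) \<in> measurable ?N MB"
      using measurable_cong[of ?N "\<lambda>y. (?a y, snd (snd y))" "\<lambda>y. snd y"] m2 sp by (auto simp: prod_eq_iff)
    have m1': "(\<lambda>y. (?a y, snd (fst y))) \<in> measurable ?N MB" using m1 by simp
    have [measurable]: "(\<lambda>y. vnorm (W (?a y)) (snd (fst y) (\<phi> n (?a y)) \<ominus>\<^bsub>W (?a y)\<^esub> snd (snd y) (\<phi> n (?a y)))) \<in> borel_measurable ?N" for n
      by (intro W.meas_norm W.meas_diff meas_eval[OF m1'] meas_eval[OF m2'] V.meas_section a)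
    have "{y \<in> space ?N. (\<lambda>((x, v), (_, w)). mdist (d x) v w) y \<le> r} =
       {y \<in> space ?N. \<forall>n. min (1 / real (Suc n)) (vnorm (W (?a y)) (snd (fst y) (\<phi> n (?a y)) \<ominus>\<^bsub>W (?a y)\<^esub> snd (snd y) (\<phi> n (?a y)))) \<le> r}"
    proof (intro Collect_cong conj_cong refl)
      fix y assume "y \<in> space ?N"
      note y = sp[OF this]
      interpret P: dense_normed_pair "V (?a y)" "W (?a y)" "\<lambda>n. \<phi> n (?a y)" "\<lambda>n. \<psi> n (?a y)" using dense_pair YX y by blast
      have "(\<lambda>((x, v), (_, w)). mdist (d x) v w) y = P.strong_dist (\<lambda>n. \<phi> n (?a y)) (snd (fst y)) (snd (snd y))"
        using mdist y by (simp add: case_prod_beta sd_def)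
      then show "((\<lambda>((x, v), (_, w)). mdist (d x) v w) y \<le> r) \<longleftrightarrow>
         (\<forall>n. min (1 / real (Suc n)) (vnorm (W (?a y)) (snd (fst y) (\<phi> n (?a y)) \<ominus>\<^bsub>W (?a y)\<^esub> snd (snd y) (\<phi> n (?a y)))) \<le> r)"
        using P.strong_dist_le_iff[of "snd (fst y)" "snd (snd y)" "\<lambda>n. \<phi> n (?a y)" r] y by (simp only: P.gap_def)
    qed
    also have "\<dots> \<in> sets ?N" by measurable
    finally show "{y \<in> space ?N. (\<lambda>((x, v), (_, w)). mdist (d x) v w) y \<le> r} \<in> sets ?N" .
  qed
  moreover have "mspace (d x) = topspace (strong_topology_ball (V x) (W x)) \<and> mcomplete_of (d x) \<and>
      mtopology_of (d x) = strong_topology_ball (V x) (W x)" if x: "x \<in> space Y" for x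
  proof -
    interpret P: dense_normed_pair "V x" "W x" "\<lambda>n. \<phi> n x" "\<lambda>n. \<psi> n x" using dense_pair[OF YX[OF x]] .
    show ?thesis
      using P.strong_dist_complete P.mtopology_strong_dist mdist[OF x] mspace[OF x]
      by (simp add: mcomplete_of_def mtopology_of_def sd_def)
  qed
  moreover have "polish_topology (strong_topology_ball (V x) (W x))" if "x \<in> space Y" for x
    using dense_normed_pair.polish_strong_topology_ball[OF dense_pair[OF YX[OF that]]] .
  moreover have "strong_topology_ball (V x) (W x) closure_of range (\<lambda>j. S j x) = topspace (strong_topology_ball (V x) (W x))"
    if x: "x \<in> space Y" for x
  proof -
    interpret P: dense_normed_pair "V x" "W x" "\<lambda>n. \<phi> n x" "\<lambda>n. \<psi> n x" using dense_pair[OF YX[OF x]] .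
    show ?thesis unfolding P.topspace_strong
      using SB[OF x] dense[OF x] by (intro P.strong_dense_criterion) auto
  qed
  moreover have "space MY = (SIGMA x:space Y. topspace (strong_topology_ball (V x) (W x)))"
    unfolding spMY using topspace_ball YX by (intro Sigma_cong) auto
  ultimately show ?thesis unfolding borel_field_polish_def using Y MY fst_MY sec by blast
qed

text \<open>Applies the two criteria in succession: operators are tested on the dense sections of
  \<open>V\<close>, and their values by distances to the dense sections of \<open>W\<close>.\<close>

lemma measurable_sectionI:
  assumes T: "\<And>x. x \<in> space X \<Longrightarrow> T x \<in> ops x"
    and d: "\<And>n k. (\<lambda>x. vnorm (W x) (T x (\<phi> n x) \<ominus>\<^bsub>W x\<^esub> \<psi> k x)) \<in> borel_measurable X"
  shows "(\<lambda>x. (x, T x)) \<in> measurable X MB"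
proof (rule measurable_into_operators[OF dense_imp_total T])
  show "W.meas X (\<lambda>x. x) (\<lambda>x. T x (\<phi> n x))" for n
  proof (rule W.measI)
    show "T x (\<phi> n x) \<in> carrier (W x)" if "x \<in> space X" for x
      using ops_carrier[OF that T[OF that]] V.section_carrier[OF that] by blast
  qed (use d in auto)
qed auto

text \<open>For one list \<open>l\<close> a single section serves all precisions \<open>m\<close>:
  block 0 minimises the largest deviation from the prescribed values, so it is at most the deviation
  of any competitor \<open>R\<close>.\<close>

lemma lexmin_selection:
  fixes K :: "'a \<Rightarrow> 'c set" and \<xi> :: "nat \<Rightarrow> 'a \<Rightarrow> 'c"
  assumes cr: "\<And>x. x \<in> space X \<Longrightarrow> compact_range (V x) (W x) (\<lambda>n. \<phi> n x) (\<lambda>n. \<psi> n x) (K x) (\<lambda>j. \<xi> j x)"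
    and sec: "\<And>j. borel_section X MW (\<xi> j)"
  shows "\<exists>S. (\<lambda>x. (x, S x)) \<in> measurable X MB \<and> (\<forall>x\<in>space X. S x \<in> ball x \<and>
    (\<forall>m. (\<exists>R\<in>near x l m. \<forall>n. R (\<phi> n x) \<in> K x) \<longrightarrow>
       (\<forall>n<length l. vnorm (W x) (S x (\<phi> n x) \<ominus>\<^bsub>W x\<^esub> \<psi> (l ! n) x) \<le> 1 / Suc m)))"
proof -
  \<comment> \<open>Block 0 is the prescription \<open>l\<close>. The later blocks run through all
    pairs \<open>(n, k)\<close> one at a time, which pins down every distance of the
    solution.\<close>
  define L :: "nat \<Rightarrow> (nat \<times> nat) list" where
    "L = (\<lambda>i. case i of 0 \<Rightarrow> zip [0..<length l] l | Suc i \<Rightarrow> [prod_decode i])"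
  define feas where "feas = (\<lambda>x. compact_range.feasible (V x) (W x) (\<lambda>n. \<phi> n x) (\<lambda>n. \<psi> n x) (K x) L)"
  define lm where "lm = (\<lambda>x. compact_range.lexmin (V x) (W x) (\<lambda>n. \<phi> n x) (\<lambda>n. \<psi> n x) (K x) L)"
  define lv where "lv = (\<lambda>x. compact_range.least_value (V x) (W x) (\<lambda>n. \<phi> n x) (\<lambda>n. \<psi> n x) (K x) L)"
  have idX: "(\<lambda>x. x) \<in> measurable X X" by simp
  have secm: "W.meas X (\<lambda>x. x) (\<xi> j)" for j using sec[of j] by (simp add: W.meas_def borel_section_def)
  have psim: "W.meas X (\<lambda>x. x) (\<psi> k)" for k using W.meas_section[OF idX, of k] .
  have phim: "V.meas X (\<lambda>x. x) (\<phi> k)" for k using V.meas_section[OF idX, of k] .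
  \<comment> \<open>Rewritten through \<open>feasible_iff_approx\<close>, feasibility quantifies
    over naturals and finite lists of naturals only.\<close>
  have feas_sets: "{x \<in> space X. feas x J (\<lambda>i. r i x) \<noteq> {}} \<in> sets X" if r: "\<And>i. r i \<in> borel_measurable X" for J and r :: "nat \<Rightarrow> 'a \<Rightarrow> real"
  proof -
    have [measurable]: "(\<lambda>x. vnorm (W x) (complex_normed_space.lin (W x) p q (\<xi> a x) (\<xi> b x) (\<xi> c x))) \<in> borel_measurable X" for p q a b c
      by (intro W.meas_norm W.meas_lin secm)
    have [measurable]: "(\<lambda>x. vnorm (V x) (complex_normed_space.lin (V x) p q (\<phi> a x) (\<phi> b x) (\<phi> c x))) \<in> borel_measurable X" for p q a b c
      by (intro V.meas_norm V.meas_lin phim)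
    have [measurable]: "(\<lambda>x. vnorm (W x) (\<xi> a x \<ominus>\<^bsub>W x\<^esub> \<psi> b x)) \<in> borel_measurable X" for a b
      by (intro W.meas_norm W.meas_diff secm psim)
    note [measurable] = r
    have "{x \<in> space X. feas x J (\<lambda>i. r i x) \<noteq> {}} = {x \<in> space X. \<forall>q. \<exists>u::nat list. length u = q \<and>
      (\<forall>i<q. \<forall>j<q. \<forall>n<q. \<forall>m<q. \<forall>k<q.
         vnorm (W x) (complex_normed_space.lin (W x) (cq i) (cq j) (\<xi> (u ! n) x) (\<xi> (u ! m) x) (\<xi> (u ! k) x))
        \<le> vnorm (V x) (complex_normed_space.lin (V x) (cq i) (cq j) (\<phi> n x) (\<phi> m x) (\<phi> k x)) + 1 / Suc q) \<and>
     (\<forall>i<q. i \<in> J \<longrightarrow> (\<forall>(n, k)\<in>set (L i). n < q \<longrightarrow> vnorm (W x) (\<xi> (u ! n) x \<ominus>\<^bsub>W x\<^esub> \<psi> k x) \<le> r i x + 1 / Suc q))}"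
    proof (intro Collect_cong conj_cong refl)
      fix x assume "x \<in> space X"
      then interpret C: compact_range "V x" "W x" "\<lambda>n. \<phi> n x" "\<lambda>n. \<psi> n x" "K x" "\<lambda>j. \<xi> j x" L by (rule cr)
      show "(feas x J (\<lambda>i. r i x) \<noteq> {}) = (\<forall>q. \<exists>u::nat list. length u = q \<and>
      (\<forall>i<q. \<forall>j<q. \<forall>n<q. \<forall>m<q. \<forall>k<q.
         vnorm (W x) (complex_normed_space.lin (W x) (cq i) (cq j) (\<xi> (u ! n) x) (\<xi> (u ! m) x) (\<xi> (u ! k) x))
        \<le> vnorm (V x) (complex_normed_space.lin (V x) (cq i) (cq j) (\<phi> n x) (\<phi> m x) (\<phi> k x)) + 1 / Suc q) \<and>
     (\<forall>i<q. i \<in> J \<longrightarrow> (\<forall>(n, k)\<in>set (L i). n < q \<longrightarrow> vnorm (W x) (\<xi> (u ! n) x \<ominus>\<^bsub>W x\<^esub> \<psi> k x) \<le> r i x + 1 / Suc q)))"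
        unfolding feas_def C.feasible_iff_approx C.approx_def by (rule refl)
    qed
    also have "\<dots> \<in> sets X" unfolding case_prod_beta by measurable
    finally show ?thesis .
  qed
  \<comment> \<open>The sublevel set of a minimal radius is a feasibility set whose other radii are
    the earlier minima, measurable by induction.\<close>
  have lm_meas: "(\<lambda>x. lm x i k) \<in> borel_measurable X" for i k
  proof (induction i arbitrary: k)
    case 0
    have "lm x 0 k = 0" if "x \<in> space X" for x
      using compact_range.lexmin.simps(1)[OF cr[OF that], of L] by (simp add: lm_def)
    then show ?case by (subst measurable_cong[of _ _ "\<lambda>_. 0"]) auto
  next
    case (Suc i)
    have eq: "lm x (Suc i) = (lm x i)(i := lv x i)" if "x \<in> space X" for x
    proof -
      interpret C: compact_range "V x" "W x" "\<lambda>n. \<phi> n x" "\<lambda>n. \<psi> n x" "K x" "\<lambda>j. \<xi> j x" L using that by (rule cr)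
      show ?thesis unfolding lm_def lv_def C.least_value_def by simp
    qed
    have lvm: "(\<lambda>x. lv x i) \<in> borel_measurable X"
    proof (rule borel_measurableI_le)
      fix c :: real
      show "{x \<in> space X. lv x i \<le> c} \<in> sets X"
      proof (cases "0 \<le> c")
        case True
        define r where "r = (\<lambda>k x. if k = i then c else lm x i k)"
        have r: "(\<lambda>k. r k x) = (lm x i)(i := c)" for x by (auto simp: r_def)
        have "{x \<in> space X. lv x i \<le> c} = {x \<in> space X. feas x {..i} (\<lambda>k. r k x) \<noteq> {}}"
        proof (intro Collect_cong conj_cong refl)
          fix x assume "x \<in> space X"
          then interpret C: compact_range "V x" "W x" "\<lambda>n. \<phi> n x" "\<lambda>n. \<psi> n x" "K x" "\<lambda>j. \<xi> j x" L by (rule cr)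
          show "(lv x i \<le> c) = (feas x {..i} (\<lambda>k. r k x) \<noteq> {})"
            unfolding r unfolding lv_def feas_def lm_def by (rule C.least_value_le_iff[OF True])
        qed
        also have "\<dots> \<in> sets X" by (rule feas_sets) (use Suc.IH in \<open>auto simp: r_def\<close>)
        finally show ?thesis .
      next
        case False
        have "\<not> lv x i \<le> c" if "x \<in> space X" for x
          using compact_range.least_value_nonneg[OF cr[OF that], of L i] False unfolding lv_def by linarith
        then have "{x \<in> space X. lv x i \<le> c} = {}" by blast
        then show ?thesis by (simp only: sets.empty_sets)
      qed
    qed
    show ?case
    proof (cases "k = i")
      case True
      have "(\<lambda>x. lm x (Suc i) k) \<in> borel_measurable X \<longleftrightarrow> (\<lambda>x. lv x i) \<in> borel_measurable X"
        by (rule measurable_cong) (simp add: eq True)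
      then show ?thesis using lvm by blast
    next
      case False
      have "(\<lambda>x. lm x (Suc i) k) \<in> borel_measurable X \<longleftrightarrow> (\<lambda>x. lm x i k) \<in> borel_measurable X"
        by (rule measurable_cong) (simp add: eq False)
      then show ?thesis using Suc.IH by blast
    qed
  qed
  have lv_meas: "(\<lambda>x. lv x i) \<in> borel_measurable X" for i
  proof -
    have "lv x i = lm x (Suc i) i" if "x \<in> space X" for x
      unfolding lv_def lm_def using compact_range.least_value_def[OF cr[OF that], of L i] .
    then have "(\<lambda>x. lv x i) \<in> borel_measurable X \<longleftrightarrow> (\<lambda>x. lm x (Suc i) i) \<in> borel_measurable X"
      by (rule measurable_cong)
    then show ?thesis using lm_meas by blast
  qed
  \<comment> \<open>An arbitrary choice is harmless, since all distances to the
    \<open>\<psi> k x\<close> are prescribed by \<open>lv x\<close>.\<close>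
  define S where "S = (\<lambda>x. SOME T. T \<in> feas x UNIV (lv x))"
  have S: "S x \<in> feas x UNIV (lv x)" if "x \<in> space X" for x
  proof -
    have "feas x UNIV (lv x) \<noteq> {}" unfolding feas_def lv_def by (rule compact_range.lexmin_solution[OF cr[OF that]])
    then show ?thesis unfolding S_def by (simp add: some_in_eq)
  qed
  have SB: "S x \<in> ball x" if "x \<in> space X" for x
    using S[OF that] compact_range.feasible_def[OF cr[OF that]] unfolding feas_def by blast
  have "(\<lambda>x. (x, S x)) \<in> measurable X MB"
  proof (rule measurable_sectionI)
    show "S x \<in> ops x" if "x \<in> space X" for x using SB[OF that] by (rule ball_ops)
    fix n k
    have "vnorm (W x) (S x (\<phi> n x) \<ominus>\<^bsub>W x\<^esub> \<psi> k x) = lv x (Suc (prod_encode (n, k)))" if "x \<in> space X" for x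
    proof -
      interpret C: compact_range "V x" "W x" "\<lambda>n. \<phi> n x" "\<lambda>n. \<psi> n x" "K x" "\<lambda>j. \<xi> j x" L using that by (rule cr)
      show ?thesis unfolding lv_def using S[OF that] unfolding feas_def lv_def
        by (rule C.lexmin_solution_value) (simp add: L_def)
    qed
    then have "(\<lambda>x. vnorm (W x) (S x (\<phi> n x) \<ominus>\<^bsub>W x\<^esub> \<psi> k x)) \<in> borel_measurable X \<longleftrightarrow> (\<lambda>x. lv x (Suc (prod_encode (n, k)))) \<in> borel_measurable X"
      by (rule measurable_cong)
    then show "(\<lambda>x. vnorm (W x) (S x (\<phi> n x) \<ominus>\<^bsub>W x\<^esub> \<psi> k x)) \<in> borel_measurable X" using lv_meas by blast
  qed
  moreover have "vnorm (W x) (S x (\<phi> n x) \<ominus>\<^bsub>W x\<^esub> \<psi> (l ! n) x) \<le> 1 / Suc m"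
    if x: "x \<in> space X" and R: "R \<in> near x l m" "\<And>n. R (\<phi> n x) \<in> K x" and n: "n < length l" for x m R n
  proof -
    interpret C: compact_range "V x" "W x" "\<lambda>n. \<phi> n x" "\<lambda>n. \<psi> n x" "K x" "\<lambda>j. \<xi> j x" L using x by (rule cr)
    have "C.least_value 0 \<le> 1 / Suc m"
    proof (rule C.least_value_0_le)
      show "R \<in> C.opball" using R(1) by (simp add: C.near_set_def)
      fix n k assume "(n, k) \<in> set (L 0)"
      then have "n < length l" "k = l ! n" by (auto simp: L_def set_zip)
      then show "vnorm (W x) (R (\<phi> n x) \<ominus>\<^bsub>W x\<^esub> \<psi> k x) \<le> 1 / Suc m" using R(1) by (auto simp: C.near_set_def less_imp_le)
    qed (use R in auto)
    moreover have "(n, l ! n) \<in> set (L 0)" using n by (auto simp: L_def set_zip intro!: exI[of _ n])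
    then have "vnorm (W x) (S x (\<phi> n x) \<ominus>\<^bsub>W x\<^esub> \<psi> (l ! n) x) \<le> C.least_value 0"
      using S[OF x] unfolding feas_def lv_def by (intro C.feasibleD) auto
    ultimately show ?thesis by linarith
  qed
  ultimately show ?thesis using SB by (intro exI[of _ S]) blast
qed

lemma ball_field_polish_of_sections:
  fixes S :: "nat \<Rightarrow> 'a \<Rightarrow> 'b \<Rightarrow> 'c"
  assumes S: "\<And>j. (\<lambda>x. (x, S j x)) \<in> measurable X MB" "\<And>j x. x \<in> space X \<Longrightarrow> S j x \<in> ball x"
    and dense: "\<And>x l m. x \<in> space X \<Longrightarrow> near x l m \<noteq> {} \<Longrightarrow>
       \<exists>j. \<forall>n<length l. vnorm (W x) (S j x (\<phi> n x) \<ominus>\<^bsub>W x\<^esub> \<psi> (l ! n) x) \<le> 1 / Suc m"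
  shows "borel_field_polish X (\<lambda>x. strong_topology_ball (V x) (W x)) (operator_ball_structure V W MB)"
proof (rule ball_field_polish[where S=S])
  show "fst \<in> measurable (operator_ball_structure V W MB) X" using measurable_compose[OF ball_to_B fst_B] .
  show "borel_section X (operator_ball_structure V W MB) (S j)" for j
    unfolding borel_section_def by (intro measurable_into_ball S)
qed (use V.standard_base standard_ball space_ball ball_to_B dense in auto)

text \<open>The whole fibre serves as \<open>K\<close>, with the dense sections
  \<open>\<psi>\<close> as \<open>\<xi>\<close>; every operator is then a competitor.\<close>

theorem reflexive_ball_field:
  assumes refl: "\<And>x. x \<in> space X \<Longrightarrow> reflexive_space (W x)"
  shows "borel_field_polish X (\<lambda>x. strong_topology_ball (V x) (W x)) (operator_ball_structure V W MB)"
proof -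
  have cr: "compact_range (V x) (W x) (\<lambda>n. \<phi> n x) (\<lambda>n. \<psi> n x) (carrier (W x)) (\<lambda>j. \<psi> j x)" if x: "x \<in> space X" for x
  proof -
    interpret P: dense_normed_pair "V x" "W x" "\<lambda>n. \<phi> n x" "\<lambda>n. \<psi> n x" using dense_pair[OF x] .
    show ?thesis
      using P.F.reflexive_weakly_compact[OF refl[OF x]] P.\<psi> unfolding P.F.dense_seq_def
      by unfold_locales auto
  qed
  have "\<forall>l. \<exists>S. (\<lambda>x. (x, S x)) \<in> measurable X MB \<and> (\<forall>x\<in>space X. S x \<in> ball x \<and>
    (\<forall>m. (\<exists>R\<in>near x l m. \<forall>n. R (\<phi> n x) \<in> carrier (W x)) \<longrightarrow>
       (\<forall>n<length l. vnorm (W x) (S x (\<phi> n x) \<ominus>\<^bsub>W x\<^esub> \<psi> (l ! n) x) \<le> 1 / Suc m)))"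
    by (intro allI lexmin_selection[OF cr W.sections])
  from choice[OF this] obtain S where S0: "\<And>p. (\<lambda>x. (x, S p x)) \<in> measurable X MB \<and> (\<forall>x\<in>space X. S p x \<in> ball x \<and>
    (\<forall>m. (\<exists>R\<in>near x p m. \<forall>n. R (\<phi> n x) \<in> carrier (W x)) \<longrightarrow>
       (\<forall>n<length p. vnorm (W x) (S p x (\<phi> n x) \<ominus>\<^bsub>W x\<^esub> \<psi> (p ! n) x) \<le> 1 / Suc m)))" by blast
  have S: "\<And>l. (\<lambda>x. (x, S l x)) \<in> measurable X MB" "\<And>l x. x \<in> space X \<Longrightarrow> S l x \<in> ball x"
    "\<And>l x m R n. x \<in> space X \<Longrightarrow> R \<in> near x l m \<Longrightarrow> (\<forall>n. R (\<phi> n x) \<in> carrier (W x)) \<Longrightarrow> n < length l \<Longrightarrow>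
       vnorm (W x) (S l x (\<phi> n x) \<ominus>\<^bsub>W x\<^esub> \<psi> (l ! n) x) \<le> 1 / Suc m"
    using S0 by blast+
  show ?thesis
  proof (rule ball_field_polish_of_sections[where S="\<lambda>j. S (from_nat j)"])
    fix x l m assume x: "x \<in> space X" and "near x l m \<noteq> {}"
    then obtain R where R: "R \<in> near x l m" by blast
    have "R \<in> ops x" using R dense_normed_pair.near_set_def[OF dense_pair[OF x]] ball_ops by blast
    then have "\<forall>n. R (\<phi> n x) \<in> carrier (W x)" using ops_carrier[OF x] V.section_carrier[OF x] by blast
    then show "\<exists>j. \<forall>n<length l. vnorm (W x) (S (from_nat j) x (\<phi> n x) \<ominus>\<^bsub>W x\<^esub> \<psi> (l ! n) x) \<le> 1 / Suc m"
      using S(3)[OF x R] by (intro exI[of _ "to_nat l"]) simp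
  qed (use S in auto)
qed

definition rational_coefficients :: "nat \<Rightarrow> nat \<Rightarrow> complex" where
  "rational_coefficients j i = (let u = from_nat j :: nat list in if i < length u then cq (u ! i) else 0)"

text \<open>Combinations of the first \<open>N\<close> dense sections with Gaussian rational
  coefficients are Borel sections and fill their span densely; they serve as \<open>\<xi>\<close>
  for \<open>K N\<close>.\<close>

definition rational_span_section :: "nat \<Rightarrow> nat \<Rightarrow> 'a \<Rightarrow> 'c" where
  "rational_span_section N j x = complex_normed_space.lc (W x) (rational_coefficients j) (\<lambda>i. \<psi> i x) N"

lemma rational_span_section: "borel_section X MW (rational_span_section N j)"
proof -
  have "W.meas X (\<lambda>x. x) (rational_span_section N j)"
  proof (induction N)
    case 0
    have z: "W.meas X (\<lambda>x. x) (\<lambda>x. 0 \<odot>\<^bsub>W x\<^esub> \<psi> 0 x)" by (intro W.meas_scale W.meas_section) auto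
    have eq: "0 \<odot>\<^bsub>W x\<^esub> \<psi> 0 x = rational_span_section 0 j x" if "x \<in> space X" for x
    proof -
      interpret F: complex_normed_space "W x" using W.normed[OF that] .
      show ?thesis using W.section_carrier[OF that] by (simp add: rational_span_section_def)
    qed
    show ?case using W.meas_cong[of X "\<lambda>x. 0 \<odot>\<^bsub>W x\<^esub> \<psi> 0 x" "rational_span_section 0 j" "\<lambda>x. x", OF eq] z by blast
  next
    case (Suc N)
    have z: "W.meas X (\<lambda>x. x) (\<lambda>x. rational_span_section N j x \<oplus>\<^bsub>W x\<^esub> rational_coefficients j N \<odot>\<^bsub>W x\<^esub> \<psi> N x)"
      by (intro W.meas_add W.meas_scale W.meas_section Suc) auto
    have eq: "rational_span_section N j x \<oplus>\<^bsub>W x\<^esub> rational_coefficients j N \<odot>\<^bsub>W x\<^esub> \<psi> N x = rational_span_section (Suc N) j x" if "x \<in> space X" for x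
    proof -
      interpret F: complex_normed_space "W x" using W.normed[OF that] .
      show ?thesis by (simp add: rational_span_section_def)
    qed
    show ?case using W.meas_cong[of X "\<lambda>x. rational_span_section N j x \<oplus>\<^bsub>W x\<^esub> rational_coefficients j N \<odot>\<^bsub>W x\<^esub> \<psi> N x" "rational_span_section (Suc N) j" "\<lambda>x. x", OF eq] z by blast
  qed
  then show ?thesis by (simp add: W.meas_def borel_section_def)
qed

text \<open>The span of the first \<open>N\<close> dense sections serves as \<open>K\<close>. The
  \<open>N\<close> required for a good competitor varies with \<open>x\<close>, so sections are
  produced for all pairs \<open>(N, l)\<close>.\<close>

theorem approximation_ball_field:
  assumes map: "\<And>x. x \<in> space X \<Longrightarrow> metric_approximation_property (V x) \<or> metric_approximation_property (W x)"
  shows "borel_field_polish X (\<lambda>x. strong_topology_ball (V x) (W x)) (operator_ball_structure V W MB)"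
proof -
  define K where "K = (\<lambda>N x. complex_normed_space.lspan (W x) (\<lambda>i. \<psi> i x) N)"
  have cr: "compact_range (V x) (W x) (\<lambda>n. \<phi> n x) (\<lambda>n. \<psi> n x) (K N x) (\<lambda>j. rational_span_section N j x)" if x: "x \<in> space X" for N x
  proof -
    interpret P: dense_normed_pair "V x" "W x" "\<lambda>n. \<phi> n x" "\<lambda>n. \<psi> n x" using dense_pair[OF x] .
    show ?thesis
    proof
      show "P.F.weakly_compact_subspace (K N x)" unfolding K_def by (rule P.F.lspan_weakly_compact) simp
      show "\<zero>\<^bsub>W x\<^esub> \<in> K N x" unfolding K_def by (rule P.F.lspan_zero) simp
      show "rational_span_section N j x \<in> K N x" for j unfolding K_def rational_span_section_def P.F.lspan_def by blast
      fix v and e :: real assume v: "v \<in> K N x" and e: "e > 0"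
      obtain s where s: "vnorm (W x) (v \<ominus>\<^bsub>W x\<^esub> P.F.lc (\<lambda>i. cq (s i)) (\<lambda>i. \<psi> i x) N) < e"
        using P.F.lspan_rational_dense[of "\<lambda>i. \<psi> i x" v N e] v e unfolding K_def by auto
      have "P.F.lc (\<lambda>i. cq (s i)) (\<lambda>i. \<psi> i x) N = rational_span_section N (to_nat (map s [0..<N])) x"
        unfolding rational_span_section_def by (rule P.F.lc_cong) (simp add: rational_coefficients_def)
      then show "\<exists>j. vnorm (W x) (v \<ominus>\<^bsub>W x\<^esub> rational_span_section N j x) < e" using s by metis
    qed
  qed
  have "\<forall>p. \<exists>S. (\<lambda>x. (x, S x)) \<in> measurable X MB \<and> (\<forall>x\<in>space X. S x \<in> ball x \<and>
    (\<forall>m. (\<exists>R\<in>near x (snd p) m. \<forall>n. R (\<phi> n x) \<in> K (fst p) x) \<longrightarrow>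
       (\<forall>n<length (snd p). vnorm (W x) (S x (\<phi> n x) \<ominus>\<^bsub>W x\<^esub> \<psi> (snd p ! n) x) \<le> 1 / Suc m)))"
    by (intro allI lexmin_selection[OF cr rational_span_section])
  from choice[OF this] obtain S where S0: "\<And>p. (\<lambda>x. (x, S p x)) \<in> measurable X MB \<and> (\<forall>x\<in>space X. S p x \<in> ball x \<and>
    (\<forall>m. (\<exists>R\<in>near x (snd p) m. \<forall>n. R (\<phi> n x) \<in> K (fst p) x) \<longrightarrow>
       (\<forall>n<length (snd p). vnorm (W x) (S p x (\<phi> n x) \<ominus>\<^bsub>W x\<^esub> \<psi> (snd p ! n) x) \<le> 1 / Suc m)))" by blast
  have S: "\<And>p. (\<lambda>x. (x, S p x)) \<in> measurable X MB" "\<And>p x. x \<in> space X \<Longrightarrow> S p x \<in> ball x"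
    "\<And>p x m R n. x \<in> space X \<Longrightarrow> R \<in> near x (snd p) m \<Longrightarrow> (\<forall>n. R (\<phi> n x) \<in> K (fst p) x) \<Longrightarrow> n < length (snd p) \<Longrightarrow>
       vnorm (W x) (S p x (\<phi> n x) \<ominus>\<^bsub>W x\<^esub> \<psi> (snd p ! n) x) \<le> 1 / Suc m"
    using S0 by blast+
  show ?thesis
  proof (rule ball_field_polish_of_sections[where S="\<lambda>j. S (from_nat j)"])
    fix x l m assume x: "x \<in> space X" and "near x l m \<noteq> {}"
    interpret P: dense_normed_pair "V x" "W x" "\<lambda>n. \<phi> n x" "\<lambda>n. \<psi> n x" using dense_pair[OF x] .
    obtain T where T: "T \<in> near x l m" using \<open>near x l m \<noteq> {}\<close> by blast
    then have TB: "T \<in> P.opball" and Tn: "\<And>n. n < length l \<Longrightarrow> vnorm (W x) (T (\<phi> n x) \<ominus>\<^bsub>W x\<^esub> \<psi> (l ! n) x) < 1 / Suc m"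
      by (auto simp: P.near_set_def)
    \<comment> \<open>The strict inequalities leave a positive margin; an approximation of
      \<open>T\<close> within it stays in the same \<open>near\<close> set. The inserted 1 covers
      the empty list.\<close>
    define e where "e = Min (insert 1 ((\<lambda>n. 1 / Suc m - vnorm (W x) (T (\<phi> n x) \<ominus>\<^bsub>W x\<^esub> \<psi> (l ! n) x)) ` {..<length l}))"
    have e: "e > 0" unfolding e_def using Tn by (subst Min_gr_iff) auto
    have e_le: "e \<le> 1 / Suc m - vnorm (W x) (T (\<phi> n x) \<ominus>\<^bsub>W x\<^esub> \<psi> (l ! n) x)" if "n < length l" for n
      unfolding e_def using that by (intro Min_le) auto
    have fin: "finite ((\<lambda>n. \<phi> n x) ` {..<length l})" by simp
    have sub: "(\<lambda>n. \<phi> n x) ` {..<length l} \<subseteq> carrier (V x)" using P.\<phi>_closed by auto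
    obtain N Q where Q: "Q \<in> P.opball" "\<And>v. v \<in> carrier (V x) \<Longrightarrow> Q v \<in> P.F.lspan (\<lambda>i. \<psi> i x) N"
      "\<And>v. v \<in> (\<lambda>n. \<phi> n x) ` {..<length l} \<Longrightarrow> vnorm (W x) (Q v \<ominus>\<^bsub>W x\<^esub> T v) < e"
      using P.metric_approximation[OF map[OF x] TB P.\<psi> e fin sub] by blast
    have Qc: "Q (\<phi> n x) \<in> carrier (W x)" "T (\<phi> n x) \<in> carrier (W x)" for n
      using Q(1) TB P.opball_bops by auto
    have "vnorm (W x) (Q (\<phi> n x) \<ominus>\<^bsub>W x\<^esub> \<psi> (l ! n) x) < 1 / Suc m" if n: "n < length l" for n
      using P.F.norm_diff_triangle[OF Qc(1)[of n] Qc(2)[of n] P.\<psi>_closed[of "l ! n"]] Q(3)[of "\<phi> n x"] e_le[OF n] n by fastforce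
    then have Qn: "Q \<in> near x (snd (N, l)) m" using Q(1) by (simp add: P.near_set_def)
    have QK: "\<forall>n. Q (\<phi> n x) \<in> K (fst (N, l)) x" using Q(2) by (simp add: K_def)
    show "\<exists>j. \<forall>n<length l. vnorm (W x) (S (from_nat j) x (\<phi> n x) \<ominus>\<^bsub>W x\<^esub> \<psi> (l ! n) x) \<le> 1 / Suc m"
      using S(3)[OF x Qn QK] by (intro exI[of _ "to_nat (N, l)"]) simp
  qed (use S in auto)
qed

end

section \<open>Measured fields of operator balls\<close>

context dense_normed_pair
begin

abbreviation row :: "(nat \<Rightarrow> nat) \<Rightarrow> nat \<Rightarrow> nat \<Rightarrow> 'b" where
  "row f n j \<equiv> \<psi> (f (prod_encode (n, j)))"

text \<open>Row \<open>n\<close> of \<open>f\<close> is meant to list vectors within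
  \<open>1 / Suc j\<close> of \<open>S (\<phi> n)\<close>; the clauses are what the triangle
  inequality leaves of Cauchyness, of boundedness by 1 and of the prescription \<open>l\<close>.
  Only entries below \<open>q\<close> are consulted, so finite prefixes index a Suslin
  scheme.\<close>

definition codes_upto :: "nat list \<Rightarrow> nat \<Rightarrow> (nat \<Rightarrow> nat) \<Rightarrow> nat \<Rightarrow> bool" where
  "codes_upto l m f q \<longleftrightarrow>
     (\<forall>n i j. prod_encode (n, i) < q \<and> prod_encode (n, j) < q \<longrightarrow>
        vnorm F (row f n i \<ominus>\<^bsub>F\<^esub> row f n j) \<le> 1 / Suc i + 1 / Suc j) \<and>
     (\<forall>a b n k i j. prod_encode (n, j) < q \<and> prod_encode (k, j) < q \<and> prod_encode (i, j) < q \<longrightarrow>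
        vnorm F (F.lin (cq a) (cq b) (row f n j) (row f k j) (row f i j)) \<le>
          vnorm E (E.lin (cq a) (cq b) (\<phi> n) (\<phi> k) (\<phi> i)) + (cmod (cq a) + cmod (cq b) + 1) / Suc j) \<and>
     (\<forall>n<length l. \<forall>j. prod_encode (n, j) < q \<longrightarrow>
        vnorm F (row f n j \<ominus>\<^bsub>F\<^esub> \<psi> (l ! n)) \<le> 1 / Suc m + 1 / Suc j)"

lemma codes_upto_cong: "(\<And>i. i < q \<Longrightarrow> f i = g i) \<Longrightarrow> codes_upto l m f q \<longleftrightarrow> codes_upto l m g q"
  unfolding codes_upto_def by (simp cong: conj_cong imp_cong)

lemma codes_upto_mono: "codes_upto l m f q \<Longrightarrow> p \<le> q \<Longrightarrow> codes_upto l m f p"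
  unfolding codes_upto_def by (meson order_less_le_trans)

text \<open>Entry \<open>(n, j)\<close> is an index of a vector of \<open>\<psi>\<close> within
  \<open>1 / Suc j\<close> of \<open>R (\<phi> n)\<close>.\<close>

lemma near_set_has_codes:
  assumes R: "R \<in> near_set l m" shows "\<exists>f. \<forall>q. codes_upto l m f q"
proof -
  have Rb: "R \<in> opball" using R by (simp add: near_set_def)
  have Rc: "R (\<phi> n) \<in> carrier F" for n using Rb opball_bops by (intro bops_closed) auto
  have "\<forall>i. \<exists>k. vnorm F (R (\<phi> (fst (prod_decode i))) \<ominus>\<^bsub>F\<^esub> \<psi> k) < 1 / Suc (snd (prod_decode i))"
    using \<psi> Rc unfolding F.dense_seq_def by simp
  from choice[OF this] obtain f where
    f: "\<And>i. vnorm F (R (\<phi> (fst (prod_decode i))) \<ominus>\<^bsub>F\<^esub> \<psi> (f i)) < 1 / Suc (snd (prod_decode i))" by blast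
  have f1: "vnorm F (R (\<phi> n) \<ominus>\<^bsub>F\<^esub> row f n j) \<le> 1 / Suc j" for n j using f[of "prod_encode (n, j)"] by simp
  then have f2: "vnorm F (row f n j \<ominus>\<^bsub>F\<^esub> R (\<phi> n)) \<le> 1 / Suc j" for n j
    using F.norm_diff_commute[OF Rc[of n] \<psi>_closed[of "f (prod_encode (n, j))"]] by metis
  have "vnorm F (row f n i \<ominus>\<^bsub>F\<^esub> row f n j) \<le> 1 / Suc i + 1 / Suc j" for n i j
    using F.norm_diff_triangle[OF \<psi>_closed[of "f (prod_encode (n, i))"] Rc[of n] \<psi>_closed[of "f (prod_encode (n, j))"]] f2[of n i] f1[of n j]
    by linarith
  moreover have "vnorm F (F.lin (cq a) (cq b) (row f n j) (row f k j) (row f i j)) \<le>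
      vnorm E (E.lin (cq a) (cq b) (\<phi> n) (\<phi> k) (\<phi> i)) + (cmod (cq a) + cmod (cq b) + 1) / Suc j" for a b n k i j
  proof -
    have "vnorm F (F.lin (cq a) (cq b) (row f n j) (row f k j) (row f i j)) \<le>
        vnorm F (F.lin (cq a) (cq b) (R (\<phi> n)) (R (\<phi> k)) (R (\<phi> i))) +
        (cmod (cq a) * vnorm F (row f n j \<ominus>\<^bsub>F\<^esub> R (\<phi> n)) + cmod (cq b) * vnorm F (row f k j \<ominus>\<^bsub>F\<^esub> R (\<phi> k)) +
         vnorm F (row f i j \<ominus>\<^bsub>F\<^esub> R (\<phi> i)))"
      by (intro F.norm_lin_le Rc \<psi>_closed)
    moreover have "vnorm F (F.lin (cq a) (cq b) (R (\<phi> n)) (R (\<phi> k)) (R (\<phi> i))) \<le> vnorm E (E.lin (cq a) (cq b) (\<phi> n) (\<phi> k) (\<phi> i))"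
      using bops_bounded_on_seq[of R 1 \<phi>] Rb unfolding bounded_on_seq_def by (auto simp: unit_ball_def)
    moreover have "cmod (cq a) * vnorm F (row f n j \<ominus>\<^bsub>F\<^esub> R (\<phi> n)) \<le> cmod (cq a) * (1 / Suc j)"
      "cmod (cq b) * vnorm F (row f k j \<ominus>\<^bsub>F\<^esub> R (\<phi> k)) \<le> cmod (cq b) * (1 / Suc j)"
      using f2 by (intro mult_left_mono; simp)+
    ultimately show ?thesis using f2[of i j] by (simp add: add_divide_distrib)
  qed
  moreover have "vnorm F (row f n j \<ominus>\<^bsub>F\<^esub> \<psi> (l ! n)) \<le> 1 / Suc m + 1 / Suc j" if "n < length l" for n j
  proof -
    have "vnorm F (R (\<phi> n) \<ominus>\<^bsub>F\<^esub> \<psi> (l ! n)) < 1 / Suc m" using R that by (simp add: near_set_def)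
    then show ?thesis
      using F.norm_diff_triangle[OF \<psi>_closed[of "f (prod_encode (n, j))"] Rc[of n] \<psi>_closed[of "l ! n"]] f2[of n j] by linarith
  qed
  ultimately show ?thesis unfolding codes_upto_def by blast
qed

definition decodes :: "(nat \<Rightarrow> nat) \<Rightarrow> ('a \<Rightarrow> 'b) \<Rightarrow> bool" where
  "decodes f S \<longleftrightarrow> S \<in> opball \<and> (\<forall>n. F.conv (row f n) (S (\<phi> n)) sequentially)"

lemma inverse_Suc_lim: "(\<lambda>j. c / real (Suc j)) \<longlonglongrightarrow> 0"
  using tendsto_mult_right_zero[OF LIMSEQ_inverse_real_of_nat, of c] by (simp add: divide_inverse)

text \<open>Rows are Cauchy, and the tolerances vanish along them, so the limits satisfy the exact
  inequalities and extend to a contraction.\<close>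

lemma codes_decode:
  assumes "\<And>q. codes_upto l m f q" shows "\<exists>S. decodes f S"
proof -
  have c1: "vnorm F (row f n i \<ominus>\<^bsub>F\<^esub> row f n j) \<le> 1 / Suc i + 1 / Suc j" for n i j
    using assms[of "Suc (max (prod_encode (n, i)) (prod_encode (n, j)))", unfolded codes_upto_def, THEN conjunct1]
    by (simp only: less_Suc_eq_le max.cobounded1 max.cobounded2)
  have c2: "vnorm F (F.lin (cq a) (cq b) (row f n j) (row f k j) (row f i j)) \<le>
          vnorm E (E.lin (cq a) (cq b) (\<phi> n) (\<phi> k) (\<phi> i)) + (cmod (cq a) + cmod (cq b) + 1) / Suc j" for a b n k i j
    using assms[of "Suc (prod_encode (n, j) + prod_encode (k, j) + prod_encode (i, j))"] unfolding codes_upto_def by auto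
  have "\<exists>w\<in>carrier F. F.conv (row f n) w sequentially" for n
  proof -
    have "\<exists>N. \<forall>i\<ge>N. \<forall>j\<ge>N. vnorm F (row f n i \<ominus>\<^bsub>F\<^esub> row f n j) < e" if e: "e > 0" for e
    proof -
      obtain N where N: "inverse (real (Suc N)) < e / 2" using reals_Archimedean[of "e / 2"] e by auto
      have "vnorm F (row f n i \<ominus>\<^bsub>F\<^esub> row f n j) < e" if "i \<ge> N" "j \<ge> N" for i j
      proof -
        have "1 / Suc i \<le> 1 / Suc N" "1 / Suc j \<le> 1 / Suc N" using that by (simp_all add: frac_le)
        then show ?thesis using c1[of n i j] N unfolding inverse_eq_divide by linarith
      qed
      then show ?thesis by blast
    qed
    moreover have "range (row f n) \<subseteq> carrier F" by auto
    ultimately show ?thesis using complete[unfolded F.mcomplete_norm_iff, THEN spec, of "row f n"] by simp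
  qed
  then have "\<forall>n. \<exists>w. w \<in> carrier F \<and> F.conv (row f n) w sequentially" by blast
  from choice[OF this] obtain w where w: "\<And>n. w n \<in> carrier F" "\<And>n. F.conv (row f n) (w n) sequentially" by blast
  have "bounded_on_seq \<phi> 1 w"
    unfolding bounded_on_seq_def
  proof (intro allI)
    fix a b n k i
    have lim: "(\<lambda>j. vnorm F (F.lin (cq a) (cq b) (row f n j) (row f k j) (row f i j))) \<longlonglongrightarrow> vnorm F (F.lin (cq a) (cq b) (w n) (w k) (w i))"
      by (intro F.conv_norm F.conv_lin tendsto_const w \<psi>_closed F.lin_closed)
    have lim2: "(\<lambda>j. vnorm E (E.lin (cq a) (cq b) (\<phi> n) (\<phi> k) (\<phi> i)) + (cmod (cq a) + cmod (cq b) + 1) / Suc j)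
        \<longlonglongrightarrow> vnorm E (E.lin (cq a) (cq b) (\<phi> n) (\<phi> k) (\<phi> i)) + 0"
      by (intro tendsto_add tendsto_const inverse_Suc_lim)
    show "vnorm F (F.lin (cq a) (cq b) (w n) (w k) (w i)) \<le> 1 * vnorm E (E.lin (cq a) (cq b) (\<phi> n) (\<phi> k) (\<phi> i))"
      using LIMSEQ_le[OF lim lim2] c2 by auto
  qed
  from extend_bounded_on_seq[OF complete \<phi> w(1) _ this]
  obtain S where S: "S \<in> bops" "\<And>n. S (\<phi> n) = w n" "opnorm S \<le> 1" by auto
  then show ?thesis using w(2) by (auto simp: decodes_def unit_ball_def)
qed

lemma decodes_norm:
  assumes "decodes f S"
  shows "(\<lambda>j. vnorm F (row f n j \<ominus>\<^bsub>F\<^esub> \<psi> k)) \<longlonglongrightarrow> vnorm F (S (\<phi> n) \<ominus>\<^bsub>F\<^esub> \<psi> k)"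
proof -
  have S: "S (\<phi> n) \<in> carrier F" "F.conv (row f n) (S (\<phi> n)) sequentially"
    using assms opball_bops unfolding decodes_def by (auto intro!: bops_closed)
  show ?thesis by (intro F.conv_norm F.conv_diff F.conv_const S \<psi>_closed F.diff_closed)
qed

lemma decodes_near:
  assumes S: "decodes f S" and c: "\<And>q. codes_upto l m f q" and n: "n < length l"
  shows "vnorm F (S (\<phi> n) \<ominus>\<^bsub>F\<^esub> \<psi> (l ! n)) \<le> 1 / Suc m"
proof -
  have "vnorm F (row f n j \<ominus>\<^bsub>F\<^esub> \<psi> (l ! n)) \<le> 1 / Suc m + 1 / Suc j" for j
    using c[of "Suc (prod_encode (n, j))"] n unfolding codes_upto_def by auto
  moreover have "(\<lambda>j. 1 / Suc m + 1 / Suc j) \<longlonglongrightarrow> 1 / Suc m + 0"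
    by (intro tendsto_add tendsto_const inverse_Suc_lim)
  ultimately show ?thesis using LIMSEQ_le[OF decodes_norm[OF S]] by fastforce
qed

end

section \<open>Measurable selection of codes almost everywhere\<close>

context operator_field_structure
begin

abbreviation codes_at where
  "codes_at x \<equiv> dense_normed_pair.codes_upto (V x) (W x) (\<lambda>n. \<phi> n x) (\<lambda>n. \<psi> n x)"

lemma codes_at_sets: "{x \<in> space X. codes_at x l m f q} \<in> sets X"
proof -
  have idX: "(\<lambda>x. x) \<in> measurable X X" by simp
  have psim: "W.meas X (\<lambda>x. x) (\<psi> k)" for k using W.meas_section[OF idX, of k] .
  have phim: "V.meas X (\<lambda>x. x) (\<phi> k)" for k using V.meas_section[OF idX, of k] .
  have [measurable]: "(\<lambda>x. vnorm (W x) (complex_normed_space.lin (W x) u v (\<psi> a x) (\<psi> b x) (\<psi> c x))) \<in> borel_measurable X" for u v a b c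
    by (intro W.meas_norm W.meas_lin psim)
  have [measurable]: "(\<lambda>x. vnorm (V x) (complex_normed_space.lin (V x) u v (\<phi> a x) (\<phi> b x) (\<phi> c x))) \<in> borel_measurable X" for u v a b c
    by (intro V.meas_norm V.meas_lin phim)
  have [measurable]: "(\<lambda>x. vnorm (W x) (\<psi> a x \<ominus>\<^bsub>W x\<^esub> \<psi> b x)) \<in> borel_measurable X" for a b
    by (intro W.meas_norm W.meas_diff psim)
  have "{x \<in> space X. codes_at x l m f q} = {x \<in> space X.
     (\<forall>n i j. prod_encode (n, i) < q \<and> prod_encode (n, j) < q \<longrightarrow>
        vnorm (W x) (\<psi> (f (prod_encode (n, i))) x \<ominus>\<^bsub>W x\<^esub> \<psi> (f (prod_encode (n, j))) x) \<le> 1 / Suc i + 1 / Suc j) \<and>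
     (\<forall>a b n k i j. prod_encode (n, j) < q \<and> prod_encode (k, j) < q \<and> prod_encode (i, j) < q \<longrightarrow>
        vnorm (W x) (complex_normed_space.lin (W x) (cq a) (cq b) (\<psi> (f (prod_encode (n, j))) x) (\<psi> (f (prod_encode (k, j))) x) (\<psi> (f (prod_encode (i, j))) x)) \<le>
          vnorm (V x) (complex_normed_space.lin (V x) (cq a) (cq b) (\<phi> n x) (\<phi> k x) (\<phi> i x)) + (cmod (cq a) + cmod (cq b) + 1) / Suc j) \<and>
     (\<forall>n<length l. \<forall>j. prod_encode (n, j) < q \<longrightarrow>
        vnorm (W x) (\<psi> (f (prod_encode (n, j))) x \<ominus>\<^bsub>W x\<^esub> \<psi> (l ! n) x) \<le> 1 / Suc m + 1 / Suc j)}"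
    using dense_normed_pair.codes_upto_def[OF dense_pair] by (intro Collect_cong conj_cong refl) blast
  also have "\<dots> \<in> sets X" by measurable
  finally show ?thesis .
qed

text \<open>Points with a nonempty \<open>near\<close> set have infinite codes, so they lie in the
  Suslin set of the scheme of code prefixes. A measurable branch gives measurable indices, hence the
  distances of the decoded operator are limits of measurable functions.\<close>

lemma almost_everywhere_selection:
  assumes \<mu>: "sets \<mu> = sets X" "sigma_finite_measure \<mu>"
  shows "\<exists>N S. N \<in> null_sets \<mu> \<and> (\<lambda>x. (x, S x)) \<in> measurable X MB \<and> (\<forall>x\<in>space X. S x \<in> ball x \<and>
    (x \<notin> N \<longrightarrow> near x l m \<noteq> {} \<longrightarrow> (\<forall>n<length l. vnorm (W x) (S x (\<phi> n x) \<ominus>\<^bsub>W x\<^esub> \<psi> (l ! n) x) \<le> 1 / Suc m)))"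
proof -
  \<comment> \<open>Reading the list as a function is safe because only positions below
    \<open>length s\<close> enter.\<close>
  define A where "A = (\<lambda>s. {x \<in> space X. codes_at x l m ((!) s) (length s)})"
  have A: "A s \<in> sets \<mu>" for s unfolding A_def \<mu> by (rule codes_at_sets)
  have map_A: "x \<in> A (map y [0..<q]) \<longleftrightarrow> x \<in> space X \<and> codes_at x l m y q" for x y q
  proof (cases "x \<in> space X")
    case True
    then show ?thesis
      using dense_normed_pair.codes_upto_cong[OF dense_pair[OF True], of q "(!) (map y [0..<q])" y l m] by (simp add: A_def)
  qed (simp add: A_def)
  have "A (s @ [a]) \<subseteq> A s" for s a
  proof
    fix x assume "x \<in> A (s @ [a])"
    then have x: "x \<in> space X" and c: "codes_at x l m ((!) (s @ [a])) (length (s @ [a]))" by (simp_all add: A_def)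
    have "codes_at x l m ((!) (s @ [a])) (length s)"
      using dense_normed_pair.codes_upto_mono[OF dense_pair[OF x] c] by simp
    then have "codes_at x l m ((!) s) (length s)"
      using dense_normed_pair.codes_upto_cong[OF dense_pair[OF x], of "length s" "(!) (s @ [a])" "(!) s" l m] by (simp add: nth_append)
    then show "x \<in> A s" using x by (simp add: A_def)
  qed
  from suslin_selection[OF \<mu>(2) A this] obtain Q N y where Q: "Q \<in> sets \<mu>" "N \<in> null_sets \<mu>" "suslin_set A \<subseteq> Q \<union> N"
    "\<And>n. (\<lambda>x. y x n) \<in> measurable \<mu> (count_space UNIV)" "\<And>x n. x \<in> Q \<Longrightarrow> x \<in> A (map (y x) [0..<n])"
    by blast
  have QX [measurable]: "Q \<in> sets X" using Q(1) \<mu>(1) by simp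
  have y [measurable]: "(\<lambda>x. y x n) \<in> measurable X (count_space UNIV)" for n
    using Q(4)[of n] measurable_cong_sets[OF \<mu>(1) refl, of "count_space UNIV"] by blast
  have cod: "codes_at x l m (y x) q" if "x \<in> Q" for x q using Q(5)[OF that, of q] map_A by blast
  define dec where "dec = (\<lambda>x. dense_normed_pair.decodes (V x) (W x) (\<lambda>n. \<phi> n x) (\<lambda>n. \<psi> n x) (y x))"
  \<comment> \<open>Where no branch was selected the zero operator keeps the section defined and
    measurable on all of \<open>X\<close>.\<close>
  define S where "S = (\<lambda>x. if x \<in> Q then SOME T. dec x T else restrict (\<lambda>_. \<zero>\<^bsub>W x\<^esub>) (carrier (V x)))"
  have dec: "dec x (S x)" if x: "x \<in> space X" "x \<in> Q" for x
  proof -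
    have "\<exists>T. dec x T" unfolding dec_def by (rule dense_normed_pair.codes_decode[OF dense_pair[OF x(1)]]) (rule cod[OF x(2)])
    then show ?thesis unfolding S_def using x(2) by (simp add: someI_ex)
  qed
  have SB: "S x \<in> ball x" if x: "x \<in> space X" for x
  proof (cases "x \<in> Q")
    case True
    then show ?thesis using dec[OF x] unfolding dec_def dense_normed_pair.decodes_def[OF dense_pair[OF x]] by blast
  next
    case False
    then show ?thesis using normed_pair.zero_operator[OF pair[OF x]] by (simp add: S_def)
  qed
  have "(\<lambda>x. (x, S x)) \<in> measurable X MB"
  proof (rule measurable_sectionI)
    show "S x \<in> ops x" if "x \<in> space X" for x using SB[OF that] by (rule ball_ops)
    fix n k
    have idX: "(\<lambda>x. x) \<in> measurable X X" by simp
    have psim: "W.meas X (\<lambda>x. x) (\<psi> k)" for k using W.meas_section[OF idX, of k] .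
    \<comment> \<open>Off \<open>Q\<close> the section is zero, so its distance to
      \<open>\<psi> k x\<close> is the norm of \<open>\<psi> k x\<close>.\<close>
    define g where "g = (\<lambda>j x. if x \<in> Q then vnorm (W x) (\<psi> (y x (prod_encode (n, j))) x \<ominus>\<^bsub>W x\<^esub> \<psi> k x)
      else vnorm (W x) (\<psi> k x))"
    have "(\<lambda>x. vnorm (W x) (\<psi> (y x (prod_encode (n, j))) x \<ominus>\<^bsub>W x\<^esub> \<psi> k x)) \<in> borel_measurable X" for j
      by (rule measurable_compose_countable[OF _ y]) (intro W.meas_norm W.meas_diff psim)
    moreover have "(\<lambda>x. vnorm (W x) (\<psi> k x)) \<in> borel_measurable X" by (intro W.meas_norm psim)
    ultimately have g: "g j \<in> borel_measurable X" for j unfolding g_def by measurable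
    show "(\<lambda>x. vnorm (W x) (S x (\<phi> n x) \<ominus>\<^bsub>W x\<^esub> \<psi> k x)) \<in> borel_measurable X"
    proof (rule borel_measurable_LIMSEQ_real[OF _ g])
      fix x assume x: "x \<in> space X"
      interpret P: dense_normed_pair "V x" "W x" "\<lambda>n. \<phi> n x" "\<lambda>n. \<psi> n x" using dense_pair[OF x] .
      show "(\<lambda>j. g j x) \<longlonglongrightarrow> vnorm (W x) (S x (\<phi> n x) \<ominus>\<^bsub>W x\<^esub> \<psi> k x)"
      proof (cases "x \<in> Q")
        case True
        then show ?thesis using P.decodes_norm[OF dec[OF x, unfolded dec_def], of n k] by (simp add: g_def)
      next
        case False
        have "S x (\<phi> n x) \<ominus>\<^bsub>W x\<^esub> \<psi> k x = \<ominus>\<^bsub>W x\<^esub> \<psi> k x"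
          using False by (simp add: S_def P.F.M.minus_eq)
        then show ?thesis using False by (simp add: g_def)
      qed
    qed
  qed
  moreover have "vnorm (W x) (S x (\<phi> n x) \<ominus>\<^bsub>W x\<^esub> \<psi> (l ! n) x) \<le> 1 / Suc m"
    if x: "x \<in> space X" "x \<notin> N" "near x l m \<noteq> {}" and n: "n < length l" for x n
  proof -
    interpret P: dense_normed_pair "V x" "W x" "\<lambda>n. \<phi> n x" "\<lambda>n. \<psi> n x" using dense_pair[OF x(1)] .
    obtain R where "R \<in> near x l m" using x(3) by blast
    then obtain f where "\<And>q. codes_at x l m f q" using P.near_set_has_codes by blast
    then have "x \<in> suslin_set A" using map_A x(1) by (auto simp: suslin_set_def)
    then have xQ: "x \<in> Q" using Q(3) x(2) by blast
    show ?thesis using P.decodes_near[OF dec[OF x(1) xQ, unfolded dec_def] cod[OF xQ] n] .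
  qed
  ultimately show ?thesis using SB Q(2) by (intro exI[of _ N] exI[of _ S]) blast
qed

text \<open>Each prescription \<open>(l, m)\<close> has its own exceptional null set. There are
  countably many, and removing their union leaves a base over which one sequence of sections is
  dense in every fibre.\<close>

theorem ball_measured_field:
  assumes \<mu>: "sets \<mu> = sets X" "sigma_finite_measure \<mu>"
  shows "measured_field_polish \<mu> (\<lambda>x. strong_topology_ball (V x) (W x)) (operator_ball_structure V W MB)"
proof -
  have sp: "space \<mu> = space X" using \<mu>(1) by (rule sets_eq_imp_space_eq)
  let ?MB = "operator_ball_structure V W MB"
  have "\<forall>p. \<exists>N S. N \<in> null_sets \<mu> \<and> (\<lambda>x. (x, S x)) \<in> measurable X MB \<and> (\<forall>x\<in>space X. S x \<in> ball x \<and>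
    (x \<notin> N \<longrightarrow> near x (fst p) (snd p) \<noteq> {} \<longrightarrow>
      (\<forall>n<length (fst p). vnorm (W x) (S x (\<phi> n x) \<ominus>\<^bsub>W x\<^esub> \<psi> (fst p ! n) x) \<le> 1 / Suc (snd p))))"
    by (intro allI almost_everywhere_selection \<mu>)
  from choice[OF this] obtain N where "\<forall>p. \<exists>S. N p \<in> null_sets \<mu> \<and> (\<lambda>x. (x, S x)) \<in> measurable X MB \<and> (\<forall>x\<in>space X. S x \<in> ball x \<and>
    (x \<notin> N p \<longrightarrow> near x (fst p) (snd p) \<noteq> {} \<longrightarrow>
      (\<forall>n<length (fst p). vnorm (W x) (S x (\<phi> n x) \<ominus>\<^bsub>W x\<^esub> \<psi> (fst p ! n) x) \<le> 1 / Suc (snd p))))" by blast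
  from choice[OF this] obtain S where NS: "\<And>p. N p \<in> null_sets \<mu> \<and> (\<lambda>x. (x, S p x)) \<in> measurable X MB \<and> (\<forall>x\<in>space X. S p x \<in> ball x \<and>
    (x \<notin> N p \<longrightarrow> near x (fst p) (snd p) \<noteq> {} \<longrightarrow>
      (\<forall>n<length (fst p). vnorm (W x) (S p x (\<phi> n x) \<ominus>\<^bsub>W x\<^esub> \<psi> (fst p ! n) x) \<le> 1 / Suc (snd p))))" by blast
  have N: "\<And>p. N p \<in> null_sets \<mu>" and S: "\<And>p. (\<lambda>x. (x, S p x)) \<in> measurable X MB" "\<And>p x. x \<in> space X \<Longrightarrow> S p x \<in> ball x"
    and near: "\<And>x l m n. x \<in> space X \<Longrightarrow> x \<notin> N (l, m) \<Longrightarrow> near x l m \<noteq> {} \<Longrightarrow> n < length l \<Longrightarrow>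
       vnorm (W x) (S (l, m) x (\<phi> n x) \<ominus>\<^bsub>W x\<^esub> \<psi> (l ! n) x) \<le> 1 / Suc m"
    using NS by force+
  define N0 where "N0 = (\<Union>p. N p)"
  have N0: "N0 \<in> null_sets \<mu>" unfolding N0_def using N by (intro null_sets_UN) auto
  then have N0s: "N0 \<in> sets \<mu>" by blast
  define X0 where "X0 = space X - N0"
  have X0: "X0 \<in> sets X" "X0 \<subseteq> space X" using N0s \<mu>(1) by (auto simp: X0_def)
  have fst_ball: "fst \<in> measurable ?MB X" using measurable_compose[OF ball_to_B fst_B] .
  define Y where "Y = restrict_space \<mu> X0"
  define MY where "MY = restrict_space ?MB {p. fst p \<in> X0}"
  have spY: "space Y = X0" using X0 sp by (auto simp: Y_def space_restrict_space)
  have setsY: "sets Y = sets (restrict_space X X0)" unfolding Y_def sets_restrict_space \<mu>(1) by (rule refl)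
  have "borel_field_polish Y (\<lambda>x. strong_topology_ball (V x) (W x)) MY"
  proof (rule ball_field_polish[where S="\<lambda>j. S (from_nat j)"])
    show "standard_borel Y"
      using setsY by (rule standard_borel_cong_sets) (rule standard_borel_restrict_space[OF V.standard_base X0(1)])
    show idY: "(\<lambda>x. x) \<in> measurable Y X"
      using measurable_cong_sets[OF setsY refl, of X] by (simp add: measurable_restrict_space1)
    have "{p. fst p \<in> X0} \<inter> space ?MB \<in> sets ?MB"
      using measurable_sets[OF fst_ball X0(1)] by (simp add: vimage_def)
    then show "standard_borel MY" unfolding MY_def by (rule standard_borel_restrict_space_Int[OF standard_ball])
    show spMY: "space MY = (SIGMA x:space Y. ball x)"
      unfolding MY_def space_restrict_space space_ball spY using X0(2) by auto
    have idMY: "(\<lambda>p. p) \<in> measurable MY ?MB" unfolding MY_def by (intro measurable_restrict_space1) simp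
    show "(\<lambda>p. p) \<in> measurable MY MB" using measurable_compose[OF idMY ball_to_B] .
    have "fst \<in> measurable MY (restrict_space X X0)"
      using measurable_compose[OF idMY fst_ball] spMY spY by (intro measurable_restrict_space2) auto
    then show "fst \<in> measurable MY Y" using measurable_cong_sets[OF refl setsY, of MY] by blast
    show "borel_section Y MY (S (from_nat j))" for j
      unfolding borel_section_def MY_def
    proof (rule measurable_restrict_space2)
      show "(\<lambda>x. (x, S (from_nat j) x)) \<in> space Y \<rightarrow> {p. fst p \<in> X0}" using spY by auto
      have "(\<lambda>x. (x, S (from_nat j) x)) \<in> measurable X ?MB" using S by (intro measurable_into_ball)
      from measurable_compose[OF idY this] show "(\<lambda>x. (x, S (from_nat j) x)) \<in> measurable Y ?MB" .
    qed
    fix x l m assume x: "x \<in> space Y" and ne: "near x l m \<noteq> {}"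
    then have xX: "x \<in> space X" and xN: "x \<notin> N (l, m)" using spY by (auto simp: X0_def N0_def)
    show "\<exists>j. \<forall>n<length l. vnorm (W x) (S (from_nat j) x (\<phi> n x) \<ominus>\<^bsub>W x\<^esub> \<psi> (l ! n) x) \<le> 1 / Suc m"
      using near[OF xX xN ne] by (intro exI[of _ "to_nat (l, m)"]) simp
  qed
  moreover have "space \<mu> - X0 = N0" using sets.sets_into_space[OF N0s] sp by (auto simp: X0_def)
  then have "emeasure \<mu> (space \<mu> - X0) = 0" using N0 by (simp add: null_setsD1)
  moreover have "polish_topology (strong_topology_ball (V x) (W x))" if "x \<in> space \<mu>" for x
    using dense_normed_pair.polish_strong_topology_ball[OF dense_pair] that sp by blast
  moreover have "space ?MB = (SIGMA x:space \<mu>. topspace (strong_topology_ball (V x) (W x)))"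
    unfolding space_ball sp using topspace_ball by (intro Sigma_cong) auto
  moreover have "standard_borel \<mu>" using \<mu>(1) V.standard_base by (rule standard_borel_cong_sets)
  moreover have "fst \<in> measurable ?MB \<mu>" using fst_ball measurable_cong_sets[OF refl \<mu>(1), of ?MB] by blast
  moreover have "X0 \<in> sets \<mu>" using X0 \<mu>(1) by simp
  ultimately show ?thesis unfolding measured_field_polish_def Y_def MY_def using standard_ball \<mu>(2) by blast
qed

end

text \<open>Each structure makes the evaluations at the dense sections measurable, so each contains
  the other by minimality.\<close>

lemma (in field_pair) operator_borel_structure_unique:
  assumes "operator_borel_structure X V MV W MW MB" "operator_borel_structure X V MV W MW MC"
  shows "sets MB = sets MC"
proof -
  interpret B: operator_field_structure X V MV \<phi> W MW \<psi> MB using assms(1) by unfold_locales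
  interpret C: operator_field_structure X V MV \<phi> W MW \<psi> MC using assms(2) by unfold_locales
  have "(\<lambda>(x, T). (x, T (\<phi> n x))) \<in> measurable MB MW" "(\<lambda>(x, T). (x, T (\<phi> n x))) \<in> measurable MC MW" for n
    using B.eval_section[OF V.sections] C.eval_section[OF V.sections] by (simp_all add: case_prod_beta)
  then show ?thesis
    using B.generated[OF dense_imp_total C.space_B C.fst_B] C.generated[OF dense_imp_total B.space_B B.fst_B] by blast
qed

theorem proposition7p1:
  fixes X :: "'x measure"
    and V :: "'x \<Rightarrow> 'v normed_module" and MV :: "('x \<times> 'v) measure"
    and W :: "'x \<Rightarrow> 'w normed_module" and MW :: "('x \<times> 'w) measure"
  assumes "standard_borel X"
    and "borel_field_banach X V MV"
    and "borel_field_banach X W MW"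
  shows
    "(\<exists>MB. operator_borel_structure X V MV W MW MB \<and>
        (\<forall>MB'. operator_borel_structure X V MV W MW MB' \<longrightarrow> sets MB' = sets MB)) \<and>
     (\<forall>MB. operator_borel_structure X V MV W MW MB \<longrightarrow>
        (fibre_norm (operator_field V W) \<in> borel_measurable MB \<and>
         fibre_add (operator_field V W) \<in> measurable (fibre_product MB MB) MB \<and>
         fibre_smult (operator_field V W) \<in> measurable (borel \<Otimes>\<^sub>M MB) MB \<and>
         (\<forall>(U :: 'x \<Rightarrow> 'u normed_module) MU MWU MVU.
            borel_field_banach X U MU \<longrightarrow>
            operator_borel_structure X W MW U MU MWU \<longrightarrow>
            operator_borel_structure X V MV U MU MVU \<longrightarrow>
            operator_composition V \<in> measurable (fibre_product MWU MB) MVU)) \<and>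
        (\<forall>\<mu>. sets \<mu> = sets X \<longrightarrow> sigma_finite_measure \<mu> \<longrightarrow>
            measured_field_polish \<mu> (\<lambda>x. strong_topology_ball (V x) (W x))
              (operator_ball_structure V W MB)) \<and>
        ((\<forall>x\<in>space X. reflexive_space (W x)) \<or>
         (\<forall>x\<in>space X. metric_approximation_property (V x) \<or>
                       metric_approximation_property (W x)) \<longrightarrow>
            borel_field_polish X (\<lambda>x. strong_topology_ball (V x) (W x))
              (operator_ball_structure V W MB)) \<and>
        (\<forall>\<phi>. total_sequence_of_sections X V MV \<phi> \<longrightarrow>
            fst \<in> measurable MB X \<and>
            (\<forall>n. (\<lambda>(x, T). (x, T (\<phi> n x))) \<in> measurable MB MW) \<and>
            (\<forall>N. space N = total_space X (operator_field V W) \<longrightarrow>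
                 fst \<in> measurable N X \<longrightarrow>
                 (\<forall>n. (\<lambda>(x, T). (x, T (\<phi> n x))) \<in> measurable N MW) \<longrightarrow>
                 sets MB \<subseteq> sets N)))"
proof -
  obtain \<phi> where "banach_field X V MV \<phi>" using borel_field_banach_imp_sections[OF assms(2)] by blast
  then interpret V: banach_field X V MV \<phi> .
  obtain \<psi> where "banach_field X W MW \<psi>" using borel_field_banach_imp_sections[OF assms(3)] by blast
  then interpret W: banach_field X W MW \<psi> .
  interpret field_pair X V MV \<phi> W MW \<psi> by unfold_locales
  have part1: "\<exists>MB. operator_borel_structure X V MV W MW MB \<and>
        (\<forall>MB'. operator_borel_structure X V MV W MW MB' \<longrightarrow> sets MB' = sets MB)"
    using operator_borel_structure_exists operator_borel_structure_unique by blast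
  show ?thesis
  proof (intro conjI part1 allI impI)
    fix MB assume MB: "operator_borel_structure X V MV W MW MB"
    interpret B: operator_field_structure X V MV \<phi> W MW \<psi> MB using MB by unfold_locales
    show "fibre_norm (operator_field V W) \<in> borel_measurable MB" by (rule B.opnorm_measurable)
    show "fibre_add (operator_field V W) \<in> measurable (fibre_product MB MB) MB" by (rule B.operator_add_measurable)
    show "fibre_smult (operator_field V W) \<in> measurable (borel \<Otimes>\<^sub>M MB) MB" by (rule B.operator_smult_measurable)
    show "operator_composition V \<in> measurable (fibre_product MWU MB) MVU"
      if "borel_field_banach X U MU" "operator_borel_structure X W MW U MU MWU" "operator_borel_structure X V MV U MU MVU"
      for U :: "'x \<Rightarrow> 'u normed_module" and MU MWU MVU
      using that by (rule B.operator_composition_measurable)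
    show "measured_field_polish \<mu> (\<lambda>x. strong_topology_ball (V x) (W x)) (operator_ball_structure V W MB)"
      if "sets \<mu> = sets X" "sigma_finite_measure \<mu>" for \<mu>
      using that by (rule B.ball_measured_field)
    show "borel_field_polish X (\<lambda>x. strong_topology_ball (V x) (W x)) (operator_ball_structure V W MB)"
      if "(\<forall>x\<in>space X. reflexive_space (W x)) \<or>
         (\<forall>x\<in>space X. metric_approximation_property (V x) \<or> metric_approximation_property (W x))"
      using that B.reflexive_ball_field B.approximation_ball_field by blast
    show "fst \<in> measurable MB X" by (rule B.fst_B)
    show "(\<lambda>(x, T). (x, T (\<xi> n x))) \<in> measurable MB MW" if "total_sequence_of_sections X V MV \<xi>" for \<xi> n
      using that B.eval_section by (simp add: case_prod_beta total_sequence_of_sections_def)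
    show "sets MB \<subseteq> sets N"
      if "total_sequence_of_sections X V MV \<xi>" "space N = total_space X (operator_field V W)"
        "fst \<in> measurable N X" "\<forall>n. (\<lambda>(x, T). (x, T (\<xi> n x))) \<in> measurable N MW" for \<xi> N
      using that by (intro B.generated) auto
  qed
qed

end
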